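(* Let $A$ be a differential graded algebra over a field $k$, with a fixed $A_\infty$-structure on $H_*(A)$ and $A_\infty$-quasi-isomorphism $f\colon H_*(A)\to A$, and let $n\ge1$. Let $X$ be a minimal $A_{n+1}$-module over $H_*(A)$, $R_i=X\otimes H_*(A)^{\otimes i}\otimes A$ and $Y_i=B_i(X,H_*(A),A)[i]$ (so $Y_0=R_0$). Then the diagram of $A$-modules consisting of the maps $$\pi_i\colon Y_i\to R_i,\qquad i_i\colon R_i\to Y_{i-1},\qquad M_{i,2}\colon R_i\to R_{i-1}\qquad(1\le i\le n)$$ projects to an $n$-Postnikov system for $X$ in the derived category of $A$-modules (with $C_i=R_i$, $j_i=\pi_i$, $d_i=M_{i,2}$). Here $\pi_i$ denotes the projection onto the last summand $R_i$ of $Y_i=R_0[i]\oplus\dots\oplus R_{i-1}[1]\oplus R_i$, and $i_i$ is the column vector $$i_i=\begin{bmatrix}(-1)^{\lfloor i/2\rfloor}M_{i,i+1}\\ \vdots\\ (-1)^{\lfloor (j-1)/2\rfloor}M_{i,j}\\ \vdots\\ M_{i,2}\end{bmatrix},$$ with entries indexed by $j=i+1,i,\dots,2$, the $j$-th entry mapping to the summand $R_{i-j+1}[j-2]$ of $Y_{i-1}$. This assignment is functorial with respect to maps of $A_{n+1}$-modules.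
   Context: Conventions. $k$ is a field; complexes are homological, $\mathbb Z$-graded, possibly unbounded. $C[n]_i=C_{i+n}$, with differential $(-1)^n d$ if $C$ is a complex. Koszul signs: $(f\otimes g)(x\otimes y)=(-1)^{|g||x|}f(x)\otimes g(y)$, so $(f\otimes g)\circ(h\otimes j)=(-1)^{|g||h|}(f\circ h)\otimes(g\circ j)$. Differential graded algebras and modules are unital. $\lfloor x\rfloor$ is the greatest integer $\le x$. $A_\infty$-algebras. An $A_\infty$-algebra structure on a graded $k$-module $R$ consists of maps $m_i\colon R^{\otimes i}\to R[i-2]$, $i\ge1$, with $\sum_{r+s+t=m}(-1)^{r+st}m_{r+t+1}(1^{\otimes r}\otimes m_s\otimes 1^{\otimes t})=0$ for all $m\geq 1$. A DGA is an $A_\infty$-algebra with $m_1=d$, $m_2$ the product, $m_i=0$ for $i\ge3$. A morphism $f\colon R\to A$ of $A_\infty$-algebras consists of maps $f_i\colon R^{\otimes i}\to A[i-1]$ with $\sum_{r+s+t=m}(-1)^{r+st}f_{r+t+1}(1^{\otimes r}\otimes m_s\otimes 1^{\otimes t})=\sum_{i_1+\dots+i_u=m}(-1)^v m_u(f_{i_1}\otimes\dots\otimes f_{i_u})$ for all $m$, where $v=(u-1)(i_1-1)+(u-2)(i_2-1)+\dots+(i_{u-1}-1)$; it is a quasi-isomorphism if $f_1$ is. By a theorem of Kadeishvili, $H_*(A)$ has an $A_\infty$-structure with $m_1=0$ and $m_2$ the induced product, together with an $A_\infty$-quasi-isomorphism $f\colon H_*(A)\to A$; such a choice is fixed. With $d,\mu$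 the differential and product of $A$, put $m_1^A=d$ and $m_l^A=(-1)^l\mu\circ(f_{l-1}\otimes1)\colon H_*(A)^{\otimes(l-1)}\otimes A\to A[l-2]$ for $l\ge2$. $A_l$-modules. A minimal right $A_l$-module $X$ over $R=H_*(A)$ is a graded $k$-module with maps $m_i^X\colon X\otimes R^{\otimes(i-1)}\to X[i-2]$, $1\le i\le l$, $m_1^X=0$, such that for each $m\le l$, $\sum_{r+s+t=m}(-1)^{r+st}m^X_{r+t+1}(1^{\otimes r}\otimes m_s\otimes1^{\otimes t})=0$, where $m_s$ means $m_s^X$ if $r=0$ and $m_s^R$ otherwise. Throughout, $m_2^X$ makes $X$ an ordinary (associative, unital) graded right $H_*(A)$-module. A morphism $g\colon X\to Y$ of $A_l$-modules consists of maps $g_i\colon X\otimes R^{\otimes(i-1)}\to Y[i-1]$, $1\le i\le l$, such that for each $m\le l$, $\sum_{r+s+t=m}(-1)^{r+st}g_{r+t+1}(1^{\otimes r}\otimes m_s\otimes 1^{\otimes t})=\sum_{i+j=m}(-1)^{(i+1)j}m^Y_{j+1}(g_i\otimes1^{\otimes j})$. Composition is $(f\circ g)_m=\sum_{r+s=m}(-1)^{(r-1)s}f_{s+1}(g_r\otimes 1^{\otimes s})$. Bar construction. For $1\le l\le i+1$ let $M_{i,l}\colon R_i\to R_{i-l+1}[l-2]$ be $M_{i,l}=\sum_{a=0}^{i+2-l}(-1)^{a(l-1)}1^{\otimes a}\otimes m_l\otimes1^{\otimes(i-l-a+2)}$, where $m_l$ is $m_l^X$ in the first term ($a=0$), $m_l^A$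 in the last term ($a=i+2-l$), and $m_l^{H_*(A)}$ otherwise. For an $A_{p+1}$-module $X$, $B_p(X,H_*(A),A)=\bigoplus_{l=0}^pR_l[-l]$ with differential given on the summand $R_l$ by $\sum_{j=1}^{l+1}(-1)^{l+\lfloor (j-1)/2\rfloor}M_{l,j}$; this is a DG right $A$-module. On a map $g$ of $A_{p+1}$-modules, $B_p(g)$ is the upper triangular matrix with entries $B_p(g)_{i,j}=(-1)^{\lfloor (j-i+1)/2\rfloor}g_{j-i+1}\otimes1^{\otimes i}$, $1\le i\le j\le p+1$ (from the summand on $R_{j-1}$ to the summand on $R_{i-1}$). Postnikov systems. An $n$-Postnikov system for $X$ is a commutative diagram in the derived category of DG $A$-modules of maps $j_i\colon Y_i\to C_i$, $i_i\colon C_i\to Y_{i-1}$, $d_i=j_{i-1}i_i\colon C_i\to C_{i-1}$, $1\le i\le n$ ($Y_0=C_0$, $j_0=\mathrm{id}$), such that $j_i$ is the homotopy fiber of $i_i$ (i.e. $Y_i\to C_i\to Y_{i-1}$ is part of a triangle), each $C_i$ is a free $A$-module, and there is a map $H_*(C_0)\to X$ with $H_*(C_n)\to\dots\to H_*(C_0)\to X\to0$ exact. Maps of $n$-Postnikov systems are maps of diagrams in the derived category which restrict to maps of triangles. *)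

theory Defs
  imports Complex_Main "HOL-Library.Function_Algebras"
begin

section \<open>Graded vector spaces\<close>

text \<open>
  A graded \<open>k\<close>-module is an internally graded subspace of an ambient vector space: the ambient
  space is the type \<open>'v\<close> with scalar multiplication \<open>scale\<close>, the homogeneous pieces are independent
  subspaces \<open>deg V n\<close>, and the underlying module is their sum \<open>total V\<close>. A map between such modules
  is a function on the ambient types of which only the values on \<open>total V\<close> matter.
\<close>

record ('k, 'v) grmod =
  scale :: "'k \<Rightarrow> 'v \<Rightarrow> 'v"
  deg :: "int \<Rightarrow> 'v set"

definition decomposes :: "('k, 'v::ab_group_add, 'z) grmod_scheme \<Rightarrow> 'v \<Rightarrow> (int \<Rightarrow> 'v) \<Rightarrow> bool" where
  "decomposes V x c \<longleftrightarrow> finite {n. c n \<noteq> 0} \<and> (\<forall>n. c n \<in> deg V n) \<and> x = (\<Sum>n | c n \<noteq> 0. c n)"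

definition total :: "('k, 'v::ab_group_add, 'z) grmod_scheme \<Rightarrow> 'v set" where
  "total V = {x. \<exists>c. decomposes V x c}"

definition graded :: "('k::field, 'v::ab_group_add, 'z) grmod_scheme \<Rightarrow> bool" where
  "graded V \<longleftrightarrow> vector_space (scale V) \<and> (\<forall>n. module.subspace (scale V) (deg V n)) \<and>
     (\<forall>c. decomposes V 0 c \<longrightarrow> (\<forall>n. c n = 0))"

definition sg :: "int \<Rightarrow> 'v::ab_group_add \<Rightarrow> 'v" where
  "sg e v = (if even e then v else - v)"

text \<open>The linear map with \<open>koszul V e x = (-1)^(e * |x|) x\<close> for homogeneous \<open>x\<close>; all Koszul signs
  are produced by applying it to the elements that an operator of degree \<open>e\<close> moves past.\<close>

definition koszul :: "('k, 'v::ab_group_add, 'z) grmod_scheme \<Rightarrow> int \<Rightarrow> 'v \<Rightarrow> 'v" where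
  "koszul V e x = (let c = (SOME c. decomposes V x c) in \<Sum>n | c n \<noteq> 0. sg (e * n) (c n))"

definition linear_on :: "('k::field, 'v::ab_group_add, 'y) grmod_scheme \<Rightarrow>
    ('k, 'w::ab_group_add, 'z) grmod_scheme \<Rightarrow> ('v \<Rightarrow> 'w) \<Rightarrow> bool" where
  "linear_on V W F \<longleftrightarrow> (\<forall>x\<in>total V. \<forall>y\<in>total V. F (x + y) = F x + F y) \<and>
     (\<forall>c. \<forall>x\<in>total V. F (scale V c x) = scale W c (F x))"

text \<open>Linear maps raising the degree by \<open>e\<close>, that is, graded maps to \<open>W[e]\<close>.\<close>

definition graded_map :: "int \<Rightarrow> ('k::field, 'v::ab_group_add, 'y) grmod_scheme \<Rightarrow>
    ('k, 'w::ab_group_add, 'z) grmod_scheme \<Rightarrow> ('v \<Rightarrow> 'w) \<Rightarrow> bool" where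
  "graded_map e V W F \<longleftrightarrow> linear_on V W F \<and> (\<forall>n. \<forall>x\<in>deg V n. F x \<in> deg W (n + e))"

text \<open>A linear map \<open>V\<^sup>\<otimes>\<^sup>i \<rightarrow> W\<close> is given by its values on pure tensors, as a function on lists of length
  \<open>i\<close>; a family of such maps, one for every \<open>i \<ge> 1\<close>, is one function on lists (its value at the
  empty list is irrelevant).\<close>

definition multilinear :: "('k::field, 'v::ab_group_add, 'y) grmod_scheme \<Rightarrow>
    ('k, 'w::ab_group_add, 'z) grmod_scheme \<Rightarrow> ('v list \<Rightarrow> 'w) \<Rightarrow> bool" where
  "multilinear V W F \<longleftrightarrow>
     (\<forall>us x y vs. F (us @ (x + y) # vs) = F (us @ x # vs) + F (us @ y # vs)) \<and>
     (\<forall>c us x vs. F (us @ scale V c x # vs) = scale W c (F (us @ x # vs)))"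

definition homogeneous :: "('k, 'v, 'z) grmod_scheme \<Rightarrow> int list \<Rightarrow> 'v list \<Rightarrow> bool" where
  "homogeneous V ds xs \<longleftrightarrow> list_all2 (\<lambda>d x. x \<in> deg V d) ds xs"

text \<open>The component on \<open>V\<^sup>\<otimes>\<^sup>i\<close> is a map to \<open>W[i + e]\<close>.\<close>

definition multidegree :: "int \<Rightarrow> ('k, 'v, 'y) grmod_scheme \<Rightarrow> ('k, 'w, 'z) grmod_scheme \<Rightarrow>
    ('v list \<Rightarrow> 'w) \<Rightarrow> bool" where
  "multidegree e V W F \<longleftrightarrow> (\<forall>ds xs. xs \<noteq> [] \<and> homogeneous V ds xs \<longrightarrow>
     F xs \<in> deg W (sum_list ds + int (length xs) + e))"


section \<open>A-infinity algebras and differential graded algebras\<close>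

record ('k, 'v) ainf = "('k, 'v) grmod" +
  ops :: "'v list \<Rightarrow> 'v"

text \<open>The tensor \<open>1\<^sup>\<otimes>\<^sup>r \<otimes> m\<^sub>s \<otimes> 1\<^sup>\<otimes>\<^sup>t\<close> evaluated at a pure tensor.\<close>

definition insert_op :: "('k, 'v::ab_group_add, 'z) ainf_scheme \<Rightarrow> nat \<Rightarrow> nat \<Rightarrow> 'v list \<Rightarrow> 'v list" where
  "insert_op R r s xs =
     map (koszul R (int s - 2)) (take r xs) @ ops R (take s (drop r xs)) # drop (r + s) xs"

text \<open>The underlying graded module of an A-infinity algebra is its whole type.\<close>

definition ainf_algebra :: "('k::field, 'v::ab_group_add, 'z) ainf_scheme \<Rightarrow> bool" where
  "ainf_algebra R \<longleftrightarrow> graded R \<and> total R = UNIV \<and>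
     multilinear R R (ops R) \<and> multidegree (- 2) R R (ops R) \<and>
     (\<forall>xs. xs \<noteq> [] \<longrightarrow>
       (\<Sum>s = 1..length xs. \<Sum>r = 0..length xs - s.
          let t = length xs - s - r in sg (int (r + s * t)) (ops R (insert_op R r s xs))) = 0)"

text \<open>\<open>f\<^bsub>i1\<^esub> \<otimes> \<dots> \<otimes> f\<^bsub>iu\<^esub>\<close> at a pure tensor; the inputs of the first factor are moved past the remaining
  ones, which have total degree \<open>\<Sum>\<^sub>k\<^sub>>\<^sub>1 (i\<^sub>k - 1)\<close>.\<close>

fun tensor_apply :: "('k, 'v::ab_group_add, 'z) grmod_scheme \<Rightarrow> ('v list \<Rightarrow> 'w) \<Rightarrow> nat list \<Rightarrow>
    'v list \<Rightarrow> 'w list" where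
  "tensor_apply R f [] xs = []"
| "tensor_apply R f (i # is) xs =
     f (map (koszul R (\<Sum>j\<leftarrow>is. int j - 1)) (take i xs)) # tensor_apply R f is (drop i xs)"

definition compositions :: "nat \<Rightarrow> nat list set" where
  "compositions m = {is. sum_list is = m \<and> 0 \<notin> set is}"

definition ainf_morphism :: "('k::field, 'v::ab_group_add, 'y) ainf_scheme \<Rightarrow>
    ('k, 'w::ab_group_add, 'z) ainf_scheme \<Rightarrow> ('v list \<Rightarrow> 'w) \<Rightarrow> bool" where
  "ainf_morphism R S f \<longleftrightarrow> multilinear R S f \<and> multidegree (- 1) R S f \<and>
     (\<forall>xs. xs \<noteq> [] \<longrightarrow>
       (\<Sum>s = 1..length xs. \<Sum>r = 0..length xs - s.
          let t = length xs - s - r in sg (int (r + s * t)) (f (insert_op R r s xs))) =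
       (\<Sum>is \<in> compositions (length xs).
          let u = length is; v = (\<Sum>k < u. (u - 1 - k) * (is ! k - 1))
          in sg (int v) (ops S (tensor_apply R f is xs))))"

definition ainf_quasi_iso :: "('k::field, 'v::ab_group_add, 'y) ainf_scheme \<Rightarrow>
    ('k, 'w::ab_group_add, 'z) ainf_scheme \<Rightarrow> ('v list \<Rightarrow> 'w) \<Rightarrow> bool" where
  "ainf_quasi_iso R S f \<longleftrightarrow> ainf_morphism R S f \<and>
     (\<forall>x. ops R [x] = 0 \<and> f [x] \<in> range (\<lambda>y. ops S [y]) \<longrightarrow> x \<in> range (\<lambda>y. ops R [y])) \<and>
     (\<forall>y. ops S [y] = 0 \<longrightarrow> (\<exists>x. ops R [x] = 0 \<and> y - f [x] \<in> range (\<lambda>y. ops S [y])))"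

record ('k, 'a) dga = "('k, 'a) grmod" +
  diff :: "'a \<Rightarrow> 'a"
  mult :: "'a \<Rightarrow> 'a \<Rightarrow> 'a"
  unit :: 'a

definition dg_algebra :: "('k::field, 'a::ab_group_add) dga \<Rightarrow> bool" where
  "dg_algebra A \<longleftrightarrow> graded A \<and> total A = UNIV \<and>
     graded_map (- 1) A A (diff A) \<and> (\<forall>a. diff A (diff A a) = 0) \<and>
     (\<forall>a. linear_on A A (mult A a)) \<and> (\<forall>b. linear_on A A (\<lambda>a. mult A a b)) \<and>
     (\<forall>p q. \<forall>a\<in>deg A p. \<forall>b\<in>deg A q. mult A a b \<in> deg A (p + q)) \<and>
     (\<forall>a b c. mult A (mult A a b) c = mult A a (mult A b c)) \<and>
     unit A \<in> deg A 0 \<and> (\<forall>a. mult A (unit A) a = a \<and> mult A a (unit A) = a) \<and>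
     (\<forall>p. \<forall>a\<in>deg A p. \<forall>b. diff A (mult A a b) = mult A (diff A a) b + sg p (mult A a (diff A b)))"

definition dga_ainf :: "('k, 'a::ab_group_add) dga \<Rightarrow> ('k, 'a) ainf" where
  "dga_ainf A = \<lparr>scale = scale A, deg = deg A,
     ops = (\<lambda>as. case as of [a] \<Rightarrow> diff A a | [a, b] \<Rightarrow> mult A a b | _ \<Rightarrow> 0)\<rparr>"

text \<open>\<open>H\<close> is the homology of \<open>A\<close>, presented by the map \<open>cls\<close> that sends a cycle to its homology
  class: the graded quotient of the cycles by the boundaries.\<close>

definition homology_of :: "('k::field, 'a::ab_group_add) dga \<Rightarrow> ('k, 'h::ab_group_add, 'z) grmod_scheme \<Rightarrow>
    ('a \<Rightarrow> 'h) \<Rightarrow> bool" where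
  "homology_of A H cls \<longleftrightarrow> graded H \<and> total H = UNIV \<and>
     (\<forall>a b. diff A a = 0 \<and> diff A b = 0 \<longrightarrow> cls (a + b) = cls a + cls b) \<and>
     (\<forall>c a. diff A a = 0 \<longrightarrow> cls (scale A c a) = scale H c (cls a)) \<and>
     (\<forall>n. cls ` {a \<in> deg A n. diff A a = 0} = deg H n) \<and>
     (\<forall>a. diff A a = 0 \<longrightarrow> (cls a = 0 \<longleftrightarrow> a \<in> range (diff A)))"

definition kadeishvili_model :: "('k::field, 'a::ab_group_add) dga \<Rightarrow> ('k, 'h::ab_group_add) ainf \<Rightarrow>
    ('a \<Rightarrow> 'h) \<Rightarrow> ('h list \<Rightarrow> 'a) \<Rightarrow> bool" where
  "kadeishvili_model A H cls f \<longleftrightarrow> homology_of A H cls \<and> ainf_algebra H \<and>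
     (\<forall>h. ops H [h] = 0) \<and>
     (\<forall>a b. diff A a = 0 \<and> diff A b = 0 \<longrightarrow> ops H [cls a, cls b] = cls (mult A a b)) \<and>
     ainf_quasi_iso H (dga_ainf A) f"


section \<open>Minimal modules over an A-infinity algebra\<close>

text \<open>\<open>act_inf X x [h\<^sub>1, \<dots>, h\<^sub>i\<^sub>-\<^sub>1]\<close> is \<open>m\<^sub>i\<^sup>X(x \<otimes> h\<^sub>1 \<otimes> \<dots> \<otimes> h\<^sub>i\<^sub>-\<^sub>1)\<close>. For an \<open>A\<^sub>l\<close>-module the values
  on lists of length at least \<open>l\<close> are irrelevant; likewise for morphisms.\<close>

record ('k, 'h, 'x) amod = "('k, 'x) grmod" +
  act_inf :: "'x \<Rightarrow> 'h list \<Rightarrow> 'x"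

definition module_maps :: "int \<Rightarrow> nat \<Rightarrow> ('k::field, 'h::ab_group_add, 'z) ainf_scheme \<Rightarrow>
    ('k, 'h, 'x::ab_group_add) amod \<Rightarrow> ('k, 'h, 'x) amod \<Rightarrow> ('x \<Rightarrow> 'h list \<Rightarrow> 'x) \<Rightarrow> bool" where
  "module_maps e l H X Y g \<longleftrightarrow>
     (\<forall>hs. length hs < l \<longrightarrow> linear_on X Y (\<lambda>x. g x hs)) \<and>
     (\<forall>x\<in>total X. \<forall>us h h' vs. length (us @ h # vs) < l \<longrightarrow>
        g x (us @ (h + h') # vs) = g x (us @ h # vs) + g x (us @ h' # vs)) \<and>
     (\<forall>x\<in>total X. \<forall>c us h vs. length (us @ h # vs) < l \<longrightarrow>
        g x (us @ scale H c h # vs) = scale Y c (g x (us @ h # vs))) \<and>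
     (\<forall>p ds hs. \<forall>x\<in>deg X p. length hs < l \<and> homogeneous H ds hs \<longrightarrow>
        g x hs \<in> deg Y (p + sum_list ds + (int (length hs) + 1) + e))"

text \<open>\<open>1\<^sup>\<otimes>\<^sup>r \<otimes> m\<^sub>s \<otimes> 1\<^sup>\<otimes>\<^sup>t\<close> on \<open>X \<otimes> H\<^sup>\<otimes>\<^sup>(\<^sup>m\<^sup>-\<^sup>1\<^sup>)\<close>, with \<open>m\<^sub>s = m\<^sub>s\<^sup>X\<close> if \<open>r = 0\<close>.\<close>

definition insert_mod :: "('k, 'h::ab_group_add, 'z) ainf_scheme \<Rightarrow> ('k, 'h, 'x::ab_group_add) amod \<Rightarrow>
    nat \<Rightarrow> nat \<Rightarrow> 'x \<Rightarrow> 'h list \<Rightarrow> 'x \<times> 'h list" where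
  "insert_mod H X r s x hs =
     (if r = 0 then (act_inf X x (take (s - 1) hs), drop (s - 1) hs)
      else (koszul X (int s - 2) x, insert_op H (r - 1) s hs))"

definition minimal_module :: "('k::field, 'h::ab_group_add) ainf \<Rightarrow> 'h \<Rightarrow> nat \<Rightarrow>
    ('k, 'h, 'x::ab_group_add) amod \<Rightarrow> bool" where
  "minimal_module H e l X \<longleftrightarrow> graded X \<and> module_maps (- 2) l H X X (act_inf X) \<and>
     (\<forall>x\<in>total X. act_inf X x [] = 0) \<and>
     (\<forall>x\<in>total X. \<forall>hs. length hs < l \<longrightarrow>
        (let m = length hs + 1 in
          (\<Sum>s = 1..m. \<Sum>r = 0..m - s. let t = m - s - r; (y, ks) = insert_mod H X r s x hs
             in sg (int (r + s * t)) (act_inf X y ks)) = 0)) \<and>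
     (\<forall>x\<in>total X. \<forall>h h'. act_inf X (act_inf X x [h]) [h'] = act_inf X x [ops H [h, h']]) \<and>
     (\<forall>x\<in>total X. act_inf X x [e] = x)"

definition module_morphism :: "('k::field, 'h::ab_group_add) ainf \<Rightarrow> nat \<Rightarrow>
    ('k, 'h, 'x::ab_group_add) amod \<Rightarrow> ('k, 'h, 'x) amod \<Rightarrow> ('x \<Rightarrow> 'h list \<Rightarrow> 'x) \<Rightarrow> bool" where
  "module_morphism H l X Y g \<longleftrightarrow> module_maps (- 1) l H X Y g \<and>
     (\<forall>x\<in>total X. \<forall>hs. length hs < l \<longrightarrow>
        (let m = length hs + 1 in
          (\<Sum>s = 1..m. \<Sum>r = 0..m - s. let t = m - s - r; (y, ks) = insert_mod H X r s x hs
             in sg (int (r + s * t)) (g y ks)) =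
          (\<Sum>i = 1..m. let j = m - i
             in sg (int ((i + 1) * j)) (act_inf Y (g x (take (i - 1) hs)) (drop (i - 1) hs)))))"

definition id_morphism :: "'x::ab_group_add \<Rightarrow> 'h list \<Rightarrow> 'x" where
  "id_morphism x hs = (if hs = [] then x else 0)"

definition comp_morphism :: "('x::ab_group_add \<Rightarrow> 'h list \<Rightarrow> 'x) \<Rightarrow> ('x \<Rightarrow> 'h list \<Rightarrow> 'x) \<Rightarrow>
    'x \<Rightarrow> 'h list \<Rightarrow> 'x" where
  "comp_morphism f g x hs = (\<Sum>r = 1..length hs + 1. let s = length hs + 1 - r
     in sg (int ((r - 1) * s)) (f (g x (take (r - 1) hs)) (drop (r - 1) hs)))"


section \<open>Differential graded modules and their derived category\<close>

record ('k, 'a, 'u) dgmod = "('k, 'u) grmod" +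
  mdiff :: "'u \<Rightarrow> 'u"
  act :: "'u \<Rightarrow> 'a \<Rightarrow> 'u"

definition dg_module :: "('k::field, 'a::ab_group_add) dga \<Rightarrow> ('k, 'a, 'u::ab_group_add) dgmod \<Rightarrow> bool" where
  "dg_module A M \<longleftrightarrow> graded M \<and> graded_map (- 1) M M (mdiff M) \<and>
     (\<forall>x\<in>total M. mdiff M (mdiff M x) = 0) \<and>
     (\<forall>a. linear_on M M (\<lambda>x. act M x a)) \<and> (\<forall>x\<in>total M. linear_on A M (act M x)) \<and>
     (\<forall>p q. \<forall>x\<in>deg M p. \<forall>a\<in>deg A q. act M x a \<in> deg M (p + q)) \<and>
     (\<forall>x\<in>total M. \<forall>a b. act M (act M x a) b = act M x (mult A a b)) \<and>
     (\<forall>x\<in>total M. act M x (unit A) = x) \<and>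
     (\<forall>p. \<forall>x\<in>deg M p. \<forall>a. mdiff M (act M x a) = act M (mdiff M x) a + sg p (act M x (diff A a)))"

definition shift :: "int \<Rightarrow> ('k, 'a, 'u::ab_group_add) dgmod \<Rightarrow> ('k, 'a, 'u) dgmod" where
  "shift n M = M\<lparr>deg := (\<lambda>i. deg M (i + n)), mdiff := (\<lambda>x. sg n (mdiff M x))\<rparr>"

definition cycles :: "('k, 'a, 'u::ab_group_add) dgmod \<Rightarrow> 'u set" where
  "cycles M = {z \<in> total M. mdiff M z = 0}"

definition boundaries :: "('k, 'a, 'u::ab_group_add) dgmod \<Rightarrow> 'u set" where
  "boundaries M = mdiff M ` total M"

definition act_linear :: "('k, 'a, 'u::ab_group_add) dgmod \<Rightarrow> ('k, 'a, 'u) dgmod \<Rightarrow> ('u \<Rightarrow> 'u) \<Rightarrow> bool" where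
  "act_linear M N F \<longleftrightarrow> (\<forall>x\<in>total M. \<forall>a. F (act M x a) = act N (F x) a)"

definition dg_map :: "('k::field, 'a, 'u::ab_group_add) dgmod \<Rightarrow> ('k, 'a, 'u) dgmod \<Rightarrow>
    ('u \<Rightarrow> 'u) \<Rightarrow> bool" where
  "dg_map M N F \<longleftrightarrow> graded_map 0 M N F \<and> act_linear M N F \<and>
     (\<forall>x\<in>total M. F (mdiff M x) = mdiff N (F x))"

definition homotopic :: "('k::field, 'a, 'u::ab_group_add) dgmod \<Rightarrow> ('k, 'a, 'u) dgmod \<Rightarrow>
    ('u \<Rightarrow> 'u) \<Rightarrow> ('u \<Rightarrow> 'u) \<Rightarrow> bool" where
  "homotopic M N F G \<longleftrightarrow> dg_map M N F \<and> dg_map M N G \<and>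
     (\<exists>S. graded_map 1 M N S \<and> act_linear M N S \<and>
        (\<forall>x\<in>total M. F x - G x = mdiff N (S x) + S (mdiff M x)))"

definition quasi_iso :: "('k::field, 'a, 'u::ab_group_add) dgmod \<Rightarrow> ('k, 'a, 'u) dgmod \<Rightarrow>
    ('u \<Rightarrow> 'u) \<Rightarrow> bool" where
  "quasi_iso M N F \<longleftrightarrow> dg_map M N F \<and>
     (\<forall>z\<in>cycles M. F z \<in> boundaries N \<longrightarrow> z \<in> boundaries M) \<and>
     (\<forall>w\<in>cycles N. \<exists>z\<in>cycles M. w - F z \<in> boundaries N)"

text \<open>
  The derived category is the localization of the homotopy category of DG right \<open>A\<close>-modules at the
  quasi-isomorphisms, by generators and relations. A morphism is represented by a word in maps of
  DG modules and formal inverses of quasi-isomorphisms (read from left to right, so that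
  concatenation is composition in diagrammatic order); \<open>Inv M N s\<close> is the formal inverse \<open>N \<rightarrow> M\<close> of
  \<open>s: M \<rightarrow> N\<close>. Two words represent the same morphism iff they are related by \<open>deq\<close>. The objects are
  all DG modules carried by subspaces of the ambient type \<open>'u\<close>.
\<close>

datatype ('m, 'u) letter = Map 'm 'm "'u \<Rightarrow> 'u" | Inv 'm 'm "'u \<Rightarrow> 'u"

type_synonym ('k, 'a, 'u) path = "(('k, 'a, 'u) dgmod, 'u) letter list"

inductive dpath :: "('k::field, 'a::ab_group_add) dga \<Rightarrow> ('k, 'a, 'u::ab_group_add) dgmod \<Rightarrow>
    ('k, 'a, 'u) path \<Rightarrow> ('k, 'a, 'u) dgmod \<Rightarrow> bool" for A where
  dpath_nil: "dg_module A M \<Longrightarrow> dpath A M [] M"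
| dpath_map: "dg_module A M \<Longrightarrow> dg_map M N F \<Longrightarrow> dpath A N p P \<Longrightarrow> dpath A M (Map M N F # p) P"
| dpath_inv: "dg_module A N \<Longrightarrow> quasi_iso M N s \<Longrightarrow> dpath A M p P \<Longrightarrow> dpath A N (Inv M N s # p) P"

inductive deq :: "('k::field, 'a::ab_group_add) dga \<Rightarrow> ('k, 'a, 'u::ab_group_add) dgmod \<Rightarrow>
    ('k, 'a, 'u) dgmod \<Rightarrow> ('k, 'a, 'u) path \<Rightarrow> ('k, 'a, 'u) path \<Rightarrow> bool" for A where
  deq_refl: "dpath A M p N \<Longrightarrow> deq A M N p p"
| deq_sym: "deq A M N p q \<Longrightarrow> deq A M N q p"
| deq_trans: "deq A M N p q \<Longrightarrow> deq A M N q r \<Longrightarrow> deq A M N p r"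
| deq_cong: "dpath A L l M \<Longrightarrow> deq A M N p q \<Longrightarrow> dpath A N r P \<Longrightarrow> deq A L P (l @ p @ r) (l @ q @ r)"
| deq_homotopic: "dg_module A M \<Longrightarrow> dg_module A N \<Longrightarrow> homotopic M N F G \<Longrightarrow>
    deq A M N [Map M N F] [Map M N G]"
| deq_id: "dg_module A M \<Longrightarrow> deq A M M [Map M M (\<lambda>x. x)] []"
| deq_comp: "dg_module A M \<Longrightarrow> dg_module A N \<Longrightarrow> dg_module A P \<Longrightarrow> dg_map M N F \<Longrightarrow> dg_map N P G \<Longrightarrow>
    deq A M P [Map M N F, Map N P G] [Map M P (\<lambda>x. G (F x))]"
| deq_inv_right: "dg_module A M \<Longrightarrow> dg_module A N \<Longrightarrow> quasi_iso M N s \<Longrightarrow>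
    deq A M M [Map M N s, Inv M N s] []"
| deq_inv_left: "dg_module A M \<Longrightarrow> dg_module A N \<Longrightarrow> quasi_iso M N s \<Longrightarrow>
    deq A N N [Inv M N s, Map M N s] []"

definition derived_iso :: "('k::field, 'a::ab_group_add) dga \<Rightarrow> ('k, 'a, 'u::ab_group_add) dgmod \<Rightarrow>
    ('k, 'a, 'u) path \<Rightarrow> ('k, 'a, 'u) dgmod \<Rightarrow> bool" where
  "derived_iso A M p N \<longleftrightarrow> dpath A M p N \<and>
     (\<exists>q. dpath A N q M \<and> deq A M M (p @ q) [] \<and> deq A N N (q @ p) [])"

fun shift_letter :: "int \<Rightarrow> (('k, 'a, 'u::ab_group_add) dgmod, 'u) letter \<Rightarrow>
    (('k, 'a, 'u) dgmod, 'u) letter" where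
  "shift_letter n (Map M N F) = Map (shift n M) (shift n N) F"
| "shift_letter n (Inv M N F) = Inv (shift n M) (shift n N) F"

text \<open>\<open>E\<close> is the mapping cone \<open>Q \<oplus> P[-1]\<close> of \<open>\<phi>: P \<rightarrow> Q\<close>, with inclusions \<open>\<iota>\<close> and \<open>\<kappa>\<close> of the two summands,
  projection \<open>\<rho>\<close> to \<open>P[-1]\<close> and differential \<open>(q, p) \<mapsto> (dq + \<phi>p, -dp)\<close>. As \<open>C[n]\<^sub>i = C\<^sub>i\<^sub>+\<^sub>n\<close>, the suspension
  of the triangulated structure is \<open>[-1]\<close>.\<close>

definition mapping_cone :: "('k::field, 'a::ab_group_add) dga \<Rightarrow> ('k, 'a, 'u::ab_group_add) dgmod \<Rightarrow>
    ('k, 'a, 'u) dgmod \<Rightarrow> ('u \<Rightarrow> 'u) \<Rightarrow> ('k, 'a, 'u) dgmod \<Rightarrow>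
    ('u \<Rightarrow> 'u) \<Rightarrow> ('u \<Rightarrow> 'u) \<Rightarrow> ('u \<Rightarrow> 'u) \<Rightarrow> bool" where
  "mapping_cone A P Q \<phi> E \<iota> \<kappa> \<rho> \<longleftrightarrow>
     dg_module A P \<and> dg_module A Q \<and> dg_module A E \<and> dg_map P Q \<phi> \<and>
     dg_map Q E \<iota> \<and> graded_map 1 P E \<kappa> \<and> act_linear P E \<kappa> \<and>
     (\<forall>n. deg E n = {\<iota> q + \<kappa> p | q p. q \<in> deg Q n \<and> p \<in> deg P (n - 1)}) \<and>
     (\<forall>q\<in>total Q. \<forall>p\<in>total P. \<iota> q + \<kappa> p = 0 \<longrightarrow> q = 0 \<and> p = 0) \<and>
     (\<forall>p\<in>total P. mdiff E (\<kappa> p) = \<iota> (\<phi> p) - \<kappa> (mdiff P p)) \<and>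
     (\<forall>q\<in>total Q. \<forall>p\<in>total P. \<rho> (\<iota> q + \<kappa> p) = p)"

text \<open>The triangle \<open>C \<rightarrow> D \<rightarrow> E \<rightarrow> C[-1]\<close> is isomorphic, in the derived category, to the triangle of a
  mapping cone.\<close>

definition distinguished :: "('k::field, 'a::ab_group_add) dga \<Rightarrow> ('k, 'a, 'u::ab_group_add) dgmod \<Rightarrow>
    ('k, 'a, 'u) dgmod \<Rightarrow> ('k, 'a, 'u) dgmod \<Rightarrow>
    ('k, 'a, 'u) path \<Rightarrow> ('k, 'a, 'u) path \<Rightarrow> ('k, 'a, 'u) path \<Rightarrow> bool" where
  "distinguished A C D E u v w \<longleftrightarrow>
     dpath A C u D \<and> dpath A D v E \<and> dpath A E w (shift (- 1) C) \<and>
     (\<exists>P Q F \<phi> \<iota> \<kappa> \<rho> a b c. mapping_cone A P Q \<phi> F \<iota> \<kappa> \<rho> \<and>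
        derived_iso A C a P \<and> derived_iso A D b Q \<and> derived_iso A E c F \<and>
        deq A C Q (u @ b) (a @ [Map P Q \<phi>]) \<and>
        deq A D F (v @ c) (b @ [Map Q F \<iota>]) \<and>
        deq A E (shift (- 1) P) (w @ map (shift_letter (- 1)) a) (c @ [Map F (shift (- 1) P) \<rho>]))"

text \<open>\<open>homology_rel N p z w\<close>: the map on homology induced by the morphism \<open>p\<close> with target \<open>N\<close> sends
  the class of the cycle \<open>z\<close> to the class of the cycle \<open>w\<close>.\<close>

fun letter_rel :: "(('k, 'a, 'u::ab_group_add) dgmod, 'u) letter \<Rightarrow> 'u \<Rightarrow> 'u \<Rightarrow> bool" where
  "letter_rel (Map M N F) z w \<longleftrightarrow> z \<in> cycles M \<and> w \<in> cycles N \<and> w - F z \<in> boundaries N"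
| "letter_rel (Inv M N s) z w \<longleftrightarrow> z \<in> cycles N \<and> w \<in> cycles M \<and> z - s w \<in> boundaries N"

fun homology_rel :: "('k, 'a, 'u::ab_group_add) dgmod \<Rightarrow> ('k, 'a, 'u) path \<Rightarrow> 'u \<Rightarrow> 'u \<Rightarrow> bool" where
  "homology_rel N [] z w \<longleftrightarrow> z \<in> cycles N \<and> w \<in> cycles N \<and> w - z \<in> boundaries N"
| "homology_rel N (e # p) z w \<longleftrightarrow> (\<exists>y. letter_rel e z y \<and> homology_rel N p y w)"

text \<open>A free DG module is a direct sum of shifts of \<open>A\<close>: it has a basis of homogeneous cycles.\<close>

definition dg_free :: "('k::field, 'a::ab_group_add) dga \<Rightarrow> ('k, 'a, 'u::ab_group_add) dgmod \<Rightarrow> bool" where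
  "dg_free A M \<longleftrightarrow> dg_module A M \<and>
     (\<exists>S. (\<forall>b\<in>S. mdiff M b = 0 \<and> (\<exists>p. b \<in> deg M p)) \<and>
        (\<forall>x\<in>total M. \<exists>!c. finite {b. c b \<noteq> 0} \<and> {b. c b \<noteq> 0} \<subseteq> S \<and>
           x = (\<Sum>b | c b \<noteq> 0. act M b (c b))))"


section \<open>Postnikov systems\<close>

text \<open>The maps \<open>j\<^sub>i: Y\<^sub>i \<rightarrow> C\<^sub>i\<close>, \<open>i\<^sub>i: C\<^sub>i \<rightarrow> Y\<^sub>i\<^sub>-\<^sub>1\<close> and \<open>d\<^sub>i: C\<^sub>i \<rightarrow> C\<^sub>i\<^sub>-\<^sub>1\<close> are \<open>jmap i\<close>, \<open>imap i\<close> and \<open>dmap i\<close>;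
  \<open>conn i: Y\<^sub>i\<^sub>-\<^sub>1 \<rightarrow> Y\<^sub>i[-1]\<close> is the third map of the triangle \<open>Y\<^sub>i \<rightarrow> C\<^sub>i \<rightarrow> Y\<^sub>i\<^sub>-\<^sub>1\<close>.\<close>

record ('k, 'a, 'u) postnikov =
  Cobj :: "nat \<Rightarrow> ('k, 'a, 'u) dgmod"
  Yobj :: "nat \<Rightarrow> ('k, 'a, 'u) dgmod"
  jmap :: "nat \<Rightarrow> ('k, 'a, 'u) path"
  imap :: "nat \<Rightarrow> ('k, 'a, 'u) path"
  dmap :: "nat \<Rightarrow> ('k, 'a, 'u) path"
  conn :: "nat \<Rightarrow> ('k, 'a, 'u) path"

text \<open>
  An augmentation \<open>\<epsilon>: H\<^sub>*(C\<^sub>0) \<rightarrow> X\<close>, given on cycles, that makes \<open>H\<^sub>*(C\<^sub>n) \<rightarrow> \<dots> \<rightarrow> H\<^sub>*(C\<^sub>0) \<rightarrow> X \<rightarrow> 0\<close> exact.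
  The function \<open>rep\<close> sends an element of \<open>H\<^sub>*(A)\<close> to a cycle through which it acts on \<open>H\<^sub>*(C\<^sub>0)\<close>. If
  this cycle represents the given class then the equation for \<open>act (C\<^sub>0) z (rep h)\<close> is
  \<open>H\<^sub>*(A)\<close>-linearity of \<open>\<epsilon>\<close>, since \<open>\<epsilon>\<close> vanishes on boundaries. For \<open>rep = f\<^sub>1\<close> with \<open>f\<^sub>1\<close> inducing an
  automorphism of \<open>H\<^sub>*(A)\<close> other than the identity, it is linearity along that automorphism.
\<close>

definition augmented_exact :: "('h \<Rightarrow> 'a) \<Rightarrow> nat \<Rightarrow> ('k::field, 'h::ab_group_add, 'x::ab_group_add) amod \<Rightarrow>
    ('k, 'a, 'u::ab_group_add) postnikov \<Rightarrow> ('u \<Rightarrow> 'x) \<Rightarrow> bool" where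
  "augmented_exact rep n X P \<epsilon> \<longleftrightarrow> (let C = Cobj P in
     (\<forall>z\<in>cycles (C 0). \<forall>w\<in>cycles (C 0). \<epsilon> (z + w) = \<epsilon> z + \<epsilon> w) \<and>
     (\<forall>c. \<forall>z\<in>cycles (C 0). \<epsilon> (scale (C 0) c z) = scale X c (\<epsilon> z)) \<and>
     (\<forall>p. \<forall>z\<in>cycles (C 0) \<inter> deg (C 0) p. \<epsilon> z \<in> deg X p) \<and>
     (\<forall>z\<in>boundaries (C 0). \<epsilon> z = 0) \<and>
     (\<forall>z\<in>cycles (C 0). \<forall>h. \<epsilon> (act (C 0) z (rep h)) = act_inf X (\<epsilon> z) [h]) \<and>
     \<epsilon> ` cycles (C 0) = total X \<and>
     (\<forall>z\<in>cycles (C 0). \<epsilon> z = 0 \<longleftrightarrow> (\<exists>y. homology_rel (C 0) (dmap P 1) y z)) \<and>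
     (\<forall>i\<in>{1..<n}. \<forall>z\<in>cycles (C i). homology_rel (C (i - 1)) (dmap P i) z 0 \<longleftrightarrow>
        (\<exists>y. homology_rel (C i) (dmap P (i + 1)) y z)))"

definition postnikov_system :: "('k::field, 'a::ab_group_add) dga \<Rightarrow> ('h \<Rightarrow> 'a) \<Rightarrow> nat \<Rightarrow>
    ('k, 'h::ab_group_add, 'x::ab_group_add) amod \<Rightarrow> ('k, 'a, 'u::ab_group_add) postnikov \<Rightarrow> bool" where
  "postnikov_system A rep n X P \<longleftrightarrow> (let C = Cobj P; Y = Yobj P; j = jmap P; i = imap P; d = dmap P in
     (\<forall>l\<le>n. dg_free A (C l) \<and> dg_module A (Y l)) \<and> Y 0 = C 0 \<and> j 0 = [] \<and>
     (\<forall>l\<in>{1..n}. dpath A (Y l) (j l) (C l) \<and> dpath A (C l) (i l) (Y (l - 1)) \<and>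
        dpath A (C l) (d l) (C (l - 1)) \<and> deq A (C l) (C (l - 1)) (d l) (i l @ j (l - 1)) \<and>
        distinguished A (Y l) (C l) (Y (l - 1)) (j l) (i l) (conn P l)) \<and>
     (\<exists>\<epsilon>. augmented_exact rep n X P \<epsilon>))"

text \<open>A map consists of morphisms \<open>\<alpha> l: C\<^sub>l \<rightarrow> C'\<^sub>l\<close> and \<open>\<beta> l: Y\<^sub>l \<rightarrow> Y'\<^sub>l\<close> in the derived category.\<close>

definition postnikov_map :: "('k::field, 'a::ab_group_add) dga \<Rightarrow> nat \<Rightarrow>
    ('k, 'a, 'u::ab_group_add) postnikov \<Rightarrow> ('k, 'a, 'u) postnikov \<Rightarrow>
    (nat \<Rightarrow> ('k, 'a, 'u) path) \<Rightarrow> (nat \<Rightarrow> ('k, 'a, 'u) path) \<Rightarrow> bool" where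
  "postnikov_map A n P P' \<alpha> \<beta> \<longleftrightarrow>
     (\<forall>l\<le>n. dpath A (Cobj P l) (\<alpha> l) (Cobj P' l) \<and> dpath A (Yobj P l) (\<beta> l) (Yobj P' l)) \<and>
     deq A (Cobj P 0) (Cobj P' 0) (\<alpha> 0) (\<beta> 0) \<and>
     (\<forall>l\<in>{1..n}.
        deq A (Yobj P l) (Cobj P' l) (jmap P l @ \<alpha> l) (\<beta> l @ jmap P' l) \<and>
        deq A (Cobj P l) (Yobj P' (l - 1)) (imap P l @ \<beta> (l - 1)) (\<alpha> l @ imap P' l) \<and>
        deq A (Cobj P l) (Cobj P' (l - 1)) (dmap P l @ \<alpha> (l - 1)) (\<alpha> l @ dmap P' l) \<and>
        deq A (Yobj P (l - 1)) (shift (- 1) (Yobj P' l))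
          (conn P l @ map (shift_letter (- 1)) (\<beta> l)) (\<beta> (l - 1) @ conn P' l))"


section \<open>The tensor products and the bar construction\<close>

text \<open>
  All \<open>R\<^sub>i = X \<otimes> H\<^sup>\<otimes>\<^sup>i \<otimes> A\<close> are realised in one space, with the pure tensor
  \<open>x \<otimes> h\<^sub>1 \<otimes> \<dots> \<otimes> h\<^sub>i \<otimes> a\<close> being evaluation at \<open>(x, [h\<^sub>1, \<dots>, h\<^sub>i], a)\<close> on the multilinear forms: a tensor
  product of vector spaces is the span of these functionals, by lemma \<open>tensor_universal\<close> below. A
  form is separately multilinear for each \<open>i\<close>, so the \<open>R\<^sub>i\<close> are independent for different \<open>i\<close> and
  direct sums of the \<open>R\<^sub>i\<close> are internal. The ambient space of functionals does not
  depend on \<open>X\<close> and has, even if \<open>X\<close> is small, dimension larger than the cardinality of each of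
  \<open>k\<close>, \<open>A\<close> and \<open>X\<close>; hence it has room for resolutions and cones of all DG modules occurring here.
\<close>

type_synonym ('x, 'h, 'a) tuple = "'x \<times> 'h list \<times> 'a"
type_synonym ('k, 'x, 'h, 'a) tens = "(('x, 'h, 'a) tuple \<Rightarrow> 'k) \<Rightarrow> 'k"

definition tscale :: "'k::field \<Rightarrow> ('k, 'x, 'h, 'a) tens \<Rightarrow> ('k, 'x, 'h, 'a) tens" where
  "tscale c t = (\<lambda>\<phi>. c * t \<phi>)"

definition tuple_multilinear :: "('k::field, 'x::ab_group_add, 'y) grmod_scheme \<Rightarrow>
    ('k, 'h::ab_group_add, 'z) grmod_scheme \<Rightarrow> ('k, 'a::ab_group_add, 'w) grmod_scheme \<Rightarrow>
    ('k \<Rightarrow> 'v::ab_group_add \<Rightarrow> 'v) \<Rightarrow> (('x, 'h, 'a) tuple \<Rightarrow> 'v) \<Rightarrow> bool" where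
  "tuple_multilinear X H A s F \<longleftrightarrow>
     (\<forall>x\<in>total X. \<forall>x'\<in>total X. \<forall>hs a. F (x + x', hs, a) = F (x, hs, a) + F (x', hs, a)) \<and>
     (\<forall>c. \<forall>x\<in>total X. \<forall>hs a. F (scale X c x, hs, a) = s c (F (x, hs, a))) \<and>
     (\<forall>x\<in>total X. \<forall>us h h' vs a.
        F (x, us @ (h + h') # vs, a) = F (x, us @ h # vs, a) + F (x, us @ h' # vs, a)) \<and>
     (\<forall>c. \<forall>x\<in>total X. \<forall>us h vs a. F (x, us @ scale H c h # vs, a) = s c (F (x, us @ h # vs, a))) \<and>
     (\<forall>x\<in>total X. \<forall>hs a a'. F (x, hs, a + a') = F (x, hs, a) + F (x, hs, a')) \<and>
     (\<forall>c. \<forall>x\<in>total X. \<forall>hs a. F (x, hs, scale A c a) = s c (F (x, hs, a)))"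

abbreviation form :: "('k::field, 'x::ab_group_add, 'y) grmod_scheme \<Rightarrow>
    ('k, 'h::ab_group_add, 'z) grmod_scheme \<Rightarrow> ('k, 'a::ab_group_add, 'w) grmod_scheme \<Rightarrow>
    (('x, 'h, 'a) tuple \<Rightarrow> 'k) \<Rightarrow> bool" where
  "form X H A \<equiv> tuple_multilinear X H A (*)"

definition pure_tensor :: "('k::field, 'x::ab_group_add, 'y) grmod_scheme \<Rightarrow>
    ('k, 'h::ab_group_add, 'z) grmod_scheme \<Rightarrow> ('k, 'a::ab_group_add, 'w) grmod_scheme \<Rightarrow>
    ('x, 'h, 'a) tuple \<Rightarrow> ('k, 'x, 'h, 'a) tens" where
  "pure_tensor X H A \<tau> = (\<lambda>\<phi>. if form X H A \<phi> then \<phi> \<tau> else 0)"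

lemma vector_space_tscale: "vector_space tscale"
  by unfold_locales (auto simp: tscale_def fun_eq_iff algebra_simps)

text \<open>Linear maps out of the span of the pure tensors are the multilinear maps on tuples.\<close>

lemma tensor_universal:
  fixes s :: "'k::field \<Rightarrow> 'v::ab_group_add \<Rightarrow> 'v"
    and X :: "('k, 'x::ab_group_add, 'y) grmod_scheme"
    and H :: "('k, 'h::ab_group_add, 'z) grmod_scheme"
    and A :: "('k, 'a::ab_group_add, 'w) grmod_scheme"
  assumes s: "vector_space s" and F: "tuple_multilinear X H A s F"
  shows "\<exists>L. Vector_Spaces.linear tscale s L \<and>
    (\<forall>x\<in>total X. \<forall>hs a. L (pure_tensor X H A (x, hs, a)) = F (x, hs, a))"
proof -
  interpret T: vector_space "tscale :: 'k \<Rightarrow> ('k, 'x, 'h, 'a) tens \<Rightarrow> _" by (rule vector_space_tscale)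
  interpret V: vector_space s by (rule s)
  interpret K: vector_space "(*) :: 'k \<Rightarrow> 'k \<Rightarrow> 'k" by unfold_locales (auto simp: algebra_simps)
  interpret TV: vector_space_pair "tscale :: 'k \<Rightarrow> ('k, 'x, 'h, 'a) tens \<Rightarrow> _" s ..
  interpret VK: vector_space_pair s "(*) :: 'k \<Rightarrow> 'k \<Rightarrow> 'k" ..
  define D :: "('x, 'h, 'a) tuple set" where "D = total X \<times> UNIV"
  define P where "P = pure_tensor X H A"
  obtain B where B: "B \<subseteq> P ` D" "T.independent B" "P ` D \<subseteq> T.span B"
    by (meson T.maximal_independent_subset)
  obtain g where g: "\<And>b. b \<in> B \<Longrightarrow> g b \<in> D \<and> P (g b) = b"
    using B(1) by (metis f_inv_into_f in_mono inv_into_into)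
  obtain L where L: "Vector_Spaces.linear tscale s L" "\<And>b. b \<in> B \<Longrightarrow> L b = F (g b)"
    using TV.linear_independent_extend[OF B(2), of "\<lambda>b. F (g b)"] by blast
  have "L (P \<tau>) = F \<tau>" if \<tau>: "\<tau> \<in> D" for \<tau>
  proof -
    obtain S r where S: "finite S" "S \<subseteq> B" and eq: "P \<tau> = (\<Sum>b\<in>S. tscale (r b) b)"
      using B(3) \<tau> unfolding T.span_explicit by blast
    have "L (P \<tau>) = (\<Sum>b\<in>S. s (r b) (L b))"
      unfolding eq Vector_Spaces.linear.axioms(3)[OF L(1), THEN module_hom.sum]
      by (intro sum.cong refl Vector_Spaces.linear.axioms(3)[OF L(1), THEN module_hom.scale])
    also have "\<dots> = (\<Sum>b\<in>S. s (r b) (F (g b)))"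
      using L(2) S(2) by (intro sum.cong) auto
    finally have L\<tau>: "L (P \<tau>) = (\<Sum>b\<in>S. s (r b) (F (g b)))" .
    show ?thesis
    proof (rule ccontr)
      define w where "w = F \<tau> - L (P \<tau>)"
      assume "L (P \<tau>) \<noteq> F \<tau>"
      then have "V.independent {w}" by (simp add: w_def)
      then obtain \<psi> where \<psi>: "Vector_Spaces.linear s (*) \<psi>" "\<psi> w = 1"
        using VK.linear_independent_extend[of "{w}" "\<lambda>_. 1"] by auto
      interpret h: Vector_Spaces.linear s "(*)" \<psi> by (rule \<psi>(1))
      have "form X H A (\<psi> \<circ> F)"
        using F unfolding tuple_multilinear_def by (simp add: h.add h.scale)
      then have P: "P \<sigma> (\<psi> \<circ> F) = \<psi> (F \<sigma>)" for \<sigma>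
        by (simp add: P_def pure_tensor_def)
      have ev: "(\<Sum>b\<in>S. G b) \<phi> = (\<Sum>b\<in>S. G b \<phi>)" for G :: "_ \<Rightarrow> ('k, 'x, 'h, 'a) tens" and \<phi>
        using S(1) by induction auto
      have "\<psi> (F \<tau>) = (\<Sum>b\<in>S. r b * b (\<psi> \<circ> F))"
        unfolding P[symmetric] eq ev by (simp add: tscale_def)
      also have "\<dots> = (\<Sum>b\<in>S. r b * \<psi> (F (g b)))"
        using g S(2) P by (intro sum.cong refl) (metis subsetD)
      also have "\<dots> = \<psi> (L (P \<tau>))"
        by (simp add: L\<tau> h.sum h.scale)
      finally have "\<psi> w = 0" by (simp add: w_def h.diff)
      with \<psi>(2) show False by simp
    qed
  qed
  then show ?thesis using L(1) by (auto simp: D_def P_def)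
qed

text \<open>For an operation \<open>T\<close> on tuples that takes multilinear forms to multilinear forms by
  composition, \<open>push X' H A S T\<close> is the linear map with \<open>x \<otimes> hs \<otimes> a \<mapsto> T (x, hs, a)\<close>, read as a pure
  tensor over \<open>X'\<close>, for \<open>length hs \<in> S\<close>, and \<open>x \<otimes> hs \<otimes> a \<mapsto> 0\<close> otherwise.\<close>

definition push :: "('k::field, 'x::ab_group_add, 'y) grmod_scheme \<Rightarrow>
    ('k, 'h::ab_group_add, 'z) grmod_scheme \<Rightarrow> ('k, 'a::ab_group_add, 'w) grmod_scheme \<Rightarrow> nat set \<Rightarrow>
    (('x, 'h, 'a) tuple \<Rightarrow> ('x, 'h, 'a) tuple) \<Rightarrow> ('k, 'x, 'h, 'a) tens \<Rightarrow> ('k, 'x, 'h, 'a) tens" where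
  "push X' H A S T t = (\<lambda>\<phi>. if form X' H A \<phi>
     then t (\<lambda>(x, hs, a). if length hs \<in> S then \<phi> (T (x, hs, a)) else 0) else 0)"

text \<open>The maps \<open>m\<^sub>l\<^sup>A\<close>, with \<open>l - 1\<close> the length of the list.\<close>

definition left_op :: "('k, 'a::ab_group_add) dga \<Rightarrow> ('h list \<Rightarrow> 'a) \<Rightarrow> 'h list \<Rightarrow> 'a \<Rightarrow> 'a" where
  "left_op A f hs a = (if hs = [] then diff A a else sg (int (length hs + 1)) (mult A (f hs) a))"

text \<open>The term \<open>1\<^sup>\<otimes>\<^sup>b \<otimes> m\<^sub>l \<otimes> 1\<^sup>\<otimes>\<^sup>(\<^sup>i\<^sup>-\<^sup>l\<^sup>-\<^sup>b\<^sup>+\<^sup>2\<^sup>)\<close> of \<open>M\<^sub>i\<^sub>,\<^sub>l\<close>.\<close>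

definition bar_term :: "('k::field, 'a::ab_group_add) dga \<Rightarrow> ('k, 'h::ab_group_add) ainf \<Rightarrow>
    ('h list \<Rightarrow> 'a) \<Rightarrow> ('k, 'h, 'x::ab_group_add) amod \<Rightarrow> nat \<Rightarrow> nat \<Rightarrow> nat \<Rightarrow>
    ('x, 'h, 'a) tuple \<Rightarrow> ('x, 'h, 'a) tuple" where
  "bar_term A H f X i l b = (\<lambda>(x, hs, a).
     if b = 0 then (act_inf X x (take (l - 1) hs), drop (l - 1) hs, a)
     else if b < i + 2 - l then (koszul X (int l - 2) x, insert_op H (b - 1) l hs, a)
     else (koszul X (int l - 2) x, map (koszul H (int l - 2)) (take (b - 1) hs),
           left_op A f (drop (b - 1) hs) a))"

definition Mop :: "('k::field, 'a::ab_group_add) dga \<Rightarrow> ('k, 'h::ab_group_add) ainf \<Rightarrow>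
    ('h list \<Rightarrow> 'a) \<Rightarrow> ('k, 'h, 'x::ab_group_add) amod \<Rightarrow> nat \<Rightarrow> nat \<Rightarrow>
    ('k, 'x, 'h, 'a) tens \<Rightarrow> ('k, 'x, 'h, 'a) tens" where
  "Mop A H f X i l t =
     (\<Sum>b = 0..i + 2 - l. sg (int (b * (l - 1))) (push X H A {i} (bar_term A H f X i l b) t))"

definition Robj :: "('k::field, 'a::ab_group_add) dga \<Rightarrow> ('k, 'h::ab_group_add) ainf \<Rightarrow>
    ('h list \<Rightarrow> 'a) \<Rightarrow> ('k, 'h, 'x::ab_group_add) amod \<Rightarrow> nat \<Rightarrow>
    ('k, 'a, ('k, 'x, 'h, 'a) tens) dgmod" where
  "Robj A H f X i = \<lparr>scale = tscale,
     deg = (\<lambda>n. module.span tscale {pure_tensor X H A (x, hs, a) | x hs a p ds q.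
        x \<in> deg X p \<and> length hs = i \<and> homogeneous H ds hs \<and> a \<in> deg A q \<and> p + sum_list ds + q = n}),
     mdiff = Mop A H f X i 1,
     act = (\<lambda>t b. push X H A UNIV (\<lambda>(x, hs, a). (x, hs, mult A a b)) t)\<rparr>"

definition bar_complex :: "('k::field, 'a::ab_group_add) dga \<Rightarrow> ('k, 'h::ab_group_add) ainf \<Rightarrow>
    ('h list \<Rightarrow> 'a) \<Rightarrow> ('k, 'h, 'x::ab_group_add) amod \<Rightarrow> nat \<Rightarrow>
    ('k, 'a, ('k, 'x, 'h, 'a) tens) dgmod" where
  "bar_complex A H f X p = \<lparr>scale = tscale,
     deg = (\<lambda>n. {\<Sum>l\<le>p. t l | t. \<forall>l\<le>p. t l \<in> deg (shift (- int l) (Robj A H f X l)) n}),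
     mdiff = (\<lambda>t. \<Sum>l\<le>p. \<Sum>j = 1..l + 1. sg (int (l + (j - 1) div 2)) (Mop A H f X l j t)),
     act = (\<lambda>t b. push X H A UNIV (\<lambda>(x, hs, a). (x, hs, mult A a b)) t)\<rparr>"

text \<open>The entry \<open>g\<^sub>r\<^sub>+\<^sub>1 \<otimes> 1\<^sup>\<otimes>\<^sup>(\<^sup>i\<^sup>-\<^sup>r\<^sup>+\<^sup>1\<^sup>)\<close>, from \<open>R\<^sub>i\<close> to \<open>R\<^sub>i\<^sub>-\<^sub>r\<close>.\<close>

definition bar_entry :: "('k::field, 'a::ab_group_add) dga \<Rightarrow> ('k, 'h::ab_group_add) ainf \<Rightarrow>
    ('k, 'h, 'x::ab_group_add) amod \<Rightarrow> ('x \<Rightarrow> 'h list \<Rightarrow> 'x) \<Rightarrow> nat \<Rightarrow> nat \<Rightarrow>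
    ('k, 'x, 'h, 'a) tens \<Rightarrow> ('k, 'x, 'h, 'a) tens" where
  "bar_entry A H X' g i r = push X' H A {i} (\<lambda>(x, hs, a). (g x (take r hs), drop r hs, a))"

definition bar_map :: "('k::field, 'a::ab_group_add) dga \<Rightarrow> ('k, 'h::ab_group_add) ainf \<Rightarrow>
    ('k, 'h, 'x::ab_group_add) amod \<Rightarrow> ('x \<Rightarrow> 'h list \<Rightarrow> 'x) \<Rightarrow> nat \<Rightarrow>
    ('k, 'x, 'h, 'a) tens \<Rightarrow> ('k, 'x, 'h, 'a) tens" where
  "bar_map A H X' g p t = (\<Sum>j = 1..p + 1. \<Sum>i = 1..j.
     sg (int ((j - i + 1) div 2)) (bar_entry A H X' g (j - 1) (j - i) t))"

text \<open>The connecting map \<open>Y\<^sub>i\<^sub>-\<^sub>1 \<rightarrow> Y\<^sub>i[-1]\<close> is the inclusion of \<open>B\<^sub>i\<^sub>-\<^sub>1\<close> into \<open>B\<^sub>i\<close>, shifted by \<open>i - 1\<close>.\<close>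

definition bar_postnikov :: "('k::field, 'a::ab_group_add) dga \<Rightarrow> ('k, 'h::ab_group_add) ainf \<Rightarrow>
    ('h list \<Rightarrow> 'a) \<Rightarrow> ('k, 'h, 'x::ab_group_add) amod \<Rightarrow>
    ('k, 'a, ('k, 'x, 'h, 'a) tens) postnikov" where
  "bar_postnikov A H f X = (let
     R = Robj A H f X;
     Y = (\<lambda>i. shift (int i) (bar_complex A H f X i))
   in \<lparr>Cobj = R, Yobj = Y,
     jmap = (\<lambda>i. if i = 0 then [] else [Map (Y i) (R i) (push X H A {i} (\<lambda>\<tau>. \<tau>))]),
     imap = (\<lambda>i. [Map (R i) (Y (i - 1))
       (\<lambda>t. \<Sum>j = 2..i + 1. sg (int ((j - 1) div 2)) (Mop A H f X i j t))]),
     dmap = (\<lambda>i. [Map (R i) (R (i - 1)) (Mop A H f X i 2)]),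
     conn = (\<lambda>i. [Map (Y (i - 1)) (shift (- 1) (Y i)) (\<lambda>t. t)])\<rparr>)"

definition bar_postnikov_C :: "('k::field, 'a::ab_group_add) dga \<Rightarrow> ('k, 'h::ab_group_add) ainf \<Rightarrow>
    ('h list \<Rightarrow> 'a) \<Rightarrow> ('k, 'h, 'x::ab_group_add) amod \<Rightarrow> ('k, 'h, 'x) amod \<Rightarrow>
    ('x \<Rightarrow> 'h list \<Rightarrow> 'x) \<Rightarrow> nat \<Rightarrow> ('k, 'a, ('k, 'x, 'h, 'a) tens) path" where
  "bar_postnikov_C A H f X X' g i =
     [Map (Robj A H f X i) (Robj A H f X' i) (bar_entry A H X' g i 0)]"

definition bar_postnikov_Y :: "('k::field, 'a::ab_group_add) dga \<Rightarrow> ('k, 'h::ab_group_add) ainf \<Rightarrow>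
    ('h list \<Rightarrow> 'a) \<Rightarrow> ('k, 'h, 'x::ab_group_add) amod \<Rightarrow> ('k, 'h, 'x) amod \<Rightarrow>
    ('x \<Rightarrow> 'h list \<Rightarrow> 'x) \<Rightarrow> nat \<Rightarrow> ('k, 'a, ('k, 'x, 'h, 'a) tens) path" where
  "bar_postnikov_Y A H f X X' g i =
     [Map (shift (int i) (bar_complex A H f X i)) (shift (int i) (bar_complex A H f X' i))
        (bar_map A H X' g i)]"

end

theory Submission
  imports Defs
begin

text \<open>
  On pure tensors the differential of \<open>B\<^sub>p\<close> is a signed sum over the splittings of \<open>h\<^sub>1 \<dots> h\<^sub>i\<close> into blocks.
  In its square, terms with two disjoint insertions cancel in pairs, and terms with nested or
  adjacent insertions cancel by the relations for \<open>X\<close> (at the left end), \<open>H\<^sub>*(A)\<close> (inside) and the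
  \<open>A\<^sub>\<infinity>\<close>-morphism \<open>f\<close> (at the right end, where \<open>m\<^sup>A\<close> is made of \<open>f\<close> and the product of \<open>A\<close>). The same
  comparison with the relation for a morphism \<open>g\<close> shows that \<open>B\<^sub>p(g)\<close> is a chain map.

  On the summand \<open>R\<^sub>l\<close> of \<open>Y\<^sub>l\<close> the differential is that of \<open>R\<^sub>l\<close> plus \<open>i\<^sub>l\<close>. Hence \<open>Y\<^sub>l\<^sub>-\<^sub>1\<close>, shifted, is the
  kernel of the surjection \<open>\<pi>\<^sub>l\<close>, is quasi-isomorphic to its cone, and \<open>i\<^sub>l\<close> becomes the inclusion of
  \<open>R\<^sub>l\<close> into the cone. The squares with \<open>i\<^sub>l\<close> commute only up to homotopy, by the part of \<open>B\<^sub>l(g)\<close>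
  off the diagonal.

  Over a field \<open>R\<^sub>l\<close> is free with \<open>H\<^sub>*(R\<^sub>l) = X \<otimes> H\<^sub>*(A)\<^sup>\<otimes>\<^sup>l \<otimes> H\<^sub>*(A)\<close>, so the homology of the \<open>R\<^sub>l\<close> is the bar
  resolution of \<open>X\<close>, which is contracted by \<open>x \<otimes> hs \<otimes> a \<mapsto> x \<otimes> hs \<otimes> a \<otimes> 1\<close>.
\<close>

section \<open>Signs and gradings\<close>

text \<open>Three obstacles shape the proof. The exponent floor(n/2) in the bar signs is not
  additive in n: floor((a+b)/2) - floor(a/2) - floor(b/2) is the carry, which is ab modulo 2. This
  quadratic defect is exactly what turns the bar signs into the signs (-1)^(r+st) of the A-infinity
  relations and into the signs of composition. Koszul signs are applied to the elements themselves
  by \<open>koszul\<close>, so that they can be moved around without choosing homogeneous inputs.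
  The bar differential sees A only through f, and f_1 may induce an automorphism of H_*(A) other
  than the identity. Elements of A are therefore converted to elements of H by the inverse of
  H(f_1), extended to all of A, and not by \<open>cls\<close>; the class of 1 is still sent to the
  unit of H. All objects of the derived category live in one fixed ambient type. A cone of tensor
  modules needs two independent copies of the tensors in it, and the second copy is obtained from
  functions that differ from a multilinear form by the constant 1.\<close>

lemma sg_0 [simp]: "sg 0 v = v" by (simp add: sg_def)
lemma sg_zero [simp]: "sg e 0 = 0" by (simp add: sg_def)
lemma sg_eq_0_iff [simp]: "sg e v = 0 \<longleftrightarrow> v = 0" by (simp add: sg_def)
lemma sg_sg [simp]: "sg e (sg e' v) = sg (e + e') v" by (auto simp: sg_def)
lemma sg_add: "sg e (v + w) = sg e v + sg e w" by (simp add: sg_def)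
lemma sg_diff: "sg e (v - w) = sg e v - sg e w" by (simp add: sg_def)
lemma sg_sum: "sg e (sum F S) = (\<Sum>x\<in>S. sg e (F x))" by (simp add: sg_def sum_negf)
lemma sg_cong: "even (e - e') \<Longrightarrow> sg e v = sg e' v" by (auto simp: sg_def)
lemma sg_even: "even e \<Longrightarrow> sg e v = v" by (simp add: sg_def)
lemma sg_odd: "odd e \<Longrightarrow> sg e v = - v" by (simp add: sg_def)

lemma additive_sg:
  fixes F :: "'v::ab_group_add \<Rightarrow> 'w::ab_group_add"
  assumes "\<And>x y. F (x + y) = F x + F y"
  shows "F (sg e x) = sg e (F x)"
proof -
  interpret additive F by unfold_locales (rule assms)
  show ?thesis by (simp add: sg_def minus)
qed

lemma additive_sum:
  fixes F :: "'v::ab_group_add \<Rightarrow> 'w::ab_group_add"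
  assumes "\<And>x y. F (x + y) = F x + F y"
  shows "F (sum f S) = (\<Sum>x\<in>S. F (f x))"
proof -
  interpret additive F by unfold_locales (rule assms)
  show ?thesis by (rule sum)
qed

lemma graded_vs: "graded V \<Longrightarrow> vector_space (scale V)"
  by (simp add: graded_def)

lemma graded_subspace: "graded V \<Longrightarrow> module.subspace (scale V) (deg V n)"
  by (simp add: graded_def)

lemma subspace_sg:
  assumes "vector_space s" "module.subspace s S" "x \<in> S"
  shows "sg e x \<in> S"
proof -
  interpret vector_space s by fact
  show ?thesis using assms(2,3) by (simp add: sg_def subspace_neg)
qed

lemma decomposes_sum_on:
  assumes "decomposes V x c" "finite N" "{n. c n \<noteq> 0} \<subseteq> N"
  shows "x = (\<Sum>n\<in>N. c n)"
  using assms unfolding decomposes_def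
  by (auto intro!: sum.mono_neutral_left)

lemma decomposesI:
  assumes "graded V" "finite N" "\<And>n. n \<in> N \<Longrightarrow> c n \<in> deg V n"
  shows "decomposes V (\<Sum>n\<in>N. c n) (\<lambda>n. if n \<in> N then c n else 0)"
proof -
  interpret vector_space "scale V" by (rule graded_vs) fact
  have "{n. (if n \<in> N then c n else 0) \<noteq> 0} \<subseteq> N" by auto
  moreover have "0 \<in> deg V n" for n using graded_subspace[OF assms(1)] by (rule subspace_0)
  moreover have "(\<Sum>n\<in>N. c n) = (\<Sum>n | (if n \<in> N then c n else 0) \<noteq> 0. if n \<in> N then c n else 0)"
    using assms(2) by (intro sum.mono_neutral_cong_right) auto
  ultimately show ?thesis
    using assms(2,3) by (auto simp: decomposes_def intro: finite_subset)
qed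

lemma graded_independent:
  assumes "graded V" "finite N" "\<And>n. n \<in> N \<Longrightarrow> c n \<in> deg V n" "(\<Sum>n\<in>N. c n) = 0" "n \<in> N"
  shows "c n = 0"
proof -
  have "decomposes V 0 (\<lambda>n. if n \<in> N then c n else 0)"
    using decomposesI[OF assms(1-3)] assms(4) by simp
  then have "\<forall>n. (if n \<in> N then c n else 0) = 0" using assms(1) unfolding graded_def by blast
  then show ?thesis using assms(5) by metis
qed

lemma decomposes_unique:
  assumes "graded V" "decomposes V x c" "decomposes V x c'"
  shows "c = c'"
proof
  fix n
  interpret vector_space "scale V" by (rule graded_vs) fact
  define N where "N = insert n ({n. c n \<noteq> 0} \<union> {n. c' n \<noteq> 0})"
  have fin: "finite N" using assms by (simp add: N_def decomposes_def)
  have "x = sum c N" "x = sum c' N"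
    by (intro decomposes_sum_on[OF assms(2) fin] decomposes_sum_on[OF assms(3) fin]; auto simp: N_def)+
  then have "(\<Sum>n\<in>N. c n - c' n) = 0" by (simp add: sum_subtractf)
  moreover have "c n - c' n \<in> deg V n" for n
    using assms(2,3) graded_subspace[OF assms(1)] subspace_diff by (auto simp: decomposes_def)
  ultimately have "c n - c' n = 0"
    using graded_independent[OF assms(1) fin, of "\<lambda>n. c n - c' n" n] by (auto simp: N_def)
  then show "c n = c' n" by simp
qed

text \<open>The choice inside \<open>koszul\<close> is harmless because a decomposition is unique;
  the facts on \<open>koszul\<close> for graded modules all rest on this.\<close>

lemma koszul_decomposes:
  assumes "graded V" "decomposes V x c"
  shows "koszul V e x = (\<Sum>n | c n \<noteq> 0. sg (e * n) (c n))"
proof -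
  have "(SOME c. decomposes V x c) = c"
    using assms by (intro some_equality) (auto intro: decomposes_unique)
  then show ?thesis by (simp add: koszul_def)
qed

lemma koszul_sum:
  assumes "graded V" "finite N" "\<And>n. n \<in> N \<Longrightarrow> c n \<in> deg V n"
  shows "koszul V e (\<Sum>n\<in>N. c n) = (\<Sum>n\<in>N. sg (e * n) (c n))"
proof -
  have "koszul V e (\<Sum>n\<in>N. c n) =
      (\<Sum>n | (if n \<in> N then c n else 0) \<noteq> 0. sg (e * n) (if n \<in> N then c n else 0))"
    by (rule koszul_decomposes[OF assms(1) decomposesI[OF assms]])
  also have "\<dots> = (\<Sum>n\<in>N. sg (e * n) (c n))"
    using assms(2) by (intro sum.mono_neutral_cong_left) auto
  finally show ?thesis .
qed

lemma koszul_deg: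
  assumes "graded V" "x \<in> deg V n"
  shows "koszul V e x = sg (e * n) x"
  using koszul_sum[of V "{n}" "\<lambda>_. x"] assms by simp

text \<open>Lets the degree of an operation be replaced by another one of the same parity, such as
  \<open>s - 2\<close> by \<open>s\<close> or -1 by 1.\<close>

lemma koszul_parity: "even (e - e') \<Longrightarrow> koszul V e = koszul V e'"
  unfolding koszul_def Let_def
  by (intro ext sum.cong refl sg_cong) (simp add: left_diff_distrib[symmetric])

lemma total_iff:
  assumes "graded V"
  shows "x \<in> total V \<longleftrightarrow> (\<exists>N c. finite N \<and> (\<forall>n\<in>N. c n \<in> deg V n) \<and> x = (\<Sum>n\<in>N. c n))"
proof
  assume "x \<in> total V"
  then show "\<exists>N c. finite N \<and> (\<forall>n\<in>N. c n \<in> deg V n) \<and> x = (\<Sum>n\<in>N. c n)"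
    unfolding total_def decomposes_def by blast
next
  assume "\<exists>N c. finite N \<and> (\<forall>n\<in>N. c n \<in> deg V n) \<and> x = (\<Sum>n\<in>N. c n)"
  then show "x \<in> total V" unfolding total_def using decomposesI[OF assms] by blast
qed

lemma total_span:
  assumes "graded V"
  shows "total V = module.span (scale V) (\<Union>n. deg V n)"
proof -
  interpret vector_space "scale V" by (rule graded_vs) fact
  note sub = graded_subspace[OF assms]
  show ?thesis
  proof safe
    fix x assume "x \<in> total V"
    then show "x \<in> span (\<Union>n. deg V n)"
      unfolding total_iff[OF assms] by (auto intro!: span_sum intro: span_base)
  next
    fix x assume "x \<in> span (\<Union>n. deg V n)"
    then obtain S r where S: "finite S" "S \<subseteq> (\<Union>n. deg V n)" "x = (\<Sum>a\<in>S. scale V (r a) a)"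
      by (auto simp: span_explicit)
    obtain d where d: "\<And>a. a \<in> S \<Longrightarrow> a \<in> deg V (d a)" using S(2) by (metis UN_E subsetD)
    have "x = (\<Sum>n\<in>d ` S. \<Sum>a | a \<in> S \<and> d a = n. scale V (r a) a)"
      unfolding S(3) by (rule sum.group[symmetric]) (use S(1) in auto)
    moreover have "(\<Sum>a | a \<in> S \<and> d a = n. scale V (r a) a) \<in> deg V n" for n
      using d sub by (intro subspace_sum subspace_scale) auto
    ultimately show "x \<in> total V" unfolding total_iff[OF assms] using S(1)
      by (intro exI[of _ "d ` S"] exI[of _ "\<lambda>n. \<Sum>a | a \<in> S \<and> d a = n. scale V (r a) a"]) auto
  qed
qed

lemma subspace_total: "graded V \<Longrightarrow> module.subspace (scale V) (total V)"
proof -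
  assume g: "graded V"
  interpret vector_space "scale V" by (rule graded_vs) fact
  show ?thesis unfolding total_span[OF g] by (rule subspace_span)
qed

lemma deg_total: "graded V \<Longrightarrow> x \<in> deg V n \<Longrightarrow> x \<in> total V"
proof -
  assume g: "graded V" and x: "x \<in> deg V n"
  interpret vector_space "scale V" by (rule graded_vs) fact
  show ?thesis unfolding total_span[OF g] using x by (auto intro: span_base)
qed

lemma total_0:
  assumes g: "graded V"
  shows "0 \<in> total V"
proof -
  interpret vector_space "scale V" by (rule graded_vs) fact
  show "0 \<in> total V"
    by (rule subspace_0[OF subspace_total[OF g]])
qed

lemma deg_0:
  assumes g: "graded V"
  shows "0 \<in> deg V n"
proof -
  interpret vector_space "scale V" by (rule graded_vs) fact
  show "0 \<in> deg V n"
    by (rule subspace_0[OF graded_subspace[OF g]])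
qed

lemma total_add:
  assumes g: "graded V"
  shows "x \<in> total V \<Longrightarrow> y \<in> total V \<Longrightarrow> x + y \<in> total V"
proof -
  interpret vector_space "scale V" by (rule graded_vs) fact
  show "x \<in> total V \<Longrightarrow> y \<in> total V \<Longrightarrow> x + y \<in> total V"
    by (rule subspace_add[OF subspace_total[OF g]])
qed

lemma total_scale:
  assumes g: "graded V"
  shows "x \<in> total V \<Longrightarrow> scale V c x \<in> total V"
proof -
  interpret vector_space "scale V" by (rule graded_vs) fact
  show "x \<in> total V \<Longrightarrow> scale V c x \<in> total V"
    by (rule subspace_scale[OF subspace_total[OF g]])
qed

lemma total_sg: "graded V \<Longrightarrow> x \<in> total V \<Longrightarrow> sg e x \<in> total V"
  using subspace_sg subspace_total graded_vs by blast

lemma deg_sg: "graded V \<Longrightarrow> x \<in> deg V n \<Longrightarrow> sg e x \<in> deg V n"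
  using subspace_sg graded_subspace graded_vs by blast

lemma total_diff:
  assumes g: "graded V"
  shows "x \<in> total V \<Longrightarrow> y \<in> total V \<Longrightarrow> x - y \<in> total V"
proof -
  interpret vector_space "scale V" by (rule graded_vs) fact
  show "x \<in> total V \<Longrightarrow> y \<in> total V \<Longrightarrow> x - y \<in> total V"
    by (rule subspace_diff[OF subspace_total[OF g]])
qed

lemma total_sum:
  assumes g: "graded V"
  shows "(\<And>i. i \<in> I \<Longrightarrow> F i \<in> total V) \<Longrightarrow> sum F I \<in> total V"
proof -
  interpret vector_space "scale V" by (rule graded_vs) fact
  show "(\<And>i. i \<in> I \<Longrightarrow> F i \<in> total V) \<Longrightarrow> sum F I \<in> total V"
    by (rule subspace_sum[OF subspace_total[OF g]])
qed

lemma total_induct [consumes 2, case_names deg add]: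
  assumes "graded V" "x \<in> total V"
    and hom: "\<And>n x. x \<in> deg V n \<Longrightarrow> Q x"
    and add: "\<And>x y. x \<in> total V \<Longrightarrow> y \<in> total V \<Longrightarrow> Q x \<Longrightarrow> Q y \<Longrightarrow> Q (x + y)"
  shows "Q x"
proof -
  obtain N c where N: "finite N" "\<And>n. n \<in> N \<Longrightarrow> c n \<in> deg V n" "x = (\<Sum>n\<in>N. c n)"
    using assms(2) total_iff[OF assms(1)] by metis
  have "Q (\<Sum>n\<in>N. c n) \<and> (\<Sum>n\<in>N. c n) \<in> total V" using N(1,2)
  proof (induction N)
    \<comment> \<open>0 is homogeneous, which covers the empty sum.\<close>
    case empty
    then show ?case using hom deg_0[OF assms(1)] total_0[OF assms(1)] by (metis sum.empty)
  next
    case (insert n N)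
    then show ?case
      using add hom deg_total[OF assms(1)] total_add[OF assms(1)] by (metis insertCI sum.insert)
  qed
  then show ?thesis by (simp add: N(3))
qed

lemma koszul_add:
  assumes g: "graded V" and "x \<in> total V" "y \<in> total V"
  shows "koszul V e (x + y) = koszul V e x + koszul V e y"
proof -
  interpret vector_space "scale V" by (rule graded_vs) fact
  obtain c c' where c: "decomposes V x c" "decomposes V y c'"
    using assms(2,3) by (auto simp: total_def)
  define N where "N = {n. c n \<noteq> 0} \<union> {n. c' n \<noteq> 0}"
  have fin: "finite N" using c by (simp add: N_def decomposes_def)
  have xy: "x = sum c N" "y = sum c' N"
    by (intro decomposes_sum_on[OF c(1) fin] decomposes_sum_on[OF c(2) fin]; auto simp: N_def)+
  have d: "c n \<in> deg V n" "c' n \<in> deg V n" "c n + c' n \<in> deg V n" for n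
    using c graded_subspace[OF g] subspace_add by (auto simp: decomposes_def)
  have "koszul V e (x + y) = koszul V e (\<Sum>n\<in>N. c n + c' n)" by (simp add: xy sum.distrib)
  then show ?thesis
    using koszul_sum[OF g fin d(3), of e] koszul_sum[OF g fin d(1), of e] koszul_sum[OF g fin d(2), of e]
    by (simp add: xy sum.distrib sg_add)
qed

lemma koszul_scale:
  assumes g: "graded V" and "x \<in> total V"
  shows "koszul V e (scale V r x) = scale V r (koszul V e x)"
proof -
  interpret vector_space "scale V" by (rule graded_vs) fact
  have scale_sg: "scale V r (sg e x) = sg e (scale V r x)" for e x by (simp add: sg_def)
  obtain N c where N: "finite N" "\<And>n. n \<in> N \<Longrightarrow> c n \<in> deg V n" "x = (\<Sum>n\<in>N. c n)"
    using assms(2) total_iff[OF g] by metis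
  have "scale V r (c n) \<in> deg V n" if "n \<in> N" for n
    using N(2)[OF that] graded_subspace[OF g] by (auto intro: subspace_scale)
  then show ?thesis
    using N by (simp add: koszul_sum[OF g] scale_sum_right scale_sg)
qed

lemma koszul_total:
  assumes g: "graded V" and x: "x \<in> total V"
  shows "koszul V e x \<in> total V"
  using g x
proof (induction rule: total_induct)
  case (deg n x)
  then show ?case using g by (simp add: koszul_deg deg_sg deg_total[of V _ n])
qed (simp add: g koszul_add total_add)

lemma koszul_koszul:
  assumes g: "graded V" and x: "x \<in> total V"
  shows "koszul V e (koszul V e' x) = koszul V (e + e') x"
  using g x
proof (induction rule: total_induct)
  case (deg n x)
  then show ?case using g by (simp add: koszul_deg[of V _ n] deg_sg algebra_simps)
qed (simp add: g koszul_add koszul_total)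

lemma koszul_even:
  assumes g: "graded V" and x: "x \<in> total V" and "even e"
  shows "koszul V e x = x"
  using g x
proof (induction rule: total_induct)
  case (deg n x)
  then show ?case using g \<open>even e\<close> by (simp add: koszul_deg[of V _ n] sg_even)
qed (simp add: g koszul_add)

lemma koszul_in_deg: "graded V \<Longrightarrow> x \<in> deg V n \<Longrightarrow> koszul V e x \<in> deg V n"
  by (simp add: koszul_deg deg_sg)

section \<open>Lists of homogeneous elements and homogeneous bases\<close>

lemma homogeneous_append:
  "homogeneous V ds (us @ vs) \<longleftrightarrow> (\<exists>d1 d2. ds = d1 @ d2 \<and> homogeneous V d1 us \<and> homogeneous V d2 vs)"
  unfolding homogeneous_def by (auto simp: list_all2_append2 intro: list_all2_appendI) (metis list_all2_lengthD)

text \<open>The entries are decomposed one at a time: the auxiliary claim keeps a homogeneous prefix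
  \<open>us\<close>, splits the next entry into homogeneous parts and moves each part into the
  prefix.\<close>

lemma multi_induct [consumes 2, case_names homogeneous add]:
  assumes V: "graded V" "total V = UNIV"
    and hom: "\<And>ds xs. homogeneous V ds xs \<Longrightarrow> Q xs"
    and add: "\<And>us x y vs. Q (us @ x # vs) \<Longrightarrow> Q (us @ y # vs) \<Longrightarrow> Q (us @ (x + y) # vs)"
  shows "Q xs"
proof -
  have "Q (us @ vs)" if "homogeneous V ds us" for ds us vs
    using that
  proof (induction vs arbitrary: ds us)
    case Nil
    then show ?case using hom by simp
  next
    case (Cons x vs)
    have "x \<in> total V" using V by simp
    with V(1) show ?case
    proof (induction rule: total_induct)
      case (deg n x)
      have "homogeneous V (ds @ [n]) (us @ [x])"
        using Cons.prems deg by (simp add: homogeneous_def list_all2_appendI)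
      then show ?case using Cons.IH[of "ds @ [n]" "us @ [x]"] by simp
    next
      case (add x y)
      then show ?case using assms(4) by blast
    qed
  qed
  from this[of "[]" "[]"] show ?thesis by (simp add: homogeneous_def)
qed

text \<open>An element of \<open>deg V n\<close> has coordinates only at basis vectors of degree n.
  In a vanishing sum of homogeneous elements each coordinate therefore comes from a single summand,
  so all summands vanish. This is how the tensor modules are seen to be graded.\<close>

lemma graded_basis:
  assumes vs: "vector_space (scale V)" and ind: "\<not> module.dependent (scale V) B"
    and deg: "\<And>n. deg V n = module.span (scale V) {b \<in> B. \<delta> b = n}"
  shows "graded V"
proof -
  interpret vector_space "scale V" by fact
  have rep0: "representation B x b = 0" if "x \<in> deg V n" "\<delta> b \<noteq> n" for x b n
  proof -
    have "representation B x b = representation {b \<in> B. \<delta> b = n} x b"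
      using that(1) by (intro fun_cong[OF representation_extend[OF ind]]) (auto simp: deg)
    then show ?thesis using representation_ne_zero that(2) by fastforce
  qed
  have sp: "x \<in> span B" if "x \<in> deg V n" for x n
    using that span_mono[of "{b \<in> B. \<delta> b = n}" B] deg by auto
  have "c m = 0" if "decomposes V 0 c" for c m
  proof (rule ccontr)
    assume m: "c m \<noteq> 0"
    define N where "N = {n. c n \<noteq> 0}"
    have N: "finite N" "\<And>n. c n \<in> deg V n" "(\<Sum>n\<in>N. c n) = 0" "m \<in> N"
      using that m by (auto simp: decomposes_def N_def)
    have "representation B (c m) b = 0" for b
    proof (cases "\<delta> b = m")
      case True
      have "(\<Sum>n\<in>N. representation B (c n) b) = 0"
        using N(2,3) representation_sum[of B N c] ind sp by (metis representation_zero)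
      moreover have "(\<Sum>n\<in>N. representation B (c n) b) = (\<Sum>n\<in>{m}. representation B (c n) b)"
        using N(1,4) rep0[OF N(2)] True by (intro sum.mono_neutral_right) auto
      ultimately show ?thesis by simp
    next
      case False
      then show ?thesis using rep0 N(2) by blast
    qed
    then have "c m = 0" using sum_nonzero_representation_eq[OF ind sp[OF N(2)], of m] by simp
    then show False using m by simp
  qed
  then show ?thesis by (auto simp: graded_def deg vs)
qed

lemma homogeneous_basis:
  assumes g: "graded V"
  obtains B \<delta> where "\<not> module.dependent (scale V) B" "total V = module.span (scale V) B"
    "\<And>n. deg V n = module.span (scale V) {b \<in> B. \<delta> b = n}"
proof -
  interpret vector_space "scale V" by (rule graded_vs) fact
  have "\<exists>B\<subseteq>deg V n. independent B \<and> span B = deg V n" for n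
    by (metis graded_subspace[OF g] maximal_independent_subset span_subspace)
  then obtain b where b: "\<And>n. b n \<subseteq> deg V n" "\<And>n. independent (b n)" "\<And>n. span (b n) = deg V n"
    by metis
  have uniq: "n = m" if "x \<in> b n" "x \<in> b m" for x n m
  proof (rule ccontr)
    assume nm: "n \<noteq> m"
    have "x \<in> deg V n" "x \<in> deg V m" using that b(1) by auto
    \<comment> \<open>A vector common to two degrees would give the vanishing sum x + (-x) with one
      summand in each of them.\<close>
    then have "(if k = n then x else - x) \<in> deg V k" if "k \<in> {n, m}" for k
      using that subspace_neg[OF graded_subspace[OF g]] by auto
    then have "x = 0"
      using graded_independent[OF g, of "{n, m}" "\<lambda>k. if k = n then x else - x" n] nm by auto
    then show False using that(1) b(2)[of n] dependent_zero by blast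
  qed
  define B where "B = (\<Union>n. b n)"
  define \<delta> where "\<delta> x = (THE n. x \<in> b n)" for x
  have \<delta>: "\<delta> x = n" if "x \<in> b n" for x n
    unfolding \<delta>_def using that uniq by blast
  have bn: "{x \<in> B. \<delta> x = n} = b n" for n
    using \<delta> by (auto simp: B_def)
  have "independent B"
  proof
    assume "dependent B"
    then obtain S u v where S: "finite S" "S \<subseteq> B" "(\<Sum>x\<in>S. scale V (u x) x) = 0" "v \<in> S" "u v \<noteq> 0"
      by (auto simp: dependent_explicit)
    have fin: "finite (\<delta> ` S)" using S by simp
    \<comment> \<open>A linear relation splits by degree, and its part in the degree of
      \<open>v\<close> is a relation within one of the chosen bases.\<close>
    have "(\<Sum>n\<in>\<delta> ` S. \<Sum>x | x \<in> S \<and> \<delta> x = n. scale V (u x) x) = 0"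
      using sum.group[OF S(1) fin, of \<delta> "\<lambda>x. scale V (u x) x"] S(3) by simp
    moreover have "(\<Sum>x | x \<in> S \<and> \<delta> x = n. scale V (u x) x) \<in> deg V n" for n
      using S(2) bn b(1) by (intro subspace_sum[OF graded_subspace[OF g]] subspace_scale[OF graded_subspace[OF g]]) blast
    ultimately have "(\<Sum>x | x \<in> S \<and> \<delta> x = \<delta> v. scale V (u x) x) = 0"
      using S(4) by (intro graded_independent[OF g fin, of "\<lambda>n. \<Sum>x | x \<in> S \<and> \<delta> x = n. scale V (u x) x"]) auto
    moreover have "{x \<in> S. \<delta> x = \<delta> v} \<subseteq> b (\<delta> v)" using S(2) bn by blast
    moreover have "finite {x \<in> S. \<delta> x = \<delta> v}" "v \<in> {x \<in> S. \<delta> x = \<delta> v}" using S by auto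
    ultimately show False using b(2)[of "\<delta> v"] S(5) unfolding dependent_explicit by blast
  qed
  moreover have "total V = span B"
    unfolding total_span[OF g] B_def
  proof (rule antisym)
    show "span (\<Union>n. deg V n) \<subseteq> span (\<Union>n. b n)"
      using b(3) by (intro span_minimal subspace_span UN_least) (metis UN_upper UNIV_I span_mono)
    show "span (\<Union>n. b n) \<subseteq> span (\<Union>n. deg V n)"
      using b(1) by (intro span_mono) blast
  qed
  moreover have "deg V n = span {x \<in> B. \<delta> x = n}" for n
    using bn b(3) by simp
  ultimately show ?thesis using that by blast
qed

section \<open>Sums over the splittings of a list\<close>

text \<open>This is deconcatenation, the coproduct of the tensor coalgebra. With it an iterated
  insertion becomes a nested \<open>ssum\<close>, and reindexing becomes coassociativity instead of
  arithmetic with \<open>take\<close> and \<open>drop\<close>.\<close>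

definition ssum :: "('a list \<Rightarrow> 'a list \<Rightarrow> 'b::comm_monoid_add) \<Rightarrow> 'a list \<Rightarrow> 'b" where
  "ssum F xs = (\<Sum>k\<le>length xs. F (take k xs) (drop k xs))"

lemma ssum_Nil [simp]: "ssum F [] = F [] []"
  by (simp add: ssum_def)

lemma ssum_Cons: "ssum F (x # xs) = F [] (x # xs) + ssum (\<lambda>u v. F (x # u) v) xs"
  by (simp add: ssum_def sum.atMost_Suc_shift del: sum.atMost_Suc)

lemma ssum_cong: "(\<And>u v. xs = u @ v \<Longrightarrow> F u v = G u v) \<Longrightarrow> ssum F xs = ssum G xs"
  unfolding ssum_def by (intro sum.cong refl) simp

lemma ssum_add: "ssum (\<lambda>u v. F u v + G u v) xs = ssum F xs + ssum G xs"
  by (simp add: ssum_def sum.distrib)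

lemma ssum_0: "ssum (\<lambda>u v. 0) xs = 0"
  by (simp add: ssum_def)

lemma ssum_additive:
  fixes h :: "'b::ab_group_add \<Rightarrow> 'c::ab_group_add"
  assumes "\<And>x y. h (x + y) = h x + h y"
  shows "h (ssum F xs) = ssum (\<lambda>u v. h (F u v)) xs"
  by (simp add: ssum_def additive_sum[of h, OF assms])

lemma ssum_sg: "sg e (ssum F xs) = ssum (\<lambda>u v. sg e (F u v)) xs"
  by (rule ssum_additive) (rule sg_add)

lemma ssum_uminus: "ssum (\<lambda>u v. - F u v) xs = - ssum F (xs :: 'a list)" for F :: "_ \<Rightarrow> _ \<Rightarrow> 'b::ab_group_add"
  by (simp add: ssum_def sum_negf)

lemma ssum_map: "ssum F (map k xs) = ssum (\<lambda>u v. F (map k u) (map k v)) xs"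
  by (simp add: ssum_def take_map drop_map)

text \<open>Coassociativity: both sides run over the cuts of \<open>xs\<close> into three
  blocks.\<close>

lemma ssum_assoc:
  "ssum (\<lambda>r w. ssum (\<lambda>u v. F u v w) r) xs = ssum (\<lambda>u r. ssum (\<lambda>v w. F u v w) r) xs"
proof (induction xs arbitrary: F)
  case (Cons x xs)
  show ?case by (simp add: ssum_Cons ssum_add Cons.IH add.assoc)
qed simp

lemma ssum_swap:
  "ssum (\<lambda>a b. ssum (\<lambda>c d. F a b c d) y) x = ssum (\<lambda>c d. ssum (\<lambda>a b. F a b c d) x) y"
  unfolding ssum_def by (rule sum.swap)

text \<open>A cut falls either before or after the marked entry \<open>h\<close>. When
  \<open>h\<close> is the output of an earlier operation, this separates the later blocks that
  contain it from those that avoid it.\<close>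

lemma ssum_middle:
  "ssum F (U @ h # w) = ssum (\<lambda>a b. F a (b @ h # w)) U + ssum (\<lambda>a b. F (U @ h # a) b) w"
  by (induction U arbitrary: F) (simp_all add: ssum_Cons add.assoc)

lemma ssum3_take_drop:
  "ssum (\<lambda>u r. ssum (\<lambda>v w. F u v w) r) xs =
    (\<Sum>r\<le>length xs. \<Sum>s\<le>length xs - r. F (take r xs) (take s (drop r xs)) (drop (r + s) xs))"
  by (simp add: ssum_def add.commute)

text \<open>The A-infinity relations sum over blocks of length s at least 1, whereas
  \<open>ssum\<close> also meets the empty block; the \<open>if\<close> accounts for the
  difference.\<close>

lemma sum_triangle_swap:
  fixes T :: "nat \<Rightarrow> nat \<Rightarrow> 'b::comm_monoid_add"
  shows "(\<Sum>s = 1..m. \<Sum>r = 0..m - s. T r s) = (\<Sum>r\<le>m. \<Sum>s\<le>m - r. if s = 0 then 0 else T r s)"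
proof -
  have "(\<Sum>s = 1..m. \<Sum>r = 0..m - s. T r s) = (\<Sum>(s, r)\<in>(SIGMA s:{1..m}. {0..m - s}). T r s)"
    by (simp add: sum.Sigma)
  also have "\<dots> = (\<Sum>(r, s)\<in>(SIGMA r:{..m}. {s. s \<noteq> 0 \<and> s \<le> m - r}). T r s)"
    by (rule sum.reindex_bij_witness[where i = "\<lambda>(r, s). (s, r)" and j = "\<lambda>(s, r). (r, s)"]) auto
  also have "\<dots> = (\<Sum>r\<le>m. \<Sum>s\<in>{s. s \<noteq> 0 \<and> s \<le> m - r}. T r s)"
    by (simp add: sum.Sigma)
  also have "\<dots> = (\<Sum>r\<le>m. \<Sum>s\<le>m - r. if s = 0 then 0 else T r s)"
    by (intro sum.cong refl sum.mono_neutral_cong_left) auto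
  finally show ?thesis .
qed

section \<open>Pure tensors\<close>

interpretation T: vector_space "tscale :: 'k::field \<Rightarrow> ('k, 'x, 'h, 'a) tens \<Rightarrow> ('k, 'x, 'h, 'a) tens"
  by (rule vector_space_tscale)

lemma pure_add_left: "x \<in> total X \<Longrightarrow> y \<in> total X \<Longrightarrow>
    pure_tensor X H A (x + y, hs, a) = pure_tensor X H A (x, hs, a) + pure_tensor X H A (y, hs, a)"
  by (auto simp: pure_tensor_def tuple_multilinear_def fun_eq_iff)

lemma pure_scale_left: "x \<in> total X \<Longrightarrow>
    pure_tensor X H A (scale X c x, hs, a) = tscale c (pure_tensor X H A (x, hs, a))"
  by (auto simp: pure_tensor_def tuple_multilinear_def fun_eq_iff tscale_def)

lemma pure_add_middle: "x \<in> total X \<Longrightarrow> pure_tensor X H A (x, us @ (h + h') # vs, a) =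
    pure_tensor X H A (x, us @ h # vs, a) + pure_tensor X H A (x, us @ h' # vs, a)"
  by (auto simp: pure_tensor_def tuple_multilinear_def fun_eq_iff)

lemma pure_scale_middle: "x \<in> total X \<Longrightarrow> pure_tensor X H A (x, us @ scale H c h # vs, a) =
    tscale c (pure_tensor X H A (x, us @ h # vs, a))"
  by (auto simp: pure_tensor_def tuple_multilinear_def fun_eq_iff tscale_def)

lemma pure_add_right: "x \<in> total X \<Longrightarrow>
    pure_tensor X H A (x, hs, a + b) = pure_tensor X H A (x, hs, a) + pure_tensor X H A (x, hs, b)"
  by (auto simp: pure_tensor_def tuple_multilinear_def fun_eq_iff)

lemma pure_scale_right: "x \<in> total X \<Longrightarrow>
    pure_tensor X H A (x, hs, scale A c a) = tscale c (pure_tensor X H A (x, hs, a))"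
  by (auto simp: pure_tensor_def tuple_multilinear_def fun_eq_iff tscale_def)

lemma pure_sg_middle: "x \<in> total X \<Longrightarrow>
    pure_tensor X H A (x, us @ sg e h # vs, a) = sg e (pure_tensor X H A (x, us @ h # vs, a))"
  by (rule additive_sg[of "\<lambda>h. pure_tensor X H A (x, us @ h # vs, a)"]) (rule pure_add_middle)

lemma pure_sg_right: "x \<in> total X \<Longrightarrow>
    pure_tensor X H A (x, hs, sg e a) = sg e (pure_tensor X H A (x, hs, a))"
  by (rule additive_sg[of "\<lambda>a. pure_tensor X H A (x, hs, a)"]) (rule pure_add_right)

lemma pure_sg_left:
  assumes "graded X" "x \<in> total X"
  shows "pure_tensor X H A (sg e x, hs, a) = sg e (pure_tensor X H A (x, hs, a))"
proof -
  interpret vector_space "scale X" by (rule graded_vs) fact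
  have "pure_tensor X H A (- x, hs, a) = - pure_tensor X H A (x, hs, a)"
    using pure_scale_left[OF assms(2), of H A "-1" hs a] by simp
  then show ?thesis by (simp add: sg_def)
qed

lemma pure_zero_left:
  assumes "graded X"
  shows "pure_tensor X H A (0, hs, a) = 0"
  using pure_add_left[of 0 X 0 H A hs a] total_0[OF assms] by simp

lemma pure_zero_middle: "x \<in> total X \<Longrightarrow> pure_tensor X H A (x, us @ 0 # vs, a) = 0"
  using pure_add_middle[of x X H A us 0 0 vs a] by simp

lemma pure_zero_right: "x \<in> total X \<Longrightarrow> pure_tensor X H A (x, hs, 0) = 0"
  using pure_add_right[of x X H A hs 0 0] by simp

section \<open>The maps \<open>push\<close> and the spans of pure tensors\<close>

lemma tscale_sg: "tscale c (sg e t) = sg e (tscale c t)"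
  by (rule additive_sg[of "tscale c"]) (rule T.scale_right_distrib)

lemma push_add: "push X H A S F (t + t') = push X H A S F t + push X H A S F t'"
  by (auto simp: push_def fun_eq_iff)

lemma push_scale: "push X H A S F (tscale c t) = tscale c (push X H A S F t)"
  by (auto simp: push_def fun_eq_iff tscale_def)

text \<open>\<open>push\<close> evaluates a pure tensor at the pulled-back function, and a pure
  tensor is 0 at a function that is not a form; hence the pullback of a form has to be a
  form.\<close>

definition multilinear_op :: "('k::field, 'x::ab_group_add, 'y) grmod_scheme \<Rightarrow>
    ('k, 'x, 'y) grmod_scheme \<Rightarrow>
    ('k, 'h::ab_group_add, 'z) grmod_scheme \<Rightarrow> ('k, 'a::ab_group_add, 'w) grmod_scheme \<Rightarrow> nat set \<Rightarrow>
    (('x, 'h, 'a) tuple \<Rightarrow> ('x, 'h, 'a) tuple) \<Rightarrow> bool" where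
  "multilinear_op X X' H A S F \<longleftrightarrow>
     (\<forall>\<phi>. form X' H A \<phi> \<longrightarrow> form X H A (\<lambda>(x, hs, a). if length hs \<in> S then \<phi> (F (x, hs, a)) else 0))"

lemma push_pure:
  assumes "multilinear_op X X' H A S F"
  shows "push X' H A S F (pure_tensor X H A (x, hs, a)) =
    (if length hs \<in> S then pure_tensor X' H A (F (x, hs, a)) else 0)"
  using assms by (auto simp: push_def pure_tensor_def multilinear_op_def fun_eq_iff)

text \<open>A pure tensor is linear in one slot at a time: the last slot is expanded first, then the
  entries of the list, then the first slot. \<open>BX\<close> lies in \<open>total X\<close> because
  forms are required to be linear only there.\<close>

lemma span_pure:
  fixes W :: "('k::field, 'x::ab_group_add, 'h::ab_group_add, 'a::ab_group_add) tens set"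
    and X :: "('k, 'x, 'y) grmod_scheme" and H :: "('k, 'h, 'z) grmod_scheme"
    and A :: "('k, 'a, 'w) grmod_scheme"
  assumes W: "module.subspace tscale W" and gX: "graded X" and gH: "graded H" and gA: "graded A"
    and BX: "BX \<subseteq> total X"
    and base: "\<And>x hs a. x \<in> BX \<Longrightarrow> list_all2 (\<lambda>h S. h \<in> S) hs Bs \<Longrightarrow> a \<in> BA \<Longrightarrow>
      pure_tensor X H A (x, hs, a) \<in> W"
    and x: "x \<in> module.span (scale X) BX"
    and hs: "list_all2 (\<lambda>h S. h \<in> module.span (scale H) S) hs Bs"
    and a: "a \<in> module.span (scale A) BA"
  shows "pure_tensor X H A (x, hs, a) \<in> W"
proof -
  interpret VX: vector_space "scale X" by (rule graded_vs) fact
  interpret VH: vector_space "scale H" by (rule graded_vs) fact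
  interpret VA: vector_space "scale A" by (rule graded_vs) fact
  note Wc = T.subspace_add[OF W] T.subspace_scale[OF W] T.subspace_0[OF W]
  have 1: "pure_tensor X H A (x, hs, a) \<in> W"
    if "x \<in> BX" "list_all2 (\<lambda>h S. h \<in> S) hs Bs" for x hs
  proof -
    have xt: "x \<in> total X" using that BX by auto
    have "VA.subspace {a. pure_tensor X H A (x, hs, a) \<in> W}"
      using xt by (auto intro!: VA.subspaceI simp: pure_add_right pure_scale_right pure_zero_right Wc)
    then show ?thesis using VA.span_induct[OF a, of "\<lambda>a. pure_tensor X H A (x, hs, a) \<in> W"] base that by blast
  qed
  have 2: "pure_tensor X H A (x, us @ vs, a) \<in> W"
    if "x \<in> BX" "list_all2 (\<lambda>h S. h \<in> module.span (scale H) S) vs Vs"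
      "\<And>ws. list_all2 (\<lambda>h S. h \<in> S) ws Vs \<Longrightarrow> pure_tensor X H A (x, us @ ws, a) \<in> W" for x us vs Vs
    using that(2,3)
  proof (induction vs arbitrary: us Vs)
    case Nil
    then show ?case by simp
  next
    case (Cons h vs)
    from Cons.prems(1) obtain S Vs' where Vs: "Vs = S # Vs'" "h \<in> VH.span S"
      "list_all2 (\<lambda>h S. h \<in> VH.span S) vs Vs'"
      by (auto simp: list_all2_Cons1)
    have xt: "x \<in> total X" using that BX by auto
    have "VH.subspace {h. pure_tensor X H A (x, us @ h # vs, a) \<in> W}"
      using xt by (auto intro!: VH.subspaceI simp: pure_add_middle pure_scale_middle pure_zero_middle Wc)
    moreover have "pure_tensor X H A (x, us @ h # vs, a) \<in> W" if "h \<in> S" for h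
      using Cons.IH[OF Vs(3), of "us @ [h]"] Cons.prems(2) that Vs(1) by simp
    ultimately show ?case
      using VH.span_induct[OF Vs(2), of "\<lambda>h. pure_tensor X H A (x, us @ h # vs, a) \<in> W"] by blast
  qed
  have 3: "pure_tensor X H A (x, hs, a) \<in> W" if "x \<in> BX" for x
    using 2[OF that hs, of "[]"] 1[OF that] by simp
  have "pure_tensor X H A (x, hs, a) \<in> W \<and> x \<in> total X"
    using x
  proof (induction rule: VX.span_induct_alt)
    case base
    then show ?case using pure_zero_left[OF gX] Wc(3) total_0[OF gX] by metis
  next
    case (step c x y)
    then have t: "x \<in> total X" "y \<in> total X" "pure_tensor X H A (y, hs, a) \<in> W" using BX by auto
    show ?case
      unfolding pure_add_left[OF total_scale[OF gX t(1)] t(2)] pure_scale_left[OF t(1)]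
      by (intro conjI Wc(1,2) total_add[OF gX] total_scale[OF gX] t 3 step)
  qed
  then show ?thesis ..
qed

text \<open>One family for all modules in play. The length is added to the degree because
  \<open>R_l\<close> sits in the bar construction as \<open>R_l[-l]\<close>; \<open>c\<close> is a
  global shift. Thus \<open>I = {i}\<close>, \<open>c = - i\<close> gives \<open>R_i\<close>, while
  \<open>I = {..p}\<close> gives \<open>B_p\<close> for \<open>c = 0\<close> and \<open>Y_p\<close>
  for \<open>c = - p\<close>.\<close>

definition blk :: "('k::field, 'x::ab_group_add, 'y) grmod_scheme \<Rightarrow>
    ('k, 'h::ab_group_add, 'z) grmod_scheme \<Rightarrow> ('k, 'a::ab_group_add, 'w) grmod_scheme \<Rightarrow>
    nat set \<Rightarrow> int \<Rightarrow> int \<Rightarrow> ('k, 'x, 'h, 'a) tens set" where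
  "blk X H A I c n = module.span tscale {pure_tensor X H A (x, hs, a) | x hs a p ds q.
     x \<in> deg X p \<and> length hs \<in> I \<and> homogeneous H ds hs \<and> a \<in> deg A q \<and>
     p + sum_list ds + q + int (length hs) + c = n}"

fun list_coef :: "('h \<Rightarrow> 'h \<Rightarrow> 'k::field) \<Rightarrow> 'h list \<Rightarrow> 'h list \<Rightarrow> 'k" where
  "list_coef r [] [] = 1"
| "list_coef r (b # bs) (h # hs) = r h b * list_coef r bs hs"
| "list_coef r _ _ = 0"

lemma list_coef_append:
  "list_coef r bs (us @ vs) = (if length us \<le> length bs
    then list_coef r (take (length us) bs) us * list_coef r (drop (length us) bs) vs else 0)"
proof (induction us arbitrary: bs)
  case (Cons u us)
  then show ?case by (cases bs) (auto simp: mult.assoc)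
qed simp

lemma list_coef_delta:
  assumes "\<And>b h. b \<in> B \<Longrightarrow> h \<in> B \<Longrightarrow> r h b = (if h = b then 1 else 0)"
    "set bs \<subseteq> B" "set hs \<subseteq> B"
  shows "list_coef r bs hs = (if hs = bs then 1 else 0)"
  using assms(2,3)
proof (induction bs arbitrary: hs)
  case Nil
  then show ?case by (cases hs) auto
next
  case (Cons b bs)
  then show ?case by (cases hs) (auto simp: assms(1))
qed

text \<open>With coordinate functions of bases in place of \<open>rX\<close>, \<open>rH\<close> and
  \<open>rA\<close> these are the forms dual to the pure tensors of basis vectors. They vanish on
  lists of the wrong length, because \<open>list_coef\<close> does.\<close>

definition coef_form :: "('x \<Rightarrow> 'x \<Rightarrow> 'k::field) \<Rightarrow> ('h \<Rightarrow> 'h \<Rightarrow> 'k) \<Rightarrow> ('a \<Rightarrow> 'k) \<Rightarrow> 'x \<Rightarrow> 'h list \<Rightarrow>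
    ('x, 'h, 'a) tuple \<Rightarrow> 'k" where
  "coef_form rX rH rA x0 hs0 = (\<lambda>(x, hs, a). rX x x0 * list_coef rH hs0 hs * rA a)"

lemma form_coef:
  fixes X :: "('k::field, 'x::ab_group_add, 'y) grmod_scheme"
  assumes "\<And>x y. x \<in> total X \<Longrightarrow> y \<in> total X \<Longrightarrow> rX (x + y) x0 = rX x x0 + rX y x0"
    "\<And>c x. x \<in> total X \<Longrightarrow> rX (scale X c x) x0 = c * rX x x0"
    "\<And>x y b. rH (x + y) b = rH x b + rH y b" "\<And>c x b. rH (scale H c x) b = c * rH x b"
    "\<And>x y. rA (x + y) = rA x + rA y" "\<And>c x. rA (scale A c x) = c * rA x"
  shows "form X H A (coef_form rX rH rA x0 hs0)"
proof -
  have 1: "list_coef rH bs (us @ (h + h') # vs) = list_coef rH bs (us @ h # vs) + list_coef rH bs (us @ h' # vs)"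
    for bs us h h' vs
    by (cases "drop (length us) bs") (auto simp: list_coef_append assms algebra_simps)
  have 2: "list_coef rH bs (us @ scale H c h # vs) = c * list_coef rH bs (us @ h # vs)"
    for bs us c h vs
    by (cases "drop (length us) bs") (auto simp: list_coef_append assms algebra_simps)
  show ?thesis
    unfolding tuple_multilinear_def coef_form_def
    by (auto simp: assms 1 2 algebra_simps)
qed

text \<open>The pure tensors of homogeneous basis vectors are dual to the forms \<open>C\<close>,
  hence injectively indexed and independent. They span by \<open>span_pure\<close>, and with the
  degree \<open>w\<close> read off the tuple \<open>graded_basis\<close> applies.\<close>

lemma graded_blk:
  fixes M :: "('k::field, ('k, 'x::ab_group_add, 'h::ab_group_add, 'a::ab_group_add) tens, 'm) grmod_scheme"
    and X :: "('k, 'x, 'y) grmod_scheme" and H :: "('k, 'h, 'z) grmod_scheme"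
    and A :: "('k, 'a, 'w) grmod_scheme"
  assumes gX: "graded X" and gH: "graded H" "total H = UNIV" and gA: "graded A" "total A = UNIV"
    and M: "scale M = tscale" "deg M = blk X H A I c"
  shows "graded M"
proof -
  interpret VX: vector_space "scale X" by (rule graded_vs) fact
  interpret VH: vector_space "scale H" by (rule graded_vs) fact
  interpret VA: vector_space "scale A" by (rule graded_vs) fact
  obtain BX dX where BX: "VX.independent BX" "total X = VX.span BX"
    "\<And>n. deg X n = VX.span {b \<in> BX. dX b = n}" using homogeneous_basis[OF gX] by blast
  obtain BH dH where BH: "VH.independent BH" "total H = VH.span BH"
    "\<And>n. deg H n = VH.span {b \<in> BH. dH b = n}" using homogeneous_basis[OF gH(1)] by blast
  obtain BA dA where BA: "VA.independent BA" "total A = VA.span BA"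
    "\<And>n. deg A n = VA.span {b \<in> BA. dA b = n}" using homogeneous_basis[OF gA(1)] by blast
  define D where "D = {(x, hs, a). x \<in> BX \<and> set hs \<subseteq> BH \<and> length hs \<in> I \<and> a \<in> BA}"
  define w where "w = (\<lambda>(x, hs, a). dX x + sum_list (map dH hs) + dA a + int (length hs) + c)"
  define C where "C = (\<lambda>(x0, hs0, a0). coef_form (VX.representation BX) (VH.representation BH)
     (\<lambda>a. VA.representation BA a a0) x0 hs0)"
  have form: "form X H A (C \<tau>)" if "\<tau> \<in> D" for \<tau>
    using that unfolding C_def D_def using BX BH BA gH gA
    by (auto intro!: form_coef simp: VX.representation_add VX.representation_scale VH.representation_add
        VH.representation_scale VA.representation_add VA.representation_scale)
  have delta: "C \<tau>0 \<tau> = (if \<tau> = \<tau>0 then 1 else 0)" if "\<tau>0 \<in> D" "\<tau> \<in> D" for \<tau>0 \<tau>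
  proof -
    obtain x0 hs0 a0 x hs a where [simp]: "\<tau>0 = (x0, hs0, a0)" "\<tau> = (x, hs, a)"
      by (metis prod_cases3)
    have "list_coef (VH.representation BH) hs0 hs = (if hs = hs0 then 1 else 0)"
      using that BH(1) by (intro list_coef_delta[of BH]) (auto simp: D_def VH.representation_basis)
    then show ?thesis
      using that BX(1) BA(1) by (auto simp: C_def coef_form_def D_def VX.representation_basis VA.representation_basis)
  qed
  define P where "P = pure_tensor X H A"
  have P: "P \<tau> (C \<tau>0) = (if \<tau> = \<tau>0 then 1 else 0)" if "\<tau>0 \<in> D" "\<tau> \<in> D" for \<tau>0 \<tau>
    using form[OF that(1)] delta[OF that] by (simp add: P_def pure_tensor_def)
  have inj: "inj_on P D"
    by (intro inj_onI) (metis P zero_neq_one)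
  have "T.independent (P ` D)"
  proof
    assume "T.dependent (P ` D)"
    then obtain S u v where S: "finite S" "S \<subseteq> P ` D" "(\<Sum>x\<in>S. tscale (u x) x) = 0" "v \<in> S" "u v \<noteq> 0"
      by (auto simp: T.dependent_explicit)
    obtain \<tau>0 where \<tau>0: "\<tau>0 \<in> D" "v = P \<tau>0" using S by auto
    have ev: "(\<Sum>b\<in>S. G b) \<phi> = (\<Sum>b\<in>S. G b \<phi>)" for G :: "_ \<Rightarrow> ('k, 'x, 'h, 'a) tens" and \<phi>
      using S(1) by induction auto
    \<comment> \<open>Evaluating the relation at the form dual to \<tau>0 leaves only the
      coefficient of \<open>v\<close>.\<close>
    have "0 = (\<Sum>x\<in>S. u x * x (C \<tau>0))"
      using arg_cong[OF S(3), of "\<lambda>t. t (C \<tau>0)"] by (simp add: ev tscale_def)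
    also have "\<dots> = (\<Sum>x\<in>S. if x = v then u x else 0)"
    proof (intro sum.cong refl)
      fix x assume "x \<in> S"
      then obtain \<tau> where \<tau>: "\<tau> \<in> D" "x = P \<tau>" using S by auto
      have "x = v \<longleftrightarrow> \<tau> = \<tau>0" using inj \<tau> \<tau>0 by (auto simp: inj_on_def)
      then show "u x * x (C \<tau>0) = (if x = v then u x else 0)"
        using P[OF \<tau>0(1) \<tau>(1)] \<tau>(2) by auto
    qed
    also have "\<dots> = u v" using S by simp
    finally show False using S(5) by simp
  qed
  define \<delta> where "\<delta> t = w (the_inv_into D P t)" for t
  have \<delta>: "\<delta> (P \<tau>) = w \<tau>" if "\<tau> \<in> D" for \<tau>
    using that inj by (simp add: \<delta>_def the_inv_into_f_f)
  have "deg M n = T.span {b \<in> P ` D. \<delta> b = n}" for n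
  proof (rule antisym)
    show "deg M n \<subseteq> T.span {b \<in> P ` D. \<delta> b = n}"
      unfolding M blk_def
    proof (intro T.span_minimal T.subspace_span subsetI, clarsimp)
      fix x hs a p ds q
      assume *: "x \<in> deg X p" "length hs \<in> I" "homogeneous H ds hs" "a \<in> deg A q"
        "n = p + sum_list ds + q + int (length hs) + c"
      let ?Bs = "map (\<lambda>d. {b \<in> BH. dH b = d}) ds"
      show "pure_tensor X H A (x, hs, a) \<in> T.span {b \<in> P ` D. \<delta> b = p + sum_list ds + q + int (length hs) + c}"
      proof (rule span_pure[OF T.subspace_span gX gH(1) gA(1)])
        show "x \<in> VX.span {b \<in> BX. dX b = p}" "a \<in> VA.span {b \<in> BA. dA b = q}"
          using * BX BA by auto
        show "{b \<in> BX. dX b = p} \<subseteq> total X" using BX(2) VX.span_base by auto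
        show "list_all2 (\<lambda>h S. h \<in> VH.span S) hs ?Bs"
          using *(3) BH(3) by (auto simp: homogeneous_def list_all2_conv_all_nth)
        fix x' hs' a'
        assume **: "x' \<in> {b \<in> BX. dX b = p}" "list_all2 (\<lambda>h S. h \<in> S) hs' ?Bs" "a' \<in> {b \<in> BA. dA b = q}"
        have hs': "map dH hs' = ds" "set hs' \<subseteq> BH"
          using **(2) by (auto simp: list_all2_conv_all_nth in_set_conv_nth intro!: nth_equalityI)
        have len: "length hs' = length hs"
          using **(2) *(3) by (auto simp: list_all2_conv_all_nth homogeneous_def)
        have "(x', hs', a') \<in> D" using ** hs' len * by (auto simp: D_def)
        moreover have "w (x', hs', a') = p + sum_list ds + q + int (length hs) + c"
          using ** hs' len by (auto simp: w_def)
        ultimately show "pure_tensor X H A (x', hs', a') \<in> T.span {b \<in> P ` D. \<delta> b = p + sum_list ds + q + int (length hs) + c}"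
          using \<delta>[of "(x', hs', a')"] by (intro T.span_base) (auto simp: P_def)
      qed
    qed
    show "T.span {b \<in> P ` D. \<delta> b = n} \<subseteq> deg M n"
      unfolding M blk_def
    proof (intro T.span_mono subsetI)
      fix t assume "t \<in> {b \<in> P ` D. \<delta> b = n}"
      then obtain x hs a where t: "t = P (x, hs, a)" "(x, hs, a) \<in> D" "w (x, hs, a) = n"
        using \<delta> by auto
      have "x \<in> deg X (dX x)" "a \<in> deg A (dA a)" "homogeneous H (map dH hs) hs"
        using t(2) BX(3) BA(3) BH(3)
        by (auto simp: D_def homogeneous_def list_all2_conv_all_nth intro!: VX.span_base VA.span_base VH.span_base)
      then show "t \<in> {pure_tensor X H A (x, hs, a) | x hs a p ds q.
         x \<in> deg X p \<and> length hs \<in> I \<and> homogeneous H ds hs \<and> a \<in> deg A q \<and>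
         p + sum_list ds + q + int (length hs) + c = n}"
        using t by (intro CollectI exI[of _ x] exI[of _ hs] exI[of _ a] exI[of _ "dX x"]
            exI[of _ "map dH hs"] exI[of _ "dA a"]) (simp add: P_def w_def D_def)
    qed
  qed
  then show ?thesis
    using graded_basis[of M "P ` D" \<delta>] \<open>T.independent (P ` D)\<close> M(1) T.vector_space_axioms by simp
qed

lemma total_blk:
  fixes M :: "('k::field, ('k, 'x::ab_group_add, 'h::ab_group_add, 'a::ab_group_add) tens, 'm) grmod_scheme"
    and X :: "('k, 'x, 'y) grmod_scheme" and H :: "('k, 'h, 'z) grmod_scheme"
    and A :: "('k, 'a, 'w) grmod_scheme"
  assumes gX: "graded X" and gH: "graded H" "total H = UNIV" and gA: "graded A" "total A = UNIV"
    and M: "scale M = tscale" "deg M = blk X H A I c"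
  shows "total M = module.span tscale {pure_tensor X H A (x, hs, a) | x (hs :: 'h list) (a :: 'a). x \<in> total X \<and> length hs \<in> I}"
    (is "_ = module.span tscale ?G")
proof -
  note gM = graded_blk[OF assms]
  interpret VX: vector_space "scale X" by (rule graded_vs) fact
  interpret VH: vector_space "scale H" by (rule graded_vs) fact
  interpret VA: vector_space "scale A" by (rule graded_vs) fact
  have tM: "total M = T.span (\<Union>n. blk X H A I c n)"
    using total_span[OF gM] by (simp add: M)
  show ?thesis
  proof (rule antisym)
    show "total M \<subseteq> T.span ?G"
      unfolding tM blk_def
      by (intro T.span_minimal T.subspace_span UN_least T.span_mono subsetI)
        (use deg_total[OF gX] in blast)
    have sub: "T.subspace (total M)" unfolding tM by (rule T.subspace_span)
    show "T.span ?G \<subseteq> total M"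
    proof (intro T.span_minimal sub subsetI, clarsimp)
      fix x and hs :: "'h list" and a :: 'a
      assume *: "x \<in> total X" "length hs \<in> I"
      show "pure_tensor X H A (x, hs, a) \<in> total M"
      proof (rule span_pure[OF sub gX gH(1) gA(1)])
        show "x \<in> VX.span (\<Union>n. deg X n)" using * total_span[OF gX] by simp
        show "a \<in> VA.span (\<Union>n. deg A n)" using gA(2) total_span[OF gA(1)] by simp
        show "list_all2 (\<lambda>h S. h \<in> VH.span S) hs (replicate (length hs) (\<Union>n. deg H n))"
          using gH(2) total_span[OF gH(1)] by (simp add: list_all2_conv_all_nth)
        show "(\<Union>n. deg X n) \<subseteq> total X" using deg_total[OF gX] by blast
        fix x' hs' a'
        assume **: "x' \<in> (\<Union>n. deg X n)" "a' \<in> (\<Union>n. deg A n)"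
          "list_all2 (\<lambda>h S. h \<in> S) hs' (replicate (length hs) (\<Union>n. deg H n))"
        then obtain p q where pq: "x' \<in> deg X p" "a' \<in> deg A q" by auto
        have "\<forall>i<length hs'. \<exists>d. hs' ! i \<in> deg H d" "length hs' = length hs"
          using **(3) by (auto simp: list_all2_conv_all_nth)
        then obtain d where d: "\<And>i. i < length hs' \<Longrightarrow> hs' ! i \<in> deg H (d i)" by metis
        have "homogeneous H (map d [0..<length hs']) hs'"
          using d by (auto simp: homogeneous_def list_all2_conv_all_nth)
        then have "pure_tensor X H A (x', hs', a') \<in>
            blk X H A I c (p + sum_list (map d [0..<length hs']) + q + int (length hs') + c)"
          unfolding blk_def using pq * \<open>length hs' = length hs\<close>
          by (intro T.span_base CollectI exI[of _ x'] exI[of _ hs'] exI[of _ a'] exI[of _ p]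
            exI[of _ "map d [0..<length hs']"] exI[of _ q]) simp
        then show "pure_tensor X H A (x', hs', a') \<in> total M"
          unfolding tM by (intro T.span_base UN_I[OF UNIV_I])
      qed
    qed
  qed
qed

lemma ssum_if_left: "ssum (\<lambda>u v. if u = [] then F u v else 0) xs = F [] xs"
  by (cases xs) (simp_all add: ssum_Cons ssum_0)

lemma ssum_if_right: "ssum (\<lambda>u v. if v = [] then F u v else 0) xs = F xs []"
  by (induction xs arbitrary: F) (simp_all add: ssum_Cons)

lemma multilinear_koszul_homogeneous:
  assumes gV: "graded V" and F: "multilinear V W F" and hom: "homogeneous V ds xs"
  shows "F (us @ map (koszul V e) xs) = sg (e * sum_list ds) (F (us @ xs))"
  using hom
proof (induction xs arbitrary: ds us)
  case Nil
  then show ?case by (simp add: homogeneous_def)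
next
  case (Cons x xs)
  then obtain d ds' where ds: "ds = d # ds'" "x \<in> deg V d" "homogeneous V ds' xs"
    by (auto simp: homogeneous_def list_all2_Cons2)
  have "F (us @ sg e' x # vs) = sg e' (F (us @ x # vs))" for e' vs
    by (rule additive_sg[of "\<lambda>x. F (us @ x # vs)"]) (use F in \<open>auto simp: multilinear_def\<close>)
  then have "F (us @ map (koszul V e) (x # xs)) = sg (e * d) (F ((us @ [x]) @ map (koszul V e) xs))"
    using ds(2) by (simp add: koszul_deg[OF gV])
  then show ?case using Cons.IH[OF ds(3), of "us @ [x]"] ds(1) by (simp add: algebra_simps)
qed

text \<open>The degree of \<open>F xs\<close> exceeds the total degree of the inputs by
  \<open>length xs + e0\<close>; the sign in front is what an operator of degree \<open>e\<close>
  picks up from this excess.\<close>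

lemma multilinear_koszul:
  assumes gV: "graded V" "total V = UNIV" and gW: "graded W" "total W = UNIV"
    and F: "multilinear V W F" and deg: "multidegree e0 V W F" and xs: "xs \<noteq> []"
  shows "koszul W e (F xs) = sg (e * (int (length xs) + e0)) (F (map (koszul V e) xs))"
proof -
  have add: "F (us @ (x + y) # vs) = F (us @ x # vs) + F (us @ y # vs)" for us x y vs
    using F by (auto simp: multilinear_def)
  have "xs \<noteq> [] \<longrightarrow> koszul W e (F xs) = sg (e * (int (length xs) + e0)) (F (map (koszul V e) xs))"
    using gV
  proof (induction xs rule: multi_induct)
    case (homogeneous ds xs)
    show ?case
    proof
      assume "xs \<noteq> []"
      then have "F xs \<in> deg W (sum_list ds + int (length xs) + e0)"
        using deg homogeneous by (auto simp: multidegree_def)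
      then show "koszul W e (F xs) = sg (e * (int (length xs) + e0)) (F (map (koszul V e) xs))"
        using multilinear_koszul_homogeneous[OF gV(1) F homogeneous, of "[]" e]
        by (simp add: koszul_deg[OF gW(1)] algebra_simps)
    qed
  next
    case (add us x y vs)
    then show ?case
      using gV gW by (simp add: assms(5)[unfolded multilinear_def] koszul_add sg_add)
  qed
  then show ?thesis using xs by simp
qed

section \<open>The relations of A-infinity algebras, modules and morphisms\<close>

locale kad =
  fixes A :: "('k::field, 'a::ab_group_add) dga"
    and H :: "('k, 'h::ab_group_add) ainf"
    and cls :: "'a \<Rightarrow> 'h"
    and f :: "'h list \<Rightarrow> 'a"
  assumes dga: "dg_algebra A" and kadeishvili: "kadeishvili_model A H cls f"
begin

lemma gA: "graded A" and tA: "total A = UNIV" and gH: "graded H" and tH: "total H = UNIV"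
  and ainfH: "ainf_algebra H" and morph: "ainf_morphism H (dga_ainf A) f"
  and ops1: "ops H [h] = 0"
  using dga kadeishvili
  by (auto simp: dg_algebra_def kadeishvili_model_def ainf_algebra_def ainf_quasi_iso_def)

lemma gA': "graded (dga_ainf A)" and tA': "total (dga_ainf A) = UNIV"
proof -
  have "decomposes (dga_ainf A) = decomposes A"
    by (auto simp: decomposes_def dga_ainf_def fun_eq_iff)
  then show "graded (dga_ainf A)" "total (dga_ainf A) = UNIV"
    using gA tA by (auto simp: graded_def total_def) (simp_all add: dga_ainf_def)
qed

lemma koszul_dga_ainf: "koszul (dga_ainf A) = koszul A"
proof -
  have "decomposes (dga_ainf A) = decomposes A"
    by (auto simp: decomposes_def dga_ainf_def fun_eq_iff)
  then show ?thesis by (intro ext) (simp add: koszul_def)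
qed

lemma diff_add: "diff A (a + b) = diff A a + diff A b"
  and diff_scale: "diff A (scale A c a) = scale A c (diff A a)"
  and diff_diff: "diff A (diff A a) = 0"
  and diff_deg: "a \<in> deg A p \<Longrightarrow> diff A a \<in> deg A (p - 1)"
  and mult_add_right: "mult A a (b + b') = mult A a b + mult A a b'"
  and mult_add_left: "mult A (a + a') b = mult A a b + mult A a' b"
  and mult_scale_right: "mult A a (scale A c b) = scale A c (mult A a b)"
  and mult_scale_left: "mult A (scale A c a) b = scale A c (mult A a b)"
  and mult_deg: "a \<in> deg A p \<Longrightarrow> b \<in> deg A q \<Longrightarrow> mult A a b \<in> deg A (p + q)"
  and mult_assoc: "mult A (mult A a b) d = mult A a (mult A b d)"
  and unit_deg: "unit A \<in> deg A 0"
  and unit_left: "mult A (unit A) a = a" and unit_right: "mult A a (unit A) = a"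
  and leibniz_deg: "a \<in> deg A p \<Longrightarrow> diff A (mult A a b) = mult A (diff A a) b + sg p (mult A a (diff A b))"
  using dga tA unfolding dg_algebra_def linear_on_def graded_map_def by auto

lemma diff_sg: "diff A (sg e a) = sg e (diff A a)"
  by (rule additive_sg) (rule diff_add)

lemma mult_sg_right: "mult A a (sg e b) = sg e (mult A a b)"
  by (rule additive_sg) (rule mult_add_right)

lemma mult_sg_left: "mult A (sg e a) b = sg e (mult A a b)"
  by (rule additive_sg[of "\<lambda>a. mult A a b"]) (rule mult_add_left)

lemma mult_minus_right: "mult A a (- b) = - mult A a b"
  using mult_sg_right[of a 1 b] by (simp add: sg_def)

lemma diff_0 [simp]: "diff A 0 = 0"
  using diff_add[of 0 0] by simp

lemma mult_0_right [simp]: "mult A a 0 = 0"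
  using mult_add_right[of a 0 0] by simp

lemma mult_0_left [simp]: "mult A 0 a = 0"
  using mult_add_left[of 0 0 a] by simp

text \<open>With the sign absorbed into \<open>koszul\<close> the rule holds for inhomogeneous
  \<open>a\<close> as well.\<close>

lemma leibniz: "diff A (mult A a b) = mult A (diff A a) b + mult A (koszul A 1 a) (diff A b)"
proof -
  have "a \<in> total A" by (simp add: tA)
  with gA show ?thesis
  proof (induction rule: total_induct)
    case (deg n x)
    then show ?case by (simp add: leibniz_deg koszul_deg[OF gA] mult_sg_left)
  next
    case (add x y)
    then show ?case by (simp add: diff_add mult_add_left koszul_add[OF gA] algebra_simps)
  qed
qed

lemma diff_koszul: "diff A (koszul A e a) = sg e (koszul A e (diff A a))"
proof -
  have "a \<in> total A" by (simp add: tA)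
  with gA show ?thesis
  proof (induction rule: total_induct)
    case (deg n x)
    have "diff A (koszul A e x) = sg (e * n) (diff A x)"
      by (simp add: koszul_deg[OF gA deg] diff_sg)
    also have "\<dots> = sg e (koszul A e (diff A x))"
      unfolding koszul_deg[OF gA diff_deg[OF deg]] by (auto intro: sg_cong simp: algebra_simps)
    finally show ?case .
  next
    case (add x y)
    then show ?case by (simp add: diff_add koszul_add[OF gA] tA sg_add)
  qed
qed

text \<open>The operations are given the value 0 at the empty list, so that sums over all
  splittings, empty blocks included, agree with the sums over non-empty blocks in the
  relations.\<close>

definition op :: "'h list \<Rightarrow> 'h" where "op v = (if v = [] then 0 else ops H v)"

definition fn :: "'h list \<Rightarrow> 'a" where "fn v = (if v = [] then 0 else f v)"

lemma op_Nil [simp]: "op [] = 0" and fn_Nil [simp]: "fn [] = 0"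
  by (simp_all add: op_def fn_def)

lemma op_single [simp]: "op [h] = 0"
  by (simp add: op_def ops1)

lemma ops_multilinear: "multilinear H H (ops H)" and ops_multidegree: "multidegree (- 2) H H (ops H)"
  using ainfH by (auto simp: ainf_algebra_def)

lemma f_multilinear: "multilinear H (dga_ainf A) f" and f_multidegree: "multidegree (- 1) H (dga_ainf A) f"
  using morph by (auto simp: ainf_morphism_def)

lemma op_add: "op (us @ (x + y) # vs) = op (us @ x # vs) + op (us @ y # vs)"
  and op_scale: "op (us @ scale H c x # vs) = scale H c (op (us @ x # vs))"
  using ops_multilinear by (auto simp: op_def multilinear_def)

lemma fn_add: "fn (us @ (x + y) # vs) = fn (us @ x # vs) + fn (us @ y # vs)"
  and fn_scale: "fn (us @ scale H c x # vs) = scale A c (fn (us @ x # vs))"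
  using f_multilinear by (auto simp: fn_def multilinear_def dga_ainf_def)

lemma op_deg: "homogeneous H ds v \<Longrightarrow> op v \<in> deg H (sum_list ds + int (length v) - 2)"
  using ops_multidegree deg_0[OF gH] by (auto simp: op_def multidegree_def)

lemma fn_deg: "homogeneous H ds v \<Longrightarrow> fn v \<in> deg A (sum_list ds + int (length v) - 1)"
  using f_multidegree deg_0[OF gA] by (auto simp: fn_def multidegree_def dga_ainf_def)

lemma op_0 [simp]: "op (us @ 0 # vs) = 0"
  using op_add[of us 0 0 vs] by simp

lemma fn_0 [simp]: "fn (us @ 0 # vs) = 0"
  using fn_add[of us 0 0 vs] by simp

lemma ops_0: "ops H (us @ 0 # vs) = 0"
  using op_0[of us vs] by (simp add: op_def)

lemma f_0: "f (us @ 0 # vs) = 0"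
  using fn_0[of us vs] by (simp add: fn_def)

lemma koszul_0 [simp]: "koszul H e 0 = 0" "koszul A e 0 = 0"
  using koszul_deg[OF gH deg_0[OF gH], of e 0] koszul_deg[OF gA deg_0[OF gA], of e 0] by simp_all

lemma koszul_op: "koszul H e (op v) = sg (e * int (length v)) (op (map (koszul H e) v))"
proof (cases "v = []")
  case False
  then show ?thesis
    using multilinear_koszul[OF gH tH gH tH ops_multilinear ops_multidegree False, of e]
    by (auto simp: op_def algebra_simps intro!: sg_cong)
qed simp

lemma koszul_fn: "koszul A e (fn v) = sg (e * (int (length v) - 1)) (fn (map (koszul H e) v))"
proof (cases "v = []")
  case False
  then show ?thesis
    using multilinear_koszul[OF gH tH gA' tA' f_multilinear f_multidegree False, of e]
    by (auto simp: fn_def koszul_dga_ainf)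
qed simp

lemma map_koszul_even: "even e \<Longrightarrow> map (koszul H e) v = v"
  by (simp add: koszul_even[OF gH] tH map_idI)

lemma map_koszul_koszul: "map (koszul H e) (map (koszul H e') v) = map (koszul H (e + e')) v"
  by (simp add: koszul_koszul[OF gH] tH)

lemma koszul_koszulH: "koszul H e (koszul H e' h) = koszul H (e + e') h"
  by (simp add: koszul_koszul[OF gH] tH)

lemma koszul_shift2: "koszul V (int s - 2) = koszul V (int s)"
  by (rule koszul_parity) simp

text \<open>The defining relation of H rewritten with splittings: r, s, t are the lengths of
  \<open>u\<close>, \<open>v\<close>, \<open>w\<close>. An empty \<open>v\<close> inserts an entry
  0, which makes its term vanish.\<close>

lemma op_relation:
  "ssum (\<lambda>u r. ssum (\<lambda>v w. sg (int (length u) + int (length v) * int (length w))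
     (op (map (koszul H (int (length v))) u @ op v # w))) r) xs = 0"
proof (cases "xs = []")
  case False
  let ?m = "length xs"
  have "0 = (\<Sum>s = 1..?m. \<Sum>r = 0..?m - s.
      let t = ?m - s - r in sg (int (r + s * t)) (ops H (insert_op H r s xs)))"
    using ainfH False unfolding ainf_algebra_def by auto
  also have "\<dots> = ssum (\<lambda>u r. ssum (\<lambda>v w. sg (int (length u) + int (length v) * int (length w))
     (op (map (koszul H (int (length v))) u @ op v # w))) r) xs"
    unfolding Let_def sum_triangle_swap ssum3_take_drop
  proof (intro sum.cong refl)
    fix r s assume "r \<in> {..?m}" "s \<in> {..?m - r}"
    then have "s \<le> length (drop r xs)" "length (take r xs) = r" "length (take s (drop r xs)) = s"
      "length (drop (r + s) xs) = ?m - s - r" by auto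
    then show "(if s = 0 then 0 else sg (int (r + s * (?m - s - r))) (ops H (insert_op H r s xs))) =
      sg (int (length (take r xs)) + int (length (take s (drop r xs))) * int (length (drop (r + s) xs)))
        (op (map (koszul H (int (length (take s (drop r xs))))) (take r xs) @ op (take s (drop r xs)) #
          drop (r + s) xs))"
      using False by (auto simp: insert_op_def koszul_shift2 op_def[of "_ @ _"])
        (auto simp: op_def ops_0)
  qed
  finally show ?thesis ..
qed simp

lemma finite_compositions: "finite (compositions m)"
proof (rule finite_subset)
  show "compositions m \<subseteq> {is. set is \<subseteq> {..m} \<and> length is \<le> m}"
  proof safe
    fix "is" assume "is \<in> compositions m"
    then have *: "sum_list is = m" "0 \<notin> set is" by (auto simp: compositions_def)
    show "x \<le> m" if "x \<in> set is" for x using *(1) that member_le_sum_list[of x "is"] by auto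
    have "length is \<le> sum_list is" using *(2) by (induction "is") auto
    then show "length is \<le> m" using * by simp
  qed
  show "finite {is. set is \<subseteq> {..m} \<and> length is \<le> m}" by (rule finite_lists_length_le) simp
qed

text \<open>The relation of the A-infinity morphism f. Its target has only a differential and a
  product, so of the sum over compositions the parts with one and two blocks remain.\<close>

lemma fn_relation:
  "ssum (\<lambda>u r. ssum (\<lambda>v w. sg (int (length u) + int (length v) * int (length w))
     (fn (map (koszul H (int (length v))) u @ op v # w))) r) xs =
   diff A (fn xs) + ssum (\<lambda>u v. sg (int (length u) + 1)
     (mult A (fn (map (koszul H (int (length v) + 1)) u)) (fn v))) xs"
proof (cases "xs = []")
  case False
  let ?m = "length xs"
  let ?L = "\<lambda>is. sg (int (\<Sum>k < length is. (length is - 1 - k) * (is ! k - 1)))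
      (ops (dga_ainf A) (tensor_apply H f is xs))"
  have "ssum (\<lambda>u r. ssum (\<lambda>v w. sg (int (length u) + int (length v) * int (length w))
     (fn (map (koszul H (int (length v))) u @ op v # w))) r) xs =
    (\<Sum>s = 1..?m. \<Sum>r = 0..?m - s.
      let t = ?m - s - r in sg (int (r + s * t)) (f (insert_op H r s xs)))"
    unfolding Let_def sum_triangle_swap ssum3_take_drop
  proof (intro sum.cong refl)
    fix r s assume "r \<in> {..?m}" "s \<in> {..?m - r}"
    then have "s \<le> length (drop r xs)" "length (take r xs) = r" "length (take s (drop r xs)) = s"
      "length (drop (r + s) xs) = ?m - s - r" by auto
    then show "sg (int (length (take r xs)) + int (length (take s (drop r xs))) * int (length (drop (r + s) xs)))
        (fn (map (koszul H (int (length (take s (drop r xs))))) (take r xs) @ op (take s (drop r xs)) #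
          drop (r + s) xs)) =
       (if s = 0 then 0 else sg (int (r + s * (?m - s - r))) (f (insert_op H r s xs)))"
      using False by (auto simp: insert_op_def koszul_shift2 fn_def[of "_ @ _"])
        (auto simp: op_def f_0)
  qed
  also have "\<dots> = (\<Sum>is \<in> compositions ?m. ?L is)"
    using morph False unfolding ainf_morphism_def Let_def by auto
  \<comment> \<open>A composition with three or more blocks would need an operation of arity at
    least 3 on A.\<close>
  also have "\<dots> = (\<Sum>is \<in> insert [?m] ((\<lambda>i. [i, ?m - i]) ` {1..<?m}). ?L is)"
  proof (rule sum.mono_neutral_right)
    show "insert [?m] ((\<lambda>i. [i, ?m - i]) ` {1..<?m}) \<subseteq> compositions ?m"
      using False by (auto simp: compositions_def)
    have len: "length (tensor_apply H f is ys) = length is" for "is" ys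
      by (induction "is" arbitrary: ys) auto
    show "\<forall>is\<in>compositions ?m - insert [?m] ((\<lambda>i. [i, ?m - i]) ` {1..<?m}). ?L is = 0"
    proof
      fix "is" assume *: "is \<in> compositions ?m - insert [?m] ((\<lambda>i. [i, ?m - i]) ` {1..<?m})"
      then have "is \<noteq> []" using False by (auto simp: compositions_def)
      moreover have "is \<noteq> [i]" for i using * by (auto simp: compositions_def)
      moreover have "is \<noteq> [i, j]" for i j
      proof
        assume ij: "is = [i, j]"
        then have "i \<in> {1..<?m}" "j = ?m - i" using * by (auto simp: compositions_def)
        then show False using * ij by auto
      qed
      ultimately obtain i j k r where "is = i # j # k # r"
        by (metis list.exhaust)
      then have "ops (dga_ainf A) (tensor_apply H f is xs) = 0"
        by (simp add: dga_ainf_def)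
      then show "?L is = 0" by simp
    qed
  qed (rule finite_compositions)
  also have "\<dots> = ?L [?m] + (\<Sum>i = 1..<?m. ?L [i, ?m - i])"
    by (subst sum.insert) (auto simp: sum.reindex inj_on_def)
  also have "?L [?m] = diff A (fn xs)"
    using False map_koszul_even[of 0] by (simp add: dga_ainf_def fn_def)
  also have "(\<Sum>i = 1..<?m. ?L [i, ?m - i]) = (\<Sum>i\<le>?m. sg (int (length (take i xs)) + 1)
     (mult A (fn (map (koszul H (int (length (drop i xs)) + 1)) (take i xs))) (fn (drop i xs))))"
  \<comment> \<open>The two splittings added at the ends, i = 0 and i = \<open>?m\<close>,
    contribute 0 because \<open>fn [] = 0\<close>.\<close>
  proof (rule sum.mono_neutral_cong_left)
    fix i assume i: "i \<in> {1..<?m}"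
    have 1: "koszul H (int (?m - i) - 1) = koszul H (int (?m - i) + 1)" by (rule koszul_parity) simp
    have 2: "ops (dga_ainf A) (tensor_apply H f [i, ?m - i] xs) =
        mult A (f (map (koszul H (int (?m - i) + 1)) (take i xs))) (f (drop i xs))"
      unfolding 1[symmetric] by (simp add: dga_ainf_def map_koszul_even)
    \<comment> \<open>Only the first of the two blocks enters the exponent, with weight 1.\<close>
    have 3: "(\<Sum>k < length [i, ?m - i]. (length [i, ?m - i] - 1 - k) * ([i, ?m - i] ! k - 1)) = i - 1"
      by (simp add: lessThan_Suc)
    have 4: "sg (int (i - 1)) t = sg (int (length (take i xs)) + 1) t" for t :: 'a
      using i by (intro sg_cong) auto
    show "?L [i, ?m - i] = sg (int (length (take i xs)) + 1)
     (mult A (fn (map (koszul H (int (length (drop i xs)) + 1)) (take i xs))) (fn (drop i xs)))"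
      unfolding 2 3 4 using i False by (simp add: fn_def)
  qed (auto simp: not_less not_le intro: le_antisym)
  finally show ?thesis by (simp add: ssum_def)
next
  case True
  then show ?thesis using fn_0[of "[]" "[]"] by simp
qed

abbreviation left where "left \<equiv> left_op A f"

text \<open>Since \<open>fn [] = 0\<close>, the case distinction of \<open>left_op\<close> becomes a
  sum, whose parts can be treated separately inside an \<open>ssum\<close>.\<close>

lemma left_eq: "left v a = (if v = [] then diff A a else 0) + sg (int (length v) + 1) (mult A (fn v) a)"
  by (simp add: left_op_def fn_def add.commute)

text \<open>The maps \<open>left\<close> make A a left A-infinity module over H along f: multiply
  \<open>fn_relation\<close> by \<open>a\<close> on the right, and use associativity and the Leibniz
  rule for \<open>fn hs\<close> times \<open>a\<close>.\<close>

lemma left_relation: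
  "ssum (\<lambda>u r. ssum (\<lambda>v w. sg (int (length u) + int (length v) * (int (length w) + 1))
     (left (map (koszul H (int (length v))) u @ op v # w) a)) r) hs +
   ssum (\<lambda>u v. sg (int (length u)) (left (map (koszul H (int (length v) + 1)) u) (left v a))) hs = 0"
proof -
  let ?m = "int (length hs)"
  let ?F = "ssum (\<lambda>u v. sg (int (length u) + 1)
     (mult A (fn (map (koszul H (int (length v) + 1)) u)) (fn v))) hs"
  have addL: "mult A (x + y) a = mult A x a + mult A y a" for x y by (rule mult_add_left)
  have "ssum (\<lambda>u r. ssum (\<lambda>v w. sg (int (length u) + int (length v) * (int (length w) + 1))
     (left (map (koszul H (int (length v))) u @ op v # w) a)) r) hs =
    ssum (\<lambda>u r. ssum (\<lambda>v w. sg ?m (mult A (sg (int (length u) + int (length v) * int (length w))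
     (fn (map (koszul H (int (length v))) u @ op v # w))) a)) r) hs"
    by (intro ssum_cong) (auto simp: left_eq mult_sg_left algebra_simps intro!: sg_cong)
  also have "\<dots> = sg ?m (mult A (diff A (fn hs) + ?F) a)"
    unfolding fn_relation[symmetric]
    by (simp add: ssum_additive[of "\<lambda>x. mult A x a", OF addL] ssum_sg)
  also have "\<dots> = sg ?m (mult A (diff A (fn hs)) a) +
     ssum (\<lambda>u v. sg (int (length v) + 1) (mult A (fn (map (koszul H (int (length v) + 1)) u)) (mult A (fn v) a))) hs"
    unfolding mult_add_left sg_add
    by (simp add: ssum_additive[of "\<lambda>x. mult A x a", OF addL] ssum_sg)
      (intro ssum_cong, auto simp: mult_sg_left mult_assoc intro!: sg_cong)
  finally have 1: "ssum (\<lambda>u r. ssum (\<lambda>v w. sg (int (length u) + int (length v) * (int (length w) + 1))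
     (left (map (koszul H (int (length v))) u @ op v # w) a)) r) hs = \<dots>" .
  \<comment> \<open>The differential in the outer \<open>left\<close> occurs only for an empty
    \<open>u\<close>, the one in the inner \<open>left\<close> only for an empty \<open>v\<close>.
    The two boundary terms meet in the Leibniz rule below; the products cancel those of
    \<open>fn_relation\<close>.\<close>
  have "ssum (\<lambda>u v. sg (int (length u)) (left (map (koszul H (int (length v) + 1)) u) (left v a))) hs =
    ssum (\<lambda>u v. (if u = [] then diff A (left v a) else 0) +
       ((if v = [] then - mult A (fn (map (koszul H (int (length v) + 1)) u)) (diff A a) else 0) +
       - sg (int (length v) + 1) (mult A (fn (map (koszul H (int (length v) + 1)) u)) (mult A (fn v) a)))) hs"
    by (intro ssum_cong) (auto simp: left_eq sg_add mult_add_right mult_sg_right mult_minus_right sg_def)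
  also have "\<dots> = diff A (left hs a) - mult A (fn (map (koszul H 1) hs)) (diff A a) -
      ssum (\<lambda>u v. sg (int (length v) + 1) (mult A (fn (map (koszul H (int (length v) + 1)) u)) (mult A (fn v) a))) hs"
    unfolding ssum_add ssum_if_left ssum_if_right ssum_uminus by simp
  also have "diff A (left hs a) = - sg ?m (mult A (diff A (fn hs)) a) + mult A (fn (map (koszul H 1) hs)) (diff A a)"
  proof -
    have "diff A (left hs a) = sg (?m + 1) (diff A (mult A (fn hs) a))"
      by (simp add: left_eq diff_diff diff_add diff_sg)
    also have "\<dots> = sg (?m + 1) (mult A (diff A (fn hs)) a) + sg (?m + 1 + (?m - 1)) (mult A (fn (map (koszul H 1) hs)) (diff A a))"
      by (simp add: leibniz koszul_fn mult_sg_left sg_add)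
    finally show ?thesis by (simp add: sg_def)
  qed
  finally show ?thesis by (simp add: 1)
qed

end

section \<open>Linearity, degrees and signs of module structures and of their morphisms\<close>

context
  fixes e0 :: int and l :: nat and H :: "('k::field, 'h::ab_group_add) ainf"
    and X Y :: "('k, 'h, 'x::ab_group_add) amod" and g :: "'x \<Rightarrow> 'h list \<Rightarrow> 'x"
  assumes mm: "module_maps e0 l H X Y g" and gX: "graded X" and gY: "graded Y"
    and gH: "graded H" and tH: "total H = UNIV"
begin

lemma module_maps_add_left: "length hs < l \<Longrightarrow> x \<in> total X \<Longrightarrow> y \<in> total X \<Longrightarrow>
    g (x + y) hs = g x hs + g y hs"
  and module_maps_scale_left: "length hs < l \<Longrightarrow> x \<in> total X \<Longrightarrow> g (scale X c x) hs = scale Y c (g x hs)"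
  and module_maps_add_middle: "length us + length vs + 1 < l \<Longrightarrow> x \<in> total X \<Longrightarrow>
    g x (us @ (h + h') # vs) = g x (us @ h # vs) + g x (us @ h' # vs)"
  and module_maps_scale_middle: "length us + length vs + 1 < l \<Longrightarrow> x \<in> total X \<Longrightarrow>
    g x (us @ scale H c h # vs) = scale Y c (g x (us @ h # vs))"
  and module_maps_deg: "length hs < l \<Longrightarrow> x \<in> deg X p \<Longrightarrow> homogeneous H ds hs \<Longrightarrow>
    g x hs \<in> deg Y (p + sum_list ds + (int (length hs) + 1) + e0)"
  using mm unfolding module_maps_def linear_on_def by auto

lemma module_maps_sg_left:
  assumes "length hs < l" "x \<in> total X"
  shows "g (sg e x) hs = sg e (g x hs)"
proof -
  interpret VX: vector_space "scale X" by (rule graded_vs) (rule gX)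
  interpret VY: vector_space "scale Y" by (rule graded_vs) (rule gY)
  show ?thesis using module_maps_scale_left[OF assms, of "-1"] by (simp add: sg_def)
qed

lemma module_maps_sg_middle:
  assumes "length us + length vs + 1 < l" "x \<in> total X"
  shows "g x (us @ sg e h # vs) = sg e (g x (us @ h # vs))"
  by (rule additive_sg[of "\<lambda>h. g x (us @ h # vs)"]) (rule module_maps_add_middle[OF assms])

lemma module_maps_zero_left: "length hs < l \<Longrightarrow> g 0 hs = 0"
  using module_maps_add_left[of hs 0 0] total_0[OF gX] by simp

lemma module_maps_zero_middle: "length us + length vs + 1 < l \<Longrightarrow> x \<in> total X \<Longrightarrow> g x (us @ 0 # vs) = 0"
  using module_maps_add_middle[of us vs x 0 0] by simp

lemma module_maps_total:
  assumes "length hs < l" "x \<in> total X"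
  shows "g x hs \<in> total Y"
proof -
  have "length hs < l \<longrightarrow> g x hs \<in> total Y" using gH tH
  proof (induction hs rule: multi_induct)
    case (homogeneous ds hs)
    show ?case
    proof
      assume l: "length hs < l"
      show "g x hs \<in> total Y" using gX assms(2)
      proof (induction rule: total_induct)
        case (deg n x)
        then show ?case using module_maps_deg[OF l _ homogeneous] deg_total[OF gY] by blast
      next
        case (add x y)
        then show ?case by (simp add: module_maps_add_left l total_add[OF gY])
      qed
    qed
  next
    case (add us h h' vs)
    then show ?case
      using module_maps_add_middle[of us vs x h h'] assms(2) by (auto simp: total_add[OF gY])
  qed
  then show ?thesis using assms(1) by simp
qed

text \<open>The counterpart of \<open>multilinear_koszul\<close>. The arity is
  \<open>length hs + 1\<close>, as x is counted too; \<open>e0\<close> is -2 for actions and -1 for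
  morphisms.\<close>

lemma module_maps_koszul:
  assumes "length hs < l" "x \<in> total X"
  shows "koszul Y e (g x hs) = sg (e * (int (length hs) + 1 + e0)) (g (koszul X e x) (map (koszul H e) hs))"
proof -
  have kt: "koszul X e x \<in> total X" by (rule koszul_total[OF gX assms(2)])
  have "length hs < l \<longrightarrow>
    koszul Y e (g x hs) = sg (e * (int (length hs) + 1 + e0)) (g (koszul X e x) (map (koszul H e) hs))"
    using gH tH
  proof (induction hs rule: multi_induct)
    case (homogeneous ds hs)
    show ?case
    proof
      assume l: "length hs < l"
      have 1: "g x (us @ map (koszul H e) hs') = sg (e * sum_list ds') (g x (us @ hs'))"
        if "homogeneous H ds' hs'" "length us + length hs' < l" "x \<in> total X" for ds' hs' us x
        using that
      proof (induction hs' arbitrary: ds' us)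
        case Nil
        then show ?case by (simp add: homogeneous_def)
      next
        case (Cons h hs')
        then obtain d ds2 where ds: "ds' = d # ds2" "h \<in> deg H d" "homogeneous H ds2 hs'"
          by (auto simp: homogeneous_def list_all2_Cons2)
        have "g x (us @ map (koszul H e) (h # hs')) = sg (e * d) (g x ((us @ [h]) @ map (koszul H e) hs'))"
          using ds(2) Cons.prems by (simp add: koszul_deg[OF gH] module_maps_sg_middle)
        then show ?case using Cons.IH[OF ds(3), of "us @ [h]"] Cons.prems ds(1) by (simp add: algebra_simps)
      qed
      show "koszul Y e (g x hs) = sg (e * (int (length hs) + 1 + e0)) (g (koszul X e x) (map (koszul H e) hs))"
        using gX assms(2)
      proof (induction rule: total_induct)
        case (deg n x)
        note t = deg_total[OF gX deg]
        show ?case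
          using 1[OF homogeneous, of "[]" "sg (e * n) x"] l t
          by (simp add: koszul_deg[OF gY module_maps_deg[OF l deg homogeneous]] koszul_deg[OF gX deg]
              total_sg[OF gX] module_maps_sg_left algebra_simps)
      next
        case (add x y)
        then show ?case
          using l by (simp add: module_maps_add_left koszul_add[OF gX] koszul_add[OF gY] koszul_total[OF gX]
              module_maps_total sg_add)
      qed
    qed
  next
    case (add us h h' vs)
    show ?case
    proof
      assume l: "length (us @ (h + h') # vs) < l"
      then show "koszul Y e (g x (us @ (h + h') # vs)) =
        sg (e * (int (length (us @ (h + h') # vs)) + 1 + e0)) (g (koszul X e x) (map (koszul H e) (us @ (h + h') # vs)))"
        using add assms(2) kt
        by (simp add: koszul_add[OF gH] tH module_maps_add_middle koszul_add[OF gY] module_maps_total sg_add)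
    qed
  qed
  then show ?thesis using assms(1) by simp
qed

text \<open>A varied entry is either among the first \<open>r\<close>, which g consumes, or in the
  remainder; \<open>r < l\<close> keeps g within the arities where it is linear.\<close>

lemma multilinear_op_front:
  assumes "r < l"
  shows "multilinear_op X Y H A S (\<lambda>(x, hs, a). (g x (take r hs), drop r hs, a))"
proof -
  have t: "g x (take r hs) \<in> total Y" if "x \<in> total X" for x hs
    using module_maps_total[of "take r hs"] that assms by simp
  have 1: "g (x + y) (take r hs) = g x (take r hs) + g y (take r hs)" if "x \<in> total X" "y \<in> total X" for x y hs
    using module_maps_add_left[of "take r hs"] that assms by simp
  have 2: "g (scale X c x) (take r hs) = scale Y c (g x (take r hs))" if "x \<in> total X" for x c hs
    using module_maps_scale_left[of "take r hs"] that assms by simp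
  have 3: "g x (us @ (h + h') # take k vs) = g x (us @ h # take k vs) + g x (us @ h' # take k vs)"
    if "x \<in> total X" "Suc (length us + k) \<le> r" for us k vs x h h'
    using that assms by (intro module_maps_add_middle) auto
  have 4: "g x (us @ scale H c h # take k vs) = scale Y c (g x (us @ h # take k vs))"
    if "x \<in> total X" "Suc (length us + k) \<le> r" for us k vs x h c
    using that assms by (intro module_maps_scale_middle) auto
  have 5: "g x (us @ h # take k vs) \<in> total Y"
    if "x \<in> total X" "Suc (length us + k) \<le> r" for us k vs x h
    using that assms by (intro module_maps_total) auto
  show ?thesis
    unfolding multilinear_op_def tuple_multilinear_def
    by (auto simp: 1 2 3 4 5 take_Cons' drop_Cons' t)
qed

end

context kad
begin

text \<open>The varied entry lies before the block, where it only receives a Koszul sign, inside it,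
  where m^H is linear, or behind it, where it is untouched.\<close>

lemma multilinear_op_middle:
  fixes X :: "('k, 'x::ab_group_add, 'y) grmod_scheme"
  assumes gX: "graded X" and s: "1 \<le> s" "r + s \<le> i"
  shows "multilinear_op X X H A {i} (\<lambda>(x, hs, a). (koszul X e x, insert_op H r s hs, a))"
proof -
  have t: "koszul X e x \<in> total X" if "x \<in> total X" for x by (rule koszul_total[OF gX that])
  note k = koszul_add[OF gX] koszul_scale[OF gX] koszul_add[OF gH] koszul_scale[OF gH]
  have tk: "h \<in> total H" for h by (simp add: tH)
  have 1: "ops H (us @ (x + y) # vs) = ops H (us @ x # vs) + ops H (us @ y # vs)"
    "ops H (us @ scale H c x # vs) = scale H c (ops H (us @ x # vs))" for us x y vs c
    using ops_multilinear by (auto simp: multilinear_def)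
  show ?thesis
    unfolding multilinear_op_def
  proof (intro allI impI)
    fix \<phi> assume \<phi>: "form X H A \<phi>"
    note F = \<phi>[unfolded tuple_multilinear_def]
    have *: "\<phi> (koszul X e x, insert_op H r s (us @ (h + h') # vs), a) =
        \<phi> (koszul X e x, insert_op H r s (us @ h # vs), a) + \<phi> (koszul X e x, insert_op H r s (us @ h' # vs), a) \<and>
      \<phi> (koszul X e x, insert_op H r s (us @ scale H c h # vs), a) =
        c * \<phi> (koszul X e x, insert_op H r s (us @ h # vs), a)"
      if "length us + length vs + 1 = i" "x \<in> total X" for us h h' vs x a c
    proof -
      consider "length us < r" | "r \<le> length us" "length us < r + s" | "r + s \<le> length us" by linarith
      then show ?thesis
      proof cases
        case 1
        then obtain d where r: "r = length us + Suc d" using less_imp_Suc_add by auto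
        have "insert_op H r s (us @ h # vs) = map (koszul H (int s - 2)) us @ koszul H (int s - 2) h #
            (map (koszul H (int s - 2)) (take d vs) @ ops H (take s (drop d vs)) # drop (d + s) vs)" for h
          by (simp add: insert_op_def r)
        then show ?thesis using F t[OF that(2)] k tk by simp
      next
        case 2
        then obtain d where r: "length us = r + d" "d < s" by (metis le_Suc_ex nat_add_left_cancel_less)
        then obtain d' where s: "s = d + Suc d'" by (metis less_imp_Suc_add add_Suc_right)
        have "insert_op H r s (us @ h # vs) = map (koszul H (int s - 2)) (take r us) @
            ops H (drop r us @ h # take d' vs) # drop d' vs" for h
          using r by (simp add: insert_op_def s)
        then show ?thesis using F t[OF that(2)] by (simp add: 1)
      next
        case 3
        then obtain d where r: "length us = r + s + d" by (metis le_Suc_ex)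
        have "insert_op H r s (us @ h # vs) = (map (koszul H (int s - 2)) (take r us) @
            ops H (take s (drop r us)) # drop (r + s) us) @ h # vs" for h
          using r by (simp add: insert_op_def)
        then show ?thesis using F t[OF that(2)] by metis
      qed
    qed
    show "form X H A (\<lambda>(x, hs, a). if length hs \<in> {i}
        then \<phi> ((\<lambda>(x, hs, a). (koszul X e x, insert_op H r s hs, a)) (x, hs, a)) else 0)"
      unfolding tuple_multilinear_def using F by (auto simp: k t *)
  qed
qed

lemma left_add: "left hs (a + b) = left hs a + left hs b"
  and left_scale: "left hs (scale A c a) = scale A c (left hs a)"
proof -
  interpret vector_space "scale A" by (rule graded_vs) (rule gA)
  show "left hs (a + b) = left hs a + left hs b" "left hs (scale A c a) = scale A c (left hs a)"
    by (simp_all add: left_op_def diff_add diff_scale mult_add_right mult_scale_right sg_def)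
qed

lemma left_add_middle: "left (us @ (h + h') # vs) a = left (us @ h # vs) a + left (us @ h' # vs) a"
  and left_scale_middle: "left (us @ scale H c h # vs) a = scale A c (left (us @ h # vs) a)"
proof -
  interpret vector_space "scale A" by (rule graded_vs) (rule gA)
  show "left (us @ (h + h') # vs) a = left (us @ h # vs) a + left (us @ h' # vs) a"
    "left (us @ scale H c h # vs) a = scale A c (left (us @ h # vs) a)"
    by (simp_all add: left_eq fn_add fn_scale mult_add_left mult_scale_left sg_def)
qed

lemma multilinear_op_last:
  fixes X :: "('k, 'x::ab_group_add, 'y) grmod_scheme"
  assumes gX: "graded X"
  shows "multilinear_op X X H A S
    (\<lambda>(x, hs, a). (koszul X e x, map (koszul H e) (take r hs), left (drop r hs) a))"
proof -
  have t: "koszul X e x \<in> total X" if "x \<in> total X" for x by (rule koszul_total[OF gX that])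
  note k = koszul_add[OF gX] koszul_scale[OF gX] koszul_add[OF gH] koszul_scale[OF gH]
  have tk: "h \<in> total H" for h by (simp add: tH)
  show ?thesis
    unfolding multilinear_op_def tuple_multilinear_def
    by (auto simp: k t tk left_add left_scale left_add_middle left_scale_middle take_Cons' drop_Cons')
qed

lemma multilinear_op_act:
  fixes X :: "('k, 'x::ab_group_add, 'y) grmod_scheme"
  shows "multilinear_op X X H A S (\<lambda>(x, hs, a). (x, hs, mult A a b))"
  unfolding multilinear_op_def tuple_multilinear_def
  by (auto simp: mult_add_left mult_scale_left)

lemma multilinear_op_id:
  fixes X :: "('k, 'x::ab_group_add, 'y) grmod_scheme"
  shows "multilinear_op X X H A S (\<lambda>\<tau>. \<tau>)"
  unfolding multilinear_op_def tuple_multilinear_def by auto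

end

section \<open>Minimal modules and the bar differential on pure tensors\<close>

locale kadmod = kad A H cls f
  for A :: "('k::field, 'a::ab_group_add) dga" and H :: "('k, 'h::ab_group_add) ainf"
    and cls :: "'a \<Rightarrow> 'h" and f :: "'h list \<Rightarrow> 'a" +
  fixes X :: "('k, 'h, 'x::ab_group_add) amod" and n :: nat
  assumes minimal: "minimal_module H (cls (unit A)) (n + 1) X"
begin

lemma gX: "graded X" and act_maps: "module_maps (- 2) (n + 1) H X X (act_inf X)"
  and act_Nil: "x \<in> total X \<Longrightarrow> act_inf X x [] = 0"
  and act_act: "x \<in> total X \<Longrightarrow> act_inf X (act_inf X x [h]) [h'] = act_inf X x [ops H [h, h']]"
  and act_unit: "x \<in> total X \<Longrightarrow> act_inf X x [cls (unit A)] = x"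
  using minimal by (auto simp: minimal_module_def)

lemmas act_add_left = module_maps_add_left[OF act_maps gX gX gH tH]
lemmas act_scale_left = module_maps_scale_left[OF act_maps gX gX gH tH]
lemmas act_add_middle = module_maps_add_middle[OF act_maps gX gX gH tH]
lemmas act_deg = module_maps_deg[OF act_maps gX gX gH tH]
lemmas act_zero_middle = module_maps_zero_middle[OF act_maps gX gX gH tH]
lemmas act_total = module_maps_total[OF act_maps gX gX gH tH]
lemmas act_koszul = module_maps_koszul[OF act_maps gX gX gH tH]

abbreviation P where "P x hs a \<equiv> pure_tensor X H A (x, hs, a)"

lemma koszulX_total: "x \<in> total X \<Longrightarrow> koszul X e x \<in> total X"
  by (rule koszul_total[OF gX])

text \<open>The first sum collects the insertions of m^X at x, the second those of m^H. Here the
  empty block is excluded explicitly: an extra entry 0 could make the list n + 1 long, where nothing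
  is known of \<open>act_inf\<close>.\<close>

lemma act_relation:
  assumes x: "x \<in> total X" and hs: "length hs \<le> n"
  shows "ssum (\<lambda>v w. sg ((int (length v) + 1) * int (length w)) (act_inf X (act_inf X x v) w)) hs +
    ssum (\<lambda>u r. ssum (\<lambda>v w. if v = [] then 0 else sg (int (length u) + 1 + int (length v) * int (length w))
      (act_inf X (koszul X (int (length v)) x) (map (koszul H (int (length v))) u @ op v # w))) r) hs = 0"
proof -
  let ?m = "length hs"
  define T where "T r s = (let t = ?m + 1 - s - r; (y, ks) = insert_mod H X r s x hs
     in sg (int (r + s * t)) (act_inf X y ks))" for r s
  have "0 = (\<Sum>s = 1..?m + 1. \<Sum>r = 0..?m + 1 - s. T r s)"
    using minimal x hs unfolding minimal_module_def T_def by (auto simp: Let_def)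
  also have "\<dots> = (\<Sum>s = 1..?m + 1. T 0 s + (\<Sum>r = 1..?m + 1 - s. T r s))"
    by (simp add: sum.atLeast_Suc_atMost)
  also have "\<dots> = (\<Sum>s = 1..?m + 1. T 0 s) + (\<Sum>s = 1..?m + 1. \<Sum>r = 1..?m + 1 - s. T r s)"
    by (rule sum.distrib)
  also have "(\<Sum>s = 1..?m + 1. T 0 s) = (\<Sum>k\<le>?m. T 0 (k + 1))"
    by (rule sum.reindex_bij_witness[where i = "\<lambda>k. k + 1" and j = "\<lambda>s. s - 1"]) auto
  also have "\<dots> = ssum (\<lambda>v w. sg ((int (length v) + 1) * int (length w)) (act_inf X (act_inf X x v) w)) hs"
    unfolding ssum_def
    by (intro sum.cong refl) (auto simp: T_def insert_mod_def min_def intro!: sg_cong)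
  also have "(\<Sum>s = 1..?m + 1. \<Sum>r = 1..?m + 1 - s. T r s) = (\<Sum>s = 1..?m. \<Sum>r = 0..?m - s. T (r + 1) s)"
  proof -
    have "(\<Sum>s = 1..?m + 1. \<Sum>r = 1..?m + 1 - s. T r s) = (\<Sum>s = 1..?m. \<Sum>r = 1..?m + 1 - s. T r s)"
      by simp
    also have "\<dots> = (\<Sum>s = 1..?m. \<Sum>r = 0..?m - s. T (r + 1) s)"
      by (intro sum.cong refl sum.reindex_bij_witness[where i = "\<lambda>k. k + 1" and j = "\<lambda>s. s - 1"]) auto
    finally show ?thesis .
  qed
  also have "\<dots> = ssum (\<lambda>u r. ssum (\<lambda>v w. if v = [] then 0 else sg (int (length u) + 1 + int (length v) * int (length w))
      (act_inf X (koszul X (int (length v)) x) (map (koszul H (int (length v))) u @ op v # w))) r) hs"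
    unfolding sum_triangle_swap ssum3_take_drop
  proof (intro sum.cong refl)
    fix r s assume "r \<in> {..?m}" "s \<in> {..?m - r}"
    then have *: "s \<le> length (drop r hs)" "length (take r hs) = r" "length (take s (drop r hs)) = s"
      "length (drop (r + s) hs) = ?m - s - r" "r + s \<le> ?m" by auto
    have 1: "length (take s (drop r hs)) = s" "take s (drop r hs) = [] \<longleftrightarrow> s = 0"
      "?m + 1 - s - (r + 1) = ?m - s - r" using *(1,3) by (auto simp: take_eq_Nil)
    show "(if s = 0 then 0 else T (r + 1) s) =
       (if take s (drop r hs) = [] then 0 else
       sg (int (length (take r hs)) + 1 + int (length (take s (drop r hs))) * int (length (drop (r + s) hs)))
        (act_inf X (koszul X (int (length (take s (drop r hs)))) x)
          (map (koszul H (int (length (take s (drop r hs))))) (take r hs) @ op (take s (drop r hs)) # drop (r + s) hs)))"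
      unfolding T_def Let_def 1 *(2,4) using *(1)
      by (auto simp: insert_mod_def insert_op_def koszul_shift2 op_def take_eq_Nil intro!: sg_cong)
  qed
  finally show ?thesis ..
qed

abbreviation len where "len xs \<equiv> int (length xs)"

text \<open>\<open>DX\<close>, \<open>DH\<close> and \<open>DA\<close> are the parts of the bar differential that insert \<open>m\<^sup>X\<close>, \<open>m\<^sup>H\<close> and \<open>m\<^sup>A\<close>.
  The exponents combine \<open>(-1)\<^sup>l\<^sup>+\<^sup>\<lfloor>\<^sup>(\<^sup>j\<^sup>-\<^sup>1\<^sup>)\<^sup>/\<^sup>2\<^sup>\<rfloor>\<close> with the sign of the summand of \<open>M\<^sub>l\<^sub>,\<^sub>j\<close>; the Koszul signs
  are left to \<open>koszul\<close>.\<close>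

definition eX :: "int \<Rightarrow> int \<Rightarrow> int" where "eX a b = a + b + a div 2"
definition eH :: "int \<Rightarrow> int \<Rightarrow> int \<Rightarrow> int" where
  "eH a b c = a + b + c + (b - 1) div 2 + (a + 1) * (b - 1)"
definition eA :: "int \<Rightarrow> int \<Rightarrow> int" where "eA a b = a + b + b div 2 + (a + 1) * b"

definition DX where
  "DX x hs a = ssum (\<lambda>v w. sg (eX (len v) (len w)) (P (act_inf X x v) w a)) hs"

definition DH where
  "DH x hs a = ssum (\<lambda>u r. ssum (\<lambda>v w. if v = [] then 0 else sg (eH (len u) (len v) (len w))
     (P (koszul X (len v) x) (map (koszul H (len v)) u @ op v # w) a)) r) hs"

definition DA where
  "DA x hs a = ssum (\<lambda>u v. sg (eA (len u) (len v))
     (P (koszul X (len v + 1) x) (map (koszul H (len v + 1)) u) (left v a))) hs"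

lemma push_bar_term:
  assumes "1 \<le> j" "j \<le> i + 1" "i \<le> n" "b \<le> i + 2 - j"
  shows "push X H A {i} (bar_term A H f X i j b) (P x hs a) =
    (if length hs = i then pure_tensor X H A (bar_term A H f X i j b (x, hs, a)) else 0)"
proof -
  consider "b = 0" | "0 < b" "b < i + 2 - j" | "0 < b" "\<not> b < i + 2 - j" by linarith
  then have "multilinear_op X X H A {i} (bar_term A H f X i j b)"
  proof cases
    case 1
    then have "bar_term A H f X i j b = (\<lambda>(x, hs, a). (act_inf X x (take (j - 1) hs), drop (j - 1) hs, a))"
      by (simp add: bar_term_def)
    then show ?thesis
      using multilinear_op_front[OF act_maps gX gX gH tH, of "j - 1" A "{i}"] assms by simp
  next
    case 2
    then have "bar_term A H f X i j b = (\<lambda>(x, hs, a). (koszul X (int j - 2) x, insert_op H (b - 1) j hs, a))"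
      by (simp add: bar_term_def)
    then show ?thesis
      using multilinear_op_middle[OF gX, of j "b - 1" i "int j - 2"] assms 2 by simp
  next
    case 3
    then have "bar_term A H f X i j b = (\<lambda>(x, hs, a). (koszul X (int j - 2) x,
        map (koszul H (int j - 2)) (take (b - 1) hs), left (drop (b - 1) hs) a))"
      by (simp add: bar_term_def)
    then show ?thesis
      using multilinear_op_last[OF gX, of "{i}" "int j - 2" "b - 1"] by simp
  qed
  then show ?thesis by (simp add: push_pure)
qed

lemma Mop_pure:
  assumes "1 \<le> j" "j \<le> i + 1" "i \<le> n"
  shows "Mop A H f X i j (P x hs a) = (if length hs = i then
    \<Sum>b = 0..i + 2 - j. sg (int (b * (j - 1))) (pure_tensor X H A (bar_term A H f X i j b (x, hs, a))) else 0)"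
  using assms by (auto simp: Mop_def push_bar_term)

text \<open>m_1 vanishes on X and on H, so of all insertions only the differential of A in the last
  slot remains.\<close>

lemma Mop1_pure:
  assumes "i \<le> n" "x \<in> total X"
  shows "Mop A H f X i 1 (P x hs a) =
    (if length hs = i then P (koszul X 1 x) (map (koszul H 1) hs) (diff A a) else 0)"
proof (cases "length hs = i")
  case True
  have k: "koszul V (int 1 - 2) = koszul V 1" for V :: "('k, 'v::ab_group_add, 'y) grmod_scheme"
    by (rule koszul_parity) simp
  have "pure_tensor X H A (bar_term A H f X i 1 b (x, hs, a)) = 0" if "b \<le> i" for b
  proof (cases b)
    case 0
    then show ?thesis using assms by (simp add: bar_term_def act_Nil pure_zero_left[OF gX])
  next
    case (Suc r)
    then have "r < length hs" using that True by simp
    then have "take 1 (drop r hs) = [hs ! r]" by (simp add: Cons_nth_drop_Suc[symmetric])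
    then show ?thesis
      using Suc that koszulX_total[OF assms(2)]
      by (simp add: bar_term_def insert_op_def ops1 pure_zero_middle)
  qed
  then show ?thesis
    using assms True by (simp add: Mop_pure sum.atLeast0_atMost_Suc)
      (simp add: bar_term_def k[simplified] left_op_def)
qed (use assms in \<open>simp add: Mop_pure\<close>)

lemma D_pure:
  assumes x: "x \<in> total X" and hs: "length hs \<le> p" and p: "p \<le> n"
  shows "mdiff (bar_complex A H f X p) (P x hs a) = DX x hs a + DH x hs a + DA x hs a"
proof -
  let ?i = "length hs"
  define t where "t j b = sg (int (?i + (j - 1) div 2)) (sg (int (b * (j - 1)))
     (pure_tensor X H A (bar_term A H f X ?i j b (x, hs, a))))" for j b
  have "mdiff (bar_complex A H f X p) (P x hs a) =
      (\<Sum>l\<le>p. \<Sum>j = 1..l + 1. sg (int (l + (j - 1) div 2)) (Mop A H f X l j (P x hs a)))"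
    by (simp add: bar_complex_def)
  also have "\<dots> = (\<Sum>l\<le>p. if ?i = l then \<Sum>j = 1..?i + 1. \<Sum>b = 0..?i + 2 - j. t j b else 0)"
  proof (intro sum.cong refl)
    fix l assume l: "l \<in> {..p}"
    have "sg (int (l + (j - 1) div 2)) (Mop A H f X l j (P x hs a)) =
        (if ?i = l then \<Sum>b = 0..?i + 2 - j. t j b else 0)" if "j \<in> {1..l + 1}" for j
      using p l that by (auto simp: Mop_pure sg_sum t_def)
    then have "(\<Sum>j = 1..l + 1. sg (int (l + (j - 1) div 2)) (Mop A H f X l j (P x hs a))) =
        (\<Sum>j = 1..l + 1. if ?i = l then \<Sum>b = 0..?i + 2 - j. t j b else 0)"
      by (intro sum.cong refl)
    then show "(\<Sum>j = 1..l + 1. sg (int (l + (j - 1) div 2)) (Mop A H f X l j (P x hs a))) =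
        (if ?i = l then \<Sum>j = 1..?i + 1. \<Sum>b = 0..?i + 2 - j. t j b else 0)"
      by (simp only: if_distrib if_distribR sum.neutral_const split: if_split) simp
  qed
  also have "\<dots> = (\<Sum>j = 1..?i + 1. \<Sum>b = 0..?i + 2 - j. t j b)"
    using hs by simp
  \<comment> \<open>For fixed arity j the first position uses m^X, the last one m^A, and those
    between use m^H.\<close>
  also have "\<dots> = (\<Sum>j = 1..?i + 1. t j 0 + (\<Sum>b = 1..?i + 1 - j. t j b) + t j (?i + 2 - j))"
  proof (intro sum.cong refl)
    fix j assume "j \<in> {1..?i + 1}"
    then have "?i + 2 - j = Suc (?i + 1 - j)" by auto
    then show "(\<Sum>b = 0..?i + 2 - j. t j b) = t j 0 + (\<Sum>b = 1..?i + 1 - j. t j b) + t j (?i + 2 - j)"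
      by (simp add: sum.atLeast_Suc_atMost add.assoc)
  qed
  also have "\<dots> = (\<Sum>j = 1..?i + 1. t j 0) + (\<Sum>j = 1..?i + 1. \<Sum>b = 1..?i + 1 - j. t j b) +
      (\<Sum>j = 1..?i + 1. t j (?i + 2 - j))"
    by (simp only: sum.distrib)
  also have "(\<Sum>j = 1..?i + 1. t j 0) = (\<Sum>k\<le>?i. t (k + 1) 0)"
    by (rule sum.reindex_bij_witness[where i = "\<lambda>k. k + 1" and j = "\<lambda>s. s - 1"]) auto
  also have "\<dots> = DX x hs a"
    unfolding DX_def ssum_def
    by (intro sum.cong refl) (auto simp: t_def bar_term_def eX_def zdiv_int min_def intro!: sg_cong)
  \<comment> \<open>The new index k is the length of the prefix that m^A leaves alone; its block has
    \<open>?i - k\<close> entries of the list, and with the element of A its arity is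
    \<open>?i + 1 - k\<close>.\<close>
  also have "(\<Sum>j = 1..?i + 1. t j (?i + 2 - j)) = (\<Sum>k\<le>?i. t (?i + 1 - k) (k + 1))"
    by (rule sum.reindex_bij_witness[where i = "\<lambda>k. ?i + 1 - k" and j = "\<lambda>j. ?i + 1 - j"])
      (auto simp: Suc_diff_le)
  also have "\<dots> = DA x hs a"
    unfolding DA_def ssum_def
  proof (intro sum.cong refl)
    fix k assume "k \<in> {..?i}"
    then have k: "k \<le> ?i" by simp
    then have l: "length (take k hs) = k" "length (drop k hs) = ?i - k" "?i + 1 - k - 1 = ?i - k" by auto
    have 1: "koszul V (int (?i + 1 - k) - 2) = koszul V (int (?i - k) + 1)"
      for V :: "('k, 'v::ab_group_add, 'y) grmod_scheme" using k by (intro koszul_parity) auto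
    have 2: "bar_term A H f X ?i (?i + 1 - k) (k + 1) (x, hs, a) =
        (koszul X (int (?i - k) + 1) x, map (koszul H (int (?i - k) + 1)) (take k hs), left (drop k hs) a)"
      unfolding bar_term_def 1 using k by auto
    show "t (?i + 1 - k) (k + 1) = sg (eA (len (take k hs)) (len (drop k hs)))
        (P (koszul X (len (drop k hs) + 1) x) (map (koszul H (len (drop k hs) + 1)) (take k hs)) (left (drop k hs) a))"
    proof -
      obtain b where b: "?i = k + b" using k le_Suc_ex by blast
      show ?thesis
        unfolding t_def 2 l eA_def sg_sg unfolding b by (simp add: zdiv_int algebra_simps)
    qed
  qed
  also have "(\<Sum>j = 1..?i + 1. \<Sum>b = 1..?i + 1 - j. t j b) = (\<Sum>j = 1..?i. \<Sum>r = 0..?i - j. t j (r + 1))"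
  proof -
    have "(\<Sum>j = 1..?i + 1. \<Sum>b = 1..?i + 1 - j. t j b) = (\<Sum>j = 1..?i. \<Sum>b = 1..?i + 1 - j. t j b)" by simp
    also have "\<dots> = (\<Sum>j = 1..?i. \<Sum>r = 0..?i - j. t j (r + 1))"
      by (intro sum.cong refl sum.reindex_bij_witness[where i = "\<lambda>k. k + 1" and j = "\<lambda>s. s - 1"]) auto
    finally show ?thesis .
  qed
  also have "\<dots> = DH x hs a"
    unfolding sum_triangle_swap DH_def ssum3_take_drop
  proof (intro sum.cong refl)
    fix r s assume "r \<in> {..?i}" "s \<in> {..?i - r}"
    then have l: "length (take r hs) = r" "length (take s (drop r hs)) = s" "take s (drop r hs) = [] \<longleftrightarrow> s = 0"
      "length (drop (r + s) hs) = ?i - s - r" "r + s \<le> ?i" by (auto simp: take_eq_Nil)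
    show "(if s = 0 then 0 else t s (r + 1)) = (if take s (drop r hs) = [] then 0 else
        sg (eH (len (take r hs)) (len (take s (drop r hs))) (len (drop (r + s) hs)))
          (P (koszul X (len (take s (drop r hs))) x) (map (koszul H (len (take s (drop r hs)))) (take r hs) @
             op (take s (drop r hs)) # drop (r + s) hs) a))"
    proof (cases "s = 0")
      case False
      then have 2: "bar_term A H f X ?i s (r + 1) (x, hs, a) = (koszul X (int s) x,
          map (koszul H (int s)) (take r hs) @ op (take s (drop r hs)) # drop (r + s) hs, a)"
        using l by (auto simp: bar_term_def insert_op_def koszul_shift2 op_def)
      have "t s (r + 1) = sg (eH (int r) (int s) (int (?i - s - r)))
          (P (koszul X (int s) x) (map (koszul H (int s)) (take r hs) @ op (take s (drop r hs)) # drop (r + s) hs) a)"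
      proof -
        obtain b where b: "?i = r + s + b" using l(5) le_Suc_ex by blast
        obtain s' where s': "s = Suc s'" using False by (cases s) auto
        have b': "?i - s - r = b" using b by simp
        show ?thesis
          unfolding t_def 2 eH_def sg_sg b' unfolding b s' by (simp add: zdiv_int algebra_simps)
      qed
      then show ?thesis unfolding l using False by simp
    qed (simp add: l)
  qed
  finally show ?thesis by (simp only: add_ac)
qed

end

section \<open>Signs with floors, and rearrangement of iterated splittings\<close>

lemma sg_opposite: "odd (e - e') \<Longrightarrow> sg e v = - sg e' v"
  by (auto simp: sg_def)

text \<open>Halving a sum of two integers produces a carry exactly when both are odd, that is, ab
  modulo 2. All comparisons of bar signs with relation signs reduce to this.\<close>

lemma half_add: "even ((a + b) div 2 - a div 2 - b div 2 - a * b)" for a b :: int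
proof -
  have "(a + b) div 2 = a div 2 + b div 2 + (if odd a \<and> odd b then 1 else 0)" by presburger
  then show ?thesis by simp
qed

text \<open>The four blocks \<open>u1\<close>, \<open>u2\<close>, \<open>v\<close>, \<open>w\<close>
  in two orders. The left side locates \<open>v\<close> first and then cuts what precedes it, as
  happens when a second operation acts in front of the output of the first.\<close>

lemma ssum_slide:
  "ssum (\<lambda>u r. ssum (\<lambda>v w. ssum (\<lambda>u1 u2. K u1 u2 v w) u) r) xs =
   ssum (\<lambda>u1 s. ssum (\<lambda>u2 r. ssum (\<lambda>v w. K u1 u2 v w) r) s) xs"
proof -
  have "ssum (\<lambda>v w. ssum (\<lambda>u1 u2. K u1 u2 v w) u) r = ssum (\<lambda>u1 u2. ssum (\<lambda>v w. K u1 u2 v w) r) u" for u r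
    by (rule ssum_swap)
  then show ?thesis by (simp only: ssum_assoc)
qed

lemma ssum_group_left:
  "ssum (\<lambda>u r. ssum (\<lambda>v s. ssum (\<lambda>w z. K u v w z) s) r) xs =
   ssum (\<lambda>y z. ssum (\<lambda>u r. ssum (\<lambda>v w. K u v w z) r) y) xs"
  by (simp only: ssum_assoc)

text \<open>Five blocks \<open>u1\<close>, \<open>u2\<close>, \<open>v\<close>, \<open>w\<close>,
  \<open>z\<close>. The right side gathers \<open>u2\<close>, \<open>v\<close>, \<open>w\<close>
  into the block \<open>y\<close> that an inner operation on \<open>v\<close> and an outer operation
  around it consume together.\<close>

lemma ssum_group_middle:
  "ssum (\<lambda>u r. ssum (\<lambda>v s. ssum (\<lambda>u1 u2. ssum (\<lambda>w z. K u1 u2 v w z) s) u) r) xs =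
   ssum (\<lambda>u1 r. ssum (\<lambda>y z. ssum (\<lambda>u2 s. ssum (\<lambda>v w. K u1 u2 v w z) s) y) r) xs"
  by (simp only: ssum_slide ssum_group_left)

lemma ssum_slide2:
  "ssum (\<lambda>u r. ssum (\<lambda>v w. ssum (\<lambda>u1 s. ssum (\<lambda>u2 u3. K u1 u2 u3 v w) s) u) r) xs =
   ssum (\<lambda>u1 r. ssum (\<lambda>u2 s. ssum (\<lambda>u3 t. ssum (\<lambda>v w. K u1 u2 u3 v w) t) s) r) xs"
  by (simp only: ssum_slide)

lemma additive_on_sum:
  fixes F :: "'v::ab_group_add \<Rightarrow> 'w::ab_group_add"
  assumes "graded V" and "\<And>x y. x \<in> total V \<Longrightarrow> y \<in> total V \<Longrightarrow> F (x + y) = F x + F y"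
    and "\<And>i. i \<in> I \<Longrightarrow> g i \<in> total V"
  shows "F (sum g I) = (\<Sum>i\<in>I. F (g i))"
proof -
  have 0: "F 0 = 0" using assms(2)[of 0 0] total_0[OF assms(1)] by simp
  show ?thesis
  proof (cases "finite I")
    case True
    then show ?thesis using assms(3)
      by (induction I) (simp_all add: 0 assms(2) total_sum[OF assms(1)])
  qed (simp add: 0)
qed

section \<open>Cancellation of the pairs of insertions\<close>

context kadmod
begin

lemma sg_P: "x \<in> total X \<Longrightarrow> P (sg e x) hs a = sg e (P x hs a)"
  "x \<in> total X \<Longrightarrow> P x (us @ sg e h # vs) a = sg e (P x (us @ h # vs) a)"
  "x \<in> total X \<Longrightarrow> P x hs (sg e a) = sg e (P x hs a)"
  by (simp_all add: pure_sg_left[OF gX] pure_sg_middle pure_sg_right)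

lemma P_ssum_left:
  assumes "\<And>u v. hs = u @ v \<Longrightarrow> F u v \<in> total X"
  shows "P (ssum F hs) ws a = ssum (\<lambda>u v. P (F u v) ws a) hs"
  unfolding ssum_def
  by (rule additive_on_sum[OF gX, of "\<lambda>x. P x ws a"]) (simp_all add: pure_add_left assms)

lemma ssum_total: "(\<And>u v. hs = u @ v \<Longrightarrow> F u v \<in> total X) \<Longrightarrow> ssum F hs \<in> total X"
  unfolding ssum_def by (rule total_sum[OF gX]) simp

lemma koszulX: "x \<in> total X \<Longrightarrow> koszul X e (koszul X e' x) = koszul X (e + e') x"
  by (rule koszul_koszul[OF gX])

lemma P_koszul_act:
  assumes "x \<in> total X" "length v \<le> n"
  shows "P (koszul X e (act_inf X x v)) ws a =
    sg (e * (len v + 1)) (P (act_inf X (koszul X e x) (map (koszul H e) v)) ws a)"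
proof -
  have "P (koszul X e (act_inf X x v)) ws a =
      sg (e * (len v + 1 + -2)) (P (act_inf X (koszul X e x) (map (koszul H e) v)) ws a)"
    using assms by (simp add: act_koszul act_total koszulX_total sg_P)
  then show ?thesis by (simp add: algebra_simps) (auto intro!: sg_cong)
qed

lemma P_koszul_op: "x \<in> total X \<Longrightarrow> P x (us @ koszul H e (op v) # ws) a =
    sg (e * len v) (P x (us @ op (map (koszul H e) v) # ws) a)"
  by (simp add: koszul_op sg_P)

lemma D_word_H:
  assumes hs: "hs = u @ v @ w" "v \<noteq> []"
  shows "length (map (koszul H e) u @ op v # w) \<le> length hs"
  using assms by (cases v) auto

text \<open>In these names X, H, A stand for the operations m^X, m^H, m^A that are composed. Here
  m^X acts on a prefix and m^H on a disjoint later block; both orders occur, and the Koszul sign of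
  m^H passing m^X leaves them with opposite signs.\<close>

lemma D2_XH:
  assumes x: "x \<in> total X" and n: "length hs \<le> n"
  shows "ssum (\<lambda>u r. ssum (\<lambda>v w. if v = [] then 0 else sg (eH (len u) (len v) (len w))
      (ssum (\<lambda>U1 U2. sg (eX (len U1) (len (U2 @ op v # w)))
        (P (act_inf X (koszul X (len v) x) U1) (U2 @ op v # w) a)) (map (koszul H (len v)) u))) r) hs +
    ssum (\<lambda>v w. sg (eX (len v) (len w)) (DH (act_inf X x v) w a)) hs = 0"
proof -
  define K where "K u1 u2 v w = (if v = [] then 0 else
     sg (eX (len u1) (len u2 + len v + len w) + eH (len u2) (len v) (len w))
       (P (koszul X (len v) (act_inf X x u1)) (map (koszul H (len v)) u2 @ op v # w) a))" for u1 u2 v w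
  have "ssum (\<lambda>u r. ssum (\<lambda>v w. if v = [] then 0 else sg (eH (len u) (len v) (len w))
      (ssum (\<lambda>U1 U2. sg (eX (len U1) (len (U2 @ op v # w)))
        (P (act_inf X (koszul X (len v) x) U1) (U2 @ op v # w) a)) (map (koszul H (len v)) u))) r) hs =
    ssum (\<lambda>u r. ssum (\<lambda>v w. ssum (\<lambda>u1 u2. - K u1 u2 v w) u) r) hs"
  proof (intro ssum_cong)
    fix u r v w assume h: "hs = u @ r" "r = v @ w"
    show "(if v = [] then 0 else sg (eH (len u) (len v) (len w))
      (ssum (\<lambda>U1 U2. sg (eX (len U1) (len (U2 @ op v # w)))
        (P (act_inf X (koszul X (len v) x) U1) (U2 @ op v # w) a)) (map (koszul H (len v)) u))) =
      ssum (\<lambda>u1 u2. - K u1 u2 v w) u"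
    proof (cases "v = []")
      case True
      then show ?thesis by (simp add: K_def ssum_0)
    next
      case False
      show ?thesis
        unfolding ssum_map K_def if_not_P[OF False] ssum_sg
      proof (intro ssum_cong)
        fix u1 u2 assume u: "u = u1 @ u2"
        have "length u1 \<le> n" using u h n by simp
        then have k: "P (koszul X (len v) (act_inf X x u1)) ws a =
           sg (len v * (len u1 + 1)) (P (act_inf X (koszul X (len v) x) (map (koszul H (len v)) u1)) ws a)" for ws
          by (rule P_koszul_act[OF x])
        show "sg (eH (len u) (len v) (len w)) (sg (eX (len (map (koszul H (len v)) u1))
            (len (map (koszul H (len v)) u2 @ op v # w)))
            (P (act_inf X (koszul X (len v) x) (map (koszul H (len v)) u1)) (map (koszul H (len v)) u2 @ op v # w) a)) =
          - sg (eX (len u1) (len u2 + len v + len w) + eH (len u2) (len v) (len w))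
            (P (koszul X (len v) (act_inf X x u1)) (map (koszul H (len v)) u2 @ op v # w) a)"
          unfolding k sg_sg u
          by (rule sg_opposite) (auto simp: eX_def eH_def)
      qed
    qed
  qed
  also have "\<dots> = ssum (\<lambda>u1 s. ssum (\<lambda>u2 r. ssum (\<lambda>v w. - K u1 u2 v w) r) s) hs"
    by (rule ssum_slide)
  also have "\<dots> = - ssum (\<lambda>v w. sg (eX (len v) (len w)) (DH (act_inf X x v) w a)) hs"
    unfolding DH_def ssum_sg ssum_uminus[symmetric] K_def
    by (intro ssum_cong) (auto simp: add.assoc)
  finally show ?thesis by simp
qed

lemma koszul_comp: "koszul H e \<circ> koszul H e' = koszul H (e + e')"
  by (auto simp: koszul_koszulH)

text \<open>In a nested composite of two m^H let b, v, w be the lengths of the three parts of the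
  combined block, a and z those of what surrounds it. The two bar signs differ from the sign b + vw
  of \<open>op_relation\<close> by an exponent that depends only on a and on b + v + w.\<close>

lemma eH_eH:
  "even ((b + v + w - 1) div 2 + a * (b + v + w + 1) + (b + v * w) - (eH (a + b) v (w + z) + eH a (b + 1 + w) z))"
proof -
  have 1: "v - 1 + (b + w) = b + v + w - 1" "b + 1 + w - 1 = b + w" by simp_all
  show ?thesis
    unfolding eH_def 1(2) using half_add[of "v - 1" "b + w", unfolded 1(1)] by auto
qed

text \<open>Group the terms by the block \<open>y\<close> that both operations consume together. For
  each \<open>y\<close> they add up to the relation \<open>act_relation\<close> for
  \<open>y\<close>, tensored with the untouched rest.\<close>

lemma D2_XX:
  assumes x: "x \<in> total X" and n: "length hs \<le> n"
  shows "ssum (\<lambda>v r. sg (eX (len v) (len r)) (DX (act_inf X x v) r a)) hs +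
    ssum (\<lambda>u r. ssum (\<lambda>v w. if v = [] then 0 else sg (eH (len u) (len v) (len w))
      (ssum (\<lambda>w1 w2. sg (eX (len (map (koszul H (len v)) u @ op v # w1)) (len w2))
        (P (act_inf X (koszul X (len v) x) (map (koszul H (len v)) u @ op v # w1)) w2 a)) w)) r) hs = 0"
    (is "?S1 + ?S2 = 0")
proof -
  define R1 where "R1 y = ssum (\<lambda>v w. sg ((len v + 1) * len w) (act_inf X (act_inf X x v) w)) y" for y
  define R2 where "R2 y = ssum (\<lambda>u r. ssum (\<lambda>v w. if v = [] then 0 else sg (len u + 1 + len v * len w)
      (act_inf X (koszul X (len v) x) (map (koszul H (len v)) u @ op v # w))) r) y" for y
  \<comment> \<open>The sign left over after the signs of \<open>act_relation\<close> are split off;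
    it depends on \<open>y\<close> alone, so it can be pulled out of the relation.\<close>
  define c where "c y = len y + len y div 2" for y :: "'h list"
  have t1: "act_inf X (act_inf X x v) w \<in> total X" if "length v + length w \<le> n" for v w
    using that x by (intro act_total) auto
  have t2: "act_inf X (koszul X e x) (map (koszul H e') u @ op v # w) \<in> total X"
    if "v \<noteq> []" "length u + length v + length w \<le> n" for u v w e e'
    using that x by (intro act_total koszulX_total) (cases v; auto)+
  have "?S1 = ssum (\<lambda>y w. ssum (\<lambda>v v2. sg (eX (len v) (len v2 + len w)) (sg (eX (len v2) (len w))
      (P (act_inf X (act_inf X x v) v2) w a))) y) hs"
    unfolding DX_def ssum_assoc by (intro ssum_cong) (auto simp: ssum_sg intro!: ssum_cong)
  also have "\<dots> = ssum (\<lambda>y w. sg (c y) (P (R1 y) w a)) hs"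
  proof (intro ssum_cong)
    fix y w assume h: "hs = y @ w"
    have "sg (c y) (P (R1 y) w a) =
        ssum (\<lambda>v v2. sg (c y) (P (sg ((len v + 1) * len v2) (act_inf X (act_inf X x v) v2)) w a)) y"
      unfolding R1_def ssum_sg[symmetric] using h n
      by (subst P_ssum_left) (auto intro!: total_sg[OF gX] t1)
    also have "\<dots> = ssum (\<lambda>v v2. sg (eX (len v) (len v2 + len w)) (sg (eX (len v2) (len w))
      (P (act_inf X (act_inf X x v) v2) w a))) y"
    proof (intro ssum_cong)
      fix v v2 assume y: "y = v @ v2"
      have "act_inf X (act_inf X x v) v2 \<in> total X" using h y n by (intro t1) auto
      then show "sg (c y) (P (sg ((len v + 1) * len v2) (act_inf X (act_inf X x v) v2)) w a) =
          sg (eX (len v) (len v2 + len w)) (sg (eX (len v2) (len w)) (P (act_inf X (act_inf X x v) v2) w a))"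
        unfolding sg_P sg_sg y c_def using half_add[of "len v" "len v2"]
        by (simp add: sg_P) (rule sg_cong, auto simp: eX_def)
    qed
    finally show "ssum (\<lambda>v v2. sg (eX (len v) (len v2 + len w)) (sg (eX (len v2) (len w))
      (P (act_inf X (act_inf X x v) v2) w a))) y = sg (c y) (P (R1 y) w a)" ..
  qed
  finally have S1: "?S1 = ssum (\<lambda>y w. sg (c y) (P (R1 y) w a)) hs" .
  define K where "K u v w1 w2 = (if v = [] then 0 else sg (eH (len u) (len v) (len w1 + len w2))
      (sg (eX (len u + 1 + len w1) (len w2))
        (P (act_inf X (koszul X (len v) x) (map (koszul H (len v)) u @ op v # w1)) w2 a)))" for u v w1 w2
  have "?S2 = ssum (\<lambda>u r. ssum (\<lambda>v w. ssum (\<lambda>w1 w2. K u v w1 w2) w) r) hs"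
    by (intro ssum_cong) (auto simp: K_def ssum_sg ssum_0 add_ac intro!: ssum_cong)
  also have "\<dots> = ssum (\<lambda>y w2. ssum (\<lambda>u r. ssum (\<lambda>v w1. K u v w1 w2) r) y) hs"
    by (rule ssum_group_left)
  also have "\<dots> = ssum (\<lambda>y w. sg (c y) (P (R2 y) w a)) hs"
  proof (intro ssum_cong)
    fix y w2 assume h: "hs = y @ w2"
    have "sg (c y) (P (R2 y) w2 a) =
        ssum (\<lambda>u r. ssum (\<lambda>v w1. sg (c y) (P (if v = [] then 0 else sg (len u + 1 + len v * len w1)
      (act_inf X (koszul X (len v) x) (map (koszul H (len v)) u @ op v # w1))) w2 a)) r) y"
      unfolding R2_def ssum_sg[symmetric] using h n
      by (subst P_ssum_left, force intro!: ssum_total total_0[OF gX] total_sg[OF gX] t2,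
        intro ssum_cong arg_cong[where f = "sg (c y)"],
        subst P_ssum_left, auto intro!: total_0[OF gX] total_sg[OF gX] t2)
    also have "\<dots> = ssum (\<lambda>u r. ssum (\<lambda>v w1. K u v w1 w2) r) y"
    proof (intro ssum_cong)
      fix u r v w1 assume y: "y = u @ r" "r = v @ w1"
      show "sg (c y) (P (if v = [] then 0 else sg (len u + 1 + len v * len w1)
        (act_inf X (koszul X (len v) x) (map (koszul H (len v)) u @ op v # w1))) w2 a) = K u v w1 w2"
      proof (cases "v = []")
        case False
        have "act_inf X (koszul X (len v) x) (map (koszul H (len v)) u @ op v # w1) \<in> total X"
          using h y n False by (intro t2) auto
        then show ?thesis
          unfolding K_def y c_def using half_add[of "len v - 1" "len u + 1 + len w1"] False
          by (simp add: sg_P) (rule sg_cong, auto simp: eX_def eH_def add_ac)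
      qed (simp add: K_def pure_zero_left[OF gX])
    qed
    finally show "ssum (\<lambda>u r. ssum (\<lambda>v w1. K u v w1 w2) r) y = sg (c y) (P (R2 y) w2 a)" ..
  qed
  finally have S2: "?S2 = ssum (\<lambda>y w. sg (c y) (P (R2 y) w a)) hs" .
  have "?S1 + ?S2 = ssum (\<lambda>y w. sg (c y) (P (R1 y + R2 y) w a)) hs"
    unfolding S1 S2 ssum_add[symmetric]
  proof (intro ssum_cong)
    fix y w assume h: "hs = y @ w"
    have "R1 y \<in> total X" "R2 y \<in> total X"
      unfolding R1_def R2_def using h n
      by (force intro!: ssum_total total_0[OF gX] total_sg[OF gX] t1 t2)+
    then show "sg (c y) (P (R1 y) w a) + sg (c y) (P (R2 y) w a) = sg (c y) (P (R1 y + R2 y) w a)"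
      by (simp only: pure_add_left sg_add)
  qed
  also have "\<dots> = ssum (\<lambda>y w. 0) hs"
  proof (intro ssum_cong)
    fix y w assume h: "hs = y @ w"
    have "R1 y + R2 y = 0" unfolding R1_def R2_def by (rule act_relation[OF x]) (use h n in simp)
    then show "sg (c y) (P (R1 y + R2 y) w a) = 0" by (simp add: pure_zero_left[OF gX])
  qed
  finally show ?thesis by (simp add: ssum_0)
qed

text \<open>The prefix used by m^X and the suffix used by m^A are disjoint, so the two orders cancel
  as in \<open>D2_XH\<close>.\<close>

lemma D2_XA:
  assumes x: "x \<in> total X" and n: "length hs \<le> n"
  shows "ssum (\<lambda>v r. sg (eX (len v) (len r)) (DA (act_inf X x v) r a)) hs +
    ssum (\<lambda>u w. sg (eA (len u) (len w)) (DX (koszul X (len w + 1) x) (map (koszul H (len w + 1)) u) (left w a))) hs = 0"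
proof -
  have "ssum (\<lambda>u w. sg (eA (len u) (len w)) (DX (koszul X (len w + 1) x) (map (koszul H (len w + 1)) u) (left w a))) hs =
    ssum (\<lambda>v r. ssum (\<lambda>u w. sg (eA (len v + len u) (len w)) (sg (eX (len v) (len u))
      (P (act_inf X (koszul X (len w + 1) x) (map (koszul H (len w + 1)) v)) (map (koszul H (len w + 1)) u) (left w a)))) r) hs"
    unfolding DX_def ssum_map ssum_sg ssum_assoc[symmetric] by (intro ssum_cong) simp
  also have "\<dots> = ssum (\<lambda>v r. - sg (eX (len v) (len r)) (DA (act_inf X x v) r a)) hs"
    unfolding DA_def ssum_sg ssum_uminus[symmetric]
  proof (intro ssum_cong)
    fix v r u w assume h: "hs = v @ r" "r = u @ w"
    have k: "P (koszul X (len w + 1) (act_inf X x v)) ws b = sg ((len w + 1) * (len v + 1))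
       (P (act_inf X (koszul X (len w + 1) x) (map (koszul H (len w + 1)) v)) ws b)" for ws b
      using h n by (intro P_koszul_act[OF x]) auto
    show "sg (eA (len v + len u) (len w)) (sg (eX (len v) (len u)) (P (act_inf X (koszul X (len w + 1) x)
        (map (koszul H (len w + 1)) v)) (map (koszul H (len w + 1)) u) (left w a))) =
      - sg (eX (len v) (len r)) (sg (eA (len u) (len w)) (P (koszul X (len w + 1) (act_inf X x v))
        (map (koszul H (len w + 1)) u) (left w a)))"
      unfolding k sg_sg h by (rule sg_opposite) (auto simp: eX_def eA_def)
  qed
  finally show ?thesis by (simp add: ssum_uminus)
qed

text \<open>The outer block contains the output of the inner one. Grouped by the combined block, the
  inner sums are instances of \<open>op_relation\<close>.\<close>

lemma D2_HH_nested:
  assumes x: "x \<in> total X"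
  shows "ssum (\<lambda>u r. ssum (\<lambda>v w. if v = [] then 0 else sg (eH (len u) (len v) (len w))
      (ssum (\<lambda>U1 U2. ssum (\<lambda>w1 w2. sg (eH (len U1) (len (U2 @ op v # w1)) (len w2))
        (P (koszul X (len (U2 @ op v # w1)) (koszul X (len v) x))
          (map (koszul H (len (U2 @ op v # w1))) U1 @ op (U2 @ op v # w1) # w2) a)) w) (map (koszul H (len v)) u))) r) hs = 0"
    (is "?S = 0")
proof -
  define R where "R y = ssum (\<lambda>u r. ssum (\<lambda>v w. sg (len u + len v * len w)
     (op (map (koszul H (len v)) u @ op v # w))) r) y" for y
  define c where "c u y = (len y - 1) div 2 + len u * (len y + 1)" for u y :: "'h list"
  define K where "K u1 u2 v w1 w2 = (if v = [] then 0 else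
      sg (eH (len u1 + len u2) (len v) (len w1 + len w2)) (sg (eH (len u1) (len u2 + 1 + len w1) (len w2))
        (P (koszul X (len (u2 @ v @ w1) + 1) x)
          (map (koszul H (len (u2 @ v @ w1) + 1)) u1 @ op (map (koszul H (len v)) u2 @ op v # w1) # w2) a)))"
    for u1 u2 v w1 w2
  have "?S = ssum (\<lambda>u r. ssum (\<lambda>v w. ssum (\<lambda>u1 u2. ssum (\<lambda>w1 w2. K u1 u2 v w1 w2) w) u) r) hs"
    unfolding ssum_map
    by (intro ssum_cong) (auto simp: K_def ssum_sg ssum_0 koszulX x koszul_comp add_ac intro!: ssum_cong)
  also have "\<dots> = ssum (\<lambda>u1 r. ssum (\<lambda>y z. ssum (\<lambda>u2 s. ssum (\<lambda>v w. K u1 u2 v w z) s) y) r) hs"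
    by (rule ssum_group_middle)
  also have "\<dots> = ssum (\<lambda>u1 r. ssum (\<lambda>y w2. sg (c u1 y)
      (P (koszul X (len y + 1) x) (map (koszul H (len y + 1)) u1 @ R y # w2) a)) r) hs"
  proof (intro ssum_cong)
    fix u1 r y w2 :: "'h list"
    have "sg (c u1 y) (P (koszul X (len y + 1) x) (map (koszul H (len y + 1)) u1 @ R y # w2) a) =
      ssum (\<lambda>u2 s. ssum (\<lambda>v w. sg (c u1 y) (P (koszul X (len y + 1) x) (map (koszul H (len y + 1)) u1 @
        sg (len u2 + len v * len w) (op (map (koszul H (len v)) u2 @ op v # w)) # w2) a)) s) y"
      unfolding R_def
      by (simp only: ssum_additive[of "\<lambda>h. P (koszul X (len y + 1) x) (map (koszul H (len y + 1)) u1 @ h # w2) a",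
        OF pure_add_middle[OF koszulX_total[OF x]]] ssum_sg)
    also have "\<dots> = ssum (\<lambda>u2 s. ssum (\<lambda>v w. K u1 u2 v w w2) s) y"
    proof (intro ssum_cong)
      fix u2 s v w assume y: "y = u2 @ s" "s = v @ w"
      show "sg (c u1 y) (P (koszul X (len y + 1) x) (map (koszul H (len y + 1)) u1 @
          sg (len u2 + len v * len w) (op (map (koszul H (len v)) u2 @ op v # w)) # w2) a) = K u1 u2 v w w2"
      proof (cases "v = []")
        case False
        then show ?thesis
          unfolding K_def y c_def sg_P(2)[OF koszulX_total[OF x]] sg_sg
          using eH_eH[of "len u2" "len v" "len w" "len u1" "len w2"]
          by (simp only: if_False) (rule sg_cong, simp add: add_ac)
      qed (simp add: K_def pure_zero_middle koszulX_total x)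
    qed
    finally show "ssum (\<lambda>u2 s. ssum (\<lambda>v w. K u1 u2 v w w2) s) y = sg (c u1 y)
      (P (koszul X (len y + 1) x) (map (koszul H (len y + 1)) u1 @ R y # w2) a)" ..
  qed
  also have "\<dots> = 0"
    by (simp add: R_def op_relation pure_zero_middle koszulX_total x ssum_0)
  finally show ?thesis .
qed

text \<open>The second block lies to the left of the first in one sum and to the right in the other.
  Exchanging the roles of the blocks identifies the sums up to sign, and moving one m^H past the
  other makes the signs opposite.\<close>

lemma D2_HH_disjoint:
  assumes x: "x \<in> total X"
  shows "ssum (\<lambda>u r. ssum (\<lambda>v w. if v = [] then 0 else sg (eH (len u) (len v) (len w))
      (ssum (\<lambda>U1 S. ssum (\<lambda>U2 U3. if U2 = [] then 0 else sg (eH (len U1) (len U2) (len (U3 @ op v # w)))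
        (P (koszul X (len U2) (koszul X (len v) x))
          (map (koszul H (len U2)) U1 @ op U2 # U3 @ op v # w) a)) S) (map (koszul H (len v)) u))) r) hs +
    ssum (\<lambda>u r. ssum (\<lambda>v w. if v = [] then 0 else sg (eH (len u) (len v) (len w))
      (ssum (\<lambda>w1 s. ssum (\<lambda>w2 w3. if w2 = [] then 0 else
        sg (eH (len (map (koszul H (len v)) u @ op v # w1)) (len w2) (len w3))
        (P (koszul X (len w2) (koszul X (len v) x))
          (map (koszul H (len w2)) (map (koszul H (len v)) u @ op v # w1) @ op w2 # w3) a)) s) w)) r) hs = 0"
    (is "?S1 + ?S2 = 0")
proof -
  define K where "K u1 u2 u3 v w = (if v = [] \<or> u2 = [] then 0 else
      sg (eH (len u1 + len u2 + len u3) (len v) (len w) + eH (len u1) (len u2) (len u3 + 1 + len w))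
        (P (koszul X (len (u2 @ v)) x) (map (koszul H (len (u2 @ v))) u1 @
          op (map (koszul H (len v)) u2) # map (koszul H (len v)) u3 @ op v # w) a))" for u1 u2 u3 v w
  have "?S1 = ssum (\<lambda>u r. ssum (\<lambda>v w. ssum (\<lambda>u1 s. ssum (\<lambda>u2 u3. K u1 u2 u3 v w) s) u) r) hs"
    unfolding ssum_map
    by (intro ssum_cong) (auto simp: K_def ssum_sg ssum_0 koszulX x koszul_comp add_ac intro!: ssum_cong)
  also have "\<dots> = ssum (\<lambda>u1 r. ssum (\<lambda>u2 s. ssum (\<lambda>u3 t. ssum (\<lambda>v w. K u1 u2 u3 v w) t) s) r) hs"
    by (rule ssum_slide2)
  also have "\<dots> = - ?S2"
    unfolding ssum_uminus[symmetric]
  proof (intro ssum_cong)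
    fix u1 r u2 s :: "'h list" assume h: "r = u2 @ s"
    show "ssum (\<lambda>u3 t. ssum (\<lambda>v w. K u1 u2 u3 v w) t) s =
      - (if u2 = [] then 0 else sg (eH (len u1) (len u2) (len s))
      (ssum (\<lambda>u3 t. ssum (\<lambda>v w. if v = [] then 0 else
        sg (eH (len (map (koszul H (len u2)) u1 @ op u2 # u3)) (len v) (len w))
        (P (koszul X (len v) (koszul X (len u2) x))
          (map (koszul H (len v)) (map (koszul H (len u2)) u1 @ op u2 # u3) @ op v # w) a)) t) s))"
    proof (cases "u2 = []")
      case False
      have "ssum (\<lambda>u3 t. ssum (\<lambda>v w. K u1 u2 u3 v w) t) s =
        ssum (\<lambda>u3 t. ssum (\<lambda>v w. - sg (eH (len u1) (len u2) (len s)) (if v = [] then 0 else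
        sg (eH (len (map (koszul H (len u2)) u1 @ op u2 # u3)) (len v) (len w))
        (P (koszul X (len v) (koszul X (len u2) x))
          (map (koszul H (len v)) (map (koszul H (len u2)) u1 @ op u2 # u3) @ op v # w) a))) t) s"
      proof (intro ssum_cong)
        fix u3 t v w assume s: "s = u3 @ t" "t = v @ w"
        show "K u1 u2 u3 v w = - sg (eH (len u1) (len u2) (len s)) (if v = [] then 0 else
        sg (eH (len (map (koszul H (len u2)) u1 @ op u2 # u3)) (len v) (len w))
        (P (koszul X (len v) (koszul X (len u2) x))
          (map (koszul H (len v)) (map (koszul H (len u2)) u1 @ op u2 # u3) @ op v # w) a))"
        proof (cases "v = []")
          case False
          with \<open>u2 \<noteq> []\<close> show ?thesis
            unfolding s K_def
            by (simp add: P_koszul_op koszulX koszulX_total x koszul_comp add.commute[of "len v" "len u2"])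
              (rule sg_opposite, auto simp: eH_def)
        qed (simp add: K_def)
      qed
      then show ?thesis using False by (simp add: ssum_uminus ssum_sg)
    qed (simp add: K_def ssum_0)
  qed
  finally show ?thesis by simp
qed

text \<open>An m^A that swallows the output of m^H, together with two successive m^A. Grouped by the
  suffix \<open>y\<close> that both operations consume, the sums add up to
  \<open>left_relation\<close>.\<close>

lemma D2_HA_nested:
  assumes x: "x \<in> total X"
  shows "ssum (\<lambda>u r. ssum (\<lambda>v w. if v = [] then 0 else sg (eH (len u) (len v) (len w))
      (ssum (\<lambda>U1 U2. sg (eA (len U1) (len (U2 @ op v # w)))
        (P (koszul X (len (U2 @ op v # w) + 1) (koszul X (len v) x))
          (map (koszul H (len (U2 @ op v # w) + 1)) U1) (left (U2 @ op v # w) a))) (map (koszul H (len v)) u))) r) hs +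
    ssum (\<lambda>u v. sg (eA (len u) (len v)) (DA (koszul X (len v + 1) x) (map (koszul H (len v + 1)) u) (left v a))) hs = 0"
    (is "?S1 + ?S2 = 0")
proof -
  define R1 where "R1 y = ssum (\<lambda>u r. ssum (\<lambda>v w. sg (len u + len v * (len w + 1))
     (left (map (koszul H (len v)) u @ op v # w) a)) r) y" for y
  define R2 where "R2 y = ssum (\<lambda>u v. sg (len u) (left (map (koszul H (len v + 1)) u) (left v a))) y" for y
  define c where "c u y = len y div 2 + len u * len y" for u y :: "'h list"
  have left0: "left (us @ 0 # vs) a = 0" for us vs by (simp add: left_eq)
  define K where "K u1 u2 v w = (if v = [] then 0 else sg (eH (len u1 + len u2) (len v) (len w))
      (sg (eA (len u1) (len u2 + 1 + len w)) (P (koszul X (len (u2 @ v @ w)) x)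
          (map (koszul H (len (u2 @ v @ w))) u1) (left (map (koszul H (len v)) u2 @ op v # w) a))))" for u1 u2 v w
  have even2: "koszul V (e + 2) = koszul V e" for e and V :: "('k, 'v::ab_group_add, 'y) grmod_scheme"
    by (rule koszul_parity) simp
  have "?S1 = ssum (\<lambda>u r. ssum (\<lambda>v w. ssum (\<lambda>u1 u2. K u1 u2 v w) u) r) hs"
    unfolding ssum_map
  proof (intro ssum_cong)
    fix u r v w
    have e: "len (map (koszul H (len v)) u2 @ op v # w) + 1 + len v = len (u2 @ v @ w) + 2" for u2
      by simp
    show "(if v = [] then 0 else sg (eH (len u) (len v) (len w))
      (ssum (\<lambda>u1 u2. sg (eA (len (map (koszul H (len v)) u1)) (len (map (koszul H (len v)) u2 @ op v # w)))
        (P (koszul X (len (map (koszul H (len v)) u2 @ op v # w) + 1) (koszul X (len v) x))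
          (map (koszul H (len (map (koszul H (len v)) u2 @ op v # w) + 1)) (map (koszul H (len v)) u1))
            (left (map (koszul H (len v)) u2 @ op v # w) a))) u)) = ssum (\<lambda>u1 u2. K u1 u2 v w) u"
      unfolding koszulX[OF x] map_koszul_koszul e even2
      by (auto simp: K_def ssum_sg ssum_0 add_ac intro!: ssum_cong)
  qed
  also have "\<dots> = ssum (\<lambda>u1 s. ssum (\<lambda>u2 r. ssum (\<lambda>v w. K u1 u2 v w) r) s) hs"
    by (rule ssum_slide)
  also have "\<dots> = ssum (\<lambda>u1 y. sg (c u1 y) (P (koszul X (len y) x) (map (koszul H (len y)) u1) (R1 y))) hs"
  proof (intro ssum_cong)
    fix u1 y :: "'h list"
    have "sg (c u1 y) (P (koszul X (len y) x) (map (koszul H (len y)) u1) (R1 y)) =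
      ssum (\<lambda>u r. ssum (\<lambda>v w. sg (c u1 y) (P (koszul X (len y) x) (map (koszul H (len y)) u1)
        (sg (len u + len v * (len w + 1)) (left (map (koszul H (len v)) u @ op v # w) a)))) r) y"
      unfolding R1_def
      by (simp only: ssum_additive[of "P (koszul X (len y) x) (map (koszul H (len y)) u1)",
        OF pure_add_right[OF koszulX_total[OF x]]] ssum_sg)
    also have "\<dots> = ssum (\<lambda>u2 s. ssum (\<lambda>v w. K u1 u2 v w) s) y"
    proof (intro ssum_cong)
      fix u2 s v w assume y: "y = u2 @ s" "s = v @ w"
      show "sg (c u1 y) (P (koszul X (len y) x) (map (koszul H (len y)) u1)
        (sg (len u2 + len v * (len w + 1)) (left (map (koszul H (len v)) u2 @ op v # w) a))) = K u1 u2 v w"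
      proof (cases "v = []")
        case False
        then show ?thesis
          unfolding K_def y c_def sg_P(3)[OF koszulX_total[OF x]] sg_sg using half_add[of "len v - 1" "len u2 + 1 + len w"]
          by (simp only: if_False) (rule sg_cong, auto simp: eH_def eA_def add_ac)
      qed (simp add: K_def pure_zero_right left0 koszulX_total x)
    qed
    finally show "ssum (\<lambda>u2 s. ssum (\<lambda>v w. K u1 u2 v w) s) y =
      sg (c u1 y) (P (koszul X (len y) x) (map (koszul H (len y)) u1) (R1 y))" ..
  qed
  finally have S1: "?S1 = ssum (\<lambda>u1 y. sg (c u1 y) (P (koszul X (len y) x) (map (koszul H (len y)) u1) (R1 y))) hs" .
  have "?S2 = ssum (\<lambda>u1 y. ssum (\<lambda>u2 v. sg (eA (len u1 + len u2) (len v)) (sg (eA (len u1) (len u2))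
      (P (koszul X (len (u2 @ v)) x) (map (koszul H (len (u2 @ v))) u1)
        (left (map (koszul H (len v + 1)) u2) (left v a))))) y) hs"
    unfolding ssum_assoc[symmetric] DA_def ssum_map ssum_sg
  proof (intro ssum_cong)
    fix u v u1 u2 :: "'h list" assume u: "u = u1 @ u2"
    have e: "len (map (koszul H (len v + 1)) u2) + 1 + (len v + 1) = len (u2 @ v) + 2" by simp
    show "sg (eA (len u) (len v)) (sg (eA (len (map (koszul H (len v + 1)) u1)) (len (map (koszul H (len v + 1)) u2)))
       (P (koszul X (len (map (koszul H (len v + 1)) u2) + 1) (koszul X (len v + 1) x))
         (map (koszul H (len (map (koszul H (len v + 1)) u2) + 1)) (map (koszul H (len v + 1)) u1))
         (left (map (koszul H (len v + 1)) u2) (left v a)))) =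
      sg (eA (len u1 + len u2) (len v)) (sg (eA (len u1) (len u2))
      (P (koszul X (len (u2 @ v)) x) (map (koszul H (len (u2 @ v))) u1)
        (left (map (koszul H (len v + 1)) u2) (left v a))))"
      unfolding koszulX[OF x] map_koszul_koszul e even2 by (simp add: u)
  qed
  also have "\<dots> = ssum (\<lambda>u1 y. sg (c u1 y) (P (koszul X (len y) x) (map (koszul H (len y)) u1) (R2 y))) hs"
  proof (intro ssum_cong)
    fix u1 y :: "'h list"
    have "sg (c u1 y) (P (koszul X (len y) x) (map (koszul H (len y)) u1) (R2 y)) =
      ssum (\<lambda>u v. sg (c u1 y) (P (koszul X (len y) x) (map (koszul H (len y)) u1)
        (sg (len u) (left (map (koszul H (len v + 1)) u) (left v a))))) y"
      unfolding R2_def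
      by (simp only: ssum_additive[of "P (koszul X (len y) x) (map (koszul H (len y)) u1)",
        OF pure_add_right[OF koszulX_total[OF x]]] ssum_sg)
    also have "\<dots> = ssum (\<lambda>u2 v. sg (eA (len u1 + len u2) (len v)) (sg (eA (len u1) (len u2))
      (P (koszul X (len (u2 @ v)) x) (map (koszul H (len (u2 @ v))) u1)
        (left (map (koszul H (len v + 1)) u2) (left v a))))) y"
    proof (intro ssum_cong)
      fix u2 v assume y: "y = u2 @ v"
      show "sg (c u1 y) (P (koszul X (len y) x) (map (koszul H (len y)) u1)
        (sg (len u2) (left (map (koszul H (len v + 1)) u2) (left v a)))) =
        sg (eA (len u1 + len u2) (len v)) (sg (eA (len u1) (len u2))
        (P (koszul X (len (u2 @ v)) x) (map (koszul H (len (u2 @ v))) u1)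
          (left (map (koszul H (len v + 1)) u2) (left v a))))"
        unfolding y c_def sg_P(3)[OF koszulX_total[OF x]] sg_sg using half_add[of "len v" "len u2"]
        by (intro sg_cong) (auto simp: eA_def add_ac)
    qed
    finally show "ssum (\<lambda>u2 v. sg (eA (len u1 + len u2) (len v)) (sg (eA (len u1) (len u2))
      (P (koszul X (len (u2 @ v)) x) (map (koszul H (len (u2 @ v))) u1)
        (left (map (koszul H (len v + 1)) u2) (left v a))))) y =
      sg (c u1 y) (P (koszul X (len y) x) (map (koszul H (len y)) u1) (R2 y))" ..
  qed
  finally have S2: "?S2 = ssum (\<lambda>u1 y. sg (c u1 y) (P (koszul X (len y) x) (map (koszul H (len y)) u1) (R2 y))) hs" .
  have "?S1 + ?S2 = ssum (\<lambda>u1 y. sg (c u1 y) (P (koszul X (len y) x) (map (koszul H (len y)) u1) (R1 y + R2 y))) hs"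
    unfolding S1 S2 ssum_add[symmetric] by (simp only: pure_add_right[OF koszulX_total[OF x]] sg_add)
  also have "\<dots> = 0"
    unfolding R1_def R2_def left_relation by (simp add: pure_zero_right koszulX_total x ssum_0)
  finally show ?thesis .
qed

text \<open>The block of m^H ends before the suffix of m^A begins, so both orders occur; the Koszul
  sign is that of m^A moving past the output of m^H.\<close>

lemma D2_HA_disjoint:
  assumes x: "x \<in> total X"
  shows "ssum (\<lambda>u r. ssum (\<lambda>v w. if v = [] then 0 else sg (eH (len u) (len v) (len w))
      (ssum (\<lambda>w1 w2. sg (eA (len (map (koszul H (len v)) u @ op v # w1)) (len w2))
        (P (koszul X (len w2 + 1) (koszul X (len v) x))
          (map (koszul H (len w2 + 1)) (map (koszul H (len v)) u @ op v # w1)) (left w2 a))) w)) r) hs +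
    ssum (\<lambda>u v. sg (eA (len u) (len v)) (DH (koszul X (len v + 1) x) (map (koszul H (len v + 1)) u) (left v a))) hs = 0"
    (is "?S1 + ?S2 = 0")
proof -
  define K where "K u v w1 w2 = (if v = [] then 0 else
      sg (eH (len u) (len v) (len w1) + eA (len u + len v + len w1) (len w2))
        (P (koszul X (len v + len w2 + 1) x) (map (koszul H (len v + len w2 + 1)) u @
          op (map (koszul H (len w2 + 1)) v) # map (koszul H (len w2 + 1)) w1) (left w2 a)))" for u v w1 w2
  have "?S2 = ssum (\<lambda>t w2. ssum (\<lambda>u r. ssum (\<lambda>v w1. K u v w1 w2) r) t) hs"
    unfolding DH_def ssum_map
    by (intro ssum_cong) (auto simp: K_def ssum_sg ssum_0 koszulX x koszul_comp add_ac intro!: ssum_cong)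
  also have "\<dots> = ssum (\<lambda>u r. ssum (\<lambda>v s. ssum (\<lambda>w1 w2. K u v w1 w2) s) r) hs"
    by (rule ssum_group_left[symmetric])
  also have "\<dots> = - ?S1"
    unfolding ssum_uminus[symmetric]
  proof (intro ssum_cong)
    fix u r v w
    show "ssum (\<lambda>w1 w2. K u v w1 w2) w = - (if v = [] then 0 else sg (eH (len u) (len v) (len w))
      (ssum (\<lambda>w1 w2. sg (eA (len (map (koszul H (len v)) u @ op v # w1)) (len w2))
        (P (koszul X (len w2 + 1) (koszul X (len v) x))
          (map (koszul H (len w2 + 1)) (map (koszul H (len v)) u @ op v # w1)) (left w2 a))) w))"
    proof (cases "v = []")
      case False
      have "ssum (\<lambda>w1 w2. K u v w1 w2) w =
        ssum (\<lambda>w1 w2. - sg (eH (len u) (len v) (len w)) (sg (eA (len (map (koszul H (len v)) u @ op v # w1)) (len w2))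
        (P (koszul X (len w2 + 1) (koszul X (len v) x))
          (map (koszul H (len w2 + 1)) (map (koszul H (len v)) u @ op v # w1)) (left w2 a)))) w"
      proof (intro ssum_cong)
        fix w1 w2 assume w: "w = w1 @ w2"
        have e: "len w2 + 1 + len v = len v + len w2 + 1" by simp
        have "P (koszul X (len w2 + 1) (koszul X (len v) x))
          (map (koszul H (len w2 + 1)) (map (koszul H (len v)) u @ op v # w1)) (left w2 a) =
          sg ((len w2 + 1) * len v) (P (koszul X (len v + len w2 + 1) x) (map (koszul H (len v + len w2 + 1)) u @
          op (map (koszul H (len w2 + 1)) v) # map (koszul H (len w2 + 1)) w1) (left w2 a))"
          unfolding map_append list.map koszulX[OF x] map_koszul_koszul e P_koszul_op[OF koszulX_total[OF x]] ..
        then show "K u v w1 w2 = - sg (eH (len u) (len v) (len w)) (sg (eA (len (map (koszul H (len v)) u @ op v # w1)) (len w2))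
        (P (koszul X (len w2 + 1) (koszul X (len v) x))
          (map (koszul H (len w2 + 1)) (map (koszul H (len v)) u @ op v # w1)) (left w2 a)))"
          using False by (simp only: K_def if_False sg_sg w) (rule sg_opposite, auto simp: eH_def eA_def)
      qed
      then show ?thesis using False by (simp add: ssum_uminus ssum_sg)
    qed (simp add: K_def ssum_0)
  qed
  finally show ?thesis by simp
qed

end

\<comment> \<open>Tensors are functionals; the simplifier must not evaluate sums of them pointwise.\<close>
declare plus_fun_apply [simp del] zero_fun_apply [simp del] minus_apply [simp del] uminus_apply [simp del]

text \<open>The letters give the two operations in the order of application. A third letter tells
  whether the second block contains the output of the first (n), lies to its left (l) or right (r),
  or is disjoint from it in the case of m^A (d).\<close>

lemma regroup:
  fixes xx :: "'v::ab_group_add"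
  assumes "xx + hxn = 0" "hxl + xh = 0" "xa + ax = 0" "hhn = 0" "hhl + hhr = 0" "han + aa = 0" "had + ah = 0"
  shows "(xx + xh + xa) + ((hxl + hxn) + (hhl + hhn + hhr) + (han + had)) + (ax + ah + aa) = 0"
proof -
  have "(xx + xh + xa) + ((hxl + hxn) + (hhl + hhn + hhr) + (han + had)) + (ax + ah + aa) =
    (xx + hxn) + (hxl + xh) + (xa + ax) + hhn + (hhl + hhr) + (han + aa) + (had + ah)"
    by (simp only: add_ac)
  then show ?thesis by (simp only: assms add_0)
qed

section \<open>The bar differential squares to zero\<close>

context kadmod
begin

lemma Mop_add: "Mop A H f X i j (t + t') = Mop A H f X i j t + Mop A H f X i j t'"
  by (simp add: Mop_def push_add sg_add sum.distrib)

lemma Mop_scale: "Mop A H f X i j (tscale c t) = tscale c (Mop A H f X i j t)"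
  by (simp add: Mop_def push_scale T.scale_sum_right tscale_sg)

lemma Mop_0: "Mop A H f X i j 0 = 0"
  using Mop_add[of i j 0 0] by simp

lemma D_add: "mdiff (bar_complex A H f X p) (t + t') =
    mdiff (bar_complex A H f X p) t + mdiff (bar_complex A H f X p) t'"
  by (simp add: bar_complex_def Mop_add sg_add sum.distrib)

lemma D_scale: "mdiff (bar_complex A H f X p) (tscale c t) = tscale c (mdiff (bar_complex A H f X p) t)"
  by (simp add: bar_complex_def Mop_scale T.scale_sum_right tscale_sg T.scale_right_distrib)

lemma DX_middle: "DX x (U @ h # w) a =
    ssum (\<lambda>U1 U2. sg (eX (len U1) (len (U2 @ h # w))) (P (act_inf X x U1) (U2 @ h # w) a)) U +
    ssum (\<lambda>w1 w2. sg (eX (len (U @ h # w1)) (len w2)) (P (act_inf X x (U @ h # w1)) w2 a)) w"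
  by (simp only: DX_def ssum_middle)

lemma DH_middle: "DH x (U @ h # w) a =
    ssum (\<lambda>U1 S. ssum (\<lambda>U2 U3. if U2 = [] then 0 else sg (eH (len U1) (len U2) (len (U3 @ h # w)))
        (P (koszul X (len U2) x) (map (koszul H (len U2)) U1 @ op U2 # U3 @ h # w) a)) S) U +
    ssum (\<lambda>U1 U2. ssum (\<lambda>w1 w2. sg (eH (len U1) (len (U2 @ h # w1)) (len w2))
        (P (koszul X (len (U2 @ h # w1)) x)
          (map (koszul H (len (U2 @ h # w1))) U1 @ op (U2 @ h # w1) # w2) a)) w) U +
    ssum (\<lambda>w1 s. ssum (\<lambda>w2 w3. if w2 = [] then 0 else sg (eH (len (U @ h # w1)) (len w2) (len w3))
        (P (koszul X (len w2) x) (map (koszul H (len w2)) (U @ h # w1) @ op w2 # w3) a)) s) w"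
  by (simp add: DH_def ssum_middle ssum_add)

lemma DA_middle: "DA x (U @ h # w) a =
    ssum (\<lambda>U1 U2. sg (eA (len U1) (len (U2 @ h # w)))
        (P (koszul X (len (U2 @ h # w) + 1) x) (map (koszul H (len (U2 @ h # w) + 1)) U1) (left (U2 @ h # w) a))) U +
    ssum (\<lambda>w1 w2. sg (eA (len (U @ h # w1)) (len w2))
        (P (koszul X (len w2 + 1) x) (map (koszul H (len w2 + 1)) (U @ h # w1)) (left w2 a))) w"
  by (simp only: DA_def ssum_middle)

lemma D2_pure:
  assumes x: "x \<in> total X" and hs: "length hs \<le> p" and p: "p \<le> n"
  shows "mdiff (bar_complex A H f X p) (mdiff (bar_complex A H f X p) (P x hs a)) = 0"
proof -
  define D where "D = mdiff (bar_complex A H f X p)"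
  have D: "D (P y ks b) = DX y ks b + DH y ks b + DA y ks b" if "y \<in> total X" "length ks \<le> p" for y ks b
    unfolding D_def using that p by (rule D_pure)
  have Dadd: "D (s + t) = D s + D t" for s t unfolding D_def by (rule D_add)
  have Dsg: "D (sg e t) = sg e (D t)" for e t by (rule additive_sg[of D]) (rule Dadd)
  have D0: "D 0 = 0" using Dadd[of 0 0] by simp
  note Dssum = ssum_additive[of D, OF Dadd]
  have if_add: "(if b then 0 else s + t) = (if b then 0 else s) + (if b then 0 else t)" for b and s t :: "('k, 'x, 'h, 'a) tens"
    by simp
  have n: "length hs \<le> n" using hs p by simp
  have 1: "D (DX x hs a) = ssum (\<lambda>v w. sg (eX (len v) (len w)) (DX (act_inf X x v) w a)) hs +
      ssum (\<lambda>v w. sg (eX (len v) (len w)) (DH (act_inf X x v) w a)) hs +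
      ssum (\<lambda>v w. sg (eX (len v) (len w)) (DA (act_inf X x v) w a)) hs"
    unfolding DX_def[of x hs] Dssum Dsg ssum_add[symmetric] sg_add[symmetric]
    using x hs n by (intro ssum_cong arg_cong[where f = "sg _"] D act_total) auto
  have "D (DH x hs a) = ssum (\<lambda>u r. ssum (\<lambda>v w. if v = [] then 0 else sg (eH (len u) (len v) (len w))
     (DX (koszul X (len v) x) (map (koszul H (len v)) u @ op v # w) a +
      DH (koszul X (len v) x) (map (koszul H (len v)) u @ op v # w) a +
      DA (koszul X (len v) x) (map (koszul H (len v)) u @ op v # w) a)) r) hs"
    unfolding DH_def[of x hs] Dssum
  proof (intro ssum_cong)
    fix u r v w assume h: "hs = u @ r" "r = v @ w"
    show "D (if v = [] then 0 else sg (eH (len u) (len v) (len w))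
        (P (koszul X (len v) x) (map (koszul H (len v)) u @ op v # w) a)) =
      (if v = [] then 0 else sg (eH (len u) (len v) (len w))
     (DX (koszul X (len v) x) (map (koszul H (len v)) u @ op v # w) a +
      DH (koszul X (len v) x) (map (koszul H (len v)) u @ op v # w) a +
      DA (koszul X (len v) x) (map (koszul H (len v)) u @ op v # w) a))"
    proof (cases "v = []")
      case False
      have "length (map (koszul H (len v)) u @ op v # w) \<le> length hs"
        by (rule D_word_H[OF _ False]) (simp add: h)
      then have "length (map (koszul H (len v)) u @ op v # w) \<le> p" using hs by simp
      then show ?thesis using False by (simp only: if_False Dsg D[OF koszulX_total[OF x]])
    qed (simp add: D0)
  qed
  \<comment> \<open>Cutting at the inserted entry \<open>op v\<close> separates the nested second
    operations from the disjoint ones.\<close>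
  note 2 = this[unfolded DX_middle DH_middle DA_middle sg_add if_add ssum_add]
  have 3: "D (DA x hs a) = ssum (\<lambda>u v. sg (eA (len u) (len v)) (DX (koszul X (len v + 1) x) (map (koszul H (len v + 1)) u) (left v a))) hs +
      ssum (\<lambda>u v. sg (eA (len u) (len v)) (DH (koszul X (len v + 1) x) (map (koszul H (len v + 1)) u) (left v a))) hs +
      ssum (\<lambda>u v. sg (eA (len u) (len v)) (DA (koszul X (len v + 1) x) (map (koszul H (len v + 1)) u) (left v a))) hs"
    unfolding DA_def[of x hs] Dssum Dsg ssum_add[symmetric] sg_add[symmetric]
    using x hs n by (intro ssum_cong arg_cong[where f = "sg _"] D koszulX_total) auto
  have "D (D (P x hs a)) = D (DX x hs a) + D (DH x hs a) + D (DA x hs a)"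
    by (simp only: D[OF x hs] Dadd)
  also have "\<dots> = 0"
    unfolding 1 2 3
    by (rule regroup[OF D2_XX[OF x n] D2_XH[OF x n] D2_XA[OF x n] D2_HH_nested[OF x]
        D2_HH_disjoint[OF x] D2_HA_nested[OF x] D2_HA_disjoint[OF x]])
  finally show ?thesis by (simp only: D_def)
qed

end

section \<open>The differential graded modules of the bar construction\<close>

lemma blkI:
  assumes "x \<in> deg X p" "length hs \<in> I" "homogeneous H ds hs" "a \<in> deg A q"
    "p + sum_list ds + q + int (length hs) + c = n"
  shows "pure_tensor X H A (x, hs, a) \<in> blk X H A I c n"
  unfolding blk_def using assms
  by (intro T.span_base CollectI exI[of _ x] exI[of _ hs] exI[of _ a] exI[of _ p] exI[of _ ds] exI[of _ q]) simp

lemma subspace_blk: "module.subspace tscale (blk X H A I c n)"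
  unfolding blk_def by (rule T.subspace_span)

lemma blk_sg: "t \<in> blk X H A I c n \<Longrightarrow> sg e t \<in> blk X H A I c n"
  by (rule subspace_sg[OF vector_space_tscale subspace_blk])

lemma blk_ssum:
  assumes "\<And>u v. xs = u @ v \<Longrightarrow> F u v \<in> blk X H A I c n"
  shows "ssum F xs \<in> blk X H A I c n"
  unfolding ssum_def using assms by (intro T.subspace_sum[OF subspace_blk]) simp

lemma blk_induct:
  assumes t: "t \<in> blk X H A I c n"
    and "\<And>x hs a p ds q. x \<in> deg X p \<Longrightarrow> length hs \<in> I \<Longrightarrow> homogeneous H ds hs \<Longrightarrow> a \<in> deg A q \<Longrightarrow>
      p + sum_list ds + q + int (length hs) + c = n \<Longrightarrow> pure_tensor X H A (x, hs, a) \<in> W"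
    and W: "module.subspace tscale W"
  shows "t \<in> W"
proof -
  have "blk X H A I c n \<subseteq> W"
    unfolding blk_def using assms(2) by (intro T.span_minimal W) auto
  then show ?thesis using t by auto
qed

section \<open>Shifts of DG modules\<close>

lemma shift_simps [simp]:
  "scale (shift i M) = scale M" "deg (shift i M) = (\<lambda>p. deg M (p + i))"
  "mdiff (shift i M) = (\<lambda>x. sg i (mdiff M x))" "act (shift i M) = act M"
  by (simp_all add: shift_def)

lemma graded_total_shift:
  assumes g: "graded M"
  shows "graded (shift i M)" "total (shift i M) = total M"
proof -
  have dec: "decomposes (shift i M) x c \<Longrightarrow> decomposes M x (\<lambda>n. c (n - i))" for x c
  proof -
    assume d: "decomposes (shift i M) x c"
    have 1: "{n. c (n - i) \<noteq> 0} = (\<lambda>n. n + i) ` {n. c n \<noteq> 0}"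
      by (force simp: image_iff)
    have "(\<Sum>n | c (n - i) \<noteq> 0. c (n - i)) = (\<Sum>n | c n \<noteq> 0. c n)"
      unfolding 1 by (subst sum.reindex) auto
    then show ?thesis using d unfolding decomposes_def 1[symmetric]
      by (metis (no_types, lifting) "1" diff_add_cancel finite_imageI shift_simps(2))
  qed
  show gs: "graded (shift i M)"
    unfolding graded_def
  proof (intro conjI allI impI)
    show "vector_space (scale (shift i M))" using graded_vs[OF g] by simp
    show "module.subspace (scale (shift i M)) (deg (shift i M) n)" for n
      using graded_subspace[OF g] by simp
    fix c m assume "decomposes (shift i M) 0 c"
    then have "decomposes M 0 (\<lambda>n. c (n - i))" by (rule dec)
    then have "\<forall>n. c (n - i) = 0" using g unfolding graded_def by blast
    from this[rule_format, of "m + i"] show "c m = 0" by simp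
  qed
  have "(\<Union>n. deg M (n + i)) = (\<Union>n. deg M n)"
    by (auto, metis diff_add_cancel)
  then show "total (shift i M) = total M"
    unfolding total_span[OF gs] total_span[OF g] by simp
qed

lemma dg_module_shift:
  assumes M: "dg_module A M"
  shows "dg_module A (shift i M)"
proof -
  note M' = M[unfolded dg_module_def]
  have g: "graded M" using M' by blast
  interpret vector_space "scale M" by (rule graded_vs) (rule g)
  note t = graded_total_shift[OF g, of i]
  have dt: "mdiff M x \<in> total M" if "x \<in> total M" for x
    using g that
  proof (induction rule: total_induct)
    case (deg n x)
    then show ?case using M' deg_total[OF g] unfolding graded_map_def by blast
  next
    case (add x y)
    then show ?case using M' total_add[OF g] unfolding graded_map_def linear_on_def by metis
  qed
  have lin: "linear_on M M (mdiff M)" using M' unfolding graded_map_def by blast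
  have dadd: "mdiff M (x + y) = mdiff M x + mdiff M y" if "x \<in> total M" "y \<in> total M" for x y
    using lin that unfolding linear_on_def by blast
  have dsc: "mdiff M (scale M c x) = scale M c (mdiff M x)" if "x \<in> total M" for c x
    using lin that unfolding linear_on_def by blast
  have dsg: "mdiff M (sg i x) = sg i (mdiff M x)" if "x \<in> total M" for x
    using dsc[OF that, of "-1"] by (simp add: sg_def)
  have asg: "act M (sg i x) a = sg i (act M x a)" if "x \<in> total M" for x a
  proof -
    have "linear_on M M (\<lambda>x. act M x a)" using M' by blast
    then have "act M (scale M (-1) x) a = scale M (-1) (act M x a)"
      using that unfolding linear_on_def by blast
    then show ?thesis by (simp add: sg_def)
  qed
  show ?thesis
    unfolding dg_module_def
  proof (intro conjI)
    show "graded_map (- 1) (shift i M) (shift i M) (mdiff (shift i M))"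
      unfolding graded_map_def linear_on_def t
    proof (intro conjI ballI allI)
      fix p x assume "x \<in> deg (shift i M) p"
      then have "mdiff M x \<in> deg M (p + i + -1)" using M' unfolding graded_map_def by simp
      then show "mdiff (shift i M) x \<in> deg (shift i M) (p + - 1)"
        using deg_sg[OF g] by (simp add: algebra_simps)
    qed (simp_all add: dadd dsc sg_add, simp add: sg_def)
    show "\<forall>x\<in>total (shift i M). mdiff (shift i M) (mdiff (shift i M) x) = 0"
      using M' unfolding t by (simp add: dsg dt)
    show "\<forall>p. \<forall>x\<in>deg (shift i M) p. \<forall>a. mdiff (shift i M) (act (shift i M) x a) =
        act (shift i M) (mdiff (shift i M) x) a + sg p (act (shift i M) x (diff A a))"
    proof (intro allI ballI)
      fix p x a assume x: "x \<in> deg (shift i M) p"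
      then have "mdiff M (act M x a) = act M (mdiff M x) a + sg (p + i) (act M x (diff A a))"
        using M' by simp
      moreover have "act M (sg i (mdiff M x)) a = sg i (act M (mdiff M x) a)"
        using x deg_total[OF g] by (intro asg dt) auto
      \<comment> \<open>An element of degree p in \<open>M[i]\<close> has degree p + i in M, and the
        differential carries (-1)^i: the two occurrences of i cancel in the Leibniz sign.\<close>
      moreover have "sg (i + (p + i)) (act M x (diff A a)) = sg p (act M x (diff A a))" by (rule sg_cong) simp
      ultimately show "mdiff (shift i M) (act (shift i M) x a) =
        act (shift i M) (mdiff (shift i M) x) a + sg p (act (shift i M) x (diff A a))"
        by (simp add: sg_add)
    qed
    show "\<forall>a. linear_on (shift i M) (shift i M) (\<lambda>x. act (shift i M) x a)"
      "\<forall>x\<in>total (shift i M). linear_on A (shift i M) (act (shift i M) x)"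
      using M' unfolding t linear_on_def by simp_all
    show "\<forall>p q. \<forall>x\<in>deg (shift i M) p. \<forall>a\<in>deg A q. act (shift i M) x a \<in> deg (shift i M) (p + q)"
    proof (intro allI ballI)
      fix p q x a assume "x \<in> deg (shift i M) p" "a \<in> deg A q"
      then have "act M x a \<in> deg M (p + i + q)" using M' by simp
      then show "act (shift i M) x a \<in> deg (shift i M) (p + q)" by (simp add: algebra_simps)
    qed
  qed (use M' t in auto)
qed

section \<open>DG modules spanned by pure tensors\<close>

context kad
begin

text \<open>All tensor modules over X carry restrictions of this one map of the ambient space, so
  inclusions and projections between them can be compared without changing the action.\<close>

definition ract :: "('k, 'x::ab_group_add, 'y) grmod_scheme \<Rightarrow> ('k, 'x, 'h, 'a) tens \<Rightarrow> 'a \<Rightarrow> ('k, 'x, 'h, 'a) tens" where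
  "ract X t b = push X H A UNIV (\<lambda>(x, hs, a). (x, hs, mult A a b)) t"

lemma ract_pure: "ract X (pure_tensor X H A (x, hs, a)) b = pure_tensor X H A (x, hs, mult A a b)"
  unfolding ract_def by (simp add: push_pure[OF multilinear_op_act])

lemma ract_add: "ract X (s + t) b = ract X s b + ract X t b"
  and ract_scale: "ract X (tscale c t) b = tscale c (ract X t b)"
  unfolding ract_def by (rule push_add, rule push_scale)

lemma ract_sg: "ract X (sg e t) b = sg e (ract X t b)"
  by (rule additive_sg[of "\<lambda>t. ract X t b"]) (rule ract_add)

lemma blk_total_induct [consumes 4, case_names pure add scale]:
  fixes X :: "('k, 'x::ab_group_add, 'y) grmod_scheme"
    and M :: "('k, ('k, 'x, 'h, 'a) tens, 'm) grmod_scheme"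
  assumes gX: "graded X" and M: "scale M = tscale" "deg M = blk X H A I c" and t: "t \<in> total M"
    and pure: "\<And>x hs a. x \<in> total X \<Longrightarrow> length hs \<in> I \<Longrightarrow> Q (pure_tensor X H A (x, hs, a))"
    and add: "\<And>s t. s \<in> total M \<Longrightarrow> t \<in> total M \<Longrightarrow> Q s \<Longrightarrow> Q t \<Longrightarrow> Q (s + t)"
    and scale: "\<And>c t. t \<in> total M \<Longrightarrow> Q t \<Longrightarrow> Q (tscale c t)"
    and 0: "Q 0"
  shows "Q t"
proof -
  let ?G = "{pure_tensor X H A (x, hs, a) | x (hs :: 'h list) (a :: 'a). x \<in> total X \<and> length hs \<in> I}"
  have tot: "total M = T.span ?G" by (rule total_blk[OF gX gH tH gA tA M])
  have "t \<in> T.span ?G" using t tot by simp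
  then have "t \<in> total M \<and> Q t"
  proof (induction rule: T.span_induct_alt)
    case base
    then show ?case using 0 unfolding tot by (simp add: T.span_zero)
  next
    case (step c s t)
    then have "s \<in> total M" "Q s" using pure unfolding tot by (auto intro: T.span_base)
    then have "tscale c s \<in> total M" "Q (tscale c s)" using scale unfolding tot by (auto intro: T.span_scale)
    then show ?case using step add unfolding tot by (auto intro: T.span_add)
  qed
  then show ?thesis ..
qed

lemma pure_total:
  fixes X :: "('k, 'x::ab_group_add, 'y) grmod_scheme"
    and M :: "('k, ('k, 'x, 'h, 'a) tens, 'm) grmod_scheme"
  assumes gX: "graded X" and M: "scale M = tscale" "deg M = blk X H A I c"
    and "x \<in> total X" "length hs \<in> I"
  shows "pure_tensor X H A (x, hs, a) \<in> total M"
  unfolding total_blk[OF gX gH tH gA tA M] using assms(4,5) by (intro T.span_base) blast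

text \<open>The laws of the action alone come from A. What concerns the differential has to be
  checked only on pure tensors, since both sides of each law are linear on the ambient
  space.\<close>

lemma dg_module_blkI:
  fixes X :: "('k, 'x::ab_group_add, 'y) grmod_scheme"
    and M :: "('k, 'a, ('k, 'x, 'h, 'a) tens) dgmod"
  assumes gX: "graded X" and M: "scale M = tscale" "deg M = blk X H A I c" "act M = ract X"
    and dadd: "\<And>s t. mdiff M (s + t) = mdiff M s + mdiff M t"
    and dscale: "\<And>r t. mdiff M (tscale r t) = tscale r (mdiff M t)"
    and ddeg: "\<And>x hs a p ds q. x \<in> deg X p \<Longrightarrow> length hs \<in> I \<Longrightarrow> homogeneous H ds hs \<Longrightarrow> a \<in> deg A q \<Longrightarrow>
       mdiff M (pure_tensor X H A (x, hs, a)) \<in> blk X H A I c (p + sum_list ds + q + int (length hs) + c - 1)"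
    and dd: "\<And>x hs a. x \<in> total X \<Longrightarrow> length hs \<in> I \<Longrightarrow> mdiff M (mdiff M (pure_tensor X H A (x, hs, a))) = 0"
    and leib: "\<And>x hs a p ds q b. x \<in> deg X p \<Longrightarrow> length hs \<in> I \<Longrightarrow> homogeneous H ds hs \<Longrightarrow> a \<in> deg A q \<Longrightarrow>
       mdiff M (pure_tensor X H A (x, hs, mult A a b)) = ract X (mdiff M (pure_tensor X H A (x, hs, a))) b +
         sg (p + sum_list ds + q + int (length hs) + c) (pure_tensor X H A (x, hs, mult A a (diff A b)))"
  shows "dg_module A M"
proof -
  note gM = graded_blk[OF gX gH tH gA tA M(1,2)]
  note ind = blk_total_induct[OF gX M(1,2)]
  have d0: "mdiff M 0 = 0" using dadd[of 0 0] by simp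
  have r0: "ract X 0 b = 0" for b using ract_add[of X 0 0 b] by simp
  have d_blk: "mdiff M t \<in> blk X H A I c (p - 1)" if "t \<in> blk X H A I c p" for t p
  proof -
    have "t \<in> {t. mdiff M t \<in> blk X H A I c (p - 1)}"
      using that
    proof (rule blk_induct)
      show "T.subspace {t. mdiff M t \<in> blk X H A I c (p - 1)}"
        using T.subspace_add[OF subspace_blk] T.subspace_scale[OF subspace_blk] T.subspace_0[OF subspace_blk]
        by (auto intro!: T.subspaceI simp: d0 dadd dscale)
      show "pure_tensor X H A (x, hs, a) \<in> {t. mdiff M t \<in> blk X H A I c (p - 1)}"
        if "x \<in> deg X p'" "length hs \<in> I" "homogeneous H ds hs" "a \<in> deg A q"
          "p' + sum_list ds + q + int (length hs) + c = p" for x hs a p' ds q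
        using ddeg[OF that(1-4)] that(5) by simp
    qed
    then show ?thesis by simp
  qed
  show ?thesis
    unfolding dg_module_def M(3)
  proof (intro conjI)
    show "graded M" by fact
    show "graded_map (- 1) M M (mdiff M)"
      unfolding graded_map_def linear_on_def M(1,2) using d_blk by (auto simp: dadd dscale)
    show "\<forall>x\<in>total M. mdiff M (mdiff M x) = 0"
    proof
      fix t assume "t \<in> total M"
      then show "mdiff M (mdiff M t) = 0"
        by (rule ind) (auto simp: dd d0 dadd dscale)
    qed
    show "\<forall>a. linear_on M M (\<lambda>x. ract X x a)"
      unfolding linear_on_def M(1) by (simp add: ract_add ract_scale)
    show "\<forall>x\<in>total M. linear_on A M (ract X x)"
    proof
      fix t assume "t \<in> total M"
      then show "linear_on A M (ract X t)"
        unfolding linear_on_def M(1)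
        by (rule ind) (auto simp: ract_pure mult_add_right mult_scale_right pure_add_right pure_scale_right
            ract_add ract_scale r0 T.scale_right_distrib algebra_simps T.scale_scale mult.commute)
    qed
    show "\<forall>p q. \<forall>x\<in>deg M p. \<forall>a\<in>deg A q. ract X x a \<in> deg M (p + q)"
    proof (intro allI ballI)
      fix p q t b assume t: "t \<in> deg M p" and b: "b \<in> deg A q"
      have "t \<in> {t. ract X t b \<in> blk X H A I c (p + q)}"
        using t[unfolded M(2)]
      proof (rule blk_induct)
        show "T.subspace {t. ract X t b \<in> blk X H A I c (p + q)}"
          using T.subspace_add[OF subspace_blk] T.subspace_scale[OF subspace_blk] T.subspace_0[OF subspace_blk]
          by (auto intro!: T.subspaceI simp: r0 ract_add ract_scale)
        show "pure_tensor X H A (x, hs, a) \<in> {t. ract X t b \<in> blk X H A I c (p + q)}"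
          if "x \<in> deg X p'" "length hs \<in> I" "homogeneous H ds hs" "a \<in> deg A q'"
            "p' + sum_list ds + q' + int (length hs) + c = p" for x hs a p' ds q'
          using blkI[OF that(1-3) mult_deg[OF that(4) b], of c "p + q"] that(5) by (simp add: ract_pure)
      qed
      then show "ract X t b \<in> deg M (p + q)" by (simp add: M(2))
    qed
    show "\<forall>x\<in>total M. \<forall>a b. ract X (ract X x a) b = ract X x (mult A a b)"
    proof
      fix t assume "t \<in> total M"
      then show "\<forall>a b. ract X (ract X t a) b = ract X t (mult A a b)"
        by (rule ind) (auto simp: ract_pure mult_assoc ract_add ract_scale r0)
    qed
    show "\<forall>x\<in>total M. ract X x (unit A) = x"
    proof
      fix t assume "t \<in> total M"
      then show "ract X t (unit A) = t"
        by (rule ind) (auto simp: ract_pure unit_right ract_add ract_scale r0)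
    qed
    show "\<forall>p. \<forall>x\<in>deg M p. \<forall>a. mdiff M (ract X x a) = ract X (mdiff M x) a + sg p (ract X x (diff A a))"
    proof (intro allI ballI)
      fix p t b assume t: "t \<in> deg M p"
      have "t \<in> {t. mdiff M (ract X t b) = ract X (mdiff M t) b + sg p (ract X t (diff A b))}"
        using t[unfolded M(2)]
      proof (rule blk_induct)
        have "tscale r (sg e s) = sg e (tscale r s)" for r e and s :: "('k, 'x, 'h, 'a) tens"
          by (rule additive_sg[of "tscale r"]) (rule T.scale_right_distrib)
        then show "T.subspace {t. mdiff M (ract X t b) = ract X (mdiff M t) b + sg p (ract X t (diff A b))}"
          by (auto intro!: T.subspaceI simp: r0 d0 ract_add ract_scale dadd dscale sg_add T.scale_right_distrib
              ) 
        show "pure_tensor X H A (x, hs, a) \<in> {t. mdiff M (ract X t b) = ract X (mdiff M t) b + sg p (ract X t (diff A b))}"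
          if "x \<in> deg X p'" "length hs \<in> I" "homogeneous H ds hs" "a \<in> deg A q'"
            "p' + sum_list ds + q' + int (length hs) + c = p" for x hs a p' ds q'
          using leib[OF that(1-4), of b] that(5) by (simp add: ract_pure)
      qed
      then show "mdiff M (ract X t b) = ract X (mdiff M t) b + sg p (ract X t (diff A b))" by simp
    qed
  qed
qed

lemma left_deg: "homogeneous H ds v \<Longrightarrow> a \<in> deg A q \<Longrightarrow> left v a \<in> deg A (sum_list ds + q + int (length v) - 1)"
proof (cases "v = []")
  case True
  assume "homogeneous H ds v" "a \<in> deg A q"
  then show ?thesis using True diff_deg by (simp add: left_op_def homogeneous_def)
next
  case False
  assume "homogeneous H ds v" "a \<in> deg A q"
  then have "mult A (fn v) a \<in> deg A (sum_list ds + int (length v) - 1 + q)"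
    by (intro mult_deg fn_deg)
  then show ?thesis using False deg_sg[OF gA] by (simp add: left_op_def fn_def algebra_simps)
qed

lemma koszul_homogeneous: "homogeneous H ds v \<Longrightarrow> homogeneous H ds (map (koszul H e) v)"
  by (auto simp: homogeneous_def list_all2_conv_all_nth koszul_in_deg[OF gH])

lemma pure_koszul:
  fixes X :: "('k, 'x::ab_group_add, 'y) grmod_scheme"
  assumes gX: "graded X" and x: "x \<in> deg X p" and hs: "homogeneous H ds hs"
  shows "pure_tensor X H A (koszul X e x, map (koszul H e) hs, a) =
    sg (e * (p + sum_list ds)) (pure_tensor X H A (x, hs, a))"
proof -
  note t = deg_total[OF gX x]
  have "pure_tensor X H A (x, us @ map (koszul H e) hs, a) = sg (e * sum_list ds) (pure_tensor X H A (x, us @ hs, a))" for us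
    using hs
  proof (induction hs arbitrary: ds us)
    case Nil
    then show ?case by (simp add: homogeneous_def)
  next
    case (Cons h hs)
    then obtain d ds' where ds: "ds = d # ds'" "h \<in> deg H d" "homogeneous H ds' hs"
      by (auto simp: homogeneous_def list_all2_Cons2)
    then have "pure_tensor X H A (x, us @ map (koszul H e) (h # hs), a) =
        sg (e * d) (pure_tensor X H A (x, (us @ [h]) @ map (koszul H e) hs, a))"
      by (simp add: koszul_deg[OF gH] pure_sg_middle[OF t])
    then show ?case using Cons.IH[OF ds(3), of "us @ [h]"] ds(1) by (simp add: algebra_simps)
  qed
  from this[of "[]"] show ?thesis
    by (simp add: koszul_deg[OF gX x] pure_sg_left[OF gX t] algebra_simps)
qed

end

section \<open>The modules \<open>R_i\<close> and \<open>B_p\<close>\<close>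

context kadmod
begin

lemma Robj_simps [simp]:
  "scale (Robj A H f X i) = tscale" "mdiff (Robj A H f X i) = Mop A H f X i 1" "act (Robj A H f X i) = ract X"
  by (auto simp: Robj_def ract_def fun_eq_iff)

lemma Robj_deg: "deg (Robj A H f X i) = blk X H A {i} (- int i)"
proof
  fix m
  have "{pure_tensor X H A (x, hs, a) | x hs a p ds q.
        x \<in> deg X p \<and> length hs = i \<and> homogeneous H ds hs \<and> a \<in> deg A q \<and> p + sum_list ds + q = m} =
    {pure_tensor X H A (x, hs, a) | x hs a p ds q. x \<in> deg X p \<and> length hs \<in> {i} \<and> homogeneous H ds hs \<and> a \<in> deg A q \<and>
     p + sum_list ds + q + int (length hs) + - int i = m}"
    by (intro Collect_cong) fastforce
  then show "deg (Robj A H f X i) m = blk X H A {i} (- int i) m"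
    by (simp add: Robj_def blk_def)
qed

lemma bar_simps [simp]:
  "scale (bar_complex A H f X p) = tscale" "act (bar_complex A H f X p) = ract X"
  by (auto simp: bar_complex_def ract_def fun_eq_iff)

lemma bar_deg: "deg (bar_complex A H f X p) = blk X H A {..p} 0"
proof
  fix m
  let ?S = "{\<Sum>l\<le>p. t l | t. \<forall>l\<le>p. t l \<in> blk X H A {l} (- int l) (m + - int l)}"
  note c = T.subspace_add[OF subspace_blk] T.subspace_scale[OF subspace_blk] T.subspace_0[OF subspace_blk]
  have "deg (bar_complex A H f X p) m = ?S"
    by (simp add: bar_complex_def Robj_deg)
  also have "\<dots> = blk X H A {..p} 0 m"
  proof (rule antisym)
    have "t \<in> blk X H A {..p} 0 m" if "t \<in> blk X H A {l} (- int l) (m + - int l)" "l \<le> p" for t l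
      using that(1)
    proof (rule blk_induct)
      show "pure_tensor X H A (x, hs, a) \<in> blk X H A {..p} 0 m"
        if "x \<in> deg X p'" "length hs \<in> {l}" "homogeneous H ds hs" "a \<in> deg A q"
          "p' + sum_list ds + q + int (length hs) + - int l = m + - int l" for x hs a p' ds q
        using that \<open>l \<le> p\<close> by (intro blkI[of x X p' hs _ H ds a A q]) auto
    qed (rule subspace_blk)
    then show "?S \<subseteq> blk X H A {..p} 0 m" by (auto intro!: T.subspace_sum[OF subspace_blk])
    show "blk X H A {..p} 0 m \<subseteq> ?S"
    proof
      fix t assume "t \<in> blk X H A {..p} 0 m"
      then show "t \<in> ?S"
      proof (rule blk_induct)
        show "T.subspace ?S"
        proof (rule T.subspaceI)
          show "0 \<in> ?S" by (intro CollectI exI[of _ "\<lambda>_. 0"]) (simp add: T.subspace_0[OF subspace_blk])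
          show "s + t \<in> ?S" if st: "s \<in> ?S" "t \<in> ?S" for s t
          proof -
            obtain s' t' where "s = (\<Sum>l\<le>p. s' l)" "\<forall>l\<le>p. s' l \<in> blk X H A {l} (- int l) (m + - int l)"
              "t = (\<Sum>l\<le>p. t' l)" "\<forall>l\<le>p. t' l \<in> blk X H A {l} (- int l) (m + - int l)" using st by blast
            then show ?thesis
              by (intro CollectI exI[of _ "\<lambda>l. s' l + t' l"]) (auto simp: sum.distrib c)
          qed
          show "tscale r s \<in> ?S" if st: "s \<in> ?S" for r s
          proof -
            obtain s' where "s = (\<Sum>l\<le>p. s' l)" "\<forall>l\<le>p. s' l \<in> blk X H A {l} (- int l) (m + - int l)"
              using st by blast
            then show ?thesis
              by (intro CollectI exI[of _ "\<lambda>l. tscale r (s' l)"]) (auto simp: T.scale_sum_right c)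
          qed
        qed
        fix x hs a p' ds q
        assume *: "x \<in> deg X p'" "length hs \<in> {..p}" "homogeneous H ds hs" "a \<in> deg A q"
          "p' + sum_list ds + q + int (length hs) + 0 = m"
        let ?t = "\<lambda>l. if l = length hs then P x hs a else 0"
        have "\<forall>l\<le>p. ?t l \<in> blk X H A {l} (- int l) (m + - int l)"
          using * c(3) by (auto intro!: blkI[of x X p' hs _ H ds a A q])
        moreover have "P x hs a = (\<Sum>l\<le>p. ?t l)" using * by (subst sum.delta) auto
        ultimately show "P x hs a \<in> ?S" by (intro CollectI exI[of _ ?t]) simp
      qed
    qed
  qed
  finally show "deg (bar_complex A H f X p) m = blk X H A {..p} 0 m" .
qed

lemma dg_module_Robj:
  assumes i: "i \<le> n"
  shows "dg_module A (Robj A H f X i)"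
proof (rule dg_module_blkI[OF gX, of _ "{i}" "- int i"])
  note M = Mop1_pure[OF i, simplified]
  show "mdiff (Robj A H f X i) (s + t) = mdiff (Robj A H f X i) s + mdiff (Robj A H f X i) t" for s t
    by (simp add: Mop_add)
  show "mdiff (Robj A H f X i) (tscale r t) = tscale r (mdiff (Robj A H f X i) t)" for r t
    by (simp add: Mop_scale)
  show "mdiff (Robj A H f X i) (P x hs a) \<in> blk X H A {i} (- int i) (p + sum_list ds + q + int (length hs) + - int i - 1)"
    if "x \<in> deg X p" "length hs \<in> {i}" "homogeneous H ds hs" "a \<in> deg A q" for x hs a p ds q
    using that deg_total[OF gX that(1)]
    by (simp add: M pure_koszul[OF gX that(1,3)])
      (intro blk_sg blkI[OF that(1) _ that(3) diff_deg[OF that(4)]], auto)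
  show "mdiff (Robj A H f X i) (mdiff (Robj A H f X i) (P x hs a)) = 0"
    if "x \<in> total X" "length hs \<in> {i}" for x hs a
    using that by (simp add: M koszulX_total diff_diff pure_zero_right)
  show "mdiff (Robj A H f X i) (P x hs (mult A a b)) = ract X (mdiff (Robj A H f X i) (P x hs a)) b +
         sg (p + sum_list ds + q + int (length hs) + - int i) (P x hs (mult A a (diff A b)))"
    if "x \<in> deg X p" "length hs \<in> {i}" "homogeneous H ds hs" "a \<in> deg A q" for x hs a p ds q b
  proof -
    note t = deg_total[OF gX that(1)]
    have "mdiff (Robj A H f X i) (P x hs (mult A a b)) = P (koszul X 1 x) (map (koszul H 1) hs) (mult A (diff A a) b) +
        P (koszul X 1 x) (map (koszul H 1) hs) (sg q (mult A a (diff A b)))"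
      using that(2) by (simp add: M t leibniz_deg[OF that(4)] pure_add_right koszulX_total)
    also have "P (koszul X 1 x) (map (koszul H 1) hs) (sg q (mult A a (diff A b))) =
        sg (p + sum_list ds + q) (P x hs (mult A a (diff A b)))"
      by (simp add: pure_koszul[OF gX that(1,3)] sg_P(3)[OF t])
    finally show ?thesis using that(2) t by (simp add: M ract_pure)
  qed
qed (simp_all add: Robj_deg)

lemma D_deg:
  assumes p: "p \<le> n" and t: "x \<in> deg X p'" "length hs \<le> p" "homogeneous H ds hs" "a \<in> deg A q"
  shows "mdiff (bar_complex A H f X p) (P x hs a) \<in> blk X H A {..p} 0 (p' + sum_list ds + q + int (length hs) - 1)"
proof -
  let ?B = "blk X H A {..p} 0 (p' + sum_list ds + q + int (length hs) - 1)"
  have n: "length hs \<le> n" using p t by simp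
  have "DX x hs a \<in> ?B"
    unfolding DX_def
  proof (intro blk_ssum blk_sg)
    fix v w assume h: "hs = v @ w"
    then obtain d1 d2 where d: "ds = d1 @ d2" "homogeneous H d1 v" "homogeneous H d2 w"
      using t(3) homogeneous_append by blast
    have "act_inf X x v \<in> deg X (p' + sum_list d1 + (int (length v) + 1) + - 2)"
      using h n by (intro act_deg t d) simp
    then have a: "act_inf X x v \<in> deg X (p' + sum_list d1 + int (length v) - 1)" by (simp add: algebra_simps)
    then show "P (act_inf X x v) w a \<in> ?B"
      using t h by (intro blkI[OF a _ d(3) t(4)]) (auto simp: d(1))
  qed
  moreover have "DH x hs a \<in> ?B"
    unfolding DH_def
  proof (intro blk_ssum)
    fix u r v w assume h: "hs = u @ r" "r = v @ w"
    then obtain d1 d2 d3 where d: "ds = d1 @ d2 @ d3" "homogeneous H d1 u" "homogeneous H d2 v" "homogeneous H d3 w"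
      using t(3) homogeneous_append by metis
    have hom: "homogeneous H (d1 @ (sum_list d2 + int (length v) - 2) # d3) (map (koszul H (len v)) u @ op v # w)"
      using koszul_homogeneous[OF d(2)] op_deg[OF d(3)] d(4)
      by (auto simp: homogeneous_def intro!: list_all2_appendI)
    show "(if v = [] then 0 else sg (eH (len u) (len v) (len w))
        (P (koszul X (len v) x) (map (koszul H (len v)) u @ op v # w) a)) \<in> ?B"
    proof (cases "v = []")
      case False
      then have l: "length v \<ge> 1" by (cases v) auto
      have "P (koszul X (len v) x) (map (koszul H (len v)) u @ op v # w) a \<in> ?B"
        using t(2) h l by (intro blkI[OF koszul_in_deg[OF gX t(1)] _ hom t(4)]) (auto simp: d(1))
      then show ?thesis using False by (simp add: blk_sg)
    qed (simp add: T.subspace_0[OF subspace_blk])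
  qed
  moreover have "DA x hs a \<in> ?B"
    unfolding DA_def
  proof (intro blk_ssum blk_sg)
    fix u v assume h: "hs = u @ v"
    then obtain d1 d2 where d: "ds = d1 @ d2" "homogeneous H d1 u" "homogeneous H d2 v"
      using t(3) homogeneous_append by blast
    show "P (koszul X (len v + 1) x) (map (koszul H (len v + 1)) u) (left v a) \<in> ?B"
      using t h by (intro blkI[OF koszul_in_deg[OF gX t(1)] _ koszul_homogeneous[OF d(2)] left_deg[OF d(3) t(4)]])
        (auto simp: d(1))
  qed
  ultimately show ?thesis
    unfolding D_pure[OF deg_total[OF gX t(1)] t(2) p] by (intro T.subspace_add[OF subspace_blk])
qed

text \<open>Only the term of \<open>DA\<close> with an empty block differentiates the last slot; all
  others are A-linear. In that term the exponent \<open>eA\<close> is the length of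
  \<open>hs\<close>, and the Koszul sign supplies the degrees of x and \<open>hs\<close>.\<close>

lemma D_leibniz:
  assumes p: "p \<le> n" and t: "x \<in> deg X p'" "length hs \<le> p" "homogeneous H ds hs" "a \<in> deg A q"
  shows "mdiff (bar_complex A H f X p) (P x hs (mult A a b)) =
     ract X (mdiff (bar_complex A H f X p) (P x hs a)) b +
     sg (p' + sum_list ds + q + int (length hs)) (P x hs (mult A a (diff A b)))"
proof -
  note x = deg_total[OF gX t(1)]
  note rs = ssum_additive[of "\<lambda>t. ract X t b", OF ract_add]
  have r0: "ract X 0 b = 0" using ract_add[of X 0 0 b] by simp
  have 1: "DX x hs (mult A a b) = ract X (DX x hs a) b"
    unfolding DX_def rs ract_sg ract_pure ..
  have 2: "DH x hs (mult A a b) = ract X (DH x hs a) b"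
    unfolding DH_def rs by (intro ssum_cong) (simp add: ract_sg ract_pure r0)
  have "DA x hs (mult A a b) = ssum (\<lambda>u v. ract X (sg (eA (len u) (len v))
     (P (koszul X (len v + 1) x) (map (koszul H (len v + 1)) u) (left v a))) b +
     (if v = [] then sg (eA (len u) (len v) + q) (P (koszul X (len v + 1) x) (map (koszul H (len v + 1)) u) (mult A a (diff A b))) else 0)) hs"
    unfolding DA_def
  proof (intro ssum_cong)
    fix u v assume "hs = u @ v"
    have l: "left v (mult A a b) = mult A (left v a) b + (if v = [] then sg q (mult A a (diff A b)) else 0)"
      by (simp add: left_op_def leibniz_deg[OF t(4)] mult_sg_left mult_assoc)
    show "sg (eA (len u) (len v)) (P (koszul X (len v + 1) x) (map (koszul H (len v + 1)) u) (left v (mult A a b))) =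
      ract X (sg (eA (len u) (len v)) (P (koszul X (len v + 1) x) (map (koszul H (len v + 1)) u) (left v a))) b +
      (if v = [] then sg (eA (len u) (len v) + q) (P (koszul X (len v + 1) x) (map (koszul H (len v + 1)) u) (mult A a (diff A b))) else 0)"
      unfolding l pure_add_right[OF koszulX_total[OF x]] sg_add ract_sg ract_pure
      by (simp add: sg_P(3) koszulX_total x pure_zero_right)
  qed
  also have "\<dots> = ract X (DA x hs a) b + sg (eA (len hs) 0 + q) (P (koszul X 1 x) (map (koszul H 1) hs) (mult A a (diff A b)))"
    unfolding ssum_add ssum_if_right DA_def rs by simp
  also have "P (koszul X 1 x) (map (koszul H 1) hs) (mult A a (diff A b)) = sg (p' + sum_list ds) (P x hs (mult A a (diff A b)))"
    by (simp add: pure_koszul[OF gX t(1,3)])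
  also have "sg (eA (len hs) 0 + q) (sg (p' + sum_list ds) (P x hs (mult A a (diff A b)))) =
      sg (p' + sum_list ds + q + int (length hs)) (P x hs (mult A a (diff A b)))"
    by (auto simp: eA_def intro!: sg_cong)
  finally show ?thesis
    unfolding D_pure[OF x t(2) p] by (simp only: 1 2 ract_add add.assoc)
qed

lemma dg_module_bar:
  assumes p: "p \<le> n"
  shows "dg_module A (bar_complex A H f X p)"
proof (rule dg_module_blkI[OF gX, of _ "{..p}" 0])
  show "mdiff (bar_complex A H f X p) (P x hs a) \<in> blk X H A {..p} 0 (p' + sum_list ds + q + int (length hs) + 0 - 1)"
    if "x \<in> deg X p'" "length hs \<in> {..p}" "homogeneous H ds hs" "a \<in> deg A q" for x hs a p' ds q
    using D_deg[OF p that(1) _ that(3,4)] that(2) by simp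
  show "mdiff (bar_complex A H f X p) (mdiff (bar_complex A H f X p) (P x hs a)) = 0"
    if "x \<in> total X" "length hs \<in> {..p}" for x hs a
    using D2_pure[OF that(1) _ p] that(2) by simp
  show "mdiff (bar_complex A H f X p) (P x hs (mult A a b)) = ract X (mdiff (bar_complex A H f X p) (P x hs a)) b +
         sg (p' + sum_list ds + q + int (length hs) + 0) (P x hs (mult A a (diff A b)))"
    if "x \<in> deg X p'" "length hs \<in> {..p}" "homogeneous H ds hs" "a \<in> deg A q" for x hs a p' ds q b
    using D_leibniz[OF p that(1) _ that(3,4)] that(2) by simp
qed (simp_all add: bar_deg D_add D_scale)

end

section \<open>Maps that are linear on the whole ambient space\<close>

definition tlin :: "(('k::field, 'x, 'h, 'a) tens \<Rightarrow> ('k, 'x, 'h, 'a) tens) \<Rightarrow> bool" where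
  "tlin F \<longleftrightarrow> (\<forall>s t. F (s + t) = F s + F t) \<and> (\<forall>c t. F (tscale c t) = tscale c (F t))"

lemma tlinI: "(\<And>s t. F (s + t) = F s + F t) \<Longrightarrow> (\<And>c t. F (tscale c t) = tscale c (F t)) \<Longrightarrow> tlin F"
  by (simp add: tlin_def)

lemma tlin_add: "tlin F \<Longrightarrow> F (s + t) = F s + F t"
  and tlin_scale: "tlin F \<Longrightarrow> F (tscale c t) = tscale c (F t)"
  by (simp_all add: tlin_def)

lemma tlin_0: "tlin F \<Longrightarrow> F 0 = 0"
  using tlin_add[of F 0 0] by simp

lemma tlin_sg: "tlin F \<Longrightarrow> F (sg e t) = sg e (F t)"
  using additive_sg[of F] tlin_add[of F] by blast

lemma tlin_sum: "tlin F \<Longrightarrow> F (sum g I) = (\<Sum>i\<in>I. F (g i))"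
  using additive_sum[of F] tlin_add[of F] by blast

lemma tlin_ssum: "tlin F \<Longrightarrow> F (ssum g xs) = ssum (\<lambda>u v. F (g u v)) xs"
  using ssum_additive[of F] tlin_add[of F] by blast

lemma tlin_diff: "tlin F \<Longrightarrow> F (s - t) = F s - F t"
  using tlin_add[of F "s - t" t] by simp

lemma tlin_push: "tlin (push X H A S F)"
  by (rule tlinI) (simp_all add: push_add push_scale)

lemma tlin_id: "tlin (\<lambda>t. t)" by (rule tlinI) simp_all
lemma tlin_comp: "tlin F \<Longrightarrow> tlin G \<Longrightarrow> tlin (\<lambda>t. F (G t))" by (rule tlinI) (simp_all add: tlin_add tlin_scale)
lemma tlin_sgI: "tlin F \<Longrightarrow> tlin (\<lambda>t. sg e (F t))"
  by (rule tlinI) (simp_all add: tlin_add tlin_scale sg_add tscale_sg)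
lemma tlin_addI: "tlin F \<Longrightarrow> tlin G \<Longrightarrow> tlin (\<lambda>t. F t + G t)"
  by (rule tlinI) (simp_all add: tlin_add tlin_scale T.scale_right_distrib)
lemma tlin_diffI: "tlin F \<Longrightarrow> tlin G \<Longrightarrow> tlin (\<lambda>t. F t - G t)"
  by (rule tlinI) (simp_all add: tlin_add tlin_scale T.scale_right_diff_distrib)
lemma tlin_sumI: "(\<And>i. tlin (F i)) \<Longrightarrow> tlin (\<lambda>t. \<Sum>i\<in>I. F i t)"
  by (rule tlinI) (simp_all add: tlin_add tlin_scale sum.distrib T.scale_sum_right)

lemma blk_shift: "m - c = m' - c' \<Longrightarrow> blk X H A I c m = blk X H A I c' m'"
proof -
  assume "m - c = m' - c'"
  then have "(s + c = m) = (s + c' = m')" for s :: int by auto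
  then show ?thesis unfolding blk_def by simp
qed

context kad
begin

lemma tlin_ract: "tlin (\<lambda>t. ract X t b)"
  by (rule tlinI) (simp_all add: ract_add ract_scale)

lemma blk_hom_induct [consumes 4, case_names pure add scale zero]:
  fixes X :: "('k, 'x::ab_group_add, 'y) grmod_scheme"
    and M :: "('k, ('k, 'x, 'h, 'a) tens, 'm) grmod_scheme"
  assumes gX: "graded X" and M: "scale M = tscale" "deg M = blk X H A I c" and t: "t \<in> total M"
    and pure: "\<And>x hs a p ds q. x \<in> deg X p \<Longrightarrow> length hs \<in> I \<Longrightarrow> homogeneous H ds hs \<Longrightarrow> a \<in> deg A q \<Longrightarrow>
      Q (pure_tensor X H A (x, hs, a))"
    and add: "\<And>s t. Q s \<Longrightarrow> Q t \<Longrightarrow> Q (s + t)"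
    and scale: "\<And>c t. Q t \<Longrightarrow> Q (tscale c t)"
    and 0: "Q 0"
  shows "Q t"
proof -
  note g = graded_blk[OF gX gH tH gA tA M]
  have sub: "T.subspace {t. Q t}" using add scale 0 by (auto intro!: T.subspaceI)
  show ?thesis using g t
  proof (induction rule: total_induct)
    case (deg m t)
    then have "t \<in> {t. Q t}" unfolding M(2) by (rule blk_induct) (use pure sub in auto)
    then show ?case by simp
  qed (rule add)
qed

text \<open>As both maps are linear on the whole ambient space, composites can be compared on pure
  tensors before it is known into which modules they map.\<close>

lemma tlin_eqI:
  fixes X :: "('k, 'x::ab_group_add, 'y) grmod_scheme"
    and M :: "('k, ('k, 'x, 'h, 'a) tens, 'm) grmod_scheme"
  assumes gX: "graded X" and M: "scale M = tscale" "deg M = blk X H A I c" and t: "t \<in> total M"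
    and F: "tlin F" "tlin G"
    and pure: "\<And>x hs a p ds q. x \<in> deg X p \<Longrightarrow> length hs \<in> I \<Longrightarrow> homogeneous H ds hs \<Longrightarrow> a \<in> deg A q \<Longrightarrow>
      F (pure_tensor X H A (x, hs, a)) = G (pure_tensor X H A (x, hs, a))"
  shows "F t = G t"
  by (rule blk_hom_induct[OF gX M t, of "\<lambda>t. F t = G t"])
    (auto simp: pure tlin_add[OF F(1)] tlin_add[OF F(2)] tlin_scale[OF F(1)] tlin_scale[OF F(2)]
      tlin_0[OF F(1)] tlin_0[OF F(2)])

lemma graded_map_blkI:
  fixes X :: "('k, 'x::ab_group_add, 'y) grmod_scheme" and X' :: "('k, 'x, 'y2) grmod_scheme"
    and M :: "('k, ('k, 'x, 'h, 'a) tens, 'm) grmod_scheme" and N :: "('k, ('k, 'x, 'h, 'a) tens, 'm2) grmod_scheme"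
  assumes M: "scale M = tscale" "deg M = blk X H A I c"
    and N: "scale N = tscale" "deg N = blk X' H A I' c'" and F: "tlin F"
    and deg: "\<And>x hs a p ds q. x \<in> deg X p \<Longrightarrow> length hs \<in> I \<Longrightarrow> homogeneous H ds hs \<Longrightarrow> a \<in> deg A q \<Longrightarrow>
      F (pure_tensor X H A (x, hs, a)) \<in> blk X' H A I' c' (p + sum_list ds + q + int (length hs) + c + e)"
  shows "graded_map e M N F"
  unfolding graded_map_def linear_on_def
proof (intro conjI allI ballI)
  fix m t assume "t \<in> deg M m"
  then have "t \<in> blk X H A I c m" by (simp add: M)
  then have "t \<in> {t. F t \<in> blk X' H A I' c' (m + e)}"
  proof (rule blk_induct)
    show "T.subspace {t. F t \<in> blk X' H A I' c' (m + e)}"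
      using T.subspace_add[OF subspace_blk] T.subspace_scale[OF subspace_blk] T.subspace_0[OF subspace_blk]
      by (auto intro!: T.subspaceI simp: tlin_0[OF F] tlin_add[OF F] tlin_scale[OF F])
    show "pure_tensor X H A (x, hs, a) \<in> {t. F t \<in> blk X' H A I' c' (m + e)}"
      if "x \<in> deg X p" "length hs \<in> I" "homogeneous H ds hs" "a \<in> deg A q"
        "p + sum_list ds + q + int (length hs) + c = m" for x hs a p ds q
      using deg[OF that(1-4)] that(5) by simp
  qed
  then show "F t \<in> deg N (m + e)" by (simp add: N)
qed (simp_all add: M N tlin_add[OF F] tlin_scale[OF F])

lemma act_linear_blkI:
  fixes X :: "('k, 'x::ab_group_add, 'y) grmod_scheme" and X' :: "('k, 'x, 'y2) grmod_scheme"
    and M N :: "('k, 'a, ('k, 'x, 'h, 'a) tens) dgmod"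
  assumes gX: "graded X" and M: "scale M = tscale" "deg M = blk X H A I c" "act M = ract X"
    and N: "act N = ract X'" and F: "tlin F"
    and act: "\<And>x hs a p ds q b. x \<in> deg X p \<Longrightarrow> length hs \<in> I \<Longrightarrow> homogeneous H ds hs \<Longrightarrow> a \<in> deg A q \<Longrightarrow>
      F (pure_tensor X H A (x, hs, mult A a b)) = ract X' (F (pure_tensor X H A (x, hs, a))) b"
  shows "act_linear M N F"
  unfolding act_linear_def M(3) N
proof (intro ballI allI)
  fix t b assume t: "t \<in> total M"
  show "F (ract X t b) = ract X' (F t) b"
    by (rule tlin_eqI[OF gX M(1,2) t tlin_comp[OF F tlin_ract] tlin_comp[OF tlin_ract F]])
      (simp add: ract_pure act)
qed

lemma dg_map_blkI:
  fixes X :: "('k, 'x::ab_group_add, 'y) grmod_scheme" and X' :: "('k, 'x, 'y2) grmod_scheme"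
    and M N :: "('k, 'a, ('k, 'x, 'h, 'a) tens) dgmod"
  assumes gX: "graded X" and M: "scale M = tscale" "deg M = blk X H A I c" "act M = ract X"
    and N: "scale N = tscale" "deg N = blk X' H A I' c'" "act N = ract X'" and F: "tlin F"
    and d: "tlin (mdiff M)" "tlin (mdiff N)"
    and deg: "\<And>x hs a p ds q. x \<in> deg X p \<Longrightarrow> length hs \<in> I \<Longrightarrow> homogeneous H ds hs \<Longrightarrow> a \<in> deg A q \<Longrightarrow>
      F (pure_tensor X H A (x, hs, a)) \<in> blk X' H A I' c' (p + sum_list ds + q + int (length hs) + c)"
    and act: "\<And>x hs a p ds q b. x \<in> deg X p \<Longrightarrow> length hs \<in> I \<Longrightarrow> homogeneous H ds hs \<Longrightarrow> a \<in> deg A q \<Longrightarrow>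
      F (pure_tensor X H A (x, hs, mult A a b)) = ract X' (F (pure_tensor X H A (x, hs, a))) b"
    and chain: "\<And>x hs a p ds q. x \<in> deg X p \<Longrightarrow> length hs \<in> I \<Longrightarrow> homogeneous H ds hs \<Longrightarrow> a \<in> deg A q \<Longrightarrow>
      F (mdiff M (pure_tensor X H A (x, hs, a))) = mdiff N (F (pure_tensor X H A (x, hs, a)))"
  shows "dg_map M N F"
  unfolding dg_map_def
proof (intro conjI ballI)
  show "graded_map 0 M N F" by (rule graded_map_blkI[OF M(1,2) N(1,2) F]) (simp add: deg)
  show "act_linear M N F" by (rule act_linear_blkI[OF gX M N(3) F]) (rule act)
  fix t assume t: "t \<in> total M"
  show "F (mdiff M t) = mdiff N (F t)"
    by (rule tlin_eqI[OF gX M(1,2) t tlin_comp[OF F d(1)] tlin_comp[OF d(2) F]]) (rule chain)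
qed

end

section \<open>The maps \<pi> and i of the bar construction\<close>

context kadmod
begin

abbreviation R where "R l \<equiv> Robj A H f X l"
abbreviation B where "B p \<equiv> bar_complex A H f X p"
abbreviation Y where "Y l \<equiv> shift (int l) (B l)"

text \<open>\<pi>_l and, in the next line, i_l, as maps of the whole ambient space.\<close>

definition proj where "proj l = push X H A {l} (\<lambda>\<tau>. \<tau>)"
definition imp where "imp l t = (\<Sum>j = 2..l + 1. sg (int ((j - 1) div 2)) (Mop A H f X l j t))"

lemma tlin_Mop: "tlin (Mop A H f X i j)"
  by (rule tlinI) (simp_all add: Mop_add Mop_scale)

lemma tlin_D: "tlin (mdiff (B p))"
  by (rule tlinI) (simp_all add: D_add D_scale)

lemma tlin_proj: "tlin (proj l)"
  unfolding proj_def by (rule tlin_push)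

lemma tlin_imp: "tlin (imp l)"
  unfolding imp_def by (intro tlin_sumI tlin_sgI tlin_Mop)

lemma tlin_dR: "tlin (mdiff (R i))" by (simp add: tlin_Mop)
lemma tlin_dY: "tlin (mdiff (Y i))" by (simp add: tlin_sgI tlin_D)

lemma Y_deg: "deg (Y l) = blk X H A {..l} (- int l)"
proof
  fix m
  have "blk X H A {..l} 0 (m + int l) = blk X H A {..l} (- int l) m"
    by (rule blk_shift) simp
  then show "deg (Y l) m = blk X H A {..l} (- int l) m" by (simp add: bar_deg)
qed

lemma dg_module_Y: "l \<le> n \<Longrightarrow> dg_module A (Y l)"
  by (intro dg_module_shift dg_module_bar)

lemma Y_simps: "scale (Y l) = tscale" "act (Y l) = ract X" "scale (R l) = tscale" "act (R l) = ract X"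
  by simp_all

lemma proj_pure: "proj l (P x hs a) = (if length hs = l then P x hs a else 0)"
  unfolding proj_def by (subst push_pure[OF multilinear_op_id]) simp

text \<open>An operation of arity j shortens the tensor by j - 1 entries, whichever slots it acts
  on.\<close>

lemma Mop_pure_length:
  assumes "1 \<le> j" "j \<le> i + 1" "i \<le> n" "length hs = i"
  shows "proj k (Mop A H f X i j (P x hs a)) = (if k = i + 1 - j then Mop A H f X i j (P x hs a) else 0)"
proof -
  have 1: "\<exists>y ks b'. bar_term A H f X i j b (x, hs, a) = (y, ks, b') \<and> length ks = i + 1 - j" if "b \<le> i + 2 - j" for b
    using that assms by (auto simp: bar_term_def insert_op_def)
  have "proj k (pure_tensor X H A (bar_term A H f X i j b (x, hs, a))) =
      (if k = i + 1 - j then pure_tensor X H A (bar_term A H f X i j b (x, hs, a)) else 0)" if "b \<le> i + 2 - j" for b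
    using 1[OF that] by (auto simp: proj_pure)
  then show ?thesis
    using assms by (simp add: Mop_pure tlin_sum[OF tlin_proj] tlin_sg[OF tlin_proj])
qed

text \<open>The formula for the differential does not mention p. Together with the fact that it
  never lengthens a list this makes \<open>B_k\<close> a subcomplex of \<open>B_p\<close> for k at
  most p.\<close>

lemma D_length:
  assumes p: "p \<le> n" and x: "x \<in> total X" and l: "length hs \<le> p"
  shows "mdiff (B p) (P x hs a) = mdiff (B (length hs)) (P x hs a)"
proof -
  have "length hs \<le> n" using p l by simp
  then show ?thesis using D_pure[OF x l p] D_pure[OF x order_refl] by simp
qed

text \<open>All summands on \<open>R_l\<close> share the factor (-1)^l. It is the sign that the
  shift in \<open>Y_l = B_l[l]\<close> introduces, so that in \<open>Y_l\<close> the differential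
  becomes the sum of the two terms in parentheses.\<close>

lemma D_imp:
  assumes x: "x \<in> total X" and l: "length hs = l" "l \<le> n"
  shows "mdiff (B l) (P x hs a) = sg (int l) (Mop A H f X l 1 (P x hs a) + imp l (P x hs a))"
proof -
  have 0: "Mop A H f X k j (P x hs a) = 0" if "k \<noteq> l" "1 \<le> j" "j \<le> k + 1" "k \<le> l" for k j
    using that l by (simp add: Mop_pure)
  have "mdiff (B l) (P x hs a) = (\<Sum>k\<le>l. \<Sum>j = 1..k + 1. sg (int (k + (j - 1) div 2)) (Mop A H f X k j (P x hs a)))"
    by (simp add: bar_complex_def)
  also have "\<dots> = (\<Sum>k\<le>l. if k = l then \<Sum>j = 1..l + 1. sg (int (l + (j - 1) div 2)) (Mop A H f X l j (P x hs a)) else 0)"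
    using 0 by (intro sum.cong refl) auto
  also have "\<dots> = (\<Sum>j = 1..l + 1. sg (int (l + (j - 1) div 2)) (Mop A H f X l j (P x hs a)))"
    by simp
  also have "\<dots> = sg (int l) (\<Sum>j = 1..l + 1. sg (int ((j - 1) div 2)) (Mop A H f X l j (P x hs a)))"
    by (simp only: sg_sum sg_sg of_nat_add)
  also have "(\<Sum>j = 1..l + 1. sg (int ((j - 1) div 2)) (Mop A H f X l j (P x hs a))) =
      Mop A H f X l 1 (P x hs a) + imp l (P x hs a)"
    unfolding imp_def by (subst sum.atLeast_Suc_atMost) (simp_all add: numeral_2_eq_2)
  finally show ?thesis .
qed

lemma proj_imp:
  assumes l: "length hs = l" "l \<le> n" "1 \<le> l"
  shows "proj l (imp l (P x hs a)) = 0"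
    "proj (l - 1) (imp l (P x hs a)) = Mop A H f X l 2 (P x hs a)"
proof -
  show "proj l (imp l (P x hs a)) = 0"
    unfolding imp_def tlin_sum[OF tlin_proj] tlin_sg[OF tlin_proj]
    using l by (intro sum.neutral ballI) (subst Mop_pure_length, auto)
  have "proj (l - 1) (imp l (P x hs a)) = (\<Sum>j = 2..l + 1. if j = 2 then Mop A H f X l 2 (P x hs a) else 0)"
    unfolding imp_def tlin_sum[OF tlin_proj] tlin_sg[OF tlin_proj]
    using l by (intro sum.cong refl) (auto simp: Mop_pure_length)
  then show "proj (l - 1) (imp l (P x hs a)) = Mop A H f X l 2 (P x hs a)"
    using l by simp
qed

lemma blk_low:
  assumes t: "t \<in> blk X H A {..l} c m" and 0: "proj l t = 0" and l: "1 \<le> l"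
  shows "t \<in> blk X H A {..l - 1} c m"
proof -
  have "t \<in> {t. t - proj l t \<in> blk X H A {..l - 1} c m}"
    using t
  proof (rule blk_induct)
    have "s + t - proj l (s + t) = (s - proj l s) + (t - proj l t)"
      "tscale r t - proj l (tscale r t) = tscale r (t - proj l t)" for s t r
      by (simp_all add: tlin_add[OF tlin_proj] tlin_scale[OF tlin_proj] T.scale_right_diff_distrib)
    then show "T.subspace {t. t - proj l t \<in> blk X H A {..l - 1} c m}"
      using T.subspace_0[OF subspace_blk, of X H A "{..l - 1}" c m]
      by (intro T.subspaceI) (simp_all only: mem_Collect_eq tlin_0[OF tlin_proj] diff_self
          T.subspace_add[OF subspace_blk] T.subspace_scale[OF subspace_blk])
    show "P x hs a \<in> {t. t - proj l t \<in> blk X H A {..l - 1} c m}"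
      if "x \<in> deg X p" "length hs \<in> {..l}" "homogeneous H ds hs" "a \<in> deg A q"
        "p + sum_list ds + q + int (length hs) + c = m" for x hs a p ds q
      using that blkI[OF that(1) _ that(3,4,5), of "{..l - 1}"] T.subspace_0[OF subspace_blk]
      by (auto simp: proj_pure)
  qed
  then show ?thesis by (simp add: 0)
qed

text \<open>Up to sign, i_l is the bar differential minus the differential of \<open>R_l\<close>,
  and the degrees of both are known; since \<pi>_l i_l = 0, the result has no part in
  \<open>R_l\<close>.\<close>

lemma imp_deg:
  assumes l: "1 \<le> l" "l \<le> n" and t: "x \<in> deg X p" "length hs = l" "homogeneous H ds hs" "a \<in> deg A q"
  shows "imp l (P x hs a) \<in> blk X H A {..l - 1} 0 (p + sum_list ds + q + int (length hs) - 1)"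
proof (rule blk_low[OF _ proj_imp(1)[OF t(2) l(2,1)] l(1)])
  note x = deg_total[OF gX t(1)]
  have "imp l (P x hs a) = sg (int l) (mdiff (B l) (P x hs a)) - Mop A H f X l 1 (P x hs a)"
    unfolding D_imp[OF x t(2) l(2)] by (simp add: sg_even)
  moreover have "Mop A H f X l 1 (P x hs a) \<in> blk X H A {..l} 0 (p + sum_list ds + q + int (length hs) - 1)"
    unfolding Mop1_pure[OF l(2) x] using t(2)
    by (simp add: pure_koszul[OF gX t(1,3)])
      (intro blk_sg blkI[OF t(1) _ t(3) diff_deg[OF t(4)]], auto)
  moreover have "mdiff (B l) (P x hs a) \<in> blk X H A {..l} 0 (p + sum_list ds + q + int (length hs) - 1)"
    using t(2) by (intro D_deg[OF l(2) t(1) _ t(3,4)]) simp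
  ultimately show "imp l (P x hs a) \<in> blk X H A {..l} 0 (p + sum_list ds + q + int (length hs) - 1)"
    by (simp add: T.subspace_diff[OF subspace_blk] blk_sg)
qed

text \<open>The bar differential and the differential of \<open>R_l\<close> fail to be A-linear by
  the same term, the one containing \<open>diff A b\<close>; it drops out of their
  difference.\<close>

lemma imp_act:
  assumes l: "l \<le> n" and t: "x \<in> deg X p" "length hs = l" "homogeneous H ds hs" "a \<in> deg A q"
  shows "imp l (P x hs (mult A a b)) = ract X (imp l (P x hs a)) b"
proof -
  note x = deg_total[OF gX t(1)]
  have i: "imp l (P x hs c) = sg (int l) (mdiff (B l) (P x hs c)) - Mop A H f X l 1 (P x hs c)" for c
    unfolding D_imp[OF x t(2) l] by (simp add: sg_even)
  have "Mop A H f X l 1 (P x hs (mult A a b)) = ract X (Mop A H f X l 1 (P x hs a)) b +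
      sg (p + sum_list ds + q) (P x hs (mult A a (diff A b)))"
  proof -
    have "Mop A H f X l 1 (P x hs (mult A a b)) = P (koszul X 1 x) (map (koszul H 1) hs) (mult A (diff A a) b) +
        P (koszul X 1 x) (map (koszul H 1) hs) (sg q (mult A a (diff A b)))"
      by (simp add: Mop1_pure[OF l x, simplified] t(2) leibniz_deg[OF t(4)] pure_add_right koszulX_total x)
    also have "P (koszul X 1 x) (map (koszul H 1) hs) (sg q (mult A a (diff A b))) =
        sg (p + sum_list ds + q) (P x hs (mult A a (diff A b)))"
      by (simp add: pure_koszul[OF gX t(1,3)] sg_P(3)[OF x])
    finally show ?thesis by (simp add: Mop1_pure[OF l x, simplified] t(2) ract_pure)
  qed
  moreover have "sg (int l) (sg (p + sum_list ds + q + int (length hs)) (P x hs (mult A a (diff A b)))) =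
      sg (p + sum_list ds + q) (P x hs (mult A a (diff A b)))"
    using t(2) by (simp add: sg_cong)
  ultimately show ?thesis
    unfolding i D_leibniz[OF l t(1) eq_imp_le[OF t(2)] t(3,4)]
    by (simp add: sg_add tlin_diff[OF tlin_ract] ract_sg)
qed

lemma D_low:
  assumes l: "1 \<le> l" "l \<le> n" and t: "t \<in> blk X H A {..l - 1} c m"
  shows "mdiff (B l) t = mdiff (B (l - 1)) t"
proof -
  have "t \<in> {t. mdiff (B l) t = mdiff (B (l - 1)) t}"
    using t
  proof (rule blk_induct)
    show "T.subspace {t. mdiff (B l) t = mdiff (B (l - 1)) t}"
      by (auto intro!: T.subspaceI simp: tlin_0[OF tlin_D] D_add D_scale)
    show "P x hs a \<in> {t. mdiff (B l) t = mdiff (B (l - 1)) t}"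
      if "x \<in> deg X p" "length hs \<in> {..l - 1}" "homogeneous H ds hs" "a \<in> deg A q"
        "p + sum_list ds + q + int (length hs) + c = m" for x hs a p ds q
      using that l deg_total[OF gX that(1)] D_length[of l x hs a] D_length[of "l - 1" x hs a] by simp
  qed
  then show ?thesis by simp
qed

text \<open>Read off from the vanishing of the square of (-1)^l (d + i_l) on \<open>R_l\<close>: as
  d is a differential, i_l d cancels against the bar differential of i_l up to the sign (-1)^(l-1),
  which is the sign of the shift in \<open>Y_(l-1)\<close>.\<close>

lemma dg_map_imp:
  assumes l: "1 \<le> l" "l \<le> n"
  shows "dg_map (R l) (Y (l - 1)) (imp l)"
proof (rule dg_map_blkI[OF gX Y_simps(3) Robj_deg Y_simps(4) Y_simps(1) Y_deg Y_simps(2) tlin_imp tlin_dR tlin_dY])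
  show "imp l (P x hs a) \<in> blk X H A {..l - 1} (- int (l - 1)) (p + sum_list ds + q + int (length hs) + - int l)"
    if "x \<in> deg X p" "length hs \<in> {l}" "homogeneous H ds hs" "a \<in> deg A q" for x hs a p ds q
  proof -
    have "blk X H A {..l - 1} 0 (p + sum_list ds + q + int (length hs) - 1) =
        blk X H A {..l - 1} (- int (l - 1)) (p + sum_list ds + q + int (length hs) + - int l)"
      using l(1) by (intro blk_shift) (simp add: of_nat_diff)
    then show ?thesis using imp_deg[OF l that(1) _ that(3,4)] that(2) by simp
  qed
  show "imp l (P x hs (mult A a b)) = ract X (imp l (P x hs a)) b"
    if "x \<in> deg X p" "length hs \<in> {l}" "homogeneous H ds hs" "a \<in> deg A q" for x hs a p ds q b
    using imp_act[OF l(2) that(1) _ that(3,4)] that(2) by simp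
  show "imp l (mdiff (R l) (P x hs a)) = mdiff (Y (l - 1)) (imp l (P x hs a))"
    if "x \<in> deg X p" "length hs \<in> {l}" "homogeneous H ds hs" "a \<in> deg A q" for x hs a p ds q
  proof -
    note x = deg_total[OF gX that(1)]
    have len: "length hs = l" using that(2) by simp
    have low: "mdiff (B l) (imp l (P x hs a)) = mdiff (B (l - 1)) (imp l (P x hs a))"
      by (rule D_low[OF l imp_deg[OF l that(1) len that(3,4)]])
    have M: "Mop A H f X l 1 (P x hs a) = P (koszul X 1 x) (map (koszul H 1) hs) (diff A a)"
      using Mop1_pure[OF l(2) x] len by simp
    have M2: "mdiff (B l) (Mop A H f X l 1 (P x hs a)) = sg (int l) (imp l (Mop A H f X l 1 (P x hs a)))"
      unfolding M using D_imp[OF koszulX_total[OF x] _ l(2)] len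
      by (simp add: Mop1_pure[OF l(2) koszulX_total[OF x], simplified] diff_diff pure_zero_right koszulX_total x)
    have "0 = mdiff (B l) (mdiff (B l) (P x hs a))" using D2_pure[OF x _ l(2)] len by simp
    also have "\<dots> = imp l (Mop A H f X l 1 (P x hs a)) + sg (int l) (mdiff (B (l - 1)) (imp l (P x hs a)))"
      unfolding D_imp[OF x len l(2)] tlin_sg[OF tlin_D] tlin_add[OF tlin_D] M2 low by (simp add: sg_add sg_even)
    finally have "imp l (Mop A H f X l 1 (P x hs a)) = - sg (int l) (mdiff (B (l - 1)) (imp l (P x hs a)))"
      by (simp add: eq_neg_iff_add_eq_0)
    also have "\<dots> = sg (int (l - 1)) (mdiff (B (l - 1)) (imp l (P x hs a)))"
      using l(1) by (simp add: sg_def of_nat_diff)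
    finally show ?thesis by simp
  qed
qed

lemma dg_map_proj:
  assumes l: "l \<le> n"
  shows "dg_map (Y l) (R l) (proj l)"
proof (rule dg_map_blkI[OF gX Y_simps(1) Y_deg Y_simps(2) Y_simps(3) Robj_deg Y_simps(4) tlin_proj tlin_dY tlin_dR])
  show "proj l (P x hs a) \<in> blk X H A {l} (- int l) (p + sum_list ds + q + int (length hs) + - int l)"
    if "x \<in> deg X p" "length hs \<in> {..l}" "homogeneous H ds hs" "a \<in> deg A q" for x hs a p ds q
    using T.subspace_0[OF subspace_blk] blkI[OF that(1) _ that(3,4)] by (auto simp: proj_pure)
  show "proj l (P x hs (mult A a b)) = ract X (proj l (P x hs a)) b" for x hs a b
    by (simp add: proj_pure ract_pure tlin_0[OF tlin_ract])
  show "proj l (mdiff (Y l) (P x hs a)) = mdiff (R l) (proj l (P x hs a))"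
    if "x \<in> deg X p" "length hs \<in> {..l}" "homogeneous H ds hs" "a \<in> deg A q" for x hs a p ds q
  proof (cases "length hs = l")
    case True
    note x = deg_total[OF gX that(1)]
    have "proj l (mdiff (Y l) (P x hs a)) = proj l (Mop A H f X l 1 (P x hs a)) + proj l (imp l (P x hs a))"
      using D_imp[OF x True l] by (simp add: tlin_add[OF tlin_proj] sg_even)
    also have "proj l (imp l (P x hs a)) = 0"
      using proj_imp(1)[OF True l, of x a] by (cases "l = 0") (simp_all add: imp_def tlin_0[OF tlin_proj])
    also have "proj l (Mop A H f X l 1 (P x hs a)) = Mop A H f X l 1 (P x hs a)"
      using Mop_pure_length[of 1 l hs l x a] True l by simp
    finally show ?thesis using True by (simp add: proj_pure)
  next
    case False
    note x = deg_total[OF gX that(1)]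
    have len: "length hs < l" using False that(2) by simp
    have "mdiff (B (length hs)) (P x hs a) \<in> blk X H A {..length hs} 0 (p + sum_list ds + q + int (length hs) - 1)"
      using len l by (intro D_deg that) auto
    \<comment> \<open>The differential does not lengthen lists, so nothing can reach the summand
      \<open>R_l\<close> from a shorter tensor.\<close>
    then have "mdiff (B (length hs)) (P x hs a) \<in> {t. proj l t = 0}"
    proof (rule blk_induct)
      show "T.subspace {t. proj l t = 0}"
        by (auto intro!: T.subspaceI simp: tlin_add[OF tlin_proj] tlin_scale[OF tlin_proj] tlin_0[OF tlin_proj])
    qed (use len in \<open>auto simp: proj_pure\<close>)
    then show ?thesis
      using False D_length[OF l x, of hs a] len
      by (simp add: proj_pure tlin_0[OF tlin_Mop] tlin_sg[OF tlin_proj])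
  qed
qed

lemma Y_total_mono:
  assumes "k \<le> l"
  shows "total (Y k) \<subseteq> total (Y l)" "total (R k) \<subseteq> total (Y l)"
  unfolding total_blk[OF gX gH tH gA tA Y_simps(1) Y_deg] total_blk[OF gX gH tH gA tA Y_simps(3) Robj_deg]
  by (intro T.span_mono subsetI; use assms in fastforce)+

lemma dg_map_incl:
  assumes l: "1 \<le> l" "l \<le> n"
  shows "dg_map (Y (l - 1)) (shift (- 1) (Y l)) (\<lambda>t. t)"
proof -
  have d: "deg (shift (- 1) (Y l)) = blk X H A {..l} (- int (l - 1))"
  proof
    fix m
    have "blk X H A {..l} (- int l) (m + - 1) = blk X H A {..l} (- int (l - 1)) m"
      using l(1) by (intro blk_shift) (simp add: of_nat_diff)
    then show "deg (shift (- 1) (Y l)) m = blk X H A {..l} (- int (l - 1)) m"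
      using fun_cong[OF Y_deg[of l], of "m + - 1"] by simp
  qed
  have tl: "tlin (mdiff (shift (- 1) (Y l)))" by (simp add: tlin_sgI tlin_D)
  show ?thesis
  proof (rule dg_map_blkI[OF gX Y_simps(1) Y_deg Y_simps(2) _ d _ tlin_id tlin_dY tl])
    show "P x hs a \<in> blk X H A {..l} (- int (l - 1)) (p + sum_list ds + q + int (length hs) + - int (l - 1))"
      if "x \<in> deg X p" "length hs \<in> {..l - 1}" "homogeneous H ds hs" "a \<in> deg A q" for x hs a p ds q
      using that by (intro blkI[OF that(1) _ that(3,4)]) auto
    show "mdiff (Y (l - 1)) (P x hs a) = mdiff (shift (- 1) (Y l)) (P x hs a)"
      if "x \<in> deg X p" "length hs \<in> {..l - 1}" "homogeneous H ds hs" "a \<in> deg A q" for x hs a p ds q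
    proof -
      note x = deg_total[OF gX that(1)]
      have "mdiff (B l) (P x hs a) = mdiff (B (l - 1)) (P x hs a)"
        using that l D_length[OF _ x, of l hs a] D_length[OF _ x, of "l - 1" hs a] by simp
      then show ?thesis using l(1) by (simp add: of_nat_diff)
    qed
  qed (simp_all add: ract_pure)
qed

end

section \<open>The derived category\<close>

lemma dg_module_graded: "dg_module A M \<Longrightarrow> graded M"
  by (simp add: dg_module_def)

lemma dg_moduleD:
  assumes "dg_module A M"
  shows "x \<in> total M \<Longrightarrow> mdiff M (mdiff M x) = 0"
    "linear_on M M (\<lambda>x. act M x a)" "x \<in> total M \<Longrightarrow> linear_on A M (act M x)"
    "x \<in> deg M p \<Longrightarrow> a \<in> deg A q \<Longrightarrow> act M x a \<in> deg M (p + q)"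
    "x \<in> total M \<Longrightarrow> act M (act M x a) b = act M x (mult A a b)"
    "x \<in> total M \<Longrightarrow> act M x (unit A) = x"
    "x \<in> deg M p \<Longrightarrow> mdiff M (act M x a) = act M (mdiff M x) a + sg p (act M x (diff A a))"
    "x \<in> deg M p \<Longrightarrow> mdiff M x \<in> deg M (p - 1)"
  using assms by (auto simp: dg_module_def graded_map_def)

lemma linear_on_0:
  assumes "graded M" "linear_on M N F"
  shows "F 0 = 0"
proof -
  have "F (0 + 0) = F 0 + F 0" using assms total_0[OF assms(1)] unfolding linear_on_def by blast
  then show ?thesis by simp
qed

lemma dg_module_mdiff_0: "dg_module A M \<Longrightarrow> mdiff M 0 = 0"
  unfolding dg_module_def graded_map_def by (blast intro: linear_on_0)

lemma dg_module_act_0: "dg_module A M \<Longrightarrow> act M 0 a = 0"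
proof -
  assume M: "dg_module A M"
  then have "linear_on M M (\<lambda>x. act M x a)" unfolding dg_module_def by blast
  from linear_on_0[OF dg_module_graded[OF M] this] show ?thesis .
qed

lemma graded_scale_0: "graded M \<Longrightarrow> scale M c 0 = 0"
proof -
  assume "graded M"
  then interpret vector_space "scale M" by (rule graded_vs)
  show ?thesis by simp
qed

lemma graded_map_total:
  assumes M: "graded M" and N: "graded N" and F: "graded_map e M N F" and x: "x \<in> total M"
  shows "F x \<in> total N"
  using M x
proof (induction rule: total_induct)
  case (deg n x)
  then show ?case using F deg_total[OF N] unfolding graded_map_def by blast
next
  case (add x y)
  then have "F (x + y) = F x + F y" using F unfolding graded_map_def linear_on_def by blast
  then show ?case using add total_add[OF N] by simp
qed

lemma mdiff_total: "dg_module A M \<Longrightarrow> x \<in> total M \<Longrightarrow> mdiff M x \<in> total M"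
  using graded_map_total[of M M "- 1" "mdiff M" x] unfolding dg_module_def by blast

lemma dg_map_total: "dg_module A M \<Longrightarrow> dg_module A N \<Longrightarrow> dg_map M N F \<Longrightarrow> x \<in> total M \<Longrightarrow> F x \<in> total N"
  using graded_map_total[of M N 0 F x] unfolding dg_module_def dg_map_def by blast

lemma dg_act_total:
  assumes M: "dg_module A M" and A: "dg_algebra A" and x: "x \<in> total M"
  shows "act M x a \<in> total M"
proof -
  have gA: "graded A" "total A = UNIV" using A by (auto simp: dg_algebra_def)
  note gM = dg_module_graded[OF M]
  show ?thesis using gM x
  proof (induction rule: total_induct)
    case (deg n x)
    have xt: "x \<in> total M" by (rule deg_total[OF gM deg])
    have "a \<in> total A" using gA by simp
    with gA(1) show ?case
    proof (induction rule: total_induct)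
      case (deg m a)
      have "\<forall>p q. \<forall>x\<in>deg M p. \<forall>a\<in>deg A q. act M x a \<in> deg M (p + q)"
        using M unfolding dg_module_def by blast
      then have "act M x a \<in> deg M (n + m)" using deg \<open>x \<in> deg M n\<close> by blast
      then show ?case by (rule deg_total[OF gM])
    next
      case (add a b)
      have "linear_on A M (act M x)" using M xt unfolding dg_module_def by blast
      then have "act M x (a + b) = act M x a + act M x b" using add unfolding linear_on_def by blast
      then show ?case using add total_add[OF gM] by simp
    qed
  next
    case (add x y)
    have "linear_on M M (\<lambda>x. act M x a)" using M unfolding dg_module_def by blast
    then have "act M (x + y) a = act M x a + act M y a" using add unfolding linear_on_def by blast
    then show ?case using add total_add[OF gM] by simp
  qed
qed

lemma dg_map_cong:
  assumes A: "dg_algebra A" and M: "dg_module A M" and F: "dg_map M N F" and eq: "\<And>x. x \<in> total M \<Longrightarrow> G x = F x"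
  shows "dg_map M N G"
proof -
  note g = dg_module_graded[OF M]
  have lin: "linear_on M N F" "\<And>n x. x \<in> deg M n \<Longrightarrow> F x \<in> deg N (n + 0)"
    using F unfolding dg_map_def graded_map_def by blast+
  show ?thesis
    unfolding dg_map_def graded_map_def act_linear_def
  proof (intro conjI ballI allI)
    show "linear_on M N G"
      using lin(1) unfolding linear_on_def
      by (auto simp: eq total_add[OF g] total_scale[OF g])
    show "G x \<in> deg N (n + 0)" if "x \<in> deg M n" for n x
      using lin(2)[OF that] eq[OF deg_total[OF g that]] by simp
    show "G (act M x a) = act N (G x) a" if "x \<in> total M" for x a
      using F that eq[OF that] eq[OF dg_act_total[OF M A that]] unfolding dg_map_def act_linear_def by simp
    show "G (mdiff M x) = mdiff N (G x)" if "x \<in> total M" for x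
      using F that eq[OF that] eq[OF mdiff_total[OF M that]] unfolding dg_map_def by simp
  qed
qed

text \<open>Letters carry functions on the whole ambient type, so maps that agree on
  \<open>total M\<close> may still be different letters; the zero homotopy identifies them.\<close>

lemma deq_eq_on:
  assumes A: "dg_algebra A" and M: "dg_module A M" and N: "dg_module A N" and F: "dg_map M N F"
    and eq: "\<And>x. x \<in> total M \<Longrightarrow> G x = F x"
  shows "deq A M N [Map M N F] [Map M N G]"
proof (rule deq_homotopic[OF M N])
  have "graded_map 1 M N (\<lambda>_. 0)"
    unfolding graded_map_def linear_on_def
    by (auto simp: graded_scale_0[OF dg_module_graded[OF N]] deg_0[OF dg_module_graded[OF N]])
  then show "homotopic M N F G"
    unfolding homotopic_def
    using F dg_map_cong[OF A M F eq]
    by (auto simp: act_linear_def dg_module_act_0[OF N] dg_module_mdiff_0[OF N] eq intro!: exI[of _ "\<lambda>_. 0"])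
qed

lemma dpath_single: "dg_module A M \<Longrightarrow> dg_module A N \<Longrightarrow> dg_map M N F \<Longrightarrow> dpath A M [Map M N F] N"
  by (intro dpath_map dpath_nil)

lemma deq_pre: "dpath A L l M \<Longrightarrow> deq A M N p q \<Longrightarrow> dg_module A N \<Longrightarrow> deq A L N (l @ p) (l @ q)"
  using deq_cong[of A L l M N p q "[]" N] dpath_nil by fastforce

lemma deq_post: "deq A M N p q \<Longrightarrow> dpath A N r P \<Longrightarrow> dg_module A M \<Longrightarrow> deq A M P (p @ r) (q @ r)"
  using deq_cong[of A M "[]" M N p q r P] dpath_nil by fastforce

lemma deq_comp_eq:
  assumes A: "dg_algebra A" and M: "dg_module A M" "dg_module A N" "dg_module A P"
    and F: "dg_map M N F" "dg_map N P G" and eq: "\<And>x. x \<in> total M \<Longrightarrow> G (F x) = K x" and K: "dg_map M P K"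
  shows "deq A M P [Map M N F, Map N P G] [Map M P K]"
proof (rule deq_trans)
  show "deq A M P [Map M N F, Map N P G] [Map M P (\<lambda>x. G (F x))]"
    by (rule deq_comp[OF M F])
  show "deq A M P [Map M P (\<lambda>x. G (F x))] [Map M P K]"
    by (rule deq_sym, rule deq_eq_on[OF A M(1,3) K]) (simp add: eq)
qed

lemma dg_map_comp:
  assumes M: "dg_module A M" "dg_module A N" and F: "dg_map M N F" "dg_map N P G"
  shows "dg_map M P (\<lambda>x. G (F x))"
proof -
  note Ft = dg_map_total[OF M F(1)]
  have lin: "linear_on M N F" "linear_on N P G"
    and d: "\<And>n x. x \<in> deg M n \<Longrightarrow> F x \<in> deg N (n + 0)" "\<And>n x. x \<in> deg N n \<Longrightarrow> G x \<in> deg P (n + 0)"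
    using F unfolding dg_map_def graded_map_def by blast+
  show ?thesis
    unfolding dg_map_def graded_map_def act_linear_def
  proof (intro conjI ballI allI)
    show "linear_on M P (\<lambda>x. G (F x))" using lin Ft unfolding linear_on_def by simp
    show "G (F x) \<in> deg P (n + 0)" if "x \<in> deg M n" for n x using d(2)[OF d(1)[OF that]] by simp
    show "G (F (act M x a)) = act P (G (F x)) a" if "x \<in> total M" for x a
      using F that Ft[OF that] unfolding dg_map_def act_linear_def by simp
    show "G (F (mdiff M x)) = mdiff P (G (F x))" if "x \<in> total M" for x
      using F that Ft[OF that] unfolding dg_map_def by simp
  qed
qed

section \<open>Mapping cones\<close>

lemma form_zero:
  assumes "form X H A \<phi>" "graded X"
  shows "\<phi> (0, hs, a) = 0"
proof -
  have "\<phi> (0 + 0, hs, a) = \<phi> (0, hs, a) + \<phi> (0, hs, a)"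
    using assms(1)[unfolded tuple_multilinear_def, THEN conjunct1] total_0[OF assms(2)] by blast
  then have "\<phi> (0, hs, a) + \<phi> (0, hs, a) = \<phi> (0, hs, a) + 0" by simp
  then show ?thesis by (simp only: add_left_cancel)
qed

context kadmod
begin

text \<open>A multilinear form plus \<open>1\<close> is not multilinear. Hence functionals supported on the translates by
  \<open>1\<close> of the forms are a copy of the tensors that is independent of the tensors, and the cone of a
  map between modules of tensors fits into the ambient space.\<close>

definition up :: "('k, 'x, 'h, 'a) tens \<Rightarrow> ('k, 'x, 'h, 'a) tens" where
  "up t = (\<lambda>\<psi>. if form X H A (\<lambda>\<tau>. \<psi> \<tau> - 1) then t (\<lambda>\<tau>. \<psi> \<tau> - 1) else 0)"

text \<open>\<open>dn\<close> and \<open>lo\<close> are the coordinates for the decomposition into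
  the two copies: \<open>lo\<close> keeps the tensors and kills the translated copy,
  \<open>dn\<close> kills the tensors and undoes \<open>up\<close>.\<close>

definition dn :: "('k, 'x, 'h, 'a) tens \<Rightarrow> ('k, 'x, 'h, 'a) tens" where
  "dn t = (\<lambda>\<phi>. if form X H A \<phi> then t (\<lambda>\<tau>. \<phi> \<tau> + 1) else 0)"

definition lo :: "('k, 'x, 'h, 'a) tens \<Rightarrow> ('k, 'x, 'h, 'a) tens" where
  "lo t = (\<lambda>\<phi>. if form X H A \<phi> then t \<phi> else 0)"

text \<open>A form vanishes at tuples with x = 0, and its translate takes the value 1 there.\<close>

lemma form_translate: "form X H A \<phi> \<Longrightarrow> \<not> form X H A (\<lambda>\<tau>. \<phi> \<tau> + 1)"
  "form X H A (\<lambda>\<tau>. \<phi> \<tau> - 1) \<Longrightarrow> \<not> form X H A \<phi>"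
  using form_zero[OF _ gX, of H A \<phi>] form_zero[OF _ gX, of H A "\<lambda>\<tau>. \<phi> \<tau> + 1"]
    form_zero[OF _ gX, of H A "\<lambda>\<tau>. \<phi> \<tau> - 1"] by fastforce+

lemma tlin_up: "tlin up" and tlin_dn: "tlin dn" and tlin_lo: "tlin lo"
  by (auto intro!: tlinI simp: up_def dn_def lo_def fun_eq_iff tscale_def plus_fun_def)

lemma dn_up: "dn (up t) = lo t"
  by (auto simp: dn_def up_def lo_def fun_eq_iff)

lemma lo_up: "lo (up t) = 0"
  using form_translate by (auto simp: lo_def up_def fun_eq_iff zero_fun_def)

lemma dn_lo: "dn (lo t) = 0"
  using form_translate by (auto simp: lo_def dn_def fun_eq_iff zero_fun_def)

lemma lo_pure: "lo (P x hs a) = P x hs a"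
  by (auto simp: lo_def pure_tensor_def fun_eq_iff)

lemma lo_total:
  assumes "scale M = tscale" "deg M = blk X H A I c" "t \<in> total M"
  shows "lo t = t"
  by (rule tlin_eqI[OF gX assms tlin_lo tlin_id]) (rule lo_pure)

text \<open>The cone differential in the coordinates \<open>(lo t, dn t)\<close>; since these are
  linear maps of the ambient space, so are the differential and the action.\<close>

definition cone :: "('k, 'a, ('k, 'x, 'h, 'a) tens) dgmod \<Rightarrow> ('k, 'a, ('k, 'x, 'h, 'a) tens) dgmod \<Rightarrow>
    (('k, 'x, 'h, 'a) tens \<Rightarrow> ('k, 'x, 'h, 'a) tens) \<Rightarrow> ('k, 'a, ('k, 'x, 'h, 'a) tens) dgmod" where
  "cone M N \<phi> = \<lparr>scale = tscale, deg = (\<lambda>m. {q + up p | q p. q \<in> deg N m \<and> p \<in> deg M (m - 1)}),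
     mdiff = (\<lambda>t. mdiff N (lo t) + \<phi> (dn t) - up (mdiff M (dn t))),
     act = (\<lambda>t a. act N (lo t) a + up (act M (dn t) a))\<rparr>"

lemma cone_simps [simp]: "scale (cone M N \<phi>) = tscale"
  "deg (cone M N \<phi>) m = {q + up p | q p. q \<in> deg N m \<and> p \<in> deg M (m - 1)}"
  by (simp_all add: cone_def)

context
  fixes M N :: "('k, 'a, ('k, 'x, 'h, 'a) tens) dgmod" and I J c c' \<phi>
  assumes M: "dg_module A M" "scale M = tscale" "deg M = blk X H A I c" "act M = ract X" "tlin (mdiff M)"
    and N: "dg_module A N" "scale N = tscale" "deg N = blk X H A J c'" "act N = ract X" "tlin (mdiff N)"
    and \<phi>: "dg_map M N \<phi>" "tlin \<phi>"
begin

lemma lo_dn: 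
  assumes "q \<in> total N" "p \<in> total M"
  shows "lo (q + up p) = q" "dn (q + up p) = p"
proof -
  have q: "lo q = q" and p: "lo p = p" using lo_total[OF N(2,3) assms(1)] lo_total[OF M(2,3) assms(2)] .
  show "lo (q + up p) = q" by (simp add: tlin_add[OF tlin_lo] q lo_up)
  have "dn q = 0" using dn_lo[of q] q by simp
  then show "dn (q + up p) = p" by (simp add: tlin_add[OF tlin_dn] dn_up p)
qed

lemma cone_mdiff: "q \<in> total N \<Longrightarrow> p \<in> total M \<Longrightarrow>
    mdiff (cone M N \<phi>) (q + up p) = (mdiff N q + \<phi> p) + up (- mdiff M p)"
  by (simp add: cone_def lo_dn tlin_diff[OF tlin_up, of 0, simplified] tlin_0[OF tlin_up])

lemma cone_act: "q \<in> total N \<Longrightarrow> p \<in> total M \<Longrightarrow>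
    act (cone M N \<phi>) (q + up p) a = ract X q a + up (ract X p a)"
  by (simp add: cone_def lo_dn M N)

lemma cone_total_iff: "t \<in> total (cone M N \<phi>) \<longleftrightarrow> (\<exists>q p. t = q + up p \<and> q \<in> total N \<and> p \<in> total M)"
  and graded_cone: "graded (cone M N \<phi>)"
proof -
  let ?E = "cone M N \<phi>"
  note gM = dg_module_graded[OF M(1)] and gN = dg_module_graded[OF N(1)]
  have subN: "T.subspace (deg N m)" and subM: "T.subspace (deg M m)" for m
    using graded_subspace[OF gN] graded_subspace[OF gM] N(2) M(2) by auto
  note tq = deg_total[OF gN] and tp = deg_total[OF gM]
  show g: "graded ?E"
    unfolding graded_def
  proof (intro conjI allI impI)
    show "vector_space (scale ?E)" by (simp add: vector_space_tscale)
    show "module.subspace (scale ?E) (deg ?E m)" for m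
    proof (simp, rule T.subspaceI)
      show "0 \<in> {q + up p | q p. q \<in> deg N m \<and> p \<in> deg M (m - 1)}"
        by (intro CollectI exI[of _ 0] conjI T.subspace_0[OF subN] T.subspace_0[OF subM]) (simp add: tlin_0[OF tlin_up])
      show "s + t \<in> {q + up p | q p. q \<in> deg N m \<and> p \<in> deg M (m - 1)}"
        if st: "s \<in> {q + up p | q p. q \<in> deg N m \<and> p \<in> deg M (m - 1)}" "t \<in> {q + up p | q p. q \<in> deg N m \<and> p \<in> deg M (m - 1)}" for s t
      proof -
        obtain q p q' p' where *: "s = q + up p" "q \<in> deg N m" "p \<in> deg M (m - 1)" "t = q' + up p'" "q' \<in> deg N m" "p' \<in> deg M (m - 1)"
          using st by blast
        have "s + t = (q + q') + up (p + p')" by (simp add: * tlin_add[OF tlin_up] add_ac)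
        then show ?thesis
          by (intro CollectI exI[of _ "q + q'"] exI[of _ "p + p'"] conjI T.subspace_add[OF subN] T.subspace_add[OF subM] *)
      qed
      show "tscale r t \<in> {q + up p | q p. q \<in> deg N m \<and> p \<in> deg M (m - 1)}"
        if t: "t \<in> {q + up p | q p. q \<in> deg N m \<and> p \<in> deg M (m - 1)}" for r t
      proof -
        obtain q p where *: "t = q + up p" "q \<in> deg N m" "p \<in> deg M (m - 1)" using t by blast
        have "tscale r t = tscale r q + up (tscale r p)" by (simp add: * tlin_scale[OF tlin_up] T.scale_right_distrib)
        then show ?thesis
          by (intro CollectI exI[of _ "tscale r q"] exI[of _ "tscale r p"] conjI T.subspace_scale[OF subN] T.subspace_scale[OF subM] *)
      qed
    qed
    fix c m assume dec: "decomposes ?E 0 c"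
    define S where "S = {m. c m \<noteq> 0}"
    note dec' = dec[unfolded decomposes_def, folded S_def]
    have S: "finite S" "(\<Sum>m\<in>S. c m) = 0" using dec' by simp_all
    have cm: "\<exists>q p. c m = q + up p \<and> q \<in> deg N m \<and> p \<in> deg M (m - 1)" for m
    proof -
      have "c m \<in> deg ?E m" using dec' by blast
      then show ?thesis unfolding cone_simps by blast
    qed
    obtain q p where qp: "\<And>m. c m = q m + up (p m)" "\<And>m. q m \<in> deg N m" "\<And>m. p m \<in> deg M (m - 1)"
      using cm by metis
    \<comment> \<open>The two coordinates turn a vanishing sum in the cone into vanishing sums in N
      and in M shifted by one, where gradedness is known.\<close>
    have ld: "lo (c m) = q m" "dn (c m) = p m" for m
      unfolding qp(1) using lo_dn[OF tq[OF qp(2)] tp[OF qp(3)]] by auto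
    have "(\<Sum>m\<in>S. q m) = 0" using arg_cong[OF S(2), of lo] by (simp add: tlin_sum[OF tlin_lo] tlin_0[OF tlin_lo] ld)
    then have q0: "q m = 0" if "m \<in> S" for m
      using qp(2) that by (intro graded_independent[OF gN S(1), of q])
    have "(\<Sum>m\<in>S. p m) = 0" using arg_cong[OF S(2), of dn] by (simp add: tlin_sum[OF tlin_dn] tlin_0[OF tlin_dn] ld)
    then have p0: "p m = 0" if "m \<in> S" for m
      using qp(3) that by (intro graded_independent[OF graded_total_shift(1)[OF gM, of "-1"] S(1), of p]) simp_all
    show "c m = 0"
    proof (cases "m \<in> S")
      case True
      then show ?thesis by (simp add: qp(1) q0 p0 tlin_0[OF tlin_up])
    qed (simp add: S_def)
  qed
  show "t \<in> total ?E \<longleftrightarrow> (\<exists>q p. t = q + up p \<and> q \<in> total N \<and> p \<in> total M)"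
  proof
    assume "t \<in> total ?E"
    with g show "\<exists>q p. t = q + up p \<and> q \<in> total N \<and> p \<in> total M"
    proof (induction rule: total_induct)
      case (deg m t)
      then show ?case unfolding cone_simps using tq tp by blast
    next
      case (add s t)
      then obtain q p q' p' where *: "s = q + up p" "q \<in> total N" "p \<in> total M" "t = q' + up p'" "q' \<in> total N" "p' \<in> total M"
        by blast
      have "s + t = (q + q') + up (p + p')" by (simp add: * tlin_add[OF tlin_up] add_ac)
      then show ?case
        by (intro exI[of _ "q + q'"] exI[of _ "p + p'"] conjI total_add[OF gN] total_add[OF gM] *)
    qed
  next
    assume "\<exists>q p. t = q + up p \<and> q \<in> total N \<and> p \<in> total M"
    then obtain q p where t: "t = q + up p" "q \<in> total N" "p \<in> total M" by blast
    have "q \<in> total ?E" using gN t(2)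
    proof (induction rule: total_induct)
      case (deg m q)
      have "q + up 0 \<in> deg ?E m" using deg T.subspace_0[OF subM] unfolding cone_simps by blast
      then show ?case using deg_total[OF g] by (simp add: tlin_0[OF tlin_up])
    qed (rule total_add[OF g])
    moreover have "up p \<in> total ?E" using gM t(3)
    proof (induction rule: total_induct)
      case (deg m p)
      have "0 + up p \<in> deg ?E (m + 1)" unfolding cone_simps
        by (intro CollectI exI[of _ 0] exI[of _ p] conjI T.subspace_0[OF subN] refl) (simp add: deg)
      then have "0 + up p \<in> total ?E" by (rule deg_total[OF g])
      then show ?case by simp
    qed (simp add: tlin_add[OF tlin_up] total_add[OF g])
    ultimately show "t \<in> total ?E" using t(1) total_add[OF g] by simp
  qed
qed

lemma cone_cases:
  assumes "t \<in> total (cone M N \<phi>)"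
  obtains q p where "t = q + up p" "q \<in> total N" "p \<in> total M"
  using assms cone_total_iff by blast

lemma mapping_cone_cone: "mapping_cone A M N \<phi> (cone M N \<phi>) (\<lambda>t. t) up dn"
proof -
  let ?E = "cone M N \<phi>"
  note gM = dg_module_graded[OF M(1)] and gN = dg_module_graded[OF N(1)]
  note tq = deg_total[OF gN] and tp = deg_total[OF gM]
  note dM = mdiff_total[OF M(1)] and dN = mdiff_total[OF N(1)] and \<phi>t = dg_map_total[OF M(1) N(1) \<phi>(1)]
  have aM: "ract X p a \<in> total M" if "p \<in> total M" for p a using dg_act_total[OF M(1) dga that] M(4) by simp
  have aN: "ract X q a \<in> total N" if "q \<in> total N" for q a using dg_act_total[OF N(1) dga that] N(4) by simp
  have negM: "- p \<in> total M" if "p \<in> total M" for p using total_diff[OF gM total_0[OF gM] that] by simp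
  have dmM: "mdiff M (- p) = - mdiff M p" for p using tlin_diff[OF M(5), of 0 p] tlin_0[OF M(5)] by simp
  have upneg: "up (- p) = - up p" for p using tlin_diff[OF tlin_up, of 0 p] tlin_0[OF tlin_up] by simp
  have phneg: "\<phi> (- p) = - \<phi> p" for p using tlin_diff[OF \<phi>(2), of 0 p] tlin_0[OF \<phi>(2)] by simp
  have rneg: "ract X (- p) a = - ract X p a" for p a using tlin_diff[OF tlin_ract[of X a], of 0 p] tlin_0[OF tlin_ract[of X a]] by simp
  note DM = dg_moduleD[OF M(1), unfolded M(4)] and DN = dg_moduleD[OF N(1), unfolded N(4)]
  note dd = DM(1) and ddN = DN(1)
  have ch: "\<phi> (mdiff M p) = mdiff N (\<phi> p)" and al: "\<phi> (ract X p a) = ract X (\<phi> p) a" if "p \<in> total M" for p a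
    using \<phi>(1) that M(4) N(4) unfolding dg_map_def act_linear_def by auto
  note leM = DM(7) and leN = DN(7)
  have tl: "tlin (mdiff ?E)" unfolding cone_def
    by (simp, intro tlin_diffI tlin_addI tlin_comp[OF N(5) tlin_lo] tlin_comp[OF \<phi>(2) tlin_dn]
      tlin_comp[OF tlin_up tlin_comp[OF M(5) tlin_dn]])
  have ta: "tlin (\<lambda>t. act ?E t a)" for a unfolding cone_def M(4) N(4)
    by (simp, intro tlin_addI tlin_comp[OF tlin_ract tlin_lo] tlin_comp[OF tlin_up tlin_comp[OF tlin_ract tlin_dn]])
  note degM = DM(8) and degN = DN(8)
  have deg\<phi>: "\<phi> p \<in> deg N m" if "p \<in> deg M m" for m p
    using \<phi>(1) that unfolding dg_map_def graded_map_def by simp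
  note adM = DM(4) and adN = DN(4)
  have subN: "T.subspace (deg N m)" and subM: "T.subspace (deg M m)" for m
    using graded_subspace[OF gN] graded_subspace[OF gM] N(2) M(2) by auto
  note linM = DM(3) and linN = DN(3)
  have linM': "ract X p (a + b) = ract X p a + ract X p b" "ract X p (scale A r a) = tscale r (ract X p a)"
    if "p \<in> total M" for p a b r using linM[OF that] by (auto simp: linear_on_def tA M(2))
  have linN': "ract X p (a + b) = ract X p a + ract X p b" "ract X p (scale A r a) = tscale r (ract X p a)"
    if "p \<in> total N" for p a b r using linN[OF that] by (auto simp: linear_on_def tA N(2))
  note assM = DM(5,6) and assN = DN(5,6)
  have E: "dg_module A ?E"
    unfolding dg_module_def
  proof (intro conjI)
    show "graded ?E" by (rule graded_cone)
    show "graded_map (- 1) ?E ?E (mdiff ?E)"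
      unfolding graded_map_def linear_on_def
    proof (intro conjI ballI allI)
      fix m t assume "t \<in> deg ?E m"
      then obtain q p where t: "t = q + up p" "q \<in> deg N m" "p \<in> deg M (m - 1)" by auto
      have "mdiff ?E t = (mdiff N q + \<phi> p) + up (- mdiff M p)"
        unfolding t(1) by (rule cone_mdiff) (use t tq tp in auto)
      moreover have "mdiff N q + \<phi> p \<in> deg N (m + - 1)"
        using T.subspace_add[OF subN] degN[OF t(2)] deg\<phi>[OF t(3)] by simp
      moreover have "- mdiff M p \<in> deg M (m + - 1 - 1)"
        using T.subspace_neg[OF subM degM[OF t(3)]] by simp
      ultimately show "mdiff ?E t \<in> deg ?E (m + - 1)" by auto
    qed (simp_all add: tlin_add[OF tl] tlin_scale[OF tl])
    show "\<forall>t\<in>total ?E. mdiff ?E (mdiff ?E t) = 0"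
    proof
      fix t assume "t \<in> total ?E"
      then obtain q p where t: "t = q + up p" "q \<in> total N" "p \<in> total M" by (rule cone_cases)
      show "mdiff ?E (mdiff ?E t) = 0"
        unfolding t(1) cone_mdiff[OF t(2,3)] cone_mdiff[OF total_add[OF gN dN[OF t(2)] \<phi>t[OF t(3)]] negM[OF dM[OF t(3)]]]
        by (simp add: tlin_add[OF N(5)] t dd ddN ch dmM phneg tlin_0[OF tlin_up])
    qed
    show "\<forall>a. linear_on ?E ?E (\<lambda>x. act ?E x a)"
      unfolding linear_on_def using tlin_add[OF ta] tlin_scale[OF ta] by simp
    show "\<forall>x\<in>total ?E. linear_on A ?E (act ?E x)"
    proof
      fix t assume "t \<in> total ?E"
      then obtain q p where t: "t = q + up p" "q \<in> total N" "p \<in> total M" by (rule cone_cases)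
      then show "linear_on A ?E (act ?E t)"
        unfolding linear_on_def
        by (simp add: cone_act linM' linN' tlin_add[OF tlin_up] tlin_scale[OF tlin_up] T.scale_right_distrib add_ac)
    qed
    show "\<forall>p q. \<forall>x\<in>deg ?E p. \<forall>a\<in>deg A q. act ?E x a \<in> deg ?E (p + q)"
    proof (intro allI ballI)
      fix m m' t a assume "t \<in> deg ?E m" and a: "a \<in> deg A m'"
      then obtain q p where t: "t = q + up p" "q \<in> deg N m" "p \<in> deg M (m - 1)" by auto
      have "act ?E t a = ract X q a + up (ract X p a)"
        unfolding t(1) by (rule cone_act) (use t tq tp in auto)
      moreover have "ract X p a \<in> deg M (m + m' - 1)" using adM[OF t(3) a] by (simp add: algebra_simps)
      ultimately show "act ?E t a \<in> deg ?E (m + m')" using adN[OF t(2) a] by auto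
    qed
    show "\<forall>x\<in>total ?E. \<forall>a b. act ?E (act ?E x a) b = act ?E x (mult A a b)"
      "\<forall>x\<in>total ?E. act ?E x (unit A) = x"
      by (auto elim!: cone_cases simp: cone_act aM aN assM assN)
    show "\<forall>p. \<forall>x\<in>deg ?E p. \<forall>a. mdiff ?E (act ?E x a) = act ?E (mdiff ?E x) a + sg p (act ?E x (diff A a))"
    proof (intro allI ballI)
      fix m t a assume "t \<in> deg ?E m"
      then obtain q p where t: "t = q + up p" "q \<in> deg N m" "p \<in> deg M (m - 1)" by auto
      have T: "q \<in> total N" "p \<in> total M" using t tq tp by auto
      \<comment> \<open>The degree of \<open>p\<close> in M is one less than that of
        \<open>t\<close> in the cone; this sign matches the minus in front of the differential of
        M.\<close>
      have s: "sg (m - 1) s = - sg m s" for s :: "('k, 'x, 'h, 'a) tens" by (simp add: sg_def)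
      show "mdiff ?E (act ?E t a) = act ?E (mdiff ?E t) a + sg m (act ?E t (diff A a))"
        unfolding t(1) cone_act[OF T] cone_mdiff[OF aN[OF T(1)] aM[OF T(2)]] cone_mdiff[OF T]
          cone_act[OF total_add[OF gN dN[OF T(1)] \<phi>t[OF T(2)]] negM[OF dM[OF T(2)]]]
          leN[OF t(2)] leM[OF t(3)] al[OF T(2)]
        by (simp add: ract_add rneg upneg s tlin_add[OF tlin_up] tlin_diff[OF tlin_up] tlin_sg[OF tlin_up] sg_add)
    qed
  qed
  have incl: "q \<in> total ?E \<and> mdiff ?E q = mdiff N q \<and> act ?E q a = ract X q a" if "q \<in> total N" for q a
  proof (intro conjI)
    show "q \<in> total ?E"
      unfolding cone_total_iff by (rule exI[of _ q], rule exI[of _ 0]) (simp add: that total_0[OF gM] tlin_0[OF tlin_up])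
    show "mdiff ?E q = mdiff N q" "act ?E q a = ract X q a"
      using cone_mdiff[OF that total_0[OF gM]] cone_act[OF that total_0[OF gM], of a]
      by (simp_all add: tlin_0[OF tlin_up] tlin_0[OF \<phi>(2)] tlin_0[OF M(5)] tlin_0[OF tlin_ract])
  qed
  have upl: "up p \<in> total ?E \<and> mdiff ?E (up p) = \<phi> p - up (mdiff M p) \<and> act ?E (up p) a = up (ract X p a)"
    if "p \<in> total M" for p a
  proof (intro conjI)
    show "up p \<in> total ?E"
      unfolding cone_total_iff by (rule exI[of _ 0], rule exI[of _ p]) (simp add: that total_0[OF gN])
    show "mdiff ?E (up p) = \<phi> p - up (mdiff M p)" "act ?E (up p) a = up (ract X p a)"
      using cone_mdiff[OF total_0[OF gN] that] cone_act[OF total_0[OF gN] that, of a]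
      by (simp_all add: upneg tlin_0[OF N(5)] tlin_0[OF tlin_ract])
  qed
  show ?thesis
    unfolding mapping_cone_def
  proof (intro conjI M(1) N(1) E \<phi>(1))
    show "dg_map N ?E (\<lambda>t. t)"
      unfolding dg_map_def graded_map_def linear_on_def act_linear_def
    proof (intro conjI ballI allI)
      show "q \<in> deg ?E (m + 0)" if "q \<in> deg N m" for m q
      proof -
        have "q + up 0 \<in> deg ?E (m + 0)" using that T.subspace_0[OF subM] unfolding cone_simps by auto
        then show ?thesis by (simp only: tlin_0[OF tlin_up] add.right_neutral)
      qed
    qed (use incl N in auto)
    show "graded_map 1 M ?E up"
      unfolding graded_map_def linear_on_def
    proof (intro conjI ballI allI)
      show "up p \<in> deg ?E (m + 1)" if "p \<in> deg M m" for m p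
      proof -
        have "0 + up p \<in> deg ?E (m + 1)" unfolding cone_simps
          by (intro CollectI exI[of _ 0] exI[of _ p] conjI T.subspace_0[OF subN] refl) (simp add: that)
        then show ?thesis by simp
      qed
    qed (simp_all add: M(2) tlin_add[OF tlin_up] tlin_scale[OF tlin_up])
    show "act_linear M ?E up" unfolding act_linear_def using upl M(4) by auto
    show "\<forall>m. deg ?E m = {q + up p |q p. q \<in> deg N m \<and> p \<in> deg M (m - 1)}" by simp
    show "\<forall>q\<in>total N. \<forall>p\<in>total M. q + up p = 0 \<longrightarrow> q = 0 \<and> p = 0"
    proof (intro ballI impI conjI)
      fix q p assume "q \<in> total N" "p \<in> total M" and 0: "q + up p = 0"
      from lo_dn[OF this(1,2)] show "q = 0" "p = 0" unfolding 0 tlin_0[OF tlin_lo] tlin_0[OF tlin_dn] by simp_all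
    qed
    show "\<forall>p\<in>total M. mdiff ?E (up p) = \<phi> p - up (mdiff M p)" using upl by blast
    show "\<forall>q\<in>total N. \<forall>p\<in>total M. dn (q + up p) = p" using lo_dn by blast
  qed
qed

end

section \<open>The triangle formed by \<open>Y_l\<close>, \<open>R_l\<close> and
  \<open>Y_(l-1)\<close>\<close>

context
  fixes l :: nat
  assumes l: "1 \<le> l" "l \<le> n"
begin

lemma l1: "l - 1 \<le> n" using l by simp

lemmas mY = dg_module_Y[OF l(2)]
lemmas mR = dg_module_Robj[OF l(2)]
lemmas mZ = dg_module_Y[OF l1]

lemma mdiff_Y_R: "t \<in> total (R l) \<Longrightarrow> mdiff (Y l) t = mdiff (R l) t + imp l t"
  by (rule tlin_eqI[OF gX Y_simps(3) Robj_deg _ tlin_dY tlin_addI[OF tlin_dR tlin_imp]])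
    (use D_imp[OF deg_total[OF gX] _ l(2)] in \<open>auto simp: sg_even\<close>)

text \<open>The same bar differential, but \<open>Y_(l-1)\<close> is shifted once less than
  \<open>Y_l\<close>.\<close>

lemma mdiff_Y_Z: "t \<in> total (Y (l - 1)) \<Longrightarrow> mdiff (Y l) t = - mdiff (Y (l - 1)) t"
  using dg_map_incl[OF l] unfolding dg_map_def by (simp add: sg_def)

lemma proj_R: "t \<in> total (R l) \<Longrightarrow> proj l t = t"
  by (rule tlin_eqI[OF gX Y_simps(3) Robj_deg _ tlin_proj tlin_id]) (auto simp: proj_pure)

lemma proj_Z: "t \<in> total (Y (l - 1)) \<Longrightarrow> proj l t = 0"
proof (rule tlin_eqI[OF gX Y_simps(1)[of "l - 1"] Y_deg[of "l - 1"] _ tlin_proj])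
  show "tlin (\<lambda>t. 0 :: ('k, 'x, 'h, 'a) tens)" by (rule tlinI) simp_all
qed (use l in \<open>auto simp: proj_pure\<close>)

lemma diff_proj: 
  assumes "t \<in> total (Y l)"
  shows "t - proj l t \<in> total (Y (l - 1))"
proof (rule blk_hom_induct[OF gX Y_simps(1) Y_deg assms])
  note g = dg_module_graded[OF mZ]
  show "P x hs a - proj l (P x hs a) \<in> total (Y (l - 1))"
    if "x \<in> deg X p" "length hs \<in> {..l}" "homogeneous H ds hs" "a \<in> deg A q" for x hs a p ds q
    using total_0[OF g] pure_total[OF gX Y_simps(1) Y_deg deg_total[OF gX that(1)], of hs "l - 1" a] that(2)
    by (auto simp: proj_pure)
  show "s + t - proj l (s + t) \<in> total (Y (l - 1))"
    if "s - proj l s \<in> total (Y (l - 1))" "t - proj l t \<in> total (Y (l - 1))" for s t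
    using total_add[OF g that] by (simp add: tlin_add[OF tlin_proj] algebra_simps)
  show "tscale c t - proj l (tscale c t) \<in> total (Y (l - 1))" if "t - proj l t \<in> total (Y (l - 1))" for c t
    using total_scale[OF g that, of c] by (simp add: tlin_scale[OF tlin_proj] T.scale_right_diff_distrib)
  show "0 - proj l 0 \<in> total (Y (l - 1))" using total_0[OF g] by (simp add: tlin_0[OF tlin_proj])
qed

definition E where "E = cone (Y l) (R l) (proj l)"

lemmas cone_facts = mY Y_simps(1) Y_deg Y_simps(2) tlin_dY mR Y_simps(3) Robj_deg Y_simps(4) tlin_dR
  dg_map_proj[OF l(2)] tlin_proj

lemma mapping_cone_E: "mapping_cone A (Y l) (R l) (proj l) E (\<lambda>t. t) up dn"
  unfolding E_def by (rule mapping_cone_cone[OF cone_facts])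

lemma E_mdiff: "q \<in> total (R l) \<Longrightarrow> p \<in> total (Y l) \<Longrightarrow>
    mdiff E (q + up p) = (mdiff (R l) q + proj l p) + up (- mdiff (Y l) p)"
  unfolding E_def by (rule cone_mdiff[OF cone_facts])

lemma E_act: "q \<in> total (R l) \<Longrightarrow> p \<in> total (Y l) \<Longrightarrow> act E (q + up p) a = ract X q a + up (ract X p a)"
  unfolding E_def by (rule cone_act[OF cone_facts])

lemma E_total: "t \<in> total E \<longleftrightarrow> (\<exists>q p. t = q + up p \<and> q \<in> total (R l) \<and> p \<in> total (Y l))"
  unfolding E_def by (rule cone_total_iff[OF cone_facts])

lemma E_lo_dn: "q \<in> total (R l) \<Longrightarrow> p \<in> total (Y l) \<Longrightarrow> lo (q + up p) = q"
  "q \<in> total (R l) \<Longrightarrow> p \<in> total (Y l) \<Longrightarrow> dn (q + up p) = p"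
  using lo_dn[OF cone_facts] by blast+

lemma E_up: "p \<in> total (Y l) \<Longrightarrow> up p \<in> total E"
  "p \<in> total (Y l) \<Longrightarrow> mdiff E (up p) = proj l p - up (mdiff (Y l) p)"
  "p \<in> total (Y l) \<Longrightarrow> act E (up p) a = up (ract X p a)"
proof -
  assume p: "p \<in> total (Y l)"
  note 0 = total_0[OF dg_module_graded[OF mR]]
  show "up p \<in> total E" unfolding E_total by (rule exI[of _ 0], rule exI[of _ p]) (simp add: p 0)
  show "mdiff E (up p) = proj l p - up (mdiff (Y l) p)"
    using mapping_cone_E p unfolding mapping_cone_def by blast
  show "act E (up p) a = up (ract X p a)"
    using E_act[OF 0 p, of a] by (simp add: tlin_0[OF tlin_ract])
qed

lemma mE: "dg_module A E" and incl_E: "dg_map (R l) E (\<lambda>t. t)"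
  using mapping_cone_E unfolding mapping_cone_def by blast+

lemma Z_Y: "t \<in> total (Y (l - 1)) \<Longrightarrow> t \<in> total (Y l)" and R_Y: "t \<in> total (R l) \<Longrightarrow> t \<in> total (Y l)"
  using Y_total_mono[of "l - 1" l] Y_total_mono[of l l] by auto

lemma up_E: "dg_map (Y (l - 1)) E up"
  unfolding dg_map_def graded_map_def linear_on_def act_linear_def
proof (intro conjI ballI allI)
  show "up t \<in> deg E (m + 0)" if "t \<in> deg (Y (l - 1)) m" for m t
  proof -
    have "graded_map 0 (Y (l - 1)) (shift (- 1) (Y l)) (\<lambda>t. t)"
      using dg_map_incl[OF l] unfolding dg_map_def by blast
    then have "t \<in> deg (shift (- 1) (Y l)) (m + 0)" using that unfolding graded_map_def by blast
    then have "t \<in> deg (Y l) (m - 1)" by simp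
    moreover have "graded_map 1 (Y l) E up" using mapping_cone_E unfolding mapping_cone_def by blast
    ultimately have "up t \<in> deg E (m - 1 + 1)" unfolding graded_map_def by blast
    then show ?thesis by simp
  qed
  show "up (act (Y (l - 1)) t a) = act E (up t) a" if "t \<in> total (Y (l - 1))" for t a
    using E_up(3)[OF Z_Y[OF that]] by simp
  show "up (mdiff (Y (l - 1)) t) = mdiff E (up t)" if "t \<in> total (Y (l - 1))" for t
    unfolding E_up(2)[OF Z_Y[OF that]] mdiff_Y_Z[OF that] proj_Z[OF that]
    using tlin_diff[OF tlin_up, of 0 "mdiff (Y (l - 1)) t"] by (simp add: tlin_0[OF tlin_up])
qed (simp_all add: tlin_add[OF tlin_up] tlin_scale[OF tlin_up] E_def)

lemma E_cycle_eqs: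
  assumes q: "q \<in> total (R l)" and p: "p \<in> total (Y l)"
  shows "lo (mdiff E (q + up p)) = mdiff (R l) q + proj l p" "dn (mdiff E (q + up p)) = - mdiff (Y l) p"
proof -
  note gR = dg_module_graded[OF mR] and gY = dg_module_graded[OF mY]
  have "mdiff (R l) q + proj l p \<in> total (R l)"
    by (intro total_add[OF gR] mdiff_total[OF mR q] dg_map_total[OF mY mR dg_map_proj[OF l(2)] p])
  moreover have "- mdiff (Y l) p \<in> total (Y l)"
    using total_diff[OF gY total_0[OF gY] mdiff_total[OF mY p]] by simp
  ultimately show "lo (mdiff E (q + up p)) = mdiff (R l) q + proj l p" "dn (mdiff E (q + up p)) = - mdiff (Y l) p"
    unfolding E_mdiff[OF q p] by (rule E_lo_dn)+
qed

lemma quasi_iso_up: "quasi_iso (Y (l - 1)) E up"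
  unfolding quasi_iso_def
proof (intro conjI ballI impI up_E)
  note gR = dg_module_graded[OF mR] and gY = dg_module_graded[OF mY] and gZ = dg_module_graded[OF mZ]
  note it = dg_map_total[OF mR mZ dg_map_imp[OF l]]
  have ic: "imp l (mdiff (R l) q) = mdiff (Y (l - 1)) (imp l q)" if "q \<in> total (R l)" for q
    using dg_map_imp[OF l] that unfolding dg_map_def by blast
  have ddR: "mdiff (R l) (mdiff (R l) q) = 0" if "q \<in> total (R l)" for q by (rule dg_moduleD(1)[OF mR that])
  \<comment> \<open>With \<pi> p = - d q the top part of p can be traded for i q: up to sign, the
    differential of p is that of p - \<pi> p + i q, which lies in \<open>Y_(l-1)\<close>.\<close>
  have key: "mdiff (Y l) p = - mdiff (Y (l - 1)) (p - proj l p) - mdiff (Y (l - 1)) (imp l q)"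
    if q: "q \<in> total (R l)" and p: "p \<in> total (Y l)" and qp: "mdiff (R l) q + proj l p = 0" for q p
  proof -
    have t: "proj l p = - mdiff (R l) q" using qp by (simp add: eq_neg_iff_add_eq_0 add.commute)
    have neg: "F (- s) = - F s" if "tlin F" for F :: "('k, 'x, 'h, 'a) tens \<Rightarrow> ('k, 'x, 'h, 'a) tens" and s
      using tlin_diff[OF that, of 0 s] by (simp add: tlin_0[OF that])
    have tR: "proj l p \<in> total (R l)" by (rule dg_map_total[OF mY mR dg_map_proj[OF l(2)] p])
    have "mdiff (Y l) p = mdiff (Y l) (p - proj l p) + mdiff (Y l) (proj l p)"
      by (simp add: tlin_diff[OF tlin_D] sg_diff)
    also have "mdiff (Y l) (proj l p) = - mdiff (Y (l - 1)) (imp l q)"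
      unfolding mdiff_Y_R[OF tR] unfolding t neg[OF tlin_dR] neg[OF tlin_imp] ddR[OF q] ic[OF q] by simp
    also have "mdiff (Y l) (p - proj l p) = - mdiff (Y (l - 1)) (p - proj l p)"
      by (rule mdiff_Y_Z[OF diff_proj[OF p]])
    finally show ?thesis by simp
  qed
  show "z \<in> boundaries (Y (l - 1))" if z: "z \<in> cycles (Y (l - 1))" and b: "up z \<in> boundaries E" for z
  proof -
    obtain q p where qp: "q \<in> total (R l)" "p \<in> total (Y l)" and up: "up z = mdiff E (q + up p)"
      using b unfolding boundaries_def E_total by (auto simp: E_total)
    have z': "z \<in> total (Y (l - 1))" using z by (simp add: cycles_def)
    note e = E_cycle_eqs[OF qp, folded up, unfolded lo_up dn_up lo_total[OF Y_simps(1) Y_deg z']]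
    have "z = mdiff (Y (l - 1)) (p - proj l p) + mdiff (Y (l - 1)) (imp l q)"
      unfolding e(2) key[OF qp e(1)[symmetric]] by simp
    also have "\<dots> = mdiff (Y (l - 1)) (p - proj l p + imp l q)"
      by (simp add: D_add sg_add)
    finally show ?thesis
      unfolding boundaries_def using total_add[OF gZ diff_proj[OF qp(2)] it[OF qp(1)]] by blast
  qed
  show "\<exists>z\<in>cycles (Y (l - 1)). w - up z \<in> boundaries E" if w: "w \<in> cycles E" for w
  proof -
    obtain q p where qp: "q \<in> total (R l)" "p \<in> total (Y l)" and wqp: "w = q + up p"
      using w unfolding cycles_def by (auto simp: E_total)
    have "mdiff E (q + up p) = 0" using w by (simp add: wqp cycles_def)
    note e = E_cycle_eqs[OF qp, unfolded this tlin_0[OF tlin_lo] tlin_0[OF tlin_dn]]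
    let ?z = "p - proj l p + imp l q"
    have zt: "?z \<in> total (Y (l - 1))" by (rule total_add[OF gZ diff_proj[OF qp(2)] it[OF qp(1)]])
    have "mdiff (Y (l - 1)) ?z = mdiff (Y (l - 1)) (p - proj l p) + mdiff (Y (l - 1)) (imp l q)"
      by (simp add: D_add sg_add)
    also have "\<dots> = - mdiff (Y l) p" unfolding key[OF qp e(1)[symmetric]] by simp
    also have "\<dots> = 0" by (rule e(2)[symmetric])
    finally have zc: "?z \<in> cycles (Y (l - 1))" using zt by (simp add: cycles_def)
    have t: "proj l p = - mdiff (R l) q" using e(1) by (simp add: eq_neg_iff_add_eq_0 add.commute)
    \<comment> \<open>Subtracting the boundary of \<open>up q\<close> removes q from w and replaces
      p by p + d q + i q = p - \<pi> p + i q; this moves w into the image of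
      \<open>up\<close>.\<close>
    have "mdiff E (up q) = q - up (mdiff (R l) q + imp l q)"
      unfolding E_up(2)[OF R_Y[OF qp(1)]] mdiff_Y_R[OF qp(1)] proj_R[OF qp(1)] ..
    also have "\<dots> = w - up ?z"
      unfolding wqp t by (simp add: tlin_add[OF tlin_up] algebra_simps)
    finally have "w - up ?z = mdiff E (up q)" ..
    then show ?thesis using zc E_up(1)[OF R_Y[OF qp(1)]] unfolding boundaries_def by blast
  qed
qed

lemma dn_E: "dg_map E (shift (- 1) (Y l)) dn"
  unfolding dg_map_def graded_map_def linear_on_def act_linear_def
proof (intro conjI ballI allI)
  show "dn t \<in> deg (shift (- 1) (Y l)) (m + 0)" if "t \<in> deg E m" for m t
  proof -
    obtain q p where t: "t = q + up p" "q \<in> deg (R l) m" "p \<in> deg (Y l) (m - 1)"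
      using \<open>t \<in> deg E m\<close> unfolding E_def cone_simps by blast
    have "dn t = p" unfolding t(1)
      by (rule E_lo_dn(2)[OF deg_total[OF dg_module_graded[OF mR] t(2)] deg_total[OF dg_module_graded[OF mY] t(3)]])
    then show ?thesis using t(3) by simp
  qed
  show "dn (act E t a) = act (shift (- 1) (Y l)) (dn t) a" if "t \<in> total E" for t a
  proof -
    obtain q p where t: "t = q + up p" "q \<in> total (R l)" "p \<in> total (Y l)" using \<open>t \<in> total E\<close> unfolding E_total by blast
    have "ract X q a \<in> total (R l)" "ract X p a \<in> total (Y l)"
      using dg_act_total[OF mR dga t(2), of a] dg_act_total[OF mY dga t(3), of a] by simp_all
    from E_lo_dn(2)[OF this] show ?thesis unfolding t(1) E_act[OF t(2,3)] E_lo_dn(2)[OF t(2,3)] by simp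
  qed
  show "dn (mdiff E t) = mdiff (shift (- 1) (Y l)) (dn t)" if "t \<in> total E" for t
  proof -
    obtain q p where t: "t = q + up p" "q \<in> total (R l)" "p \<in> total (Y l)" using \<open>t \<in> total E\<close> unfolding E_total by blast
    show ?thesis unfolding t(1) E_cycle_eqs(2)[OF t(2,3)] E_lo_dn(2)[OF t(2,3)] by (simp add: sg_def)
  qed
qed (simp_all add: tlin_add[OF tlin_dn] tlin_scale[OF tlin_dn] E_def)

text \<open>In the cone the boundary of \<open>up t\<close> is t minus \<open>up\<close> of the
  differential of t in \<open>Y_l\<close>, which is d t + i t. Hence \<open>- up\<close> is a
  homotopy from \<open>up\<close> composed with i_l to the inclusion.\<close>

lemma homotopic_up_imp: "homotopic (R l) E (\<lambda>x. up (imp l x)) (\<lambda>x. x)"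
  unfolding homotopic_def
proof (intro conjI incl_E dg_map_comp[OF mR mZ dg_map_imp[OF l] up_E] exI[of _ "\<lambda>t. - up t"] ballI)
  have upneg: "- up t = up (- t)" for t
    using tlin_diff[OF tlin_up, of 0 t] by (simp add: tlin_0[OF tlin_up])
  note gY = dg_module_graded[OF mY] and gE = dg_module_graded[OF mE]
  interpret VE: vector_space "scale E" by (rule graded_vs) (rule gE)
  show "graded_map 1 (R l) E (\<lambda>t. - up t)"
    unfolding graded_map_def linear_on_def
  proof (intro conjI ballI allI)
    show "- up t \<in> deg E (m + 1)" if "t \<in> deg (R l) m" for m t
    proof -
      have "t \<in> deg (Y l) m"
        using that unfolding Robj_deg Y_deg by (rule blk_induct) (auto intro!: blkI subspace_blk)
      then have "up t \<in> deg E (m + 1)"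
        using mapping_cone_E unfolding mapping_cone_def graded_map_def by blast
      then show ?thesis using VE.subspace_neg[OF graded_subspace[OF gE]] by blast
    qed
  qed (simp_all add: tlin_add[OF tlin_up] tlin_scale[OF tlin_up] E_def)
  show "act_linear (R l) E (\<lambda>t. - up t)"
    unfolding act_linear_def
  proof (intro ballI allI)
    fix t a assume t: "t \<in> total (R l)"
    have m: "- t \<in> total (Y l)" using total_diff[OF gY total_0[OF gY] R_Y[OF t]] by simp
    have "ract X (- t) a = - ract X t a"
      using tlin_diff[OF tlin_ract[of X a], of 0 t] by (simp add: tlin_0[OF tlin_ract])
    then show "- up (act (R l) t a) = act E (- up t) a"
      unfolding upneg using E_up(3)[OF m, of a] by simp
  qed
  fix t assume t: "t \<in> total (R l)"
  have m: "- t \<in> total (Y l)" using total_diff[OF gY total_0[OF gY] R_Y[OF t]] by simp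
  have "mdiff E (- up t) = - (proj l t - up (mdiff (Y l) t))"
    unfolding upneg E_up(2)[OF m]
    using tlin_diff[OF tlin_proj[of l], of 0 t] tlin_diff[OF tlin_dY[of l], of 0 t] tlin_diff[OF tlin_up, of 0 "mdiff (Y l) t"]
    by (simp add: tlin_0[OF tlin_proj] dg_module_mdiff_0[OF mY] tlin_0[OF tlin_up] del: shift_simps)
  then show "up (imp l t) - t = mdiff E (- up t) + - up (mdiff (R l) t)"
    unfolding mdiff_Y_R[OF t] proj_R[OF t] by (simp add: tlin_add[OF tlin_up] algebra_simps)
qed

text \<open>The comparison with the cone of \<pi>_l consists of identities on \<open>Y_l\<close> and
  \<open>R_l\<close> and of the quasi-isomorphism \<open>up\<close> on \<open>Y_(l-1)\<close>. The
  middle square is \<open>homotopic_up_imp\<close>; the last one commutes because \<open>dn\<close>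
  undoes \<open>up\<close>.\<close>

lemma distinguished_bar:
  "distinguished A (Y l) (R l) (Y (l - 1)) [Map (Y l) (R l) (proj l)] [Map (R l) (Y (l - 1)) (imp l)]
     [Map (Y (l - 1)) (shift (- 1) (Y l)) (\<lambda>t. t)]"
  unfolding distinguished_def
proof (intro conjI)
  note mS = dg_module_shift[OF mY, of "- 1"]
  show "dpath A (Y l) [Map (Y l) (R l) (proj l)] (R l)" by (rule dpath_single[OF mY mR dg_map_proj[OF l(2)]])
  show "dpath A (R l) [Map (R l) (Y (l - 1)) (imp l)] (Y (l - 1))" by (rule dpath_single[OF mR mZ dg_map_imp[OF l]])
  show "dpath A (Y (l - 1)) [Map (Y (l - 1)) (shift (- 1) (Y l)) (\<lambda>t. t)] (shift (- 1) (Y l))"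
    by (rule dpath_single[OF mZ mS dg_map_incl[OF l]])
  have nil: "derived_iso A M [] M" if "dg_module A M" for M :: "('k, 'a, ('k, 'x, 'h, 'a) tens) dgmod"
    unfolding derived_iso_def using that by (auto intro!: exI[of _ "[]"] dpath_nil deq_refl)
  have c: "derived_iso A (Y (l - 1)) [Map (Y (l - 1)) E up] E"
    unfolding derived_iso_def append.simps
    by (intro conjI exI[of _ "[Inv (Y (l - 1)) E up]"] dpath_single mZ mE up_E dpath_inv quasi_iso_up dpath_nil)
      (simp_all only: append.simps deq_inv_right[OF mZ mE quasi_iso_up] deq_inv_left[OF mZ mE quasi_iso_up])
  have d1: "deq A (R l) E ([Map (R l) (Y (l - 1)) (imp l)] @ [Map (Y (l - 1)) E up]) ([] @ [Map (R l) E (\<lambda>t. t)])"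
    unfolding append.simps by (rule deq_trans[OF deq_comp[OF mR mZ mE dg_map_imp[OF l] up_E] deq_homotopic[OF mR mE homotopic_up_imp]])
  have "deq A (Y (l - 1)) (shift (- 1) (Y l)) [Map (Y (l - 1)) E up, Map E (shift (- 1) (Y l)) dn]
      [Map (Y (l - 1)) (shift (- 1) (Y l)) (\<lambda>t. t)]"
    by (rule deq_comp_eq[OF dga mZ mE mS up_E dn_E _ dg_map_incl[OF l]])
      (simp add: dn_up lo_total[OF Y_simps(1) Y_deg])
  then have d2: "deq A (Y (l - 1)) (shift (- 1) (Y l))
      ([Map (Y (l - 1)) (shift (- 1) (Y l)) (\<lambda>t. t)] @ map (shift_letter (- 1)) [])
      ([Map (Y (l - 1)) E up] @ [Map E (shift (- 1) (Y l)) dn])"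
    by (simp add: deq_sym)
  have d0: "deq A (Y l) (R l) ([Map (Y l) (R l) (proj l)] @ []) ([] @ [Map (Y l) (R l) (proj l)])"
    unfolding append.simps by (rule deq_refl[OF dpath_single[OF mY mR dg_map_proj[OF l(2)]]])
  show "\<exists>P Q F \<phi> \<iota> \<kappa> \<rho> a b c. mapping_cone A P Q \<phi> F \<iota> \<kappa> \<rho> \<and>
        derived_iso A (Y l) a P \<and> derived_iso A (R l) b Q \<and> derived_iso A (Y (l - 1)) c F \<and>
        deq A (Y l) Q ([Map (Y l) (R l) (proj l)] @ b) (a @ [Map P Q \<phi>]) \<and>
        deq A (R l) F ([Map (R l) (Y (l - 1)) (imp l)] @ c) (b @ [Map Q F \<iota>]) \<and>
        deq A (Y (l - 1)) (shift (- 1) P) ([Map (Y (l - 1)) (shift (- 1) (Y l)) (\<lambda>t. t)] @ map (shift_letter (- 1)) a)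
          (c @ [Map F (shift (- 1) P) \<rho>])"
    by (intro exI conjI) (rule mapping_cone_E nil[OF mY] nil[OF mR] c d0 d1 d2)+
qed

end

end

section \<open>Maps of bar constructions\<close>

text \<open>Linearity and degrees of g give the formula for \<open>B_p(g)\<close> on pure tensors.
  The relation of a morphism is added only in \<open>kadmap\<close>, so that the formula can also be
  used for the identity and for composites, whose bar maps are found by direct comparison.\<close>

locale kadpre = kadmod A H cls f X n + M': kadmod A H cls f X' n
  for A :: "('k::field, 'a::ab_group_add) dga" and H :: "('k, 'h::ab_group_add) ainf"
    and cls :: "'a \<Rightarrow> 'h" and f :: "'h list \<Rightarrow> 'a"
    and X X' :: "('k, 'h, 'x::ab_group_add) amod" and n :: nat +
  fixes g :: "'x \<Rightarrow> 'h list \<Rightarrow> 'x"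
  assumes g_maps: "module_maps (- 1) (n + 1) H X X' g"
begin

lemmas g_add_left = module_maps_add_left[OF g_maps gX M'.gX gH tH]
lemmas g_deg = module_maps_deg[OF g_maps gX M'.gX gH tH]
lemmas g_total = module_maps_total[OF g_maps gX M'.gX gH tH]
lemmas g_koszul = module_maps_koszul[OF g_maps gX M'.gX gH tH]

definition eG :: "int \<Rightarrow> int" where "eG a = (a + 1) div 2"

definition GB where "GB x hs a = ssum (\<lambda>v w. sg (eG (len v)) (M'.P (g x v) w a)) hs"

abbreviation BM where "BM p \<equiv> bar_map A H X' g p"
abbreviation al where "al l \<equiv> bar_entry A H X' g l 0"

lemma bar_entry_pure:
  assumes "r \<le> n"
  shows "bar_entry A H X' g i r (P x hs a) = (if length hs = i then M'.P (g x (take r hs)) (drop r hs) a else 0)"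
  unfolding bar_entry_def
  using push_pure[OF multilinear_op_front[OF g_maps gX M'.gX gH tH, of r A "{i}"], of x hs a] assms by simp

lemma bar_map_pure:
  assumes p: "p \<le> n" and hs: "length hs \<le> p"
  shows "BM p (P x hs a) = GB x hs a"
proof -
  let ?k = "length hs"
  have "BM p (P x hs a) = (\<Sum>j = 1..p + 1. \<Sum>i = 1..j.
     sg (int ((j - i + 1) div 2)) (if ?k = j - 1 then M'.P (g x (take (j - i) hs)) (drop (j - i) hs) a else 0))"
    unfolding bar_map_def using p by (intro sum.cong refl) (auto simp: bar_entry_pure)
  also have "\<dots> = (\<Sum>j = 1..p + 1. if j = ?k + 1 then \<Sum>i = 1..?k + 1.
     sg (int ((?k + 1 - i + 1) div 2)) (M'.P (g x (take (?k + 1 - i) hs)) (drop (?k + 1 - i) hs) a) else 0)"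
    by (intro sum.cong refl) (auto intro!: sum.neutral)
  also have "\<dots> = (\<Sum>i = 1..?k + 1. sg (int ((?k + 1 - i + 1) div 2)) (M'.P (g x (take (?k + 1 - i) hs)) (drop (?k + 1 - i) hs) a))"
    using hs by (subst sum.delta) auto
  also have "\<dots> = (\<Sum>r\<le>?k. sg (int ((r + 1) div 2)) (M'.P (g x (take r hs)) (drop r hs) a))"
    by (rule sum.reindex_bij_witness[where i = "\<lambda>r. ?k + 1 - r" and j = "\<lambda>i. ?k + 1 - i"]) auto
  also have "\<dots> = GB x hs a"
    unfolding GB_def ssum_def by (intro sum.cong refl) (auto simp: eG_def zdiv_int min_def add_ac)
  finally show ?thesis .
qed

lemma tlin_al: "tlin (bar_entry A H X' g l r)"
  unfolding bar_entry_def by (rule tlin_push)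

lemma tlin_BM: "tlin (BM p)"
  unfolding bar_map_def by (intro tlin_sumI tlin_sgI tlin_al)

lemma al_pure: "al l (P x hs a) = (if length hs = l then M'.P (g x []) hs a else 0)"
  by (simp add: bar_entry_pure)

end

locale kadmap = kadpre A H cls f X X' n g
  for A :: "('k::field, 'a::ab_group_add) dga" and H :: "('k, 'h::ab_group_add) ainf"
    and cls :: "'a \<Rightarrow> 'h" and f :: "'h list \<Rightarrow> 'a"
    and X X' :: "('k, 'h, 'x::ab_group_add) amod" and n :: nat and g :: "'x \<Rightarrow> 'h list \<Rightarrow> 'x" +
  assumes mor: "module_morphism H (n + 1) X X' g"
begin

text \<open>The relation of a morphism in terms of splittings, arranged as in
  \<open>act_relation\<close>: m^X before g, m^H before g, and g before the action on X'.\<close>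

lemma g_relation:
  assumes x: "x \<in> total X" and hs: "length hs \<le> n"
  shows "ssum (\<lambda>v w. sg ((int (length v) + 1) * int (length w)) (g (act_inf X x v) w)) hs +
    ssum (\<lambda>u r. ssum (\<lambda>v w. if v = [] then 0 else sg (int (length u) + 1 + int (length v) * int (length w))
      (g (koszul X (int (length v)) x) (map (koszul H (int (length v))) u @ op v # w))) r) hs =
    ssum (\<lambda>v w. sg (int (length v) * int (length w)) (act_inf X' (g x v) w)) hs"
proof -
  let ?m = "length hs"
  define T where "T r s = (let t = ?m + 1 - s - r; (y, ks) = insert_mod H X r s x hs
     in sg (int (r + s * t)) (g y ks))" for r s
  have "ssum (\<lambda>v w. sg (int (length v) * int (length w)) (act_inf X' (g x v) w)) hs =
      (\<Sum>i = 1..?m + 1. let j = ?m + 1 - i in sg (int ((i + 1) * j)) (act_inf X' (g x (take (i - 1) hs)) (drop (i - 1) hs)))"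
    unfolding ssum_def
    by (rule sum.reindex_bij_witness[where i = "\<lambda>k. k - 1" and j = "\<lambda>s. s + 1"])
      (auto simp: min_def Let_def intro!: sg_cong)
  also have "\<dots> = (\<Sum>s = 1..?m + 1. \<Sum>r = 0..?m + 1 - s. T r s)"
    using mor x hs unfolding module_morphism_def T_def by (auto simp: Let_def)
  also have "\<dots> = (\<Sum>s = 1..?m + 1. T 0 s + (\<Sum>r = 1..?m + 1 - s. T r s))"
    by (simp add: sum.atLeast_Suc_atMost)
  also have "\<dots> = (\<Sum>s = 1..?m + 1. T 0 s) + (\<Sum>s = 1..?m + 1. \<Sum>r = 1..?m + 1 - s. T r s)"
    by (rule sum.distrib)
  also have "(\<Sum>s = 1..?m + 1. T 0 s) = (\<Sum>k\<le>?m. T 0 (k + 1))"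
    by (rule sum.reindex_bij_witness[where i = "\<lambda>k. k + 1" and j = "\<lambda>s. s - 1"]) auto
  also have "\<dots> = ssum (\<lambda>v w. sg ((int (length v) + 1) * int (length w)) (g (act_inf X x v) w)) hs"
    unfolding ssum_def
    by (intro sum.cong refl) (auto simp: T_def insert_mod_def min_def intro!: sg_cong)
  also have "(\<Sum>s = 1..?m + 1. \<Sum>r = 1..?m + 1 - s. T r s) = (\<Sum>s = 1..?m. \<Sum>r = 0..?m - s. T (r + 1) s)"
  proof -
    have "(\<Sum>s = 1..?m + 1. \<Sum>r = 1..?m + 1 - s. T r s) = (\<Sum>s = 1..?m. \<Sum>r = 1..?m + 1 - s. T r s)"
      by simp
    also have "\<dots> = (\<Sum>s = 1..?m. \<Sum>r = 0..?m - s. T (r + 1) s)"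
      by (intro sum.cong refl sum.reindex_bij_witness[where i = "\<lambda>k. k + 1" and j = "\<lambda>s. s - 1"]) auto
    finally show ?thesis .
  qed
  also have "\<dots> = ssum (\<lambda>u r. ssum (\<lambda>v w. if v = [] then 0 else sg (int (length u) + 1 + int (length v) * int (length w))
      (g (koszul X (int (length v)) x) (map (koszul H (int (length v))) u @ op v # w))) r) hs"
    unfolding sum_triangle_swap ssum3_take_drop
  proof (intro sum.cong refl)
    fix r s assume "r \<in> {..?m}" "s \<in> {..?m - r}"
    then have *: "s \<le> length (drop r hs)" "length (take r hs) = r" "length (take s (drop r hs)) = s"
      "length (drop (r + s) hs) = ?m - s - r" "r + s \<le> ?m" by auto
    have 1: "length (take s (drop r hs)) = s" "take s (drop r hs) = [] \<longleftrightarrow> s = 0"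
      "?m + 1 - s - (r + 1) = ?m - s - r" using *(1,3) by (auto simp: take_eq_Nil)
    show "(if s = 0 then 0 else T (r + 1) s) =
       (if take s (drop r hs) = [] then 0 else
       sg (int (length (take r hs)) + 1 + int (length (take s (drop r hs))) * int (length (drop (r + s) hs)))
        (g (koszul X (int (length (take s (drop r hs)))) x)
          (map (koszul H (int (length (take s (drop r hs))))) (take r hs) @ op (take s (drop r hs)) # drop (r + s) hs)))"
      unfolding T_def Let_def 1 *(2,4) using *(1)
      by (auto simp: insert_mod_def insert_op_def koszul_shift2 op_def take_eq_Nil intro!: sg_cong)
  qed
  finally show ?thesis ..
qed

lemma P'_koszul_g:
  assumes "x \<in> total X" "length v \<le> n"
  shows "M'.P (koszul X' e (g x v)) ws a = sg (e * len v) (M'.P (g (koszul X e x) (map (koszul H e) v)) ws a)"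
  using assms by (simp add: g_koszul g_total koszulX_total M'.sg_P)

lemma GB_middle: "GB x (U @ h # w) a =
    ssum (\<lambda>U1 U2. sg (eG (len U1)) (M'.P (g x U1) (U2 @ h # w) a)) U +
    ssum (\<lambda>w1 w2. sg (eG (len (U @ h # w1))) (M'.P (g x (U @ h # w1)) w2 a)) w"
  by (simp only: GB_def ssum_middle)

text \<open>The sign comparison for m^H followed by a g that consumes its output: u, v, w are the
  parts of the combined block and z is the length of the rest. What remains beside the sign of
  \<open>g_relation\<close> depends only on the combined length and on z.\<close>

lemma eH_eG:
  "even (z + (u + v + w + 1) div 2 + (u + 1 + v * w) - (eH u v (w + z) + eG (u + 1 + w)))"
proof -
  have 1: "v - 1 + (u + w) = u + v + w - 1" by simp
  have 2: "(u + 1 + w + 1) div 2 = (u + w) div 2 + 1" "(u + v + w + 1) div 2 = (u + v + w - 1) div 2 + 1"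
    by presburger+
  show ?thesis
    unfolding eH_def eG_def 2 using half_add[of "v - 1" "u + w", unfolded 1] by auto
qed

text \<open>All terms in which g and the other operation share one initial block \<open>y\<close>.
  Grouped by \<open>y\<close>, the identity is \<open>g_relation\<close> for \<open>y\<close> with a
  common sign.\<close>

lemma GB_X:
  assumes x: "x \<in> total X" and n: "length hs \<le> n"
  shows "ssum (\<lambda>v r. sg (eX (len v) (len r)) (GB (act_inf X x v) r a)) hs +
    ssum (\<lambda>u r. ssum (\<lambda>v w. if v = [] then 0 else sg (eH (len u) (len v) (len w))
      (ssum (\<lambda>w1 w2. sg (eG (len (map (koszul H (len v)) u @ op v # w1)))
        (M'.P (g (koszul X (len v) x) (map (koszul H (len v)) u @ op v # w1)) w2 a)) w)) r) hs =
    ssum (\<lambda>v r. sg (eG (len v)) (M'.DX (g x v) r a)) hs"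
    (is "?S1 + ?S2 = ?S3")
proof -
  define R1 where "R1 y = ssum (\<lambda>v w. sg ((len v + 1) * len w) (g (act_inf X x v) w)) y" for y
  define R2 where "R2 y = ssum (\<lambda>u r. ssum (\<lambda>v w. if v = [] then 0 else sg (len u + 1 + len v * len w)
      (g (koszul X (len v) x) (map (koszul H (len v)) u @ op v # w))) r) y" for y
  define R3 where "R3 y = ssum (\<lambda>v w. sg (len v * len w) (act_inf X' (g x v) w)) y" for y
  define c where "c y w = len w + (len y + 1) div 2" for y w :: "'h list"
  have t1: "g (act_inf X x v) w \<in> total X'" if "length v + length w \<le> n" for v w
    using that x by (intro g_total act_total) auto
  have t2: "g (koszul X e x) (map (koszul H e') u @ op v # w) \<in> total X'"
    if "v \<noteq> []" "length u + length v + length w \<le> n" for u v w e e'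
    using that x by (intro g_total koszulX_total) (cases v; auto)+
  have t3: "act_inf X' (g x v) w \<in> total X'" if "length v + length w \<le> n" for v w
    using that x by (intro g_total M'.act_total) auto
  have "?S1 = ssum (\<lambda>y w. ssum (\<lambda>v v2. sg (eX (len v) (len v2 + len w)) (sg (eG (len v2))
      (M'.P (g (act_inf X x v) v2) w a))) y) hs"
    unfolding GB_def ssum_assoc by (intro ssum_cong) (auto simp: ssum_sg intro!: ssum_cong)
  also have "\<dots> = ssum (\<lambda>y w. sg (c y w) (M'.P (R1 y) w a)) hs"
  proof (intro ssum_cong)
    fix y w assume h: "hs = y @ w"
    have "sg (c y w) (M'.P (R1 y) w a) =
        ssum (\<lambda>v v2. sg (c y w) (M'.P (sg ((len v + 1) * len v2) (g (act_inf X x v) v2)) w a)) y"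
      unfolding R1_def ssum_sg[symmetric] using h n
      by (subst M'.P_ssum_left) (auto intro!: total_sg[OF M'.gX] t1)
    also have "\<dots> = ssum (\<lambda>v v2. sg (eX (len v) (len v2 + len w)) (sg (eG (len v2))
      (M'.P (g (act_inf X x v) v2) w a))) y"
    proof (intro ssum_cong)
      fix v v2 assume y: "y = v @ v2"
      have "g (act_inf X x v) v2 \<in> total X'" using h y n by (intro t1) auto
      then show "sg (c y w) (M'.P (sg ((len v + 1) * len v2) (g (act_inf X x v) v2)) w a) =
          sg (eX (len v) (len v2 + len w)) (sg (eG (len v2)) (M'.P (g (act_inf X x v) v2) w a))"
        unfolding y c_def using half_add[of "len v" "len v2 + 1"]
        by (simp add: M'.sg_P) (rule sg_cong, auto simp: eX_def eG_def add_ac)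
    qed
    finally show "ssum (\<lambda>v v2. sg (eX (len v) (len v2 + len w)) (sg (eG (len v2))
      (M'.P (g (act_inf X x v) v2) w a))) y = sg (c y w) (M'.P (R1 y) w a)" ..
  qed
  finally have S1: "?S1 = ssum (\<lambda>y w. sg (c y w) (M'.P (R1 y) w a)) hs" .
  have "?S3 = ssum (\<lambda>y w. ssum (\<lambda>v v2. sg (eG (len v)) (sg (eX (len v2) (len w))
      (M'.P (act_inf X' (g x v) v2) w a))) y) hs"
    unfolding M'.DX_def ssum_assoc by (intro ssum_cong) (auto simp: ssum_sg intro!: ssum_cong)
  also have "\<dots> = ssum (\<lambda>y w. sg (c y w) (M'.P (R3 y) w a)) hs"
  proof (intro ssum_cong)
    fix y w assume h: "hs = y @ w"
    have "sg (c y w) (M'.P (R3 y) w a) =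
        ssum (\<lambda>v v2. sg (c y w) (M'.P (sg (len v * len v2) (act_inf X' (g x v) v2)) w a)) y"
      unfolding R3_def ssum_sg[symmetric] using h n
      by (subst M'.P_ssum_left) (auto intro!: total_sg[OF M'.gX] t3)
    also have "\<dots> = ssum (\<lambda>v v2. sg (eG (len v)) (sg (eX (len v2) (len w))
      (M'.P (act_inf X' (g x v) v2) w a))) y"
    proof (intro ssum_cong)
      fix v v2 assume y: "y = v @ v2"
      have "act_inf X' (g x v) v2 \<in> total X'" using h y n by (intro t3) auto
      then show "sg (c y w) (M'.P (sg (len v * len v2) (act_inf X' (g x v) v2)) w a) =
          sg (eG (len v)) (sg (eX (len v2) (len w)) (M'.P (act_inf X' (g x v) v2) w a))"
        unfolding y c_def using half_add[of "len v + 1" "len v2"]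
        by (simp add: M'.sg_P) (rule sg_cong, auto simp: eX_def eG_def add_ac)
    qed
    finally show "ssum (\<lambda>v v2. sg (eG (len v)) (sg (eX (len v2) (len w))
      (M'.P (act_inf X' (g x v) v2) w a))) y = sg (c y w) (M'.P (R3 y) w a)" ..
  qed
  finally have S3: "?S3 = ssum (\<lambda>y w. sg (c y w) (M'.P (R3 y) w a)) hs" .
  define K where "K u v w1 w2 = (if v = [] then 0 else sg (eH (len u) (len v) (len w1 + len w2))
      (sg (eG (len u + 1 + len w1))
        (M'.P (g (koszul X (len v) x) (map (koszul H (len v)) u @ op v # w1)) w2 a)))" for u v w1 w2
  have "?S2 = ssum (\<lambda>u r. ssum (\<lambda>v w. ssum (\<lambda>w1 w2. K u v w1 w2) w) r) hs"
    by (intro ssum_cong) (auto simp: K_def ssum_sg ssum_0 add_ac intro!: ssum_cong)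
  also have "\<dots> = ssum (\<lambda>y w2. ssum (\<lambda>u r. ssum (\<lambda>v w1. K u v w1 w2) r) y) hs"
    by (rule ssum_group_left)
  also have "\<dots> = ssum (\<lambda>y w. sg (c y w) (M'.P (R2 y) w a)) hs"
  proof (intro ssum_cong)
    fix y w2 assume h: "hs = y @ w2"
    have "sg (c y w2) (M'.P (R2 y) w2 a) =
        ssum (\<lambda>u r. ssum (\<lambda>v w1. sg (c y w2) (M'.P (if v = [] then 0 else sg (len u + 1 + len v * len w1)
      (g (koszul X (len v) x) (map (koszul H (len v)) u @ op v # w1))) w2 a)) r) y"
      unfolding R2_def ssum_sg[symmetric] using h n
      by (subst M'.P_ssum_left, force intro!: M'.ssum_total total_0[OF M'.gX] total_sg[OF M'.gX] t2,
        intro ssum_cong arg_cong[where f = "sg (c y w2)"],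
        subst M'.P_ssum_left, auto intro!: total_0[OF M'.gX] total_sg[OF M'.gX] t2)
    also have "\<dots> = ssum (\<lambda>u r. ssum (\<lambda>v w1. K u v w1 w2) r) y"
    proof (intro ssum_cong)
      fix u r v w1 assume y: "y = u @ r" "r = v @ w1"
      show "sg (c y w2) (M'.P (if v = [] then 0 else sg (len u + 1 + len v * len w1)
        (g (koszul X (len v) x) (map (koszul H (len v)) u @ op v # w1))) w2 a) = K u v w1 w2"
      proof (cases "v = []")
        case False
        have "g (koszul X (len v) x) (map (koszul H (len v)) u @ op v # w1) \<in> total X'"
          using h y n False by (intro t2) auto
        then show ?thesis
          unfolding K_def y c_def using eH_eG[of "len w2" "len u" "len v" "len w1"] False
          by (simp add: M'.sg_P) (rule sg_cong, auto simp: add_ac)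
      qed (simp add: K_def pure_zero_left[OF M'.gX])
    qed
    finally show "ssum (\<lambda>u r. ssum (\<lambda>v w1. K u v w1 w2) r) y = sg (c y w2) (M'.P (R2 y) w2 a)" ..
  qed
  finally have S2: "?S2 = ssum (\<lambda>y w. sg (c y w) (M'.P (R2 y) w a)) hs" .
  show ?thesis
    unfolding S1 S2 S3 ssum_add[symmetric]
  proof (intro ssum_cong)
    fix y w assume h: "hs = y @ w"
    have t: "R1 y \<in> total X'" "R2 y \<in> total X'"
      unfolding R1_def R2_def using h n
      by (force intro!: M'.ssum_total total_0[OF M'.gX] total_sg[OF M'.gX] t1 t2)+
    have "R1 y + R2 y = R3 y" unfolding R1_def R2_def R3_def by (rule g_relation[OF x]) (use h n in simp)
    then show "sg (c y w) (M'.P (R1 y) w a) + sg (c y w) (M'.P (R2 y) w a) = sg (c y w) (M'.P (R3 y) w a)"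
      by (simp only: pure_add_left[OF t, symmetric] sg_add[symmetric])
  qed
qed

text \<open>The block of m^H begins after that of g, so both composites consist of the same terms.
  The Koszul sign between m^H and g equals the change of \<open>eH\<close> when the prefix is
  shortened by the entries that g consumes.\<close>

lemma GB_H:
  assumes x: "x \<in> total X" and n: "length hs \<le> n"
  shows "ssum (\<lambda>u r. ssum (\<lambda>v w. if v = [] then 0 else sg (eH (len u) (len v) (len w))
      (ssum (\<lambda>U1 U2. sg (eG (len U1)) (M'.P (g (koszul X (len v) x) U1) (U2 @ op v # w) a)) (map (koszul H (len v)) u))) r) hs =
    ssum (\<lambda>v w. sg (eG (len v)) (M'.DH (g x v) w a)) hs"
proof -
  define K where "K u1 u2 v w = (if v = [] then 0 else
     sg (eG (len u1) + eH (len u2) (len v) (len w))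
       (M'.P (koszul X' (len v) (g x u1)) (map (koszul H (len v)) u2 @ op v # w) a))" for u1 u2 v w
  have "ssum (\<lambda>u r. ssum (\<lambda>v w. if v = [] then 0 else sg (eH (len u) (len v) (len w))
      (ssum (\<lambda>U1 U2. sg (eG (len U1)) (M'.P (g (koszul X (len v) x) U1) (U2 @ op v # w) a)) (map (koszul H (len v)) u))) r) hs =
    ssum (\<lambda>u r. ssum (\<lambda>v w. ssum (\<lambda>u1 u2. K u1 u2 v w) u) r) hs"
  proof (intro ssum_cong)
    fix u r v w assume h: "hs = u @ r" "r = v @ w"
    show "(if v = [] then 0 else sg (eH (len u) (len v) (len w))
      (ssum (\<lambda>U1 U2. sg (eG (len U1)) (M'.P (g (koszul X (len v) x) U1) (U2 @ op v # w) a)) (map (koszul H (len v)) u))) =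
      ssum (\<lambda>u1 u2. K u1 u2 v w) u"
    proof (cases "v = []")
      case True
      then show ?thesis by (simp add: K_def ssum_0)
    next
      case False
      show ?thesis
        unfolding ssum_map K_def if_not_P[OF False] ssum_sg
      proof (intro ssum_cong)
        fix u1 u2 assume u: "u = u1 @ u2"
        have "length u1 \<le> n" using u h n by simp
        then have k: "M'.P (koszul X' (len v) (g x u1)) ws a =
           sg (len v * len u1) (M'.P (g (koszul X (len v) x) (map (koszul H (len v)) u1)) ws a)" for ws
          by (rule P'_koszul_g[OF x])
        show "sg (eH (len u) (len v) (len w)) (sg (eG (len (map (koszul H (len v)) u1)))
            (M'.P (g (koszul X (len v) x) (map (koszul H (len v)) u1)) (map (koszul H (len v)) u2 @ op v # w) a)) =
          sg (eG (len u1) + eH (len u2) (len v) (len w))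
            (M'.P (koszul X' (len v) (g x u1)) (map (koszul H (len v)) u2 @ op v # w) a)"
          unfolding k sg_sg u
          by (rule sg_cong) (auto simp: eG_def eH_def)
      qed
    qed
  qed
  also have "\<dots> = ssum (\<lambda>u1 s. ssum (\<lambda>u2 r. ssum (\<lambda>v w. K u1 u2 v w) r) s) hs"
    by (rule ssum_slide)
  also have "\<dots> = ssum (\<lambda>v w. sg (eG (len v)) (M'.DH (g x v) w a)) hs"
    unfolding M'.DH_def ssum_sg K_def
    by (intro ssum_cong) auto
  finally show ?thesis .
qed

text \<open>As in \<open>GB_H\<close>, with m^A on a suffix disjoint from the prefix used by
  g.\<close>

lemma GB_A:
  assumes x: "x \<in> total X" and n: "length hs \<le> n"
  shows "ssum (\<lambda>u w. sg (eA (len u) (len w)) (GB (koszul X (len w + 1) x) (map (koszul H (len w + 1)) u) (left w a))) hs =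
    ssum (\<lambda>v r. sg (eG (len v)) (M'.DA (g x v) r a)) hs"
proof -
  have "ssum (\<lambda>u w. sg (eA (len u) (len w)) (GB (koszul X (len w + 1) x) (map (koszul H (len w + 1)) u) (left w a))) hs =
    ssum (\<lambda>v r. ssum (\<lambda>u w. sg (eA (len v + len u) (len w)) (sg (eG (len v))
      (M'.P (g (koszul X (len w + 1) x) (map (koszul H (len w + 1)) v)) (map (koszul H (len w + 1)) u) (left w a)))) r) hs"
    unfolding GB_def ssum_map ssum_sg ssum_assoc[symmetric] by (intro ssum_cong) simp
  also have "\<dots> = ssum (\<lambda>v r. sg (eG (len v)) (M'.DA (g x v) r a)) hs"
    unfolding M'.DA_def ssum_sg
  proof (intro ssum_cong)
    fix v r u w assume h: "hs = v @ r" "r = u @ w"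
    have k: "M'.P (koszul X' (len w + 1) (g x v)) ws b = sg ((len w + 1) * len v)
       (M'.P (g (koszul X (len w + 1) x) (map (koszul H (len w + 1)) v)) ws b)" for ws b
      using h n by (intro P'_koszul_g[OF x]) auto
    show "sg (eA (len v + len u) (len w)) (sg (eG (len v)) (M'.P (g (koszul X (len w + 1) x)
        (map (koszul H (len w + 1)) v)) (map (koszul H (len w + 1)) u) (left w a))) =
      sg (eG (len v)) (sg (eA (len u) (len w)) (M'.P (koszul X' (len w + 1) (g x v))
        (map (koszul H (len w + 1)) u) (left w a)))"
      unfolding k sg_sg h by (rule sg_cong) (auto simp: eA_def)
  qed
  finally show ?thesis .
qed

lemma BM_chain:
  assumes p: "p \<le> n" and x: "x \<in> total X" and hs: "length hs \<le> p"
  shows "BM p (mdiff (B p) (P x hs a)) = mdiff (M'.B p) (BM p (P x hs a))"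
proof -
  have B: "BM p (P y ks b) = GB y ks b" if "length ks \<le> p" for y ks b
    by (rule bar_map_pure[OF p that])
  note Badd = tlin_add[OF tlin_BM] and Bsg = tlin_sg[OF tlin_BM] and Bssum = tlin_ssum[OF tlin_BM]
  have if_add: "(if b then 0 else s + t) = (if b then 0 else s) + (if b then 0 else t)" for b and s t :: "('k, 'x, 'h, 'a) tens"
    by simp
  have n: "length hs \<le> n" using hs p by simp
  have 1: "BM p (DX x hs a) = ssum (\<lambda>v w. sg (eX (len v) (len w)) (GB (act_inf X x v) w a)) hs"
    unfolding DX_def Bssum Bsg
    using hs by (intro ssum_cong arg_cong[where f = "sg _"] B) auto
  have "BM p (DH x hs a) = ssum (\<lambda>u r. ssum (\<lambda>v w. if v = [] then 0 else sg (eH (len u) (len v) (len w))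
     (GB (koszul X (len v) x) (map (koszul H (len v)) u @ op v # w) a)) r) hs"
    unfolding DH_def Bssum
  proof (intro ssum_cong)
    fix u r v w assume h: "hs = u @ r" "r = v @ w"
    show "BM p (if v = [] then 0 else sg (eH (len u) (len v) (len w))
        (P (koszul X (len v) x) (map (koszul H (len v)) u @ op v # w) a)) =
      (if v = [] then 0 else sg (eH (len u) (len v) (len w))
        (GB (koszul X (len v) x) (map (koszul H (len v)) u @ op v # w) a))"
    proof (cases "v = []")
      case False
      have "length (map (koszul H (len v)) u @ op v # w) \<le> length hs"
        by (rule D_word_H[OF _ False]) (simp add: h)
      then have "length (map (koszul H (len v)) u @ op v # w) \<le> p" using hs by simp
      then show ?thesis using False by (simp only: if_False Bsg B)
    qed (simp add: tlin_0[OF tlin_BM])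
  qed
  note 2 = this[unfolded GB_middle sg_add if_add ssum_add]
  have 3: "BM p (DA x hs a) = ssum (\<lambda>u v. sg (eA (len u) (len v)) (GB (koszul X (len v + 1) x) (map (koszul H (len v + 1)) u) (left v a))) hs"
    unfolding DA_def Bssum Bsg
    using hs by (intro ssum_cong arg_cong[where f = "sg _"] B) auto
  have "mdiff (M'.B p) (GB x hs a) = ssum (\<lambda>v w. sg (eG (len v)) (M'.DX (g x v) w a)) hs +
      ssum (\<lambda>v w. sg (eG (len v)) (M'.DH (g x v) w a)) hs + ssum (\<lambda>v w. sg (eG (len v)) (M'.DA (g x v) w a)) hs"
    unfolding GB_def tlin_ssum[OF M'.tlin_D] tlin_sg[OF M'.tlin_D] ssum_add[symmetric] sg_add[symmetric]
    using x hs n p by (intro ssum_cong arg_cong[where f = "sg _"] M'.D_pure g_total) auto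
  also have "\<dots> = BM p (DX x hs a) + BM p (DH x hs a) + BM p (DA x hs a)"
    unfolding 1 2 3 GB_X[OF x n, symmetric] GB_H[OF x n, symmetric] GB_A[OF x n, symmetric]
    by (simp only: add_ac)
  finally show ?thesis
    unfolding B[OF hs] D_pure[OF x hs p] Badd ..
qed

lemma g_pure_deg:
  assumes t: "x \<in> deg X p'" "length hs \<le> n" "homogeneous H ds hs" "a \<in> deg A q" and h: "hs = v @ w"
    and c: "p' + sum_list ds + q + int (length hs) + c = m" "length w \<in> I"
  shows "M'.P (g x v) w a \<in> blk X' H A I c m"
proof -
  obtain d1 d2 where d: "ds = d1 @ d2" "homogeneous H d1 v" "homogeneous H d2 w"
    using t(3) h homogeneous_append by blast
  have "g x v \<in> deg X' (p' + sum_list d1 + (int (length v) + 1) + - 1)"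
    using h t(2) by (intro g_deg t d) simp
  then have "g x v \<in> deg X' (p' + sum_list d1 + int (length v))" by (simp add: algebra_simps)
  then show ?thesis by (rule blkI[OF _ c(2) d(3) t(4)]) (use c(1) in \<open>simp add: d(1) h\<close>)
qed

lemma BM_deg:
  assumes p: "p \<le> n" and t: "x \<in> deg X p'" "length hs \<le> p" "homogeneous H ds hs" "a \<in> deg A q"
    and c: "p' + sum_list ds + q + int (length hs) + c = m"
  shows "BM p (P x hs a) \<in> blk X' H A {..p} c m"
  unfolding bar_map_pure[OF p t(2)] GB_def
  using t p by (intro blk_ssum blk_sg g_pure_deg[OF t(1) _ t(3,4) _ c]) auto

lemma al_deg:
  assumes l: "l \<le> n" and t: "x \<in> deg X p'" "length hs = l" "homogeneous H ds hs" "a \<in> deg A q"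
    and c: "p' + sum_list ds + q + int (length hs) + c = m"
  shows "al l (P x hs a) \<in> blk X' H A {l} c m"
  using t l by (simp add: al_pure) (rule g_pure_deg[OF t(1) _ t(3,4) _ c], auto)

lemma dg_map_al:
  assumes l: "l \<le> n"
  shows "dg_map (R l) (M'.R l) (al l)"
proof (rule dg_map_blkI[OF gX Y_simps(3) Robj_deg Y_simps(4) M'.Y_simps(3) M'.Robj_deg M'.Y_simps(4) tlin_al tlin_dR M'.tlin_dR])
  show "al l (P x hs a) \<in> blk X' H A {l} (- int l) (p + sum_list ds + q + int (length hs) + - int l)"
    if "x \<in> deg X p" "length hs \<in> {l}" "homogeneous H ds hs" "a \<in> deg A q" for x hs a p ds q
    using that(2) by (intro al_deg[OF l that(1) _ that(3,4)]) auto
  show "al l (P x hs (mult A a b)) = ract X' (al l (P x hs a)) b" if "length hs \<in> {l}" for x hs a b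
    using that by (simp add: al_pure ract_pure)
  show "al l (mdiff (R l) (P x hs a)) = mdiff (M'.R l) (al l (P x hs a))"
    if "x \<in> deg X p" "length hs \<in> {l}" for x hs a p
    using that deg_total[OF gX that(1)]
    by (simp add: Mop1_pure[OF l, simplified] M'.Mop1_pure[OF l, simplified] al_pure g_total g_koszul M'.sg_P koszulX_total)
qed

lemma BM_act:
  assumes "p \<le> n" "length hs \<le> p"
  shows "BM p (P x hs (mult A a b)) = ract X' (BM p (P x hs a)) b"
  unfolding bar_map_pure[OF assms] GB_def tlin_ssum[OF tlin_ract] tlin_sg[OF tlin_ract] ract_pure ..

lemma dg_map_BM:
  assumes l: "l \<le> n"
  shows "dg_map (Y l) (M'.Y l) (BM l)"
proof (rule dg_map_blkI[OF gX Y_simps(1) Y_deg Y_simps(2) M'.Y_simps(1) M'.Y_deg M'.Y_simps(2) tlin_BM tlin_dY M'.tlin_dY])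
  show "BM l (P x hs a) \<in> blk X' H A {..l} (- int l) (p + sum_list ds + q + int (length hs) + - int l)"
    if "x \<in> deg X p" "length hs \<in> {..l}" "homogeneous H ds hs" "a \<in> deg A q" for x hs a p ds q
    using that by (intro BM_deg[OF l]) auto
  show "BM l (P x hs (mult A a b)) = ract X' (BM l (P x hs a)) b" if "length hs \<in> {..l}" for x hs a b
    using that by (intro BM_act[OF l]) simp
  show "BM l (mdiff (Y l) (P x hs a)) = mdiff (M'.Y l) (BM l (P x hs a))"
    if "x \<in> deg X p" "length hs \<in> {..l}" for x hs a p
    using BM_chain[OF l deg_total[OF gX that(1)], of hs a] that(2) by (simp add: tlin_sg[OF tlin_BM])
qed

lemma dg_map_BM_shift:
  assumes l: "l \<le> n"
  shows "dg_map (shift (- 1) (Y l)) (shift (- 1) (M'.Y l)) (BM l)"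
proof -
  note Y = dg_module_graded[OF dg_module_Y[OF l]] and Y' = dg_module_graded[OF M'.dg_module_Y[OF l]]
  note tY = graded_total_shift(2)[OF Y, of "-1"]
  note F = dg_map_BM[OF l, unfolded dg_map_def graded_map_def linear_on_def act_linear_def]
  show ?thesis
    unfolding dg_map_def graded_map_def linear_on_def act_linear_def tY
  proof (intro conjI ballI allI)
    show "BM l t \<in> deg (shift (- 1) (M'.Y l)) (m + 0)" if "t \<in> deg (shift (- 1) (Y l)) m" for t m
    proof -
      have "\<forall>m. \<forall>t\<in>deg (Y l) m. BM l t \<in> deg (M'.Y l) (m + 0)" using F by blast
      moreover have "t \<in> deg (Y l) (m + - 1)" using that by simp
      ultimately have "BM l t \<in> deg (M'.Y l) (m + - 1 + 0)" by blast
      then show ?thesis by simp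
    qed
    show "BM l (mdiff (shift (- 1) (Y l)) t) = mdiff (shift (- 1) (M'.Y l)) (BM l t)" if "t \<in> total (Y l)" for t
    proof -
      have "BM l (mdiff (Y l) t) = mdiff (M'.Y l) (BM l t)" using F that by blast
      then have "sg (- 1) (BM l (mdiff (Y l) t)) = sg (- 1) (mdiff (M'.Y l) (BM l t))" by simp
      then show ?thesis by (simp only: shift_simps(3) tlin_sg[OF tlin_BM])
    qed
    show "BM l (act (shift (- 1) (Y l)) t a) = act (shift (- 1) (M'.Y l)) (BM l t) a" if "t \<in> total (Y l)" for t a
      using F that by simp
  qed (simp_all add: tlin_add[OF tlin_BM] tlin_scale[OF tlin_BM])
qed

text \<open>Only the term in which g consumes no entry keeps the full length l; so the top component
  of \<open>B_l(g)\<close> is its diagonal entry.\<close>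

lemma proj_BM:
  assumes l: "l \<le> n" and t: "t \<in> total (Y l)"
  shows "M'.proj l (BM l t) = al l (proj l t)"
proof (rule tlin_eqI[OF gX Y_simps(1) Y_deg t tlin_comp[OF M'.tlin_proj tlin_BM] tlin_comp[OF tlin_al tlin_proj]])
  show "M'.proj l (BM l (P x hs a)) = al l (proj l (P x hs a))" if "length hs \<in> {..l}" for x hs a
  proof -
    have len: "length hs \<le> l" using that by simp
    have "M'.proj l (BM l (P x hs a)) = ssum (\<lambda>v w. if v = [] then
        (if length w = l then M'.P (g x v) w a else 0) else 0) hs"
      unfolding bar_map_pure[OF l len] GB_def tlin_ssum[OF M'.tlin_proj] tlin_sg[OF M'.tlin_proj] M'.proj_pure
      using len by (intro ssum_cong) (auto simp: eG_def)
    also have "\<dots> = (if length hs = l then M'.P (g x []) hs a else 0)" by (rule ssum_if_left)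
    finally show ?thesis by (simp add: proj_pure al_pure tlin_0[OF tlin_al])
  qed
qed

lemma BM_low:
  assumes l: "1 \<le> l" "l \<le> n" and t: "t \<in> total (Y (l - 1))"
  shows "BM l t = BM (l - 1) t"
proof (rule tlin_eqI[OF gX Y_simps(1) Y_deg t tlin_BM tlin_BM])
  show "BM l (P x hs a) = BM (l - 1) (P x hs a)" if "length hs \<in> {..l - 1}" for x hs a
    using that l by (simp add: bar_map_pure)
qed

context
  fixes l :: nat
  assumes l: "1 \<le> l" "l \<le> n"
begin

text \<open>On \<open>R_l\<close> write \<open>B_l(g)\<close> as its diagonal entry plus S, where S
  takes values in \<open>Y'_(l-1)\<close>. Expanding both sides of the chain map property of
  \<open>B_l(g)\<close> there and cancelling the differentials of \<open>R_l\<close> and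
  \<open>R'_l\<close> leaves the homotopy formula for S; the differential of \<open>Y'_l\<close> is
  minus that of \<open>Y'_(l-1)\<close>, which gives the right sign.\<close>

lemma homotopic_imp:
  "homotopic (R l) (M'.Y (l - 1)) (\<lambda>t. M'.imp l (al l t)) (\<lambda>t. BM (l - 1) (imp l t))"
  unfolding homotopic_def
proof (intro conjI exI[of _ "\<lambda>t. BM l t - al l t"] ballI)
  note mR = dg_module_Robj[OF l(2)] and mR' = M'.dg_module_Robj[OF l(2)]
    and mZ = dg_module_Y[OF l1[OF l]] and mZ' = M'.dg_module_Y[OF l1[OF l]]
    and mY = dg_module_Y[OF l(2)] and mY' = M'.dg_module_Y[OF l(2)]
  show "dg_map (R l) (M'.Y (l - 1)) (\<lambda>t. M'.imp l (al l t))"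
    by (rule dg_map_comp[OF mR mR' dg_map_al[OF l(2)] M'.dg_map_imp[OF l]])
  show "dg_map (R l) (M'.Y (l - 1)) (\<lambda>t. BM (l - 1) (imp l t))"
    by (rule dg_map_comp[OF mR mZ dg_map_imp[OF l] dg_map_BM[OF l1[OF l]]])
  have tS: "tlin (\<lambda>t. BM l t - al l t)" by (rule tlin_diffI[OF tlin_BM tlin_al])
  have S_pure: "BM l (P x hs a) - al l (P x hs a) \<in> blk X' H A {..l - 1} c m"
    if "x \<in> deg X p" "length hs = l" "homogeneous H ds hs" "a \<in> deg A q"
      "p + sum_list ds + q + int (length hs) + c = m" for x hs a p ds q c m
  proof (rule M'.blk_low[OF _ _ l(1)])
    have "al l (P x hs a) \<in> blk X' H A {..l} c m"
      using that l(2) by (simp add: al_pure) (rule g_pure_deg[OF that(1) _ that(3,4) _ that(5)], auto)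
    then show "BM l (P x hs a) - al l (P x hs a) \<in> blk X' H A {..l} c m"
      using that by (intro T.subspace_diff[OF subspace_blk] BM_deg[OF l(2) that(1) _ that(3,4,5)]) auto
    have "P x hs a \<in> total (Y l)" using that deg_total[OF gX that(1)] by (intro pure_total[OF gX Y_simps(1) Y_deg]) auto
    then show "M'.proj l (BM l (P x hs a) - al l (P x hs a)) = 0"
      using that(2) by (simp add: tlin_diff[OF M'.tlin_proj] proj_BM[OF l(2)] proj_pure al_pure M'.proj_pure)
  qed
  show gS: "graded_map 1 (R l) (M'.Y (l - 1)) (\<lambda>t. BM l t - al l t)"
  proof (rule graded_map_blkI[OF Y_simps(3) Robj_deg M'.Y_simps(1) M'.Y_deg tS])
    show "BM l (P x hs a) - al l (P x hs a) \<in> blk X' H A {..l - 1} (- int (l - 1)) (p + sum_list ds + q + int (length hs) + - int l + 1)"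
      if "x \<in> deg X p" "length hs \<in> {l}" "homogeneous H ds hs" "a \<in> deg A q" for x hs a p ds q
      using that l(1) by (intro S_pure) (auto simp: of_nat_diff)
  qed
  show "act_linear (R l) (M'.Y (l - 1)) (\<lambda>t. BM l t - al l t)"
    by (rule act_linear_blkI[OF gX Y_simps(3) Robj_deg Y_simps(4) M'.Y_simps(2) tS])
      (simp add: BM_act[OF l(2)] al_pure ract_pure tlin_diff[OF tlin_ract])
  fix t assume t: "t \<in> total (R l)"
  have tY: "t \<in> total (Y l)" by (rule R_Y[OF l t])
  let ?S = "\<lambda>t. BM l t - al l t"
  have St: "?S t \<in> total (M'.Y (l - 1))"
    by (rule graded_map_total[OF dg_module_graded[OF mR] dg_module_graded[OF mZ'] gS t])
  have alt: "al l t \<in> total (M'.R l)" by (rule dg_map_total[OF mR mR' dg_map_al[OF l(2)] t])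
  have it: "imp l t \<in> total (Y (l - 1))" by (rule dg_map_total[OF mR mZ dg_map_imp[OF l] t])
  have "mdiff (M'.Y l) (BM l t) = mdiff (M'.Y l) (al l t) + mdiff (M'.Y l) (?S t)"
    using tlin_add[OF M'.tlin_dY, of l "al l t" "?S t"] by simp
  also have "\<dots> = mdiff (M'.R l) (al l t) + M'.imp l (al l t) - mdiff (M'.Y (l - 1)) (?S t)"
    unfolding M'.mdiff_Y_R[OF l alt] M'.mdiff_Y_Z[OF l St] by simp
  finally have 1: "mdiff (M'.Y l) (BM l t) = \<dots>" .
  have "mdiff (M'.Y l) (BM l t) = BM l (mdiff (Y l) t)"
    using dg_map_BM[OF l(2)] tY unfolding dg_map_def by simp
  also have "\<dots> = BM l (mdiff (R l) t) + BM (l - 1) (imp l t)"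
    unfolding mdiff_Y_R[OF l t] tlin_add[OF tlin_BM] BM_low[OF l it] ..
  finally have 2: "mdiff (M'.Y l) (BM l t) = \<dots>" .
  have 3: "al l (mdiff (R l) t) = mdiff (M'.R l) (al l t)"
    using dg_map_al[OF l(2)] t unfolding dg_map_def by blast
  show "M'.imp l (al l t) - BM (l - 1) (imp l t) = mdiff (M'.Y (l - 1)) (?S t) + ?S (mdiff (R l) t)"
    using 1 unfolding 2 3 by (simp add: algebra_simps del: shift_simps)
qed

end

end

section \<open>Free modules and exactness\<close>

context kad
begin

lemma homology: "homology_of A H cls"
  and op_cls: "diff A a = 0 \<Longrightarrow> diff A b = 0 \<Longrightarrow> ops H [cls a, cls b] = cls (mult A a b)"
  and qi: "ainf_quasi_iso H (dga_ainf A) f"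
  using kadeishvili by (auto simp: kadeishvili_model_def)

abbreviation bnd where "bnd \<equiv> range (diff A)"

lemma bnd_diff: "a \<in> bnd \<Longrightarrow> b \<in> bnd \<Longrightarrow> a - b \<in> bnd"
proof -
  assume "a \<in> bnd" "b \<in> bnd"
  then obtain a' b' where ab: "a = diff A a'" "b = diff A b'" by auto
  have "diff A (a' - b') = a - b" using diff_add[of "a' - b'" b'] by (simp add: ab)
  then show ?thesis by (metis rangeI)
qed

lemma bnd_add: "a \<in> bnd \<Longrightarrow> b \<in> bnd \<Longrightarrow> a + b \<in> bnd"
  by (auto simp: diff_add[symmetric])

lemma f1_add: "f [h + h'] = f [h] + f [h']" and f1_scale: "f [scale H c h] = scale A c (f [h])"
  using fn_add[of "[]" h h' "[]"] fn_scale[of "[]" c h "[]"] by (simp_all add: fn_def)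

lemma f1_diff: "f [h - h'] = f [h] - f [h']"
  using f1_add[of "h - h'" h'] by simp

lemma f1_0: "f [0] = 0"
  using f1_add[of 0 0] by simp

lemma f1_deg: "h \<in> deg H p \<Longrightarrow> f [h] \<in> deg A p"
  using fn_deg[of "[p]" "[h]"] by (simp add: fn_def homogeneous_def)

lemma fn_zero: "fn [0] = 0" "fn [0, x] = 0" "fn [x, 0] = 0" "fn [0, x, y] = 0" "fn [x, 0, y] = 0" "fn [x, y, 0] = 0"
  using fn_0[of "[]" "[]"] fn_0[of "[]" "[x]"] fn_0[of "[x]" "[]"] fn_0[of "[]" "[x, y]"] fn_0[of "[x]" "[y]"]
    fn_0[of "[x, y]" "[]"] by simp_all

lemma fn_eq_f: "fn (h # hs) = f (h # hs)"
  by (simp add: fn_def)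

lemma d_f1: "diff A (f [h]) = 0"
  using fn_relation[of "[h]"] by (simp add: ssum_Cons fn_zero) (simp add: fn_eq_f)

text \<open>f_1 is multiplicative up to the boundary of f_2: this is the morphism relation in arity
  2.\<close>

lemma f1_mult: "f [ops H [h, h']] = diff A (f [h, h']) + mult A (f [h]) (f [h'])"
proof -
  have "koszul H 2 h = h" by (rule koszul_even[OF gH]) (simp_all add: tH)
  then have "fn [op [h, h']] = diff A (fn [h, h']) + mult A (fn [h]) (fn [h'])"
    using fn_relation[of "[h, h']"] by (simp add: ssum_Cons fn_zero sg_even)
  then show ?thesis by (simp add: fn_eq_f op_def)
qed

lemma ops_dga: "ops (dga_ainf A) [y] = diff A y"
  by (simp add: dga_ainf_def)

lemma mult_diff_right: "mult A a (b - c) = mult A a b - mult A a c"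
  using mult_add_right[of a "b - c" c] by simp

lemma mult_diff_left: "mult A (b - c) a = mult A b a - mult A c a"
  using mult_add_left[of "b - c" c a] by simp

lemma f1_inj: "f [h] \<in> bnd \<Longrightarrow> h = 0"
  using qi unfolding ainf_quasi_iso_def by (auto simp: ops1 ops_dga)

lemma f1_surj: "diff A a = 0 \<Longrightarrow> \<exists>h. a - f [h] \<in> bnd"
  using qi unfolding ainf_quasi_iso_def by (simp add: ops1 ops_dga)

lemma cls_surj: "\<exists>a. diff A a = 0 \<and> cls a = h"
proof -
  have "h \<in> total H" by (simp add: tH)
  with gH show ?thesis
  proof (induction rule: total_induct)
    case (deg p h)
    then have "h \<in> cls ` {a \<in> deg A p. diff A a = 0}" using homology by (simp add: homology_of_def)
    then show ?case by auto
  next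
    case (add h h')
    then obtain a a' where "diff A a = 0" "cls a = h" "diff A a' = 0" "cls a' = h'" by auto
    then show ?case using homology
      by (intro exI[of _ "a + a'"]) (auto simp: homology_of_def diff_add)
  qed
qed

lemma diff_unit: "diff A (unit A) = 0"
  using leibniz_deg[OF unit_deg, of "unit A"] by (simp add: unit_left unit_right)

lemma op_unit_left: "ops H [cls (unit A), h] = h"
  using cls_surj[of h] op_cls[OF diff_unit] by (auto simp: unit_left)

lemma mult_bnd_left: "diff A z = 0 \<Longrightarrow> b \<in> bnd \<Longrightarrow> mult A z b \<in> bnd"
proof -
  assume z: "diff A z = 0" and "b \<in> bnd"
  then obtain b' where b: "b = diff A b'" by auto
  have "diff A (mult A (koszul A 1 z) b') = mult A z b"
    by (simp add: leibniz diff_koszul z koszul_koszul[OF gA] tA koszul_even[OF gA] b)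
  then show ?thesis by (metis rangeI)
qed

lemma mult_bnd_right: "diff A z = 0 \<Longrightarrow> b \<in> bnd \<Longrightarrow> mult A b z \<in> bnd"
proof -
  assume z: "diff A z = 0" and "b \<in> bnd"
  then obtain b' where b: "b = diff A b'" by auto
  have "diff A (mult A b' z) = mult A b z" by (simp add: leibniz z b)
  then show ?thesis by (metis rangeI)
qed

text \<open>Over a field the differential has a linear section on the boundaries, which may be
  prescribed on a homogeneous basis of them and extended to A. On boundaries it raises degrees by
  one, so k d preserves degrees.\<close>

lemma exists_homotopy:
  "\<exists>k. (\<forall>a b. k (a + b) = k a + k b) \<and> (\<forall>c a. k (scale A c a) = scale A c (k a)) \<and>
     (\<forall>a. diff A (k (diff A a)) = diff A a) \<and> (\<forall>p. \<forall>a\<in>deg A p. k (diff A a) \<in> deg A p)"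
proof -
  interpret V: vector_space "scale A" by (rule graded_vs) (rule gA)
  interpret VV: vector_space_pair "scale A" "scale A" ..
  \<comment> \<open>A regraded by its boundaries: a homogeneous basis of V is a homogeneous basis of
    the space of boundaries.\<close>
  define V where "V = A\<lparr>deg := \<lambda>p. diff A ` deg A (p + 1)\<rparr>"
  have V_simps: "scale V = scale A" "\<And>p. deg V p = diff A ` deg A (p + 1)" by (simp_all add: V_def)
  have gV: "graded V"
    unfolding graded_def V_simps(1)
  proof (intro conjI allI impI)
    show "vector_space (scale A)" by (rule graded_vs) (rule gA)
    show "V.subspace (deg V p)" for p
      unfolding V_simps(2)
    proof (rule V.subspaceI)
      have "diff A 0 \<in> diff A ` deg A (p + 1)" by (rule imageI) (rule deg_0[OF gA])
      then show "0 \<in> diff A ` deg A (p + 1)" by simp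
    next
      fix x y assume "x \<in> diff A ` deg A (p + 1)" "y \<in> diff A ` deg A (p + 1)"
      then obtain a b where "x = diff A a" "y = diff A b" "a \<in> deg A (p + 1)" "b \<in> deg A (p + 1)" by blast
      then show "x + y \<in> diff A ` deg A (p + 1)"
        using V.subspace_add[OF graded_subspace[OF gA], of a "p + 1" b] by (auto simp: diff_add[symmetric])
    next
      fix c x assume "x \<in> diff A ` deg A (p + 1)"
      then obtain a where "x = diff A a" "a \<in> deg A (p + 1)" by blast
      then show "scale A c x \<in> diff A ` deg A (p + 1)"
        using V.subspace_scale[OF graded_subspace[OF gA], of a "p + 1" c] by (auto simp: diff_scale[symmetric])
    qed
    fix c m assume "decomposes V 0 c"
    moreover have "diff A ` deg A (p + 1) \<subseteq> deg A p" for p using diff_deg[of _ "p + 1"] by auto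
    ultimately have "decomposes A 0 c" unfolding decomposes_def V_simps by blast
    then show "c m = 0" using gA unfolding graded_def by blast
  qed
  obtain D \<delta> where D': "\<not> module.dependent (scale V) D" "total V = module.span (scale V) D"
    "\<And>p. deg V p = module.span (scale V) {b \<in> D. \<delta> b = p}"
    using homogeneous_basis[OF gV] by blast
  note D = D'[unfolded V_simps(1)]
  have dV: "diff A a \<in> V.span D" for a
  proof -
    have "a \<in> total A" by (simp add: tA)
    with gA show ?thesis
    proof (induction rule: total_induct)
      case (deg p a)
      then have "diff A a \<in> deg V (p - 1)" by (simp add: V_simps)
      then show ?case using deg_total[OF gV] D(2) by blast
    next
      case (add a b)
      then show ?case by (simp add: diff_add V.span_add)
    qed
  qed
  have "\<forall>b\<in>D. \<exists>a. a \<in> deg A (\<delta> b + 1) \<and> diff A a = b"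
  proof
    fix b assume b: "b \<in> D"
    have "b \<in> deg V (\<delta> b)" unfolding D(3) by (rule V.span_base) (simp add: b)
    then show "\<exists>a. a \<in> deg A (\<delta> b + 1) \<and> diff A a = b" unfolding V_simps by blast
  qed
  then obtain k0 where k0: "\<And>b. b \<in> D \<Longrightarrow> k0 b \<in> deg A (\<delta> b + 1) \<and> diff A (k0 b) = b" by metis
  obtain k where k: "Vector_Spaces.linear (scale A) (scale A) k" "\<And>b. b \<in> D \<Longrightarrow> k b = k0 b"
    using VV.linear_independent_extend[OF D(1), of k0] by blast
  interpret k: Vector_Spaces.linear "scale A" "scale A" k by (rule k(1))
  have 1: "diff A (k x) = x" if "x \<in> V.span D" for x
    using that
  proof (induction rule: V.span_induct_alt)
    case base
    then show ?case by (simp add: k.zero)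
  next
    case (step c x y)
    then show ?case using k0 k(2) by (simp add: k.add k.scale diff_add diff_scale)
  qed
  have 2: "k (diff A a) \<in> deg A p" if "a \<in> deg A p" for a p
  proof -
    have "diff A a \<in> deg V (p - 1)" using that by (simp add: V_simps)
    then have "diff A a \<in> V.span {b \<in> D. \<delta> b = p - 1}" by (simp add: D(3))
    then show ?thesis
    proof (induction rule: V.span_induct_alt)
      case base
      then show ?case by (simp add: k.zero deg_0[OF gA])
    next
      case (step c x y)
      then have "k x \<in> deg A p" using k0[of x] k(2)[of x] by auto
      then show ?case using step graded_subspace[OF gA, of p]
        by (simp add: k.add k.scale V.subspace_add V.subspace_scale)
    qed
  qed
  show ?thesis
    by (intro exI[of _ k] conjI allI ballI k.add k.scale 1[OF dV] 2)
qed

definition hk where "hk = (SOME k. (\<forall>a b. k (a + b) = k a + k b) \<and> (\<forall>c a. k (scale A c a) = scale A c (k a)) \<and>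
     (\<forall>a. diff A (k (diff A a)) = diff A a) \<and> (\<forall>p. \<forall>a\<in>deg A p. k (diff A a) \<in> deg A p))"

lemma hk_add: "hk (a + b) = hk a + hk b"
  and hk_scale: "hk (scale A c a) = scale A c (hk a)"
  and diff_hk_diff: "diff A (hk (diff A a)) = diff A a"
  and hk_diff_deg: "a \<in> deg A p \<Longrightarrow> hk (diff A a) \<in> deg A p"
  using someI_ex[OF exists_homotopy] unfolding hk_def[symmetric] by blast+

definition cyc where "cyc a = a - hk (diff A a)"

lemma hk_0: "hk 0 = 0"
  using hk_add[of 0 0] by simp

lemma cyc_add: "cyc (a + b) = cyc a + cyc b"
  by (simp add: cyc_def diff_add hk_add)

lemma cyc_scale: "cyc (scale A c a) = scale A c (cyc a)"
proof -
  interpret V: vector_space "scale A" by (rule graded_vs) (rule gA)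
  show ?thesis by (simp add: cyc_def diff_scale hk_scale V.scale_right_diff_distrib)
qed

lemma diff_minus: "diff A (a - b) = diff A a - diff A b"
  using diff_add[of "a - b" b] by simp

lemma diff_cyc: "diff A (cyc a) = 0"
  by (simp add: cyc_def diff_minus diff_hk_diff)

lemma cyc_cycle: "diff A a = 0 \<Longrightarrow> cyc a = a"
  by (simp add: cyc_def hk_0)

lemma cyc_deg: "a \<in> deg A p \<Longrightarrow> cyc a \<in> deg A p"
proof -
  interpret V: vector_space "scale A" by (rule graded_vs) (rule gA)
  show "a \<in> deg A p \<Longrightarrow> cyc a \<in> deg A p"
    unfolding cyc_def by (intro V.subspace_diff[OF graded_subspace[OF gA]] hk_diff_deg)
qed

text \<open>The class of \<open>cyc a\<close> read in H through the inverse of H(f_1). It is defined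
  on all of A, not only on cycles, because a linear map on tensors must be given on every element of
  the last slot.\<close>

definition lam where "lam a = (SOME h. cyc a - f [h] \<in> bnd)"

lemma lam_bnd: "cyc a - f [lam a] \<in> bnd"
  unfolding lam_def by (rule someI_ex) (rule f1_surj[OF diff_cyc])

lemma lam_eqI: "cyc a - f [h] \<in> bnd \<Longrightarrow> lam a = h"
proof -
  assume "cyc a - f [h] \<in> bnd"
  from bnd_diff[OF this lam_bnd[of a]] have "f [lam a - h] \<in> bnd" by (simp add: f1_diff)
  then have "lam a - h = 0" by (rule f1_inj)
  then show ?thesis by simp
qed

lemma lam_add: "lam (a + b) = lam a + lam b"
proof (rule lam_eqI)
  show "cyc (a + b) - f [lam a + lam b] \<in> bnd"
    using bnd_add[OF lam_bnd[of a] lam_bnd[of b]] by (simp add: cyc_add f1_add algebra_simps)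
qed

lemma lam_scale: "lam (scale A c a) = scale H c (lam a)"
proof (rule lam_eqI)
  interpret V: vector_space "scale A" by (rule graded_vs) (rule gA)
  obtain b where "cyc a - f [lam a] = diff A b" using lam_bnd[of a] by auto
  then have "cyc (scale A c a) - f [scale H c (lam a)] = diff A (scale A c b)"
    by (simp add: cyc_scale f1_scale diff_scale V.scale_right_diff_distrib[symmetric])
  then show "cyc (scale A c a) - f [scale H c (lam a)] \<in> bnd" by simp
qed

lemma lam_cycle: "diff A a = 0 \<Longrightarrow> a - f [lam a] \<in> bnd"
  using lam_bnd[of a] by (simp add: cyc_cycle)

lemma lam_diff: "lam (diff A a) = 0"
  by (rule lam_eqI) (simp add: cyc_cycle diff_diff f1_0)

lemma lam_mult_left: "diff A a = 0 \<Longrightarrow> lam (mult A (f [h]) a) = ops H [h, lam a]"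
proof (rule lam_eqI)
  assume a: "diff A a = 0"
  have "mult A (f [h]) (a - f [lam a]) \<in> bnd" by (rule mult_bnd_left[OF d_f1 lam_cycle[OF a]])
  then have "mult A (f [h]) a - mult A (f [h]) (f [lam a]) \<in> bnd"
    by (simp add: mult_diff_right)
  from bnd_diff[OF this, of "diff A (f [h, lam a])"]
  have "mult A (f [h]) a - f [ops H [h, lam a]] \<in> bnd" by (simp add: f1_mult algebra_simps)
  then show "cyc (mult A (f [h]) a) - f [ops H [h, lam a]] \<in> bnd"
    by (simp add: cyc_cycle leibniz d_f1 a)
qed

lemma lam_mult_right: "diff A a = 0 \<Longrightarrow> lam (mult A a (f [h])) = ops H [lam a, h]"
proof (rule lam_eqI)
  assume a: "diff A a = 0"
  have "mult A (a - f [lam a]) (f [h]) \<in> bnd" by (rule mult_bnd_right[OF d_f1 lam_cycle[OF a]])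
  then have "mult A a (f [h]) - mult A (f [lam a]) (f [h]) \<in> bnd"
    by (simp add: mult_diff_left)
  from bnd_diff[OF this, of "diff A (f [lam a, h])"]
  have "mult A a (f [h]) - f [ops H [lam a, h]] \<in> bnd" by (simp add: f1_mult algebra_simps)
  then show "cyc (mult A a (f [h])) - f [ops H [lam a, h]] \<in> bnd"
    by (simp add: cyc_cycle leibniz d_f1 a)
qed

text \<open>Let e be the class of 1 and h = \<open>lam (unit A)\<close>. Modulo boundaries f_1(e) =
  f_1(e) 1 = f_1(e) f_1(h) = f_1(eh) = f_1(h), because e is a left unit of H; f_1 is injective on
  homology.\<close>

lemma lam_unit: "lam (unit A) = cls (unit A)"
proof -
  let ?e = "cls (unit A)" and ?h = "lam (unit A)"
  have "mult A (f [?e]) (unit A - f [?h]) \<in> bnd" by (rule mult_bnd_left[OF d_f1 lam_cycle[OF diff_unit]])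
  then have "f [?e] - mult A (f [?e]) (f [?h]) \<in> bnd"
    by (simp add: unit_right mult_diff_right)
  from bnd_diff[OF this, of "diff A (f [?e, ?h])"]
  have "f [?e] - f [ops H [?e, ?h]] \<in> bnd" by (simp add: f1_mult algebra_simps)
  then have "f [?e - ?h] \<in> bnd" by (simp add: op_unit_left f1_diff)
  from f1_inj[OF this] show ?thesis by simp
qed

text \<open>Surjectivity of H(f_1) yields an h without control of its degree. The part of degree p
  of the equation z - f_1(h) = d b shows that the component of h in degree p represents the same
  class, so it equals h by uniqueness.\<close>

lemma lam_deg:
  assumes a: "a \<in> deg A p"
  shows "lam a \<in> deg H p"
proof -
  interpret V: vector_space "scale A" by (rule graded_vs) (rule gA)
  let ?z = "cyc a" and ?h = "lam a"
  obtain b where b: "?z - f [?h] = diff A b" using lam_bnd[of a] by auto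
  have "?h \<in> total H" "b \<in> total A" by (simp_all add: tH tA)
  then obtain ch cb where ch: "decomposes H ?h ch" and cb: "decomposes A b cb" unfolding total_def by blast
  \<comment> \<open>d lowers degrees, so the part of b in degree m contributes in degree m -
    1.\<close>
  define N where "N = insert p ({m. ch m \<noteq> 0} \<union> (\<lambda>m. m - 1) ` {m. cb m \<noteq> 0})"
  have fin: "finite N" using ch cb by (simp add: N_def decomposes_def)
  have h: "?h = (\<Sum>m\<in>N. ch m)" by (rule decomposes_sum_on[OF ch fin]) (auto simp: N_def)
  have b': "b = (\<Sum>m\<in>(\<lambda>m. m + 1) ` N. cb m)"
    by (rule decomposes_sum_on[OF cb]) (use fin in \<open>force simp: N_def\<close>)+
  have b'': "b = (\<Sum>m\<in>N. cb (m + 1))" unfolding b' by (subst sum.reindex) auto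
  define e where "e m = (if m = p then ?z else 0) - f [ch m] - diff A (cb (m + 1))" for m
  have "(\<Sum>m\<in>N. e m) = ?z - f [\<Sum>m\<in>N. ch m] - diff A (\<Sum>m\<in>N. cb (m + 1))"
    using fin additive_sum[of "\<lambda>h. f [h]" ch N, OF f1_add] additive_sum[of "diff A" "\<lambda>m. cb (m + 1)" N, OF diff_add]
    by (simp add: e_def sum_subtractf N_def)
  also have "\<dots> = 0" using b unfolding h[symmetric] b''[symmetric] by simp
  finally have 0: "(\<Sum>m\<in>N. e m) = 0" .
  have "e m \<in> deg A m" for m
  proof -
    have "ch m \<in> deg H m" "cb (m + 1) \<in> deg A (m + 1)" using ch cb by (simp_all add: decomposes_def)
    then have "f [ch m] \<in> deg A m" "diff A (cb (m + 1)) \<in> deg A m" using f1_deg diff_deg[of _ "m + 1"] by auto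
    moreover have "(if m = p then ?z else 0) \<in> deg A m" using cyc_deg[OF a] deg_0[OF gA] by auto
    ultimately show ?thesis unfolding e_def by (intro V.subspace_diff[OF graded_subspace[OF gA]])
  qed
  then have "e p = 0" by (rule graded_independent[OF gA fin _ 0]) (simp add: N_def)
  then have "?z - f [ch p] = diff A (cb (p + 1))" by (simp add: e_def)
  then have "?h = ch p" by (intro lam_eqI) simp
  moreover have "ch p \<in> deg H p" using ch unfolding decomposes_def by blast
  ultimately show ?thesis by (simp only:)
qed

end

section \<open>Freeness of \<open>R_l\<close>\<close>

context kadmod
begin

lemma sum_ract_subspace:
  "module.subspace tscale {t. \<exists>F c. finite F \<and> F \<subseteq> S \<and> t = (\<Sum>b\<in>F. ract X b (c b))}" (is "T.subspace ?W")
  if S: "S \<subseteq> total (R l)" and l: "l \<le> n" for S l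
proof (rule T.subspaceI)
  note M = dg_module_Robj[OF l]
  have act_add: "ract X b (a + a') = ract X b a + ract X b a'"
    and act_scale: "ract X b (scale A r a) = tscale r (ract X b a)" and act_0: "ract X b 0 = 0"
    if "b \<in> S" for b a a' r
  proof -
    have "linear_on A (R l) (ract X b)" using dg_moduleD(3)[OF M] S that by (auto simp: subset_iff)
    then have 1: "ract X b (a + a') = ract X b a + ract X b a'" and 2: "ract X b (scale A r a) = tscale r (ract X b a)" for a a'
      by (auto simp: linear_on_def tA)
    show "ract X b (a + a') = ract X b a + ract X b a'" by (rule 1)
    show "ract X b (scale A r a) = tscale r (ract X b a)" by (rule 2)
    show "ract X b 0 = 0" using 1[of 0 0] by simp
  qed
  show "0 \<in> ?W" by (intro CollectI exI[of _ "{}"]) simp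
  show "s + t \<in> ?W" if "s \<in> ?W" "t \<in> ?W" for s t
  proof -
    obtain F c F' c' where F: "finite F" "F \<subseteq> S" "s = (\<Sum>b\<in>F. ract X b (c b))"
      "finite F'" "F' \<subseteq> S" "t = (\<Sum>b\<in>F'. ract X b (c' b))" using \<open>s \<in> ?W\<close> \<open>t \<in> ?W\<close> by blast
    define d where "d b = (if b \<in> F then c b else 0) + (if b \<in> F' then c' b else 0)" for b
    have "(\<Sum>b\<in>F \<union> F'. ract X b (d b)) = (\<Sum>b\<in>F \<union> F'. if b \<in> F then ract X b (c b) else 0) +
        (\<Sum>b\<in>F \<union> F'. if b \<in> F' then ract X b (c' b) else 0)"
      unfolding sum.distrib[symmetric] d_def using F(2,5) by (intro sum.cong refl) (auto simp: act_add)
    also have "(\<Sum>b\<in>F \<union> F'. if b \<in> F then ract X b (c b) else 0) = s"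
      unfolding F(3) using F(1,4) by (intro sum.mono_neutral_cong_right) auto
    also have "(\<Sum>b\<in>F \<union> F'. if b \<in> F' then ract X b (c' b) else 0) = t"
      unfolding F(6) using F(1,4) by (intro sum.mono_neutral_cong_right) auto
    finally show ?thesis using F(1,2,4,5) by (intro CollectI exI[of _ "F \<union> F'"] exI[of _ d]) auto
  qed
  show "tscale r t \<in> ?W" if "t \<in> ?W" for r t
  proof -
    obtain F c where F: "finite F" "F \<subseteq> S" "t = (\<Sum>b\<in>F. ract X b (c b))" using \<open>t \<in> ?W\<close> by blast
    have "tscale r t = (\<Sum>b\<in>F. ract X b (scale A r (c b)))"
      unfolding F(3) T.scale_sum_right using F(2) by (intro sum.cong refl) (auto simp: act_scale)
    then show ?thesis using F(1,2) by (intro CollectI exI[of _ F] exI[of _ "\<lambda>b. scale A r (c b)"]) simp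
  qed
qed

text \<open>The basis consists of the x \<otimes> hs \<otimes> 1 with x and the entries of hs in
  homogeneous bases. These are cycles since the differential of \<open>R_l\<close> only meets the
  last slot and d 1 = 0.\<close>

lemma dg_free_Robj:
  assumes l: "l \<le> n"
  shows "dg_free A (R l)"
proof -
  interpret VX: vector_space "scale X" by (rule graded_vs) (rule gX)
  interpret VH: vector_space "scale H" by (rule graded_vs) (rule gH)
  interpret VA: vector_space "scale A" by (rule graded_vs) (rule gA)
  obtain BX dX where BX: "VX.independent BX" "total X = VX.span BX"
    "\<And>n. deg X n = VX.span {b \<in> BX. dX b = n}" using homogeneous_basis[OF gX] by blast
  obtain BH dH where BH: "VH.independent BH" "total H = VH.span BH"
    "\<And>n. deg H n = VH.span {b \<in> BH. dH b = n}" using homogeneous_basis[OF gH] by blast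
  obtain BA dA where BA: "VA.independent BA" "total A = VA.span BA"
    "\<And>n. deg A n = VA.span {b \<in> BA. dA b = n}" using homogeneous_basis[OF gA] by blast
  define S where "S = {P x hs (unit A) | x hs. x \<in> BX \<and> set hs \<subseteq> BH \<and> length hs = l}"
  have BXt: "BX \<subseteq> total X" using BX(2) VX.span_base by auto
  have "\<exists>xh. b \<in> S \<longrightarrow> b = P (fst xh) (snd xh) (unit A) \<and> fst xh \<in> BX \<and> set (snd xh) \<subseteq> BH \<and> length (snd xh) = l" for b
    unfolding S_def by fastforce
  then obtain rep where rep: "\<And>b. b \<in> S \<Longrightarrow> b = P (fst (rep b)) (snd (rep b)) (unit A) \<and>
      fst (rep b) \<in> BX \<and> set (snd (rep b)) \<subseteq> BH \<and> length (snd (rep b)) = l" by metis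
  have act_rep: "ract X b a = P (fst (rep b)) (snd (rep b)) a" if "b \<in> S" for b a
    using rep[OF that] ract_pure[of X "fst (rep b)" "snd (rep b)" "unit A" a] by (simp add: unit_left)
  have St: "S \<subseteq> total (R l)"
    unfolding S_def using BXt by (auto intro!: pure_total[OF gX Y_simps(3) Robj_deg])
  have act0: "ract X b 0 = 0" if "b \<in> S" for b
    using rep[OF that] BXt by (auto simp: act_rep[OF that] pure_zero_right subset_iff)
  note M = dg_module_Robj[OF l]
  show ?thesis
    unfolding dg_free_def
  proof (intro conjI M exI[of _ S] ballI)
    fix b assume "b \<in> S"
    then obtain x hs where b: "b = P x hs (unit A)" "x \<in> BX" "set hs \<subseteq> BH" "length hs = l" unfolding S_def by blast
    have x: "x \<in> total X" using b(2) BXt by auto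
    show "mdiff (R l) b = 0"
      using Mop1_pure[OF l x, of hs "unit A"] b(4) by (simp add: b(1) diff_unit pure_zero_right koszulX_total x)
    have "x \<in> deg X (dX x)" using b(2) by (auto simp: BX(3) intro: VX.span_base)
    moreover have "homogeneous H (map dH hs) hs"
      using b(3) by (auto simp: homogeneous_def list_all2_conv_all_nth BH(3) intro!: VH.span_base)
    ultimately have "b \<in> blk X H A {l} (- int l) (dX x + sum_list (map dH hs) + 0 + int (length hs) + - int l)"
      unfolding b(1) using b(4) by (intro blkI[OF _ _ _ unit_deg]) auto
    then show "\<exists>p. b \<in> deg (R l) p" by (auto simp: Robj_deg)
  next
    fix t assume t: "t \<in> total (R l)"
    let ?W = "{t. \<exists>F c. finite F \<and> F \<subseteq> S \<and> t = (\<Sum>b\<in>F. ract X b (c b))}"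
    have W: "T.subspace ?W" by (rule sum_ract_subspace[OF St l])
    have "P x hs a \<in> ?W" if "x \<in> total X" "length hs \<in> {l}" for x hs a
    proof (rule span_pure[OF W gX gH gA BXt])
      show "x \<in> VX.span BX" using that BX(2) by simp
      show "list_all2 (\<lambda>h S. h \<in> VH.span S) hs (replicate l BH)"
        using that BH(2) tH by (auto simp: list_all2_conv_all_nth)
      show "a \<in> VA.span UNIV" by (simp add: VA.span_UNIV)
      show "P x' hs' a' \<in> ?W" if "x' \<in> BX" "list_all2 (\<lambda>h S. h \<in> S) hs' (replicate l BH)" for x' hs' a'
      proof -
        have "set hs' \<subseteq> BH" "length hs' = l" using that(2) by (auto simp: list_all2_conv_all_nth in_set_conv_nth)
        then have "P x' hs' (unit A) \<in> S" using that(1) by (auto simp: S_def)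
        moreover have "P x' hs' a' = (\<Sum>b\<in>{P x' hs' (unit A)}. ract X b a')" by (simp add: ract_pure unit_left)
        ultimately show ?thesis by (intro CollectI exI[of _ "{P x' hs' (unit A)}"] exI[of _ "\<lambda>_. a'"]) simp
      qed
    qed
    then have "total (R l) \<subseteq> ?W"
      unfolding total_blk[OF gX gH tH gA tA Y_simps(3) Robj_deg] by (intro T.span_minimal W) auto
    then obtain F c where F: "finite F" "F \<subseteq> S" "t = (\<Sum>b\<in>F. ract X b (c b))" using t by blast
    define c0 where "c0 b = (if b \<in> F then c b else 0)" for b
    have supp: "{b. c0 b \<noteq> 0} \<subseteq> F" by (auto simp: c0_def)
    have t0: "t = (\<Sum>b | c0 b \<noteq> 0. ract X b (c0 b))"
      unfolding F(3) using F(1) supp act0 F(2) by (intro sum.mono_neutral_cong_right) (auto simp: c0_def)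
    show "\<exists>!c. finite {b. c b \<noteq> 0} \<and> {b. c b \<noteq> 0} \<subseteq> S \<and> t = (\<Sum>b | c b \<noteq> 0. act (R l) b (c b))"
    proof (rule ex1I[of _ c0], intro conjI)
      show "finite {b. c0 b \<noteq> 0}" using supp F(1) by (rule finite_subset)
      show "{b. c0 b \<noteq> 0} \<subseteq> S" using supp F(2) by simp
      show "t = (\<Sum>b | c0 b \<noteq> 0. act (R l) b (c0 b))" using t0 by simp
      fix c1 assume c1: "finite {b. c1 b \<noteq> 0} \<and> {b. c1 b \<noteq> 0} \<subseteq> S \<and> t = (\<Sum>b | c1 b \<noteq> 0. act (R l) b (c1 b))"
      define G where "G = F \<union> {b. c1 b \<noteq> 0}"
      have G: "finite G" "G \<subseteq> S" using F c1 by (auto simp: G_def)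
      have s0: "t = (\<Sum>b\<in>G. ract X b (c0 b))"
        unfolding t0 using G supp act0 by (intro sum.mono_neutral_left) (auto simp: G_def)
      have s1: "t = (\<Sum>b\<in>G. ract X b (c1 b))"
        using c1 G act0 by (simp, intro sum.mono_neutral_left) (auto simp: G_def)
      show "c1 = c0"
      proof
        fix b0
        show "c1 b0 = c0 b0"
        proof (cases "b0 \<in> G")
          case False
          then show ?thesis by (auto simp: G_def c0_def)
        next
          case True
          then have b0: "b0 \<in> S" using G by auto
          \<comment> \<open>Evaluating both expansions at the form dual to \<open>b0\<close>, with
            the coordinate \<open>y\<close> in the last slot, isolates one coordinate of the
            coefficient of \<open>b0\<close>.\<close>
          have coef: "VA.representation BA (c1 b0) y = VA.representation BA (c0 b0) y" for y
          proof -
            define C where "C = coef_form (VX.representation BX) (VH.representation BH)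
              (\<lambda>a. VA.representation BA a y) (fst (rep b0)) (snd (rep b0))"
            have form: "form X H A C"
              unfolding C_def using BX BH BA tH tA
              by (auto intro!: form_coef simp: VX.representation_add VX.representation_scale VH.representation_add
                VH.representation_scale VA.representation_add VA.representation_scale)
            have ev: "(\<Sum>b\<in>G. h b) C = (\<Sum>b\<in>G. h b C)" for h :: "_ \<Rightarrow> ('k, 'x, 'h, 'a) tens"
              using G(1) by induction (auto simp: zero_fun_def plus_fun_def)
            have val: "(ract X b a) C = (if b = b0 then VA.representation BA a y else 0)" if "b \<in> G" for b a
            proof -
              have b: "b \<in> S" using that G by auto
              have "list_coef (VH.representation BH) (snd (rep b0)) (snd (rep b)) = (if snd (rep b) = snd (rep b0) then 1 else 0)"
                using rep[OF b] rep[OF b0] BH(1) by (intro list_coef_delta[of BH]) (auto simp: VH.representation_basis)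
              moreover have "VX.representation BX (fst (rep b)) (fst (rep b0)) = (if fst (rep b) = fst (rep b0) then 1 else 0)"
                using rep[OF b] rep[OF b0] BX(1) by (auto simp: VX.representation_basis)
              moreover have "b = b0 \<longleftrightarrow> fst (rep b) = fst (rep b0) \<and> snd (rep b) = snd (rep b0)"
                using rep[OF b] rep[OF b0] by metis
              ultimately show ?thesis
                using form by (auto simp: act_rep[OF b] pure_tensor_def C_def coef_form_def)
            qed
            have "(\<Sum>b\<in>G. (ract X b (c1 b)) C) = (\<Sum>b\<in>G. (ract X b (c0 b)) C)"
              using s0 s1 ev by metis
            then show ?thesis using val True G(1) by simp
          qed
          have "c1 b0 \<in> VA.span BA" "c0 b0 \<in> VA.span BA" using BA(2) tA by auto
          then show ?thesis
            using coef VA.sum_nonzero_representation_eq[OF BA(1)] by (metis (no_types, lifting) ext)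
        qed
      qed
    qed
  qed
qed

end

section \<open>The homology of \<open>R_i\<close> and the contraction of the bar resolution\<close>

context kadmod
begin

lemma multilinear_op_right:
  assumes k: "\<And>a b. k (a + b) = k a + k b" "\<And>c a. k (scale A c a) = scale A c (k a)"
  shows "multilinear_op X X H A S (\<lambda>(x, hs, a). (koszul X e x, map (koszul H e) hs, k a))"
proof -
  note t = koszulX_total
  have tk: "h \<in> total H" for h by (simp add: tH)
  note kk = koszul_add[OF gX] koszul_scale[OF gX] koszul_add[OF gH] koszul_scale[OF gH]
  show ?thesis
    unfolding multilinear_op_def tuple_multilinear_def by (auto simp: kk t tk k)
qed

lemma multilinear_op_append:
  "multilinear_op X X H A S (\<lambda>(x, hs, a). (x, hs @ [lam a], unit A))"
proof -
  have "F (x, hs @ [lam (a + b)], unit A) = F (x, hs @ [lam a], unit A) + F (x, hs @ [lam b], unit A)"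
    "F (x, hs @ [lam (scale A c a)], unit A) = c * F (x, hs @ [lam a], unit A)"
    if F: "form X H A F" and x: "x \<in> total X" for F :: "('x, 'h, 'a) tuple \<Rightarrow> 'k" and x hs a b c
    using F x unfolding tuple_multilinear_def lam_add lam_scale by blast+
  then show ?thesis
    unfolding multilinear_op_def
    by (intro allI impI) (simp (no_asm_use) add: tuple_multilinear_def, auto)
qed

text \<open>\<open>con\<close> is a contraction of \<open>H\<^sub>*(R\<^sub>n) \<rightarrow> \<dots> \<rightarrow> H\<^sub>*(R\<^sub>0) \<rightarrow> X\<close>, the extra degeneracy
  \<open>x \<otimes> hs \<otimes> a \<mapsto> x \<otimes> hs \<otimes> [a] \<otimes> 1\<close> of the bar resolution.\<close>

definition con where "con i = push X H A {i} (\<lambda>(x, hs, a). (x, hs @ [lam a], unit A))"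
text \<open>\<open>cp\<close>, \<open>hp\<close> and \<open>flp\<close> change only the last slot,
  up to Koszul signs: to its cycle part, by the splitting homotopy, and to the representative of its
  class under f_1. The trivial \<open>koszul\<close> with exponent 0 lets
  \<open>multilinear_op_right\<close> cover all three.\<close>

definition cp where "cp = push X H A UNIV (\<lambda>(x, hs, a). (koszul X 0 x, map (koszul H 0) hs, cyc a))"
definition hp where "hp = push X H A UNIV (\<lambda>(x, hs, a). (koszul X 1 x, map (koszul H 1) hs, hk a))"
definition flp where "flp = push X H A UNIV (\<lambda>(x, hs, a). (koszul X 0 x, map (koszul H 0) hs, f [lam a]))"

lemma tlin_con: "tlin (con i)" and tlin_cp: "tlin cp" and tlin_hp: "tlin hp" and tlin_flp: "tlin flp"
  unfolding con_def cp_def hp_def flp_def by (rule tlin_push)+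

lemma con_pure: "length hs = i \<Longrightarrow> con i (P x hs a) = P x (hs @ [lam a]) (unit A)"
  unfolding con_def by (subst push_pure[OF multilinear_op_append]) simp

lemma koszulX_0: "x \<in> total X \<Longrightarrow> koszul X 0 x = x"
  by (rule koszul_even[OF gX]) simp_all

lemma map_koszul_0: "map (koszul H 0) hs = hs"
  by (rule map_koszul_even) simp

lemma cp_pure: "x \<in> total X \<Longrightarrow> cp (P x hs a) = P x hs (cyc a)"
  unfolding cp_def by (subst push_pure[OF multilinear_op_right[OF cyc_add cyc_scale]]) (simp add: koszulX_0 map_koszul_0)

lemma hp_pure: "hp (P x hs a) = P (koszul X 1 x) (map (koszul H 1) hs) (hk a)"
  unfolding hp_def by (subst push_pure[OF multilinear_op_right[OF hk_add hk_scale]]) simp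

lemma flp_pure: "x \<in> total X \<Longrightarrow> flp (P x hs a) = P x hs (f [lam a])"
  unfolding flp_def
  by (subst push_pure[OF multilinear_op_right[of "\<lambda>a. f [lam a]"]])
    (simp_all add: koszulX_0 map_koszul_0 lam_add f1_add lam_scale f1_scale)

lemma koszul_1_1: "x \<in> total X \<Longrightarrow> koszul X 1 (koszul X 1 x) = x" "map (koszul H 1) (map (koszul H 1) hs) = hs"
  using koszulX[of x 1 1] koszul_even[OF gX, of x 2] map_koszul_koszul[of 1 1 hs] map_koszul_even[of 2 hs]
  by (simp_all del: map_map)

text \<open>Over a field the cycles of \<open>X \<otimes> H\<^sup>\<otimes>\<^sup>i \<otimes> A\<close> are \<open>X \<otimes> H\<^sup>\<otimes>\<^sup>i \<otimes> Z(A)\<close>, because \<open>cyc\<close> is a projection of \<open>A\<close> onto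
  its cycles.\<close>

lemma cp_cycle:
  assumes i: "i \<le> n" and z: "z \<in> cycles (R i)"
  shows "cp z = z"
proof -
  have zt: "z \<in> total (R i)" and z0: "Mop A H f X i 1 z = 0" using z by (simp_all add: cycles_def)
  \<comment> \<open>This is a = \<open>cyc a + hk (diff A a)\<close> in the last slot; the Koszul
    sign in \<open>hp\<close> undoes the one in the differential of \<open>R_i\<close>.\<close>
  have "z = cp z + hp (Mop A H f X i 1 z)"
  proof (rule tlin_eqI[OF gX Y_simps(3) Robj_deg zt tlin_id tlin_addI[OF tlin_cp tlin_comp[OF tlin_hp tlin_Mop]]])
    fix x hs a p ds q
    assume *: "x \<in> deg X p" "length hs \<in> {i}" "homogeneous H ds hs" "a \<in> deg A q"
    note x = deg_total[OF gX *(1)]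
    have "hp (Mop A H f X i 1 (P x hs a)) = P x hs (hk (diff A a))"
      using *(2) Mop1_pure[OF i x, of hs a] koszul_1_1(1)[OF x] koszul_1_1(2)[of hs] by (simp add: hp_pure del: map_map)
    then have "cp (P x hs a) + hp (Mop A H f X i 1 (P x hs a)) = P x hs (cyc a + hk (diff A a))"
      by (simp add: cp_pure[OF x] pure_add_right[OF x])
    then show "P x hs a = cp (P x hs a) + hp (Mop A H f X i 1 (P x hs a))" by (simp add: cyc_def)
  qed
  then show ?thesis unfolding z0 tlin_0[OF tlin_hp] by simp
qed

text \<open>A cycle equals its image under \<open>cp\<close>, which is a combination of pure tensors
  with a cycle in the last slot.\<close>

lemma cycle_induct [consumes 2, case_names pure add scale zero]:
  assumes i: "i \<le> n" and z: "z \<in> cycles (R i)"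
    and pure: "\<And>x hs a. x \<in> total X \<Longrightarrow> length hs = i \<Longrightarrow> diff A a = 0 \<Longrightarrow> Q (P x hs a)"
    and add: "\<And>s t. Q s \<Longrightarrow> Q t \<Longrightarrow> Q (s + t)" and scale: "\<And>c t. Q t \<Longrightarrow> Q (tscale c t)" and 0: "Q 0"
  shows "Q z"
proof -
  have zt: "z \<in> total (R i)" using z by (simp add: cycles_def)
  have "Q (cp z)"
  proof (rule blk_hom_induct[OF gX Y_simps(3) Robj_deg zt])
    show "Q (cp (P x hs a))" if "x \<in> deg X p" "length hs \<in> {i}" for x hs a p
      using pure[OF deg_total[OF gX that(1)], of hs "cyc a"] that by (simp add: cp_pure[OF deg_total[OF gX that(1)]] diff_cyc)
  qed (simp_all add: tlin_add[OF tlin_cp] tlin_scale[OF tlin_cp] tlin_0[OF tlin_cp] add scale 0)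
  then show ?thesis by (simp add: cp_cycle[OF i z])
qed

lemma boundaries_closed:
  assumes i: "i \<le> n"
  shows "0 \<in> boundaries (R i)"
    "s \<in> boundaries (R i) \<Longrightarrow> t \<in> boundaries (R i) \<Longrightarrow> s + t \<in> boundaries (R i)"
    "t \<in> boundaries (R i) \<Longrightarrow> tscale c t \<in> boundaries (R i)"
    "t \<in> boundaries (R i) \<Longrightarrow> - t \<in> boundaries (R i)"
    "t \<in> boundaries (R i) \<Longrightarrow> sg e t \<in> boundaries (R i)"
proof -
  note g = dg_module_graded[OF dg_module_Robj[OF i]]
  have "T.subspace (boundaries (R i))"
  proof (rule T.subspaceI)
    show "0 \<in> boundaries (R i)" unfolding boundaries_def
      using total_0[OF g] tlin_0[OF tlin_dR] by (auto intro!: image_eqI[of _ _ 0] simp: tlin_0[OF tlin_Mop])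
    show "s + t \<in> boundaries (R i)" if "s \<in> boundaries (R i)" "t \<in> boundaries (R i)" for s t
    proof -
      obtain s' t' where "s = mdiff (R i) s'" "t = mdiff (R i) t'" "s' \<in> total (R i)" "t' \<in> total (R i)"
        using \<open>s \<in> boundaries (R i)\<close> \<open>t \<in> boundaries (R i)\<close> unfolding boundaries_def by blast
      then show ?thesis unfolding boundaries_def
        by (intro image_eqI[of _ _ "s' + t'"]) (simp_all add: Mop_add total_add[OF g])
    qed
    show "tscale c t \<in> boundaries (R i)" if "t \<in> boundaries (R i)" for c t
    proof -
      obtain t' where "t = mdiff (R i) t'" "t' \<in> total (R i)"
        using \<open>t \<in> boundaries (R i)\<close> unfolding boundaries_def by blast
      then show ?thesis unfolding boundaries_def
        using total_scale[OF g, of t' c] by (intro image_eqI[of _ _ "tscale c t'"]) (simp_all add: Mop_scale)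
    qed
  qed
  note S = this
  show "0 \<in> boundaries (R i)" "s \<in> boundaries (R i) \<Longrightarrow> t \<in> boundaries (R i) \<Longrightarrow> s + t \<in> boundaries (R i)"
    "t \<in> boundaries (R i) \<Longrightarrow> tscale c t \<in> boundaries (R i)" "t \<in> boundaries (R i) \<Longrightarrow> - t \<in> boundaries (R i)"
    "t \<in> boundaries (R i) \<Longrightarrow> sg e t \<in> boundaries (R i)"
    using T.subspace_0[OF S] T.subspace_add[OF S] T.subspace_scale[OF S] T.subspace_neg[OF S]
      subspace_sg[OF vector_space_tscale S] by blast+
qed

text \<open>A cycle in the last slot differs from the f_1-representative of its class by a boundary
  of A, and this boundary can be taken inside the tensor.\<close>

lemma cycle_flp:
  assumes i: "i \<le> n" and z: "z \<in> cycles (R i)"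
  shows "z - flp z \<in> boundaries (R i)"
  using i z
proof (induction rule: cycle_induct)
  case (pure x hs a)
  obtain b where b: "a - f [lam a] = diff A b" using lam_cycle[OF pure(3)] by auto
  have kx: "koszul X 1 x \<in> total X" by (rule koszulX_total[OF pure(1)])
  have "P x hs (a - f [lam a]) + P x hs (f [lam a]) = P x hs a"
    using pure_add_right[OF pure(1), of H A hs "a - f [lam a]" "f [lam a]"] by simp
  then have "P x hs a - flp (P x hs a) = P x hs (a - f [lam a])"
    unfolding flp_pure[OF pure(1)] by (simp only: diff_eq_eq)
  also have "\<dots> = Mop A H f X i 1 (P (koszul X 1 x) (map (koszul H 1) hs) b)"
    using Mop1_pure[OF i kx, of "map (koszul H 1) hs" b] pure(2) koszul_1_1(1)[OF pure(1)] koszul_1_1(2)[of hs]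
    by (simp add: b del: map_map)
  finally show ?case
    unfolding boundaries_def
    using pure_total[OF gX Y_simps(3) Robj_deg kx, of "map (koszul H 1) hs" i b] pure(2) by simp
next
  case (add s t)
  have "s + t - flp (s + t) = (s - flp s) + (t - flp t)" by (simp add: tlin_add[OF tlin_flp])
  then show ?case using boundaries_closed(2)[OF i add] by (simp only:)
next
  case (scale c t)
  then show ?case using boundaries_closed(3)[OF i, of "t - flp t" c] by (simp add: tlin_scale[OF tlin_flp] T.scale_right_diff_distrib)
next
  case zero
  then show ?case by (simp add: tlin_0[OF tlin_flp] boundaries_closed(1)[OF i])
qed

lemma con_cycle:
  assumes i: "i + 1 \<le> n" and z: "z \<in> total (R i)"
  shows "con i z \<in> cycles (R (i + 1))"
proof (rule blk_hom_induct[OF gX Y_simps(3) Robj_deg z])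
  note g = dg_module_graded[OF dg_module_Robj[OF i]]
  show "con i (P x hs a) \<in> cycles (R (i + 1))" if "x \<in> deg X p" "length hs \<in> {i}" for x hs a p
    using that deg_total[OF gX that(1)] pure_total[OF gX Y_simps(3) Robj_deg deg_total[OF gX that(1)], of "hs @ [lam a]" "i + 1" "unit A"]
    by (simp add: con_pure cycles_def Mop1_pure[OF i, simplified] diff_unit pure_zero_right koszulX_total)
  show "con i (s + t) \<in> cycles (R (i + 1))" if "con i s \<in> cycles (R (i + 1))" "con i t \<in> cycles (R (i + 1))" for s t
    using that total_add[OF g] by (simp add: cycles_def tlin_add[OF tlin_con] Mop_add)
  show "con i (tscale c t) \<in> cycles (R (i + 1))" if "con i t \<in> cycles (R (i + 1))" for c t
    using that total_scale[OF g, of "con i t" c] by (simp add: cycles_def tlin_scale[OF tlin_con] Mop_scale)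
  show "con i 0 \<in> cycles (R (i + 1))" using total_0[OF g] by (simp add: cycles_def tlin_0[OF tlin_con] Mop_0)
qed

lemma con_boundary:
  assumes i: "i \<le> n" and t: "t \<in> total (R i)"
  shows "con i (Mop A H f X i 1 t) = 0"
proof (rule tlin_eqI[OF gX Y_simps(3) Robj_deg t tlin_comp[OF tlin_con tlin_Mop]])
  show "tlin (\<lambda>t. 0 :: ('k, 'x, 'h, 'a) tens)" by (rule tlinI) simp_all
  show "con i (Mop A H f X i 1 (P x hs a)) = 0" if "x \<in> deg X p" "length hs \<in> {i}" for x hs a p
    using that deg_total[OF gX that(1)]
    by (simp add: Mop1_pure[OF i, simplified] con_pure lam_diff pure_zero_middle koszulX_total)
qed

text \<open>Up to the sign (-1)^(i+1) this is the contracting homotopy formula. The last insertion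
  multiplies the class \<open>lam a\<close> back onto the new unit and returns x \<otimes> hs
  \<otimes> f_1(lam a); all other insertions commute with appending \<open>lam a\<close>.\<close>

lemma contraction:
  assumes i: "1 \<le> i" "i + 1 \<le> n" and x: "x \<in> total X" and hs: "length hs = i" and a: "diff A a = 0"
  shows "Mop A H f X (i + 1) 2 (con i (P x hs a)) =
    con (i - 1) (Mop A H f X i 2 (P x hs a)) + sg (int (i + 1)) (P x hs (f [lam a]))"
proof -
  let ?l = "lam a"
  let ?T = "\<lambda>b. pure_tensor X H A (bar_term A H f X (i + 1) 2 b (x, hs @ [?l], unit A))"
  have "Mop A H f X (i + 1) 2 (con i (P x hs a)) = (\<Sum>b = 0..i + 1. sg (int b) (?T b))"
    using i hs Mop_pure[of 2 "i + 1" x "hs @ [?l]" "unit A"] by (simp add: con_pure)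
  also have "\<dots> = (\<Sum>b = 0..i. sg (int b) (?T b)) + sg (int (i + 1)) (?T (i + 1))" by simp
  also have "?T (i + 1) = P x hs (f [?l])"
    using hs by (simp add: bar_term_def koszulX_0[OF x] map_koszul_0 left_op_def unit_right sg_even)
  also have "(\<Sum>b = 0..i. sg (int b) (?T b)) = con (i - 1) (Mop A H f X i 2 (P x hs a))"
  proof -
    have "con (i - 1) (pure_tensor X H A (bar_term A H f X i 2 b (x, hs, a))) = ?T b" if b: "b \<le> i" for b
    proof -
      consider "b = 0" | "0 < b" "b < i" | "b = i" using b by linarith
      then show ?thesis
      proof cases
        case 1
        obtain h t where ht: "hs = h # t" using hs i(1) by (cases hs) auto
        show ?thesis using hs 1 by (simp add: ht bar_term_def con_pure)
      next
        case 2
        then have b1: "b - 1 + 2 \<le> length hs" using hs by simp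
        have "insert_op H (b - 1) 2 (hs @ [?l]) = insert_op H (b - 1) 2 hs @ [?l]"
          using b1 by (simp add: insert_op_def)
        moreover have "length (insert_op H (b - 1) 2 hs) = i - 1" using b1 hs by (simp add: insert_op_def)
        ultimately show ?thesis using 2 hs by (simp add: bar_term_def con_pure)
      next
        \<comment> \<open>The last entry h meets a, by multiplication with f_1(h) in A on one side
          and by the product of H with \<open>lam a\<close> on the other;
          \<open>lam_mult_left\<close> identifies the results.\<close>
        case 3
        obtain us h where uh: "hs = us @ [h]" using hs i(1) by (cases hs rule: rev_cases) auto
        have u: "length us = i - 1" and iu: "i = Suc (length us)" using hs uh by simp_all
        have "con (i - 1) (pure_tensor X H A (bar_term A H f X i 2 b (x, hs, a))) = P x (us @ [lam (mult A (f [h]) a)]) (unit A)"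
          using 3 iu by (simp add: bar_term_def uh koszulX_0[OF x] map_koszul_0 left_op_def sg_even con_pure)
        also have "\<dots> = ?T b"
          using 3 iu by (simp add: bar_term_def uh koszulX_0[OF x] map_koszul_0 insert_op_def lam_mult_left[OF a])
        finally show ?thesis .
      qed
    qed
    then show ?thesis
      using i hs by (simp add: Mop_pure tlin_sum[OF tlin_con] tlin_sg[OF tlin_con])
  qed
  finally show ?thesis .
qed

text \<open>The bottom of the contraction: the insertion of m^X now yields the augmentation x
  \<open>lam a\<close>, followed by the section x \<mapsto> x \<otimes> 1 of the
  augmentation.\<close>

lemma contraction_0:
  assumes n: "1 \<le> n" and x: "x \<in> total X"
  shows "Mop A H f X 1 2 (con 0 (P x [] a)) = P (act_inf X x [lam a]) [] (unit A) - P x [] (f [lam a])"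
proof -
  have "Mop A H f X 1 2 (con 0 (P x [] a)) = (\<Sum>b = 0..1. sg (int b) (pure_tensor X H A (bar_term A H f X 1 2 b (x, [lam a], unit A))))"
    using n Mop_pure[of 2 1 x "[lam a]" "unit A"] by (simp add: con_pure)
  also have "\<dots> = P (act_inf X x [lam a]) [] (unit A) - P x [] (f [lam a])"
    by (simp add: bar_term_def koszulX_0[OF x] left_op_def unit_right sg_even sg_odd)
  finally show ?thesis .
qed

lemma Mop2_1:
  assumes n: "1 \<le> n" and x: "x \<in> total X"
  shows "Mop A H f X 1 2 (P x [h] a) = P (act_inf X x [h]) [] a - P x [] (mult A (f [h]) a)"
proof -
  have "Mop A H f X 1 2 (P x [h] a) = (\<Sum>b = 0..1. sg (int b) (pure_tensor X H A (bar_term A H f X 1 2 b (x, [h], a))))"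
    using n Mop_pure[of 2 1 x "[h]" a] by simp
  also have "\<dots> = P (act_inf X x [h]) [] a - P x [] (mult A (f [h]) a)"
    by (simp add: bar_term_def koszulX_0[OF x] left_op_def sg_even sg_odd)
  finally show ?thesis .
qed

lemma proj_imp_R:
  assumes l: "1 \<le> l" "l \<le> n" and t: "t \<in> total (R l)"
  shows "proj (l - 1) (imp l t) = Mop A H f X l 2 t"
  by (rule tlin_eqI[OF gX Y_simps(3) Robj_deg t tlin_comp[OF tlin_proj tlin_imp] tlin_Mop])
    (use proj_imp(2)[OF _ l(2,1)] in auto)

lemma dg_map_Mop2:
  assumes l: "1 \<le> l" "l \<le> n"
  shows "dg_map (R l) (R (l - 1)) (Mop A H f X l 2)"
proof (rule dg_map_cong[OF dga])
  show "dg_module A (R l)" by (rule dg_module_Robj[OF l(2)])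
  show "dg_map (R l) (R (l - 1)) (\<lambda>t. proj (l - 1) (imp l t))"
    by (rule dg_map_comp[OF dg_module_Robj[OF l(2)] dg_module_Y[OF l1[OF l]] dg_map_imp[OF l] dg_map_proj[OF l1[OF l]]])
qed (rule proj_imp_R[OF l, symmetric])

text \<open>For a cycle y the element i_(i+1) y is a cycle of \<open>Y_i\<close> with top component
  M_{i+1,2} y. The \<open>R_(i-1)\<close> component of its differential expresses M_{i,2} M_{i+1,2}
  y as the boundary of the next component, which is M_{i+1,3} y up to sign.\<close>

lemma Mop2_Mop2:
  assumes i: "1 \<le> i" "i + 1 \<le> n" and y: "y \<in> cycles (R (i + 1))"
  shows "Mop A H f X i 2 (Mop A H f X (i + 1) 2 y) \<in> boundaries (R (i - 1))"
proof -
  have i': "i \<le> n" "1 \<le> i + 1" "i - 1 \<le> n" using i by simp_all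
  have yt: "y \<in> total (R (i + 1))" and y0: "mdiff (R (i + 1)) y = 0" using y by (simp_all add: cycles_def)
  let ?w = "imp (i + 1) y"
  note mR = dg_module_Robj[OF i'(1)] and mY = dg_module_Y[OF i'(1)] and mR' = dg_module_Robj[OF i'(3)] and mY' = dg_module_Y[OF i'(3)]
  have dgw: "dg_map (R (i + 1)) (Y i) (imp (i + 1))" using dg_map_imp[OF i'(2) i(2)] by simp
  have wt: "?w \<in> total (Y i)" by (rule dg_map_total[OF dg_module_Robj[OF i(2)] mY dgw yt])
  have "mdiff (Y i) ?w = imp (i + 1) (mdiff (R (i + 1)) y)" using dgw yt unfolding dg_map_def by metis
  then have w0: "mdiff (Y i) ?w = 0" unfolding y0 by (simp add: tlin_0[OF tlin_imp])
  define t where "t = Mop A H f X (i + 1) 2 y"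
  have pt: "proj i ?w = t" using proj_imp_R[OF i'(2) i(2) yt] by (simp add: t_def)
  have tt: "t \<in> total (R i)" unfolding pt[symmetric] by (rule dg_map_total[OF mY mR dg_map_proj[OF i'(1)] wt])
  define w' where "w' = ?w - t"
  have w't: "w' \<in> total (Y (i - 1))" unfolding w'_def pt[symmetric] by (rule diff_proj[OF i(1) i'(1) wt])
  have "0 = mdiff (Y i) t + mdiff (Y i) w'"
    using tlin_add[OF tlin_dY[of i], of t w'] w0 by (simp add: w'_def del: shift_simps)
  also have "\<dots> = mdiff (R i) t + imp i t - mdiff (Y (i - 1)) w'"
    unfolding mdiff_Y_R[OF i(1) i'(1) tt] mdiff_Y_Z[OF i(1) i'(1) w't] by simp
  finally have "proj (i - 1) (mdiff (R i) t + imp i t - mdiff (Y (i - 1)) w') = proj (i - 1) 0" by simp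
  then have "proj (i - 1) (mdiff (R i) t) + Mop A H f X i 2 t - proj (i - 1) (mdiff (Y (i - 1)) w') = 0"
    by (simp only: tlin_add[OF tlin_proj] tlin_diff[OF tlin_proj] tlin_0[OF tlin_proj] proj_imp_R[OF i(1) i'(1) tt])
  moreover have "proj (i - 1) s = 0" if "s \<in> total (R i)" for s
  proof (rule tlin_eqI[OF gX Y_simps(3) Robj_deg that tlin_proj])
    show "tlin (\<lambda>t. 0 :: ('k, 'x, 'h, 'a) tens)" by (rule tlinI) simp_all
  qed (use i in \<open>auto simp: proj_pure\<close>)
  then have "proj (i - 1) (mdiff (R i) t) = 0" using mdiff_total[OF mR tt] by blast
  moreover have "proj (i - 1) (mdiff (Y (i - 1)) w') = mdiff (R (i - 1)) (proj (i - 1) w')"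
    using dg_map_proj[OF i'(3)] w't unfolding dg_map_def by blast
  ultimately have "Mop A H f X i 2 t = mdiff (R (i - 1)) (proj (i - 1) w')" by simp
  moreover have "proj (i - 1) w' \<in> total (R (i - 1))" by (rule dg_map_total[OF mY' mR' dg_map_proj[OF i'(3)] w't])
  ultimately show ?thesis unfolding t_def boundaries_def by blast
qed

text \<open>The augmentation x \<otimes> a \<mapsto> x \<open>lam a\<close> of the bar resolution,
  obtained from the universal property of the tensors.\<close>

lemma exists_augmentation:
  assumes n: "1 \<le> n"
  shows "\<exists>L. (\<forall>s t. L (s + t) = L s + L t) \<and> (\<forall>c t. L (tscale c t) = scale X c (L t)) \<and>
    (\<forall>x\<in>total X. \<forall>a. L (P x [] a) = act_inf X x [lam a])"
proof -
  define F where "F = (\<lambda>(x, hs :: 'h list, a). if hs = [] then act_inf X x [lam a] else 0)"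
  interpret VX: vector_space "scale X" by (rule graded_vs) (rule gX)
  have add: "act_inf X x [h + h'] = act_inf X x [h] + act_inf X x [h']"
    and sc: "act_inf X x [scale H c h] = scale X c (act_inf X x [h])" if "x \<in> total X" for x h h' c
    using act_add_middle[of "[]" "[]" x h h'] module_maps_scale_middle[OF act_maps gX gX gH tH, of "[]" "[]" x c h] n that by auto
  have F: "tuple_multilinear X H A (scale X) F"
    unfolding tuple_multilinear_def F_def
    using n by (auto simp: act_add_left act_scale_left lam_add lam_scale add sc)
  obtain L where L: "Vector_Spaces.linear tscale (scale X) L" "\<forall>x\<in>total X. \<forall>hs a. L (P x hs a) = F (x, hs, a)"
    using tensor_universal[OF VX.vector_space_axioms F] by blast
  interpret L: Vector_Spaces.linear tscale "scale X" L by (rule L(1))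
  show ?thesis using L.add L.scale L(2) by (intro exI[of _ L]) (auto simp: F_def)
qed

lemma augmented_exact_bar:
  assumes n: "1 \<le> n"
  shows "\<exists>\<epsilon>. augmented_exact (\<lambda>h. f [h]) n X (bar_postnikov A H f X) \<epsilon>"
proof -
  obtain L where L: "\<And>s t. L (s + t) = L s + L t" "\<And>c t. L (tscale c t) = scale X c (L t)"
    "\<And>x a. x \<in> total X \<Longrightarrow> L (P x [] a) = act_inf X x [lam a]"
    using exists_augmentation[OF n] by blast
  interpret VX: vector_space "scale X" by (rule graded_vs) (rule gX)
  have L0: "L 0 = 0" using L(1)[of 0 0] by simp
  have Ldiff: "L (s - t) = L s - L t" for s t using L(1)[of "s - t" t] by simp
  have act1_t: "act_inf X x [h] \<in> total X" if "x \<in> total X" for x h using that n by (intro act_total) auto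
  have act1_0: "act_inf X x [0] = 0" if "x \<in> total X" for x using act_zero_middle[of "[]" "[]" x] that n by simp
  have Lt: "L t \<in> total X" if "t \<in> total (R 0)" for t
  proof (rule blk_hom_induct[OF gX Y_simps(3) Robj_deg that])
    show "L (P x hs a) \<in> total X" if "x \<in> deg X p" "length hs \<in> {0}" for x hs a p
      using that deg_total[OF gX that(1)] act1_t by (simp add: L(3))
  qed (simp_all add: L L0 total_add[OF gX] total_scale[OF gX] total_0[OF gX])
  note m0 = dg_module_Robj[of 0, simplified] and m1 = dg_module_Robj[OF n]
  have d1: "dg_map (R 1) (R 0) (Mop A H f X 1 2)" using dg_map_Mop2[of 1] n by simp
  \<comment> \<open>A path with one letter allows a boundary at the letter and another one at the
    end; the two add up to a single boundary.\<close>
  have hrel: "homology_rel (R (i - 1)) [Map (R i) (R (i - 1)) (Mop A H f X i 2)] z w \<longleftrightarrow>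
      z \<in> cycles (R i) \<and> w \<in> cycles (R (i - 1)) \<and> w - Mop A H f X i 2 z \<in> boundaries (R (i - 1))"
    if i: "1 \<le> i" "i \<le> n" for i z w
  proof
    have i': "i - 1 \<le> n" using i by simp
    assume "homology_rel (R (i - 1)) [Map (R i) (R (i - 1)) (Mop A H f X i 2)] z w"
    then obtain y where y: "z \<in> cycles (R i)" "w \<in> cycles (R (i - 1))" "y - Mop A H f X i 2 z \<in> boundaries (R (i - 1))" "w - y \<in> boundaries (R (i - 1))"
      by auto
    show "z \<in> cycles (R i) \<and> w \<in> cycles (R (i - 1)) \<and> w - Mop A H f X i 2 z \<in> boundaries (R (i - 1))"
      using boundaries_closed(2)[OF i' y(4,3)] y by simp
  next
    have i': "i - 1 \<le> n" using i by simp
    assume *: "z \<in> cycles (R i) \<and> w \<in> cycles (R (i - 1)) \<and> w - Mop A H f X i 2 z \<in> boundaries (R (i - 1))"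
    then show "homology_rel (R (i - 1)) [Map (R i) (R (i - 1)) (Mop A H f X i 2)] z w"
      using boundaries_closed(1)[OF i'] by (auto intro!: exI[of _ w])
  qed
  have Lb: "L z = 0" if "z \<in> boundaries (R 0)" for z
  proof -
    obtain t where t: "t \<in> total (R 0)" "z = Mop A H f X 0 1 t"
      using \<open>z \<in> boundaries (R 0)\<close> unfolding boundaries_def by auto
    have "L (Mop A H f X 0 1 t) = 0"
    proof (rule blk_hom_induct[OF gX Y_simps(3) Robj_deg t(1)])
      show "L (Mop A H f X 0 1 (P x hs a)) = 0" if "x \<in> deg X p" "length hs \<in> {0}" for x hs a p
        using that deg_total[OF gX that(1)] act1_0 by (simp add: Mop1_pure[of 0, simplified] L(3) koszulX_total lam_diff)
    qed (simp_all add: L L0 Mop_add Mop_scale Mop_0)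
    then show ?thesis by (simp add: t(2))
  qed
  \<comment> \<open>For a cycle a, multiplication by f_1(h) becomes multiplication by h under
    \<open>lam\<close>; the rest is associativity of the action. Membership of \<open>L z\<close> in
    \<open>total X\<close> is carried along because the action is linear only there.\<close>
  have Lact: "L (ract X z (f [h])) = act_inf X (L z) [h] \<and> L z \<in> total X" if "z \<in> cycles (R 0)" for z h
    using le0 that
  proof (induction rule: cycle_induct)
    case (pure x hs a)
    then show ?case using act1_t
      by (simp add: ract_pure L(3) lam_mult_right act_act)
  next
    case (add s t)
    then show ?case using n by (simp add: ract_add L act_add_left total_add[OF gX])
  next
    case (scale c t)
    then show ?case using n by (simp add: ract_scale L act_scale_left total_scale[OF gX])
  next
    case zero
    then show ?case using module_maps_zero_left[OF act_maps gX gX gH tH, of "[h]"] n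
      by (simp add: tlin_0[OF tlin_ract] L0 total_0[OF gX])
  qed
  have contr0: "Mop A H f X 1 2 (con 0 z) = P (L z) [] (unit A) - flp z \<and> L z \<in> total X" if "z \<in> cycles (R 0)" for z
    using le0 that
  proof (induction rule: cycle_induct)
    case (pure x hs a)
    then show ?case using act1_t contraction_0[OF n pure(1), of a] by (simp add: L(3) flp_pure)
  next
    case (add s t)
    then show ?case
      by (simp add: tlin_add[OF tlin_con] Mop_add L(1) pure_add_left tlin_add[OF tlin_flp] total_add[OF gX])
  next
    case (scale c t)
    then show ?case
      by (simp add: tlin_scale[OF tlin_con] Mop_scale L(2) pure_scale_left tlin_scale[OF tlin_flp] total_scale[OF gX] T.scale_right_diff_distrib)
  next
    case zero
    then show ?case
      by (simp add: tlin_0[OF tlin_con] Mop_0 L0 pure_zero_left[OF gX] tlin_0[OF tlin_flp] total_0[OF gX])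
  qed
  \<comment> \<open>The two terms of M_{1,2} are (xh)(lam a) and x(h lam a) under the
    augmentation.\<close>
  have LM: "L (Mop A H f X 1 2 y) = 0" if "y \<in> cycles (R 1)" for y
    using n that
  proof (induction rule: cycle_induct)
    case (pure x hs a)
    then obtain h where hs: "hs = [h]" by (cases hs) auto
    show ?case
      unfolding hs Mop2_1[OF n pure(1)] using pure(1,3) act1_t by (simp add: Ldiff L(3) act_act lam_mult_left)
  qed (simp_all add: Mop_add Mop_scale Mop_0 L L0)
  have C: "Cobj (bar_postnikov A H f X) = R" and D: "dmap (bar_postnikov A H f X) i = [Map (R i) (R (i - 1)) (Mop A H f X i 2)]" for i
    by (simp_all add: bar_postnikov_def Let_def)
  have "augmented_exact (\<lambda>h. f [h]) n X (bar_postnikov A H f X) L"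
    unfolding augmented_exact_def Let_def C D
  proof (intro conjI ballI allI)
    show "L (z + w) = L z + L w" for z w by (rule L(1))
    show "L (scale (R 0) c z) = scale X c (L z)" for c z by (simp add: L(2))
    show "L z \<in> deg X p" if "z \<in> cycles (R 0) \<inter> deg (R 0) p" for z p
    proof -
      have "z \<in> blk X H A {0} (- int 0) p" using that by (simp add: Robj_deg)
      then have "z \<in> {z. L z \<in> deg X p}"
      proof (rule blk_induct)
        show "T.subspace {z. L z \<in> deg X p}"
          using VX.subspace_add[OF graded_subspace[OF gX]] VX.subspace_scale[OF graded_subspace[OF gX]] deg_0[OF gX]
          by (auto intro!: T.subspaceI simp: L L0)
        show "P x hs a \<in> {z. L z \<in> deg X p}"
          if "x \<in> deg X p'" "length hs \<in> {0}" "homogeneous H ds hs" "a \<in> deg A q"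
            "p' + sum_list ds + q + int (length hs) + - int 0 = p" for x hs a p' ds q
        proof -
          have "act_inf X x [lam a] \<in> deg X (p' + sum_list [q] + (int (length [lam a]) + 1) + - 2)"
            using n lam_deg[OF that(4)] by (intro act_deg that(1)) (auto simp: homogeneous_def)
          moreover have "ds = []" using that by (simp add: homogeneous_def)
          ultimately show ?thesis using that deg_total[OF gX that(1)] by (simp add: L(3))
        qed
      qed
      then show ?thesis by simp
    qed
    show "L z = 0" if "z \<in> boundaries (R 0)" for z by (rule Lb[OF that])
    show "L (act (R 0) z (f [h])) = act_inf X (L z) [h]" if "z \<in> cycles (R 0)" for z h using Lact[OF that] by simp
    show "L ` cycles (R 0) = total X"
    proof
      show "L ` cycles (R 0) \<subseteq> total X" using Lt by (auto simp: cycles_def)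
      show "total X \<subseteq> L ` cycles (R 0)"
      proof
        fix x assume x: "x \<in> total X"
        have "P x [] (unit A) \<in> cycles (R 0)"
          using x pure_total[OF gX Y_simps(3) Robj_deg x, of "[]" 0 "unit A"]
          by (simp add: cycles_def Mop1_pure[of 0, simplified] diff_unit pure_zero_right koszulX_total)
        moreover have "L (P x [] (unit A)) = x" using x by (simp add: L(3) lam_unit act_unit)
        ultimately show "x \<in> L ` cycles (R 0)" by (metis imageI)
      qed
    qed
    show "L z = 0 \<longleftrightarrow> (\<exists>y. homology_rel (R 0) [Map (R 1) (R (1 - 1)) (Mop A H f X 1 2)] y z)" if z: "z \<in> cycles (R 0)" for z
    proof
      assume 0: "L z = 0"
      \<comment> \<open>With L z = 0 the bottom contraction formula gives minus the representative
        \<open>flp z\<close>, hence the sign.\<close>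
      let ?y = "- con 0 z"
      have zt: "z \<in> total (R 0)" using z by (simp add: cycles_def)
      have "con 0 z \<in> cycles (R 1)" using con_cycle[of 0 z] n zt by simp
      then have yc: "?y \<in> cycles (R 1)"
        using total_diff[OF dg_module_graded[OF m1] total_0[OF dg_module_graded[OF m1]], of "con 0 z"] tlin_diff[OF tlin_Mop[of 1 1], of 0 "con 0 z"]
        by (simp add: cycles_def Mop_0)
      have "Mop A H f X 1 2 ?y = flp z"
        using contr0[OF z] tlin_diff[OF tlin_Mop[of 1 2], of 0 "con 0 z"] by (simp add: 0 Mop_0 pure_zero_left[OF gX])
      then have "z - Mop A H f X 1 2 ?y \<in> boundaries (R 0)" using cycle_flp[OF le0 z] by simp
      then show "\<exists>y. homology_rel (R 0) [Map (R 1) (R (1 - 1)) (Mop A H f X 1 2)] y z"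
        using hrel[of 1 ?y z] n yc z by (intro exI[of _ ?y]) simp
    next
      assume "\<exists>y. homology_rel (R 0) [Map (R 1) (R (1 - 1)) (Mop A H f X 1 2)] y z"
      then obtain y where y: "y \<in> cycles (R 1)" "z - Mop A H f X 1 2 y \<in> boundaries (R 0)"
        using hrel[of 1 _ z] n by auto
      show "L z = 0" using Lb[OF y(2)] LM[OF y(1)] by (simp add: Ldiff)
    qed
    show "homology_rel (R (i - 1)) [Map (R i) (R (i - 1)) (Mop A H f X i 2)] z 0 \<longleftrightarrow>
        (\<exists>y. homology_rel (R i) [Map (R (i + 1)) (R (i + 1 - 1)) (Mop A H f X (i + 1) 2)] y z)"
      if i: "i \<in> {1..<n}" and z: "z \<in> cycles (R i)" for i z
    proof -
      have i': "1 \<le> i" "i \<le> n" "i + 1 \<le> n" "i - 1 \<le> n" "1 \<le> i + 1" using i by auto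
      have hrel': "homology_rel (R i) [Map (R (i + 1)) (R (i + 1 - 1)) (Mop A H f X (i + 1) 2)] y z \<longleftrightarrow>
        y \<in> cycles (R (i + 1)) \<and> z \<in> cycles (R i) \<and> z - Mop A H f X (i + 1) 2 y \<in> boundaries (R i)" for y
        using hrel[OF i'(5,3), of y z] by simp
      have zt: "z \<in> total (R i)" using z by (simp add: cycles_def)
      note m = dg_module_Robj[OF i'(2)] and m' = dg_module_Robj[OF i'(4)] and m'' = dg_module_Robj[OF i'(3)]
      have 0: "0 \<in> cycles (R (i - 1))"
        using total_0[OF dg_module_graded[OF m']] by (simp add: cycles_def Mop_0)
      show ?thesis
        unfolding hrel[OF i'(1,2)] hrel'
      proof
        assume *: "z \<in> cycles (R i) \<and> 0 \<in> cycles (R (i - 1)) \<and> 0 - Mop A H f X i 2 z \<in> boundaries (R (i - 1))"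
        then have "Mop A H f X i 2 z \<in> boundaries (R (i - 1))" using boundaries_closed(4)[OF i'(4), of "- Mop A H f X i 2 z"] by simp
        then obtain w where "w \<in> total (R (i - 1))" "Mop A H f X i 2 z = Mop A H f X (i - 1) 1 w" unfolding boundaries_def by auto
        \<comment> \<open>\<open>con\<close> kills boundaries, so the hypothesis removes the first
          term of the contraction formula; \<open>con i z\<close> then hits z up to sign and a
          boundary.\<close>
        then have c0: "con (i - 1) (Mop A H f X i 2 z) = 0" by (simp only: con_boundary[OF i'(4)])
        have "Mop A H f X (i + 1) 2 (con i z) = con (i - 1) (Mop A H f X i 2 z) + sg (int (i + 1)) (flp z)"
          using i'(2) z
        proof (induction rule: cycle_induct)
          case (pure x hs a)
          then show ?case using contraction[OF i'(1,3) pure] by (simp only: flp_pure)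
        qed (simp_all add: tlin_add[OF tlin_con] Mop_add tlin_add[OF tlin_flp] sg_add
            tlin_scale[OF tlin_con] Mop_scale tlin_scale[OF tlin_flp] tscale_sg T.scale_right_distrib
            tlin_0[OF tlin_con] Mop_0 tlin_0[OF tlin_flp])
        then have e: "Mop A H f X (i + 1) 2 (con i z) = sg (int (i + 1)) (flp z)" by (simp only: c0 add_0)
        let ?y = "sg (int (i + 1)) (con i z)"
        have "con i z \<in> cycles (R (i + 1))" by (rule con_cycle[OF i'(3) zt])
        then have yc: "?y \<in> cycles (R (i + 1))"
          using total_sg[OF dg_module_graded[OF m''], of "con i z" "int (i + 1)"] tlin_sg[OF tlin_dR[of "i + 1"], of "int (i + 1)" "con i z"]
          by (simp add: cycles_def)
        have "Mop A H f X (i + 1) 2 ?y = flp z"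
          unfolding tlin_sg[OF tlin_Mop] e by (simp add: sg_even)
        then show "\<exists>y. y \<in> cycles (R (i + 1)) \<and> z \<in> cycles (R i) \<and> z - Mop A H f X (i + 1) 2 y \<in> boundaries (R i)"
          using yc z cycle_flp[OF i'(2) z] by (intro exI[of _ ?y]) simp
      next
        assume "\<exists>y. y \<in> cycles (R (i + 1)) \<and> z \<in> cycles (R i) \<and> z - Mop A H f X (i + 1) 2 y \<in> boundaries (R i)"
        then obtain y b where y: "y \<in> cycles (R (i + 1))" and b: "b \<in> total (R i)" "z - Mop A H f X (i + 1) 2 y = mdiff (R i) b"
          unfolding boundaries_def by blast
        have zz: "z = Mop A H f X (i + 1) 2 y + mdiff (R i) b" using b(2) by (simp add: algebra_simps)
        have d: "dg_map (R i) (R (i - 1)) (Mop A H f X i 2)" by (rule dg_map_Mop2[OF i'(1,2)])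
        have "Mop A H f X i 2 (mdiff (R i) b) = mdiff (R (i - 1)) (Mop A H f X i 2 b)"
          using d b(1) unfolding dg_map_def by blast
        then have "Mop A H f X i 2 (mdiff (R i) b) \<in> boundaries (R (i - 1))"
          unfolding boundaries_def using dg_map_total[OF m m' d b(1)] by blast
        from boundaries_closed(2)[OF i'(4) Mop2_Mop2[OF i'(1,3) y] this]
        have "Mop A H f X i 2 z \<in> boundaries (R (i - 1))" unfolding zz Mop_add .
        then show "z \<in> cycles (R i) \<and> 0 \<in> cycles (R (i - 1)) \<and> 0 - Mop A H f X i 2 z \<in> boundaries (R (i - 1))"
          using z 0 boundaries_closed(4)[OF i'(4)] by simp
      qed
    qed
  qed
  then show ?thesis by blast
qed

end

section \<open>The Postnikov system\<close>

lemma dg_map_id: "dg_map M M (\<lambda>x. x)"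
  by (simp add: dg_map_def graded_map_def linear_on_def act_linear_def)

context kadmod
begin

lemma imp_1: "imp 1 = Mop A H f X 1 2"
  by (simp add: imp_def fun_eq_iff numeral_2_eq_2 sg_even)

text \<open>A Postnikov system requires equality of the two objects and not just an isomorphism; for
  l = 0 the bar differential consists of the single term M_{0,1}.\<close>

lemma Y_0: "Y 0 = R 0"
proof (rule dgmod.equality)
  show "deg (Y 0) = deg (R 0)" unfolding Y_deg Robj_deg by simp
  show "mdiff (Y 0) = mdiff (R 0)" by (simp add: bar_complex_def sg_even fun_eq_iff)
qed (simp_all add: bar_complex_def Robj_def shift_def)

lemma postnikov_simps:
  "Cobj (bar_postnikov A H f X) = R" "Yobj (bar_postnikov A H f X) = (\<lambda>i. Y i)"
  "jmap (bar_postnikov A H f X) i = (if i = 0 then [] else [Map (Y i) (R i) (proj i)])"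
  "imap (bar_postnikov A H f X) i = [Map (R i) (Y (i - 1)) (imp i)]"
  "dmap (bar_postnikov A H f X) i = [Map (R i) (R (i - 1)) (Mop A H f X i 2)]"
  "conn (bar_postnikov A H f X) i = [Map (Y (i - 1)) (shift (- 1) (Y i)) (\<lambda>t. t)]"
  by (simp_all add: bar_postnikov_def Let_def proj_def imp_def[abs_def])

lemma jmap_pos: "1 \<le> l \<Longrightarrow> jmap (bar_postnikov A H f X) l = [Map (Y l) (R l) (proj l)]"
  unfolding postnikov_simps by (rule if_not_P) simp

lemma dpath_jmap:
  assumes l: "l \<le> n"
  shows "dpath A (Y l) (jmap (bar_postnikov A H f X) l) (R l)"
proof (cases "l = 0")
  case True
  show ?thesis unfolding True postnikov_simps Y_0 using dpath_nil[OF dg_module_Robj[of 0]] by simp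
next
  case False
  then have "1 \<le> l" by simp
  show ?thesis unfolding jmap_pos[OF \<open>1 \<le> l\<close>]
    by (rule dpath_single[OF dg_module_Y[OF l] dg_module_Robj[OF l] dg_map_proj[OF l]])
qed

lemma dpath_imap: "1 \<le> l \<Longrightarrow> l \<le> n \<Longrightarrow> dpath A (R l) (imap (bar_postnikov A H f X) l) (Y (l - 1))"
  unfolding postnikov_simps by (intro dpath_single dg_module_Robj dg_module_Y dg_map_imp) auto

lemma dpath_dmap: "1 \<le> l \<Longrightarrow> l \<le> n \<Longrightarrow> dpath A (R l) (dmap (bar_postnikov A H f X) l) (R (l - 1))"
  unfolding postnikov_simps by (intro dpath_single dg_module_Robj dg_map_Mop2) auto

text \<open>For l = 1 the path j_0 is empty and the two sides coincide, as i_1 = M_{1,2}. For larger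
  l the composite \<pi> i agrees with M_{l,2} only on the elements of \<open>R_l\<close>, so the
  letters are compared in the derived category.\<close>

lemma dmap_deq:
  assumes l: "1 \<le> l" "l \<le> n"
  shows "deq A (R l) (R (l - 1)) (dmap (bar_postnikov A H f X) l)
    (imap (bar_postnikov A H f X) l @ jmap (bar_postnikov A H f X) (l - 1))"
proof (cases "l = 1")
  case True
  have e: "imap (bar_postnikov A H f X) l @ jmap (bar_postnikov A H f X) (l - 1) = dmap (bar_postnikov A H f X) l"
    unfolding True postnikov_simps imp_1 diff_self_eq_0 Y_0 by (simp only: simp_thms if_True append_Nil2)
  show ?thesis unfolding e by (rule deq_refl[OF dpath_dmap[OF l]])
next
  case False
  then have l': "1 \<le> l - 1" using l by simp
  have "deq A (R l) (R (l - 1)) [Map (R l) (Y (l - 1)) (imp l), Map (Y (l - 1)) (R (l - 1)) (proj (l - 1))]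
      [Map (R l) (R (l - 1)) (Mop A H f X l 2)]"
    by (rule deq_comp_eq[OF dga dg_module_Robj[OF l(2)] dg_module_Y[OF l1[OF l]] dg_module_Robj[OF l1[OF l]]
        dg_map_imp[OF l] dg_map_proj[OF l1[OF l]]])
      (erule proj_imp_R[OF l], rule dg_map_Mop2[OF l])
  then show ?thesis unfolding jmap_pos[OF l'] postnikov_simps(4,5) append_Cons append_Nil by (rule deq_sym)
qed

lemma postnikov_system_bar:
  assumes n: "1 \<le> n"
  shows "postnikov_system A (\<lambda>h. f [h]) n X (bar_postnikov A H f X)"
  unfolding postnikov_system_def Let_def
proof (intro conjI allI impI ballI)
  let ?P = "bar_postnikov A H f X"
  show "\<exists>\<epsilon>. augmented_exact (\<lambda>h. f [h]) n X ?P \<epsilon>" by (rule augmented_exact_bar[OF n])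
  show "Yobj ?P 0 = Cobj ?P 0" unfolding postnikov_simps by (rule Y_0)
  show "jmap ?P 0 = []" by (simp add: postnikov_simps)
  show "dg_free A (Cobj ?P l)" "dg_module A (Yobj ?P l)" if "l \<le> n" for l
    unfolding postnikov_simps by (rule dg_free_Robj[OF that], rule dg_module_Y[OF that])
  fix l assume "l \<in> {1..n}"
  then have l: "1 \<le> l" "l \<le> n" by simp_all
  show "dpath A (Yobj ?P l) (jmap ?P l) (Cobj ?P l)" unfolding postnikov_simps(1,2) by (rule dpath_jmap[OF l(2)])
  show "dpath A (Cobj ?P l) (imap ?P l) (Yobj ?P (l - 1))" unfolding postnikov_simps(1,2) by (rule dpath_imap[OF l])
  show "dpath A (Cobj ?P l) (dmap ?P l) (Cobj ?P (l - 1))" unfolding postnikov_simps(1,2) by (rule dpath_dmap[OF l])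
  show "deq A (Cobj ?P l) (Cobj ?P (l - 1)) (dmap ?P l) (imap ?P l @ jmap ?P (l - 1))"
    unfolding postnikov_simps(1,2) by (rule dmap_deq[OF l])
  show "distinguished A (Yobj ?P l) (Cobj ?P l) (Yobj ?P (l - 1)) (jmap ?P l) (imap ?P l) (conn ?P l)"
    unfolding jmap_pos[OF l(1)] postnikov_simps(1,2,4,6) by (rule distinguished_bar[OF l])
qed

end

section \<open>Naturality for morphisms of modules\<close>

context kadmap
begin

abbreviation C_map where "C_map l \<equiv> bar_postnikov_C A H f X X' g l"
abbreviation Y_map where "Y_map l \<equiv> bar_postnikov_Y A H f X X' g l"

lemma map_simps: "C_map l = [Map (R l) (M'.R l) (al l)]" "Y_map l = [Map (Y l) (M'.Y l) (BM l)]"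
  by (simp_all add: bar_postnikov_C_def bar_postnikov_Y_def)

lemma dpath_C_map: "l \<le> n \<Longrightarrow> dpath A (R l) (C_map l) (M'.R l)"
  and dpath_Y_map: "l \<le> n \<Longrightarrow> dpath A (Y l) (Y_map l) (M'.Y l)"
  unfolding map_simps
  by (intro dpath_single dg_module_Robj dg_module_Y M'.dg_module_Robj M'.dg_module_Y dg_map_al dg_map_BM; assumption)+

lemma Y_map_0: "Y_map 0 = C_map 0"
proof -
  have "BM 0 = al 0" by (simp add: bar_map_def sg_even fun_eq_iff)
  then show ?thesis unfolding map_simps Y_0 M'.Y_0 by (simp only:)
qed

lemma jmap_natural:
  assumes l: "l \<le> n"
  shows "deq A (Y l) (M'.R l) (jmap (bar_postnikov A H f X) l @ C_map l) (Y_map l @ jmap (bar_postnikov A H f X') l)"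
proof (cases "l = 0")
  case True
  have "jmap (bar_postnikov A H f X) 0 = []" "jmap (bar_postnikov A H f X') 0 = []"
    by (simp_all add: postnikov_simps M'.postnikov_simps)
  then show ?thesis
    unfolding True Y_map_0 Y_0 append_Nil append_Nil2 using deq_refl[OF dpath_C_map[OF le0]] by simp
next
  case False
  then have l': "1 \<le> l" by simp
  have K: "dg_map (Y l) (M'.R l) (\<lambda>t. al l (proj l t))"
    by (rule dg_map_comp[OF dg_module_Y[OF l] dg_module_Robj[OF l] dg_map_proj[OF l] dg_map_al[OF l]])
  have 1: "deq A (Y l) (M'.R l) [Map (Y l) (R l) (proj l), Map (R l) (M'.R l) (al l)] [Map (Y l) (M'.R l) (\<lambda>t. al l (proj l t))]"
    by (rule deq_comp[OF dg_module_Y[OF l] dg_module_Robj[OF l] M'.dg_module_Robj[OF l] dg_map_proj[OF l] dg_map_al[OF l]])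
  have 2: "deq A (Y l) (M'.R l) [Map (Y l) (M'.Y l) (BM l), Map (M'.Y l) (M'.R l) (M'.proj l)]
      [Map (Y l) (M'.R l) (\<lambda>t. al l (proj l t))]"
    by (rule deq_comp_eq[OF dga dg_module_Y[OF l] M'.dg_module_Y[OF l] M'.dg_module_Robj[OF l]
          dg_map_BM[OF l] M'.dg_map_proj[OF l]]) (erule proj_BM[OF l], rule K)
  show ?thesis
    unfolding map_simps jmap_pos[OF l'] M'.jmap_pos[OF l'] append_Cons append_Nil
    by (rule deq_trans[OF 1 deq_sym[OF 2]])
qed

lemma imap_natural:
  assumes l: "1 \<le> l" "l \<le> n"
  shows "deq A (R l) (M'.Y (l - 1)) (imap (bar_postnikov A H f X) l @ Y_map (l - 1))
    (C_map l @ imap (bar_postnikov A H f X') l)"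
proof -
  note m = dg_module_Robj[OF l(2)] M'.dg_module_Y[OF l1[OF l]]
  have 1: "deq A (R l) (M'.Y (l - 1)) [Map (R l) (Y (l - 1)) (imp l), Map (Y (l - 1)) (M'.Y (l - 1)) (BM (l - 1))]
      [Map (R l) (M'.Y (l - 1)) (\<lambda>t. BM (l - 1) (imp l t))]"
    by (rule deq_comp[OF m(1) dg_module_Y[OF l1[OF l]] m(2) dg_map_imp[OF l] dg_map_BM[OF l1[OF l]]])
  have 2: "deq A (R l) (M'.Y (l - 1)) [Map (R l) (M'.R l) (al l), Map (M'.R l) (M'.Y (l - 1)) (M'.imp l)]
      [Map (R l) (M'.Y (l - 1)) (\<lambda>t. M'.imp l (al l t))]"
    by (rule deq_comp[OF m(1) M'.dg_module_Robj[OF l(2)] m(2) dg_map_al[OF l(2)] M'.dg_map_imp[OF l]])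
  have 3: "deq A (R l) (M'.Y (l - 1)) [Map (R l) (M'.Y (l - 1)) (\<lambda>t. M'.imp l (al l t))]
      [Map (R l) (M'.Y (l - 1)) (\<lambda>t. BM (l - 1) (imp l t))]"
    by (rule deq_homotopic[OF m homotopic_imp[OF l]])
  show ?thesis
    unfolding map_simps postnikov_simps M'.postnikov_simps
    unfolding append_Cons append_Nil by (rule deq_trans[OF 1 deq_sym[OF deq_trans[OF 2 3]]])
qed

text \<open>As d is the composite of i and j in the derived category, its square is pasted from
  theirs.\<close>

lemma dmap_natural:
  assumes l: "1 \<le> l" "l \<le> n"
  shows "deq A (R l) (M'.R (l - 1)) (dmap (bar_postnikov A H f X) l @ C_map (l - 1))
    (C_map l @ dmap (bar_postnikov A H f X') l)"
proof -
  let ?P = "bar_postnikov A H f X" and ?P' = "bar_postnikov A H f X'"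
  note m = dg_module_Robj[OF l(2)] M'.dg_module_Robj[OF l1[OF l]]
  have 1: "deq A (R l) (M'.R (l - 1)) (dmap ?P l @ C_map (l - 1)) ((imap ?P l @ jmap ?P (l - 1)) @ C_map (l - 1))"
    by (rule deq_post[OF dmap_deq[OF l] dpath_C_map[OF l1[OF l]] m(1)])
  have 2: "deq A (R l) (M'.R (l - 1)) (imap ?P l @ (jmap ?P (l - 1) @ C_map (l - 1)))
      (imap ?P l @ (Y_map (l - 1) @ jmap ?P' (l - 1)))"
    by (rule deq_pre[OF dpath_imap[OF l] jmap_natural[OF l1[OF l]] m(2)])
  have 3: "deq A (R l) (M'.R (l - 1)) ((imap ?P l @ Y_map (l - 1)) @ jmap ?P' (l - 1))
      ((C_map l @ imap ?P' l) @ jmap ?P' (l - 1))"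
    by (rule deq_post[OF imap_natural[OF l] M'.dpath_jmap[OF l1[OF l]] m(1)])
  have 4: "deq A (R l) (M'.R (l - 1)) (C_map l @ (imap ?P' l @ jmap ?P' (l - 1))) (C_map l @ dmap ?P' l)"
    by (rule deq_pre[OF dpath_C_map[OF l(2)] deq_sym[OF M'.dmap_deq[OF l]] m(2)])
  show ?thesis
    by (rule deq_trans[OF 1[unfolded append_assoc] deq_trans[OF 2 deq_trans[OF 3[unfolded append_assoc] 4]]])
qed

text \<open>\<open>B_l(g)\<close> restricts to \<open>B_(l-1)(g)\<close> on the subcomplex, so this
  square commutes on elements.\<close>

lemma conn_natural:
  assumes l: "1 \<le> l" "l \<le> n"
  shows "deq A (Y (l - 1)) (shift (- 1) (M'.Y l))
    (conn (bar_postnikov A H f X) l @ map (shift_letter (- 1)) (Y_map l)) (Y_map (l - 1) @ conn (bar_postnikov A H f X') l)"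
proof -
  note m = dg_module_Y[OF l1[OF l]] dg_module_shift[OF dg_module_Y[OF l(2)], of "- 1"]
    M'.dg_module_Y[OF l1[OF l]] dg_module_shift[OF M'.dg_module_Y[OF l(2)], of "- 1"]
  have K: "dg_map (Y (l - 1)) (shift (- 1) (M'.Y l)) (BM (l - 1))"
    by (rule dg_map_comp[OF m(1,3) dg_map_BM[OF l1[OF l]] M'.dg_map_incl[OF l]])
  have 1: "deq A (Y (l - 1)) (shift (- 1) (M'.Y l))
      [Map (Y (l - 1)) (shift (- 1) (Y l)) (\<lambda>t. t), Map (shift (- 1) (Y l)) (shift (- 1) (M'.Y l)) (BM l)]
      [Map (Y (l - 1)) (shift (- 1) (M'.Y l)) (BM (l - 1))]"
    by (rule deq_comp_eq[OF dga m(1,2,4) dg_map_incl[OF l] dg_map_BM_shift[OF l(2)]])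
      (erule BM_low[OF l], rule K)
  have 2: "deq A (Y (l - 1)) (shift (- 1) (M'.Y l))
      [Map (Y (l - 1)) (M'.Y (l - 1)) (BM (l - 1)), Map (M'.Y (l - 1)) (shift (- 1) (M'.Y l)) (\<lambda>t. t)]
      [Map (Y (l - 1)) (shift (- 1) (M'.Y l)) (BM (l - 1))]"
    by (rule deq_comp[OF m(1,3,4) dg_map_BM[OF l1[OF l]] M'.dg_map_incl[OF l]])
  show ?thesis
    unfolding map_simps postnikov_simps M'.postnikov_simps
    unfolding append_Cons append_Nil list.map shift_letter.simps by (rule deq_trans[OF 1 deq_sym[OF 2]])
qed

lemma postnikov_map_bar:
  "postnikov_map A n (bar_postnikov A H f X) (bar_postnikov A H f X') C_map Y_map"
  unfolding postnikov_map_def postnikov_simps(1,2) M'.postnikov_simps(1,2)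
proof (intro conjI allI impI ballI)
  show "deq A (R 0) (M'.R 0) (C_map 0) (Y_map 0)" unfolding Y_map_0 by (rule deq_refl[OF dpath_C_map[OF le0]])
  show "dpath A (R l) (C_map l) (M'.R l)" "dpath A (Y l) (Y_map l) (M'.Y l)" if "l \<le> n" for l
    by (rule dpath_C_map[OF that], rule dpath_Y_map[OF that])
  fix l assume "l \<in> {1..n}"
  then have l: "1 \<le> l" "l \<le> n" by simp_all
  show "deq A (Y l) (M'.R l) (jmap (bar_postnikov A H f X) l @ C_map l) (Y_map l @ jmap (bar_postnikov A H f X') l)"
    by (rule jmap_natural[OF l(2)])
  show "deq A (R l) (M'.Y (l - 1)) (imap (bar_postnikov A H f X) l @ Y_map (l - 1))
      (C_map l @ imap (bar_postnikov A H f X') l)"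
    by (rule imap_natural[OF l])
  show "deq A (R l) (M'.R (l - 1)) (dmap (bar_postnikov A H f X) l @ C_map (l - 1))
      (C_map l @ dmap (bar_postnikov A H f X') l)"
    by (rule dmap_natural[OF l])
  show "deq A (Y (l - 1)) (shift (- 1) (M'.Y l))
      (conn (bar_postnikov A H f X) l @ map (shift_letter (- 1)) (Y_map l))
      (Y_map (l - 1) @ conn (bar_postnikov A H f X') l)"
    by (rule conn_natural[OF l])
qed

end

section \<open>Identities and composites\<close>

context kadmod
begin

lemma id_maps: "module_maps (- 1) (n + 1) H X X id_morphism"
  unfolding module_maps_def linear_on_def id_morphism_def
  using deg_0[OF gX] by (auto simp: graded_scale_0[OF gX] homogeneous_def)

text \<open>The higher components of the identity are 0, so only diagonal entries remain. The
  resulting functions are the identity only on the modules and not on the ambient type, hence the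
  detour through \<open>deq_eq_on\<close>.\<close>

lemma bar_id:
  assumes l: "l \<le> n"
  shows "deq A (R l) (R l) (bar_postnikov_C A H f X X id_morphism l) []"
    "deq A (Y l) (Y l) (bar_postnikov_Y A H f X X id_morphism l) []"
proof -
  interpret I: kadpre A H cls f X X n id_morphism
    by unfold_locales (rule id_maps)
  note R = dg_module_Robj[OF l] and Y = dg_module_Y[OF l]
  have al: "I.al l t = t" if "t \<in> total (R l)" for t
    by (rule tlin_eqI[OF gX Y_simps(3) Robj_deg that I.tlin_al tlin_id]) (simp add: I.al_pure id_morphism_def)
  have "I.GB x hs a = P x hs a" for x hs a
  proof -
    have "I.GB x hs a = ssum (\<lambda>v w. if v = [] then P x w a else 0) hs"
      unfolding I.GB_def by (rule ssum_cong) (simp add: id_morphism_def pure_zero_left[OF gX] I.eG_def)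
    then show ?thesis by (simp add: ssum_if_left)
  qed
  then have BM: "I.BM l t = t" if "t \<in> total (Y l)" for t
    by (intro tlin_eqI[OF gX Y_simps(1) Y_deg that I.tlin_BM tlin_id]) (simp add: I.bar_map_pure[OF l])
  show "deq A (R l) (R l) (bar_postnikov_C A H f X X id_morphism l) []"
    unfolding bar_postnikov_C_def
    by (rule deq_trans[OF deq_sym[OF deq_eq_on[OF dga R R dg_map_id]] deq_id[OF R]]) (rule al)
  show "deq A (Y l) (Y l) (bar_postnikov_Y A H f X X id_morphism l) []"
    unfolding bar_postnikov_Y_def
    by (rule deq_trans[OF deq_sym[OF deq_eq_on[OF dga Y Y dg_map_id]] deq_id[OF Y]]) (rule BM)
qed

end

locale kadcomp = kadmap A H cls f X X' n g + N: kadmap A H cls f X' X'' n g'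
  for A :: "('k::field, 'a::ab_group_add) dga" and H :: "('k, 'h::ab_group_add) ainf"
    and cls :: "'a \<Rightarrow> 'h" and f :: "'h list \<Rightarrow> 'a"
    and X X' X'' :: "('k, 'h, 'x::ab_group_add) amod" and n :: nat and g g' :: "'x \<Rightarrow> 'h list \<Rightarrow> 'x"
begin

abbreviation gg where "gg \<equiv> comp_morphism g' g"

text \<open>For a splitting into \<open>v\<close> and \<open>w\<close> the first factor has r =
  \<open>len v + 1\<close> inputs, so the composition sign (-1)^((r-1)s) becomes the product of the
  two lengths.\<close>

lemma gg_ssum: "gg x hs = ssum (\<lambda>v w. sg (len v * len w) (g' (g x v) w)) hs"
  unfolding comp_morphism_def ssum_def
  by (rule sum.reindex_bij_witness[where i = "\<lambda>k. k + 1" and j = "\<lambda>s. s - 1"]) (auto simp: min_absorb2 Let_def)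

lemma gg_maps: "module_maps (- 1) (n + 1) H X X'' gg"
proof -
  interpret V: vector_space "scale X''" by (rule graded_vs) (rule N.M'.gX)
  have sc: "scale X'' c (ssum F xs) = ssum (\<lambda>u v. scale X'' c (F u v)) xs" for c F and xs :: "'h list"
    by (rule ssum_additive) (rule V.scale_right_distrib)
  have sgs: "scale X'' c (sg e y) = sg e (scale X'' c y)" for c e y by (simp add: sg_def)
  note scale_left = module_maps_scale_left[OF g_maps gX M'.gX gH tH] module_maps_scale_left[OF N.g_maps M'.gX N.M'.gX gH tH]
  note add_middle = module_maps_add_middle[OF g_maps gX M'.gX gH tH] module_maps_add_middle[OF N.g_maps M'.gX N.M'.gX gH tH]
  note scale_middle = module_maps_scale_middle[OF g_maps gX M'.gX gH tH] module_maps_scale_middle[OF N.g_maps M'.gX N.M'.gX gH tH]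
  show ?thesis
    unfolding module_maps_def linear_on_def
  proof (intro conjI allI ballI impI)
    show "gg (x + y) hs = gg x hs + gg y hs" if "length hs < n + 1" "x \<in> total X" "y \<in> total X" for x y hs
      unfolding gg_ssum ssum_add[symmetric] using that
      by (intro ssum_cong) (simp add: g_add_left N.g_add_left g_total sg_add)
    show "gg (scale X c x) hs = scale X'' c (gg x hs)" if "length hs < n + 1" "x \<in> total X" for c x hs
      unfolding gg_ssum sc using that
      by (intro ssum_cong) (simp add: scale_left g_total sgs)
    show "gg x (us @ (h + h') # vs) = gg x (us @ h # vs) + gg x (us @ h' # vs)"
      if "x \<in> total X" "length (us @ h # vs) < n + 1" for x us h h' vs
    proof -
      have "ssum (\<lambda>a b. sg (len a * len (b @ (h + h') # vs)) (g' (g x a) (b @ (h + h') # vs))) us =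
          ssum (\<lambda>a b. sg (len a * len (b @ h # vs)) (g' (g x a) (b @ h # vs))) us +
          ssum (\<lambda>a b. sg (len a * len (b @ h' # vs)) (g' (g x a) (b @ h' # vs))) us"
        unfolding ssum_add[symmetric] using that by (intro ssum_cong) (simp add: add_middle(2) g_total sg_add)
      moreover have "ssum (\<lambda>a b. sg (len (us @ (h + h') # a) * len b) (g' (g x (us @ (h + h') # a)) b)) vs =
          ssum (\<lambda>a b. sg (len (us @ h # a) * len b) (g' (g x (us @ h # a)) b)) vs +
          ssum (\<lambda>a b. sg (len (us @ h' # a) * len b) (g' (g x (us @ h' # a)) b)) vs"
        unfolding ssum_add[symmetric] using that
        by (intro ssum_cong) (simp add: add_middle(1) N.g_add_left g_total sg_add)
      ultimately show ?thesis unfolding gg_ssum ssum_middle by (simp only: add_ac)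
    qed
    show "gg x (us @ scale H c h # vs) = scale X'' c (gg x (us @ h # vs))"
      if "x \<in> total X" "length (us @ h # vs) < n + 1" for x c us h vs
    proof -
      have "ssum (\<lambda>a b. sg (len a * len (b @ scale H c h # vs)) (g' (g x a) (b @ scale H c h # vs))) us =
          scale X'' c (ssum (\<lambda>a b. sg (len a * len (b @ h # vs)) (g' (g x a) (b @ h # vs))) us)"
        unfolding sc using that by (intro ssum_cong) (simp add: scale_middle(2) g_total sgs)
      moreover have "ssum (\<lambda>a b. sg (len (us @ scale H c h # a) * len b) (g' (g x (us @ scale H c h # a)) b)) vs =
          scale X'' c (ssum (\<lambda>a b. sg (len (us @ h # a) * len b) (g' (g x (us @ h # a)) b)) vs)"
        unfolding sc using that by (intro ssum_cong) (simp add: scale_middle(1) scale_left(2) g_total sgs)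
      ultimately show ?thesis unfolding gg_ssum ssum_middle by (simp only: V.scale_right_distrib)
    qed
    show "gg x hs \<in> deg X'' (p + sum_list ds + (int (length hs) + 1) + - 1)"
      if x: "x \<in> deg X p" and hs: "length hs < n + 1 \<and> homogeneous H ds hs" for p ds hs x
    proof -
      have *: "sg (len v * len w) (g' (g x v) w) \<in> deg X'' (p + sum_list ds + (int (length hs) + 1) + - 1)"
        if h: "hs = v @ w" for v w
      proof -
        obtain d1 d2 where d: "ds = d1 @ d2" "homogeneous H d1 v" "homogeneous H d2 w"
          using hs h homogeneous_append by blast
        have v: "length v < n + 1" "length w < n + 1" using hs h by auto
        have "g' (g x v) w \<in> deg X'' (p + sum_list d1 + (int (length v) + 1) + - 1 + sum_list d2 + (int (length w) + 1) + - 1)"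
          by (rule N.g_deg[OF v(2) g_deg[OF v(1) x d(2)] d(3)])
        then show ?thesis by (intro deg_sg[OF N.M'.gX]) (simp add: d(1) h algebra_simps)
      qed
      show ?thesis
        unfolding gg_ssum ssum_def by (intro V.subspace_sum graded_subspace[OF N.M'.gX]) (rule *, simp)
    qed
  qed
qed

lemma bar_comp:
  assumes l: "l \<le> n"
  shows "deq A (R l) (N.M'.R l) (bar_postnikov_C A H f X X'' gg l) (C_map l @ N.C_map l)"
    "deq A (Y l) (N.M'.Y l) (bar_postnikov_Y A H f X X'' gg l) (Y_map l @ N.Y_map l)"
proof -
  interpret I: kadpre A H cls f X X'' n gg
    by unfold_locales (rule gg_maps)
  have al: "N.al l (al l t) = I.al l t" if "t \<in> total (R l)" for t
    by (rule tlin_eqI[OF gX Y_simps(3) Robj_deg that tlin_comp[OF N.tlin_al tlin_al] I.tlin_al])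
      (simp add: al_pure N.al_pure I.al_pure gg_ssum sg_even)
  have GB: "N.BM l (GB x hs a) = I.GB x hs a" if x: "x \<in> total X" and hs: "length hs \<le> l" for x hs a
  proof -
    have "N.BM l (GB x hs a) = ssum (\<lambda>v r. sg (eG (len v)) (N.GB (g x v) r a)) hs"
      unfolding GB_def tlin_ssum[OF N.tlin_BM] tlin_sg[OF N.tlin_BM]
      using hs by (intro ssum_cong arg_cong[where f = "sg _"] N.bar_map_pure[OF l]) auto
    also have "\<dots> = ssum (\<lambda>y s. ssum (\<lambda>v w. sg (eG (len v)) (sg (eG (len w)) (N.M'.P (g' (g x v) w) s a))) y) hs"
      unfolding N.GB_def ssum_sg ssum_assoc N.eG_def eG_def ..
    also have "\<dots> = ssum (\<lambda>y s. sg (eG (len y)) (N.M'.P (gg x y) s a)) hs"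
    proof (intro ssum_cong)
      fix y s assume h: "hs = y @ s"
      have t: "g' (g x v) w \<in> total X''" if "y = v @ w" for v w
        using that h hs l x by (intro N.g_total g_total) auto
      \<comment> \<open>The bar sign is quadratic: its failure to be additive is the product of the
        lengths, which is the sign in the composition of morphisms.\<close>
      have sign: "even (eG a + eG b - (eG (a + b) + a * b))" for a b
      proof -
        have "eG a + eG b - eG (a + b) = (if odd a \<and> odd b then 1 else 0)" unfolding eG_def by presburger
        then show ?thesis by (auto simp: diff_add_eq_diff_diff_swap diff_diff_eq)
      qed
      have "sg (eG (len y)) (N.M'.P (gg x y) s a) = ssum (\<lambda>v w. sg (eG (len y)) (N.M'.P (sg (len v * len w) (g' (g x v) w)) s a)) y"
        unfolding gg_ssum ssum_sg[symmetric] by (subst N.M'.P_ssum_left) (auto intro!: total_sg[OF N.M'.gX] t)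
      also have "\<dots> = ssum (\<lambda>v w. sg (eG (len v)) (sg (eG (len w)) (N.M'.P (g' (g x v) w) s a))) y"
        by (intro ssum_cong) (simp add: N.M'.sg_P t, rule sg_cong, use sign in \<open>simp\<close>)
      finally show "ssum (\<lambda>v w. sg (eG (len v)) (sg (eG (len w)) (N.M'.P (g' (g x v) w) s a))) y =
        sg (eG (len y)) (N.M'.P (gg x y) s a)" ..
    qed
    finally show ?thesis unfolding I.GB_def I.eG_def eG_def .
  qed
  have BM: "N.BM l (BM l t) = I.BM l t" if "t \<in> total (Y l)" for t
    by (rule tlin_eqI[OF gX Y_simps(1) Y_deg that tlin_comp[OF N.tlin_BM tlin_BM] I.tlin_BM])
      (simp add: bar_map_pure[OF l] I.bar_map_pure[OF l] GB deg_total[OF gX])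
  note R = dg_module_Robj[OF l] M'.dg_module_Robj[OF l] N.M'.dg_module_Robj[OF l]
    and Y = dg_module_Y[OF l] M'.dg_module_Y[OF l] N.M'.dg_module_Y[OF l]
  have alm: "dg_map (R l) (N.M'.R l) (I.al l)"
    by (rule dg_map_cong[OF dga R(1) dg_map_comp[OF R(1,2) dg_map_al[OF l] N.dg_map_al[OF l]]]) (rule al[symmetric])
  have BMm: "dg_map (Y l) (N.M'.Y l) (I.BM l)"
    by (rule dg_map_cong[OF dga Y(1) dg_map_comp[OF Y(1,2) dg_map_BM[OF l] N.dg_map_BM[OF l]]]) (rule BM[symmetric])
  show "deq A (R l) (N.M'.R l) (bar_postnikov_C A H f X X'' gg l) (C_map l @ N.C_map l)"
    unfolding map_simps N.map_simps append_Cons append_Nil unfolding bar_postnikov_C_def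
    by (rule deq_sym[OF deq_comp_eq[OF dga R dg_map_al[OF l] N.dg_map_al[OF l]]]) (erule al, rule alm)
  show "deq A (Y l) (N.M'.Y l) (bar_postnikov_Y A H f X X'' gg l) (Y_map l @ N.Y_map l)"
    unfolding map_simps N.map_simps append_Cons append_Nil unfolding bar_postnikov_Y_def
    by (rule deq_sym[OF deq_comp_eq[OF dga Y dg_map_BM[OF l] N.dg_map_BM[OF l]]]) (erule BM, rule BMm)
qed

end

theorem theorem5p3:
  fixes A :: "('k::field, 'a::ab_group_add) dga"
    and H :: "('k, 'h::ab_group_add) ainf"
    and cls :: "'a \<Rightarrow> 'h"
    and f :: "'h list \<Rightarrow> 'a"
    and n :: nat
  assumes "dg_algebra A"
    and "kadeishvili_model A H cls f"
    and "n \<ge> 1"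
  shows "(\<forall>X :: ('k, 'h, 'x::ab_group_add) amod.
            minimal_module H (cls (unit A)) (n + 1) X \<longrightarrow>
            postnikov_system A (\<lambda>h. f [h]) n X (bar_postnikov A H f X)) \<and>
         (\<forall>(X :: ('k, 'h, 'x) amod) X' g.
            minimal_module H (cls (unit A)) (n + 1) X \<and>
            minimal_module H (cls (unit A)) (n + 1) X' \<and>
            module_morphism H (n + 1) X X' g \<longrightarrow>
            postnikov_map A n (bar_postnikov A H f X) (bar_postnikov A H f X')
              (bar_postnikov_C A H f X X' g) (bar_postnikov_Y A H f X X' g)) \<and>
         (\<forall>X :: ('k, 'h, 'x) amod.
            minimal_module H (cls (unit A)) (n + 1) X \<longrightarrow>
            (let P = bar_postnikov A H f X in \<forall>i\<le>n.
              deq A (Cobj P i) (Cobj P i) (bar_postnikov_C A H f X X id_morphism i) [] \<and>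
              deq A (Yobj P i) (Yobj P i) (bar_postnikov_Y A H f X X id_morphism i) [])) \<and>
         (\<forall>(X :: ('k, 'h, 'x) amod) X' X'' g g'.
            minimal_module H (cls (unit A)) (n + 1) X \<and>
            minimal_module H (cls (unit A)) (n + 1) X' \<and>
            minimal_module H (cls (unit A)) (n + 1) X'' \<and>
            module_morphism H (n + 1) X X' g \<and> module_morphism H (n + 1) X' X'' g' \<longrightarrow>
            (let P = bar_postnikov A H f X; P'' = bar_postnikov A H f X'' in \<forall>i\<le>n.
              deq A (Cobj P i) (Cobj P'' i)
                (bar_postnikov_C A H f X X'' (comp_morphism g' g) i)
                (bar_postnikov_C A H f X X' g i @ bar_postnikov_C A H f X' X'' g' i) \<and>
              deq A (Yobj P i) (Yobj P'' i)
                (bar_postnikov_Y A H f X X'' (comp_morphism g' g) i)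
                (bar_postnikov_Y A H f X X' g i @ bar_postnikov_Y A H f X' X'' g' i)))"
proof -
  have K: "kad A H cls f" using assms by unfold_locales
  have M: "kadmod A H cls f X n" if "minimal_module H (cls (unit A)) (n + 1) X" for X :: "('k, 'h, 'x) amod"
    using K that by (intro kadmod.intro kadmod_axioms.intro)
  have G: "kadmap A H cls f X X' n g"
    if "minimal_module H (cls (unit A)) (n + 1) X" "minimal_module H (cls (unit A)) (n + 1) X'"
      "module_morphism H (n + 1) X X' g" for X X' :: "('k, 'h, 'x) amod" and g
    using M that unfolding module_morphism_def
    by (intro kadmap.intro kadpre.intro kadpre_axioms.intro kadmap_axioms.intro) (auto simp: module_morphism_def)
  show ?thesis
  proof (intro conjI allI impI)
    fix X :: "('k, 'h, 'x) amod" assume X: "minimal_module H (cls (unit A)) (n + 1) X"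
    show "postnikov_system A (\<lambda>h. f [h]) n X (bar_postnikov A H f X)"
      by (rule kadmod.postnikov_system_bar[OF M[OF X] assms(3)])
    show "let P = bar_postnikov A H f X in \<forall>i\<le>n.
      deq A (Cobj P i) (Cobj P i) (bar_postnikov_C A H f X X id_morphism i) [] \<and>
      deq A (Yobj P i) (Yobj P i) (bar_postnikov_Y A H f X X id_morphism i) []"
      unfolding Let_def kadmod.postnikov_simps(1,2)[OF M[OF X]] using kadmod.bar_id[OF M[OF X]] by blast
  next
    fix X X' :: "('k, 'h, 'x) amod" and g
    assume "minimal_module H (cls (unit A)) (n + 1) X \<and> minimal_module H (cls (unit A)) (n + 1) X' \<and>
      module_morphism H (n + 1) X X' g"
    then show "postnikov_map A n (bar_postnikov A H f X) (bar_postnikov A H f X')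
        (bar_postnikov_C A H f X X' g) (bar_postnikov_Y A H f X X' g)"
      using kadmap.postnikov_map_bar[OF G] by blast
  next
    fix X X' X'' :: "('k, 'h, 'x) amod" and g g'
    assume *: "minimal_module H (cls (unit A)) (n + 1) X \<and> minimal_module H (cls (unit A)) (n + 1) X' \<and>
      minimal_module H (cls (unit A)) (n + 1) X'' \<and>
      module_morphism H (n + 1) X X' g \<and> module_morphism H (n + 1) X' X'' g'"
    then have C: "kadcomp A H cls f X X' X'' n g g'" by (intro kadcomp.intro G) auto
    have X: "kadmod A H cls f X n" and X'': "kadmod A H cls f X'' n" using * M by auto
    show "let P = bar_postnikov A H f X; P'' = bar_postnikov A H f X'' in \<forall>i\<le>n.
        deq A (Cobj P i) (Cobj P'' i) (bar_postnikov_C A H f X X'' (comp_morphism g' g) i)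
          (bar_postnikov_C A H f X X' g i @ bar_postnikov_C A H f X' X'' g' i) \<and>
        deq A (Yobj P i) (Yobj P'' i) (bar_postnikov_Y A H f X X'' (comp_morphism g' g) i)
          (bar_postnikov_Y A H f X X' g i @ bar_postnikov_Y A H f X' X'' g' i)"
      unfolding Let_def kadmod.postnikov_simps(1,2)[OF X] kadmod.postnikov_simps(1,2)[OF X'']
      using kadcomp.bar_comp[OF C] by blast
  qed
qed

end
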